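(* The following hold. (0) For $n\ge 1$, any compact Legendrian submanifold of $J^1(\mathbb{R}^n)$ belongs to a closed positive path of Legendrian embeddings. (i) There exists a connected component of the space of Legendrian embeddings in $(J^1(S^1),\zeta)$ whose elements are homotopic to $j^10$ and which contains a closed positive path. (ii) There exists a closed positive path in the connected component of the space of Legendrian immersions in $(J^1(S^1),\zeta)$ which contains the one-jet extensions of functions. (iii) Given any connected surface $N$, there exists a positive path of Legendrian immersions between any two fibers of $\pi\colon ST^*N\to N$.
   Context: $J^1(N)=T^*N\times\mathbb{R}$ is the space of one-jets of functions on $N$, with contact form $\alpha=du-\lambda$, where $\lambda$ is the Liouville one-form of $T^*N$ and $u$ is the $\mathbb{R}$-coordinate; $\zeta=\ker\alpha$, cooriented by $\alpha$. For a smooth $f\colon N\to\mathbb{R}$, $j^1f=\{(q,d_qf,f(q)) : q\in N\}$ is its one-jet extension, a Legendrian submanifold; $j^10$ is the one-jet extension of the zero function. $ST^*N$ is the fiberwise spherization of $T^*N$ (nonzero covectors up to multiplication by positive reals), with projection $\pi\colon ST^*N\to N$ and the cooriented contact structure induced by the Liouville form: at the class $[p]$ of a covector $p$ at $q$, the contact hyperplane is $\{v : p(D\pi\cdot v)=0\}$ and its positive side is $\{v : p(D\pi\cdot v)>0\}$. The fibers of $\pi$ are Legendrian. A path of Legendrian embeddings (resp. immersions) of a compact manifold $L$ in a cooriented contact manifold is a smooth path $L_t=\varphi_t(L)$, $t\in[0,1]$, of Legendrian embeddings (resp. immersions) $\varphi_t$ of $L$. It is positive if $\dot\varphi_t(x)$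 lies on the positive side of the contact hyperplane at $\varphi_t(x)$ for every $x\in L$ and $t\in[0,1]$. (Positivity does not depend on the parametrization of the $L_t$.) The path is closed if its initial and final Legendrians coincide. *)

theory Defs
  imports "HOL-Analysis.Analysis"
begin

section \<open>Smooth maps between open subsets of Euclidean spaces\<close>

text \<open>The domain \<open>S\<close> is meant to be open.\<close>

primrec Ck_on :: "nat \<Rightarrow> ('a::real_normed_vector \<Rightarrow> 'b::real_normed_vector) \<Rightarrow> 'a set \<Rightarrow> bool" where
  "Ck_on 0 f S \<longleftrightarrow> continuous_on S f"
| "Ck_on (Suc k) f S \<longleftrightarrow>
     (\<forall>x\<in>S. f differentiable (at x)) \<and> (\<forall>v. Ck_on k (\<lambda>x. frechet_derivative f (at x) v) S)"

definition smooth_on :: "'a::real_normed_vector set \<Rightarrow> ('a \<Rightarrow> 'b::real_normed_vector) \<Rightarrow> bool" where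
  "smooth_on S f \<longleftrightarrow> (\<forall>k. Ck_on k f S)"

primrec iterated_derivative ::
  "'a::real_normed_vector list \<Rightarrow> ('a \<Rightarrow> 'b::real_normed_vector) \<Rightarrow> 'a \<Rightarrow> 'b" where
  "iterated_derivative [] f = f"
| "iterated_derivative (v # vs) f = (\<lambda>x. frechet_derivative (iterated_derivative vs f) (at x) v)"


section \<open>Smooth manifolds\<close>

type_synonym ('a, 'e) chart = "'a set \<times> ('a \<Rightarrow> 'e)"
type_synonym ('a, 'e) atlas = "('a, 'e) chart set"

definition carrier :: "('a, 'e) atlas \<Rightarrow> 'a set" where
  "carrier A = \<Union> (fst ` A)"

definition charts_at :: "('a, 'e) atlas \<Rightarrow> 'a \<Rightarrow> ('a, 'e) chart set" where
  "charts_at A x = {c \<in> A. x \<in> fst c}"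

definition chart_inv :: "('a, 'e) chart \<Rightarrow> 'e \<Rightarrow> 'a" where
  "chart_inv c = inv_into (fst c) (snd c)"

definition in_charts :: "('a, 'e) chart \<Rightarrow> ('b, 'f) chart \<Rightarrow> ('a \<Rightarrow> 'b) \<Rightarrow> 'e \<Rightarrow> 'f" where
  "in_charts c d f = snd d \<circ> f \<circ> chart_inv c"

definition transition :: "('a, 'e) chart \<Rightarrow> ('a, 'e) chart \<Rightarrow> 'e \<Rightarrow> 'e" where
  "transition c d = in_charts c d (\<lambda>x. x)"

definition manifold_topology :: "('a, 'e::euclidean_space) atlas \<Rightarrow> 'a topology" where
  "manifold_topology A =
     topology (\<lambda>W. W \<subseteq> carrier A \<and> (\<forall>c\<in>A. open (snd c ` (W \<inter> fst c))))"

definition smooth_manifold :: "('a, 'e::euclidean_space) atlas \<Rightarrow> bool" where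
  "smooth_manifold A \<longleftrightarrow>
     (\<forall>c\<in>A. inj_on (snd c) (fst c) \<and> open (snd c ` fst c)) \<and>
     (\<forall>c\<in>A. \<forall>d\<in>A. open (snd c ` (fst c \<inter> fst d)) \<and>
        smooth_on (snd c ` (fst c \<inter> fst d)) (transition c d)) \<and>
     Hausdorff_space (manifold_topology A) \<and> second_countable (manifold_topology A)"

definition smooth_map ::
  "('a, 'e::euclidean_space) atlas \<Rightarrow> ('b, 'f::euclidean_space) atlas \<Rightarrow> ('a \<Rightarrow> 'b) \<Rightarrow> bool" where
  "smooth_map A B f \<longleftrightarrow>
     continuous_map (manifold_topology A) (manifold_topology B) f \<and>
     (\<forall>c\<in>A. \<forall>d\<in>B. smooth_on (snd c ` (fst c \<inter> f -` fst d)) (in_charts c d f))"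

definition diffeomorphism ::
  "('a, 'e::euclidean_space) atlas \<Rightarrow> ('b, 'f::euclidean_space) atlas \<Rightarrow> ('a \<Rightarrow> 'b) \<Rightarrow> bool" where
  "diffeomorphism A B f \<longleftrightarrow> bij_betw f (carrier A) (carrier B) \<and>
     smooth_map A B f \<and> smooth_map B A (inv_into (carrier A) f)"

text \<open>Smoothness of \<open>(t, x) \<mapsto> \<phi> t x\<close> on the manifold with boundary \<open>[0,1] \<times> L\<close>: in charts,
  the map extends smoothly to a neighbourhood of each point.\<close>

definition smooth_path ::
  "('a, 'e::euclidean_space) atlas \<Rightarrow> ('b, 'f::euclidean_space) atlas \<Rightarrow> (real \<Rightarrow> 'a \<Rightarrow> 'b) \<Rightarrow> bool" where
  "smooth_path L A \<phi> \<longleftrightarrow>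
     (\<forall>t\<in>{0..1}. \<forall>x\<in>carrier L. \<phi> t x \<in> carrier A \<and>
        (\<forall>c\<in>charts_at L x. \<forall>d\<in>charts_at A (\<phi> t x). \<exists>W G.
           open W \<and> (t, snd c x) \<in> W \<and> smooth_on W G \<and>
           (\<forall>s\<in>{0..1}. \<forall>y\<in>fst c. (s, snd c y) \<in> W \<longrightarrow>
              \<phi> s y \<in> fst d \<and> snd d (\<phi> s y) = G (s, snd c y))))"


section \<open>Tangent vectors and covectors\<close>

text \<open>A tangent vector or a covector is the family of its coordinate vectors in all the charts
  around the base point, subject to the usual transformation rule (and 0 in all other charts).
  The components of a covector form the vector that represents it through the inner product.\<close>

type_synonym ('a, 'e) tangent = "('a, 'e) chart \<Rightarrow> 'e"
type_synonym ('a, 'e) covector = "('a, 'e) chart \<Rightarrow> 'e"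

definition tangent_space :: "('a, 'e::euclidean_space) atlas \<Rightarrow> 'a \<Rightarrow> ('a, 'e) tangent set" where
  "tangent_space A x =
     {v. (\<forall>c\<in>charts_at A x. \<forall>d\<in>charts_at A x.
            v d = frechet_derivative (transition c d) (at (snd c x)) (v c)) \<and>
         (\<forall>c. c \<notin> charts_at A x \<longrightarrow> v c = 0)}"

definition cotangent_space :: "('a, 'e::euclidean_space) atlas \<Rightarrow> 'a \<Rightarrow> ('a, 'e) covector set" where
  "cotangent_space A x =
     {p. (\<forall>c\<in>charts_at A x. \<forall>d\<in>charts_at A x. \<forall>w.
            p c \<bullet> w = p d \<bullet> frechet_derivative (transition c d) (at (snd c x)) w) \<and>
         (\<forall>c. c \<notin> charts_at A x \<longrightarrow> p c = 0)}"

text \<open>The next two definitions do not depend on the chart that is chosen.\<close>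

definition pairing ::
  "('a, 'e::euclidean_space) atlas \<Rightarrow> 'a \<Rightarrow> ('a, 'e) covector \<Rightarrow> ('a, 'e) tangent \<Rightarrow> real" where
  "pairing A x p v = (let c = (SOME c. c \<in> charts_at A x) in p c \<bullet> v c)"

definition differential ::
  "('a, 'e::euclidean_space) atlas \<Rightarrow> ('b, 'f::euclidean_space) atlas \<Rightarrow> ('a \<Rightarrow> 'b) \<Rightarrow> 'a \<Rightarrow>
     ('a, 'e) tangent \<Rightarrow> ('b, 'f) tangent" where
  "differential A B f x v =
     (let c = (SOME c. c \<in> charts_at A x) in
      (\<lambda>d. if d \<in> charts_at B (f x)
           then frechet_derivative (in_charts c d f) (at (snd c x)) (v c) else 0))"

definition velocity ::
  "('a, 'e::euclidean_space) atlas \<Rightarrow> (real \<Rightarrow> 'a) \<Rightarrow> real \<Rightarrow> ('a, 'e) tangent" where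
  "velocity A \<gamma> t =
     (\<lambda>d. if d \<in> charts_at A (\<gamma> t)
          then vector_derivative (\<lambda>s. snd d (\<gamma> s)) (at t within {0..1}) else 0)"

definition immersion ::
  "('a, 'e::euclidean_space) atlas \<Rightarrow> ('b, 'f::euclidean_space) atlas \<Rightarrow> ('a \<Rightarrow> 'b) \<Rightarrow> bool" where
  "immersion A B f \<longleftrightarrow>
     smooth_map A B f \<and> (\<forall>x\<in>carrier A. inj_on (differential A B f x) (tangent_space A x))"


section \<open>Legendrians and positive paths\<close>

text \<open>A cooriented contact structure on the manifold \<open>A\<close> is given by a function \<open>\<alpha>\<close> that at each
  point \<open>m\<close> is a linear form \<open>\<alpha> m\<close> on the tangent space; the contact hyperplane is its kernel and
  the positive side is where \<open>\<alpha> m\<close> is positive. Only \<open>\<alpha> m\<close> up to positive factors matters.\<close>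

type_synonym ('a, 'e) form = "'a \<Rightarrow> ('a, 'e) tangent \<Rightarrow> real"

definition legendrian_immersion ::
  "('a, 'e::euclidean_space) atlas \<Rightarrow> ('b, 'f::euclidean_space) atlas \<Rightarrow> ('b, 'f) form \<Rightarrow>
     ('a \<Rightarrow> 'b) \<Rightarrow> bool" where
  "legendrian_immersion L A \<alpha> f \<longleftrightarrow>
     DIM('f) = 2 * DIM('e) + 1 \<and> immersion L A f \<and>
     (\<forall>x\<in>carrier L. \<forall>v\<in>tangent_space L x. \<alpha> (f x) (differential L A f x v) = 0)"

definition legendrian_embedding ::
  "('a, 'e::euclidean_space) atlas \<Rightarrow> ('b, 'f::euclidean_space) atlas \<Rightarrow> ('b, 'f) form \<Rightarrow>
     ('a \<Rightarrow> 'b) \<Rightarrow> bool" where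
  "legendrian_embedding L A \<alpha> f \<longleftrightarrow>
     legendrian_immersion L A \<alpha> f \<and> embedding_map (manifold_topology L) (manifold_topology A) f"

text \<open>The submanifold is the set \<open>carrier L\<close>, and \<open>L\<close> is an atlas of it.\<close>

definition legendrian_submanifold ::
  "('b, 'e::euclidean_space) atlas \<Rightarrow> ('b, 'f::euclidean_space) atlas \<Rightarrow> ('b, 'f) form \<Rightarrow> bool" where
  "legendrian_submanifold L A \<alpha> \<longleftrightarrow> smooth_manifold L \<and> legendrian_embedding L A \<alpha> (\<lambda>x. x)"

definition legendrian_immersion_path ::
  "('a, 'e::euclidean_space) atlas \<Rightarrow> ('b, 'f::euclidean_space) atlas \<Rightarrow> ('b, 'f) form \<Rightarrow>
     (real \<Rightarrow> 'a \<Rightarrow> 'b) \<Rightarrow> bool" where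
  "legendrian_immersion_path L A \<alpha> \<phi> \<longleftrightarrow>
     smooth_path L A \<phi> \<and> (\<forall>t\<in>{0..1}. legendrian_immersion L A \<alpha> (\<phi> t))"

definition legendrian_embedding_path ::
  "('a, 'e::euclidean_space) atlas \<Rightarrow> ('b, 'f::euclidean_space) atlas \<Rightarrow> ('b, 'f) form \<Rightarrow>
     (real \<Rightarrow> 'a \<Rightarrow> 'b) \<Rightarrow> bool" where
  "legendrian_embedding_path L A \<alpha> \<phi> \<longleftrightarrow>
     smooth_path L A \<phi> \<and> (\<forall>t\<in>{0..1}. legendrian_embedding L A \<alpha> (\<phi> t))"

definition positive_path ::
  "('a, 'e::euclidean_space) atlas \<Rightarrow> ('b, 'f::euclidean_space) atlas \<Rightarrow> ('b, 'f) form \<Rightarrow>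
     (real \<Rightarrow> 'a \<Rightarrow> 'b) \<Rightarrow> bool" where
  "positive_path L A \<alpha> \<phi> \<longleftrightarrow>
     (\<forall>t\<in>{0..1}. \<forall>x\<in>carrier L. \<alpha> (\<phi> t x) (velocity A (\<lambda>s. \<phi> s x) t) > 0)"

text \<open>Two immersions define the same immersed submanifold iff they differ by a diffeomorphism of
  the source. For embeddings of a compact manifold this just says that the images are equal; for
  immersions it also excludes, say, a curve and its double cover.\<close>

definition closed_legendrian_path :: "('a, 'e::euclidean_space) atlas \<Rightarrow> (real \<Rightarrow> 'a \<Rightarrow> 'b) \<Rightarrow> bool" where
  "closed_legendrian_path L \<phi> \<longleftrightarrow> (\<exists>h. diffeomorphism L L h \<and> (\<forall>x\<in>carrier L. \<phi> 1 x = \<phi> 0 (h x)))"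


section \<open>Spaces of Legendrians\<close>

text \<open>The \<open>C\<^sup>\<infinity>\<close> topology on the set of smooth maps, through its usual subbasis. For definiteness
  the maps are undefined outside of the source manifold.\<close>

definition smooth_maps ::
  "('a, 'e::euclidean_space) atlas \<Rightarrow> ('b, 'f::euclidean_space) atlas \<Rightarrow> ('a \<Rightarrow> 'b) set" where
  "smooth_maps A B = {f \<in> extensional (carrier A). smooth_map A B f}"

definition smooth_nbhd ::
  "('a, 'e::euclidean_space) atlas \<Rightarrow> ('b, 'f::euclidean_space) atlas \<Rightarrow> ('a, 'e) chart \<Rightarrow> ('b, 'f) chart \<Rightarrow>
     'a set \<Rightarrow> 'e list \<Rightarrow> real \<Rightarrow> ('a \<Rightarrow> 'b) \<Rightarrow> ('a \<Rightarrow> 'b) set" where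
  "smooth_nbhd A B c d K vs \<epsilon> f =
     {g \<in> smooth_maps A B. g ` K \<subseteq> fst d \<and>
        (\<forall>x\<in>K. norm (iterated_derivative vs (in_charts c d g) (snd c x)
                    - iterated_derivative vs (in_charts c d f) (snd c x)) < \<epsilon>)}"

definition smooth_topology ::
  "('a, 'e::euclidean_space) atlas \<Rightarrow> ('b, 'f::euclidean_space) atlas \<Rightarrow> ('a \<Rightarrow> 'b) topology" where
  "smooth_topology A B = topology_generated_by
     {smooth_nbhd A B c d K vs \<epsilon> f | c d K vs \<epsilon> f.
        c \<in> A \<and> d \<in> B \<and> compactin (manifold_topology A) K \<and> K \<subseteq> fst c \<and> \<epsilon> > 0 \<and>
        f \<in> smooth_maps A B \<and> f ` K \<subseteq> fst d}"

definition legendrian_immersion_space ::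
  "('a, 'e::euclidean_space) atlas \<Rightarrow> ('b, 'f::euclidean_space) atlas \<Rightarrow> ('b, 'f) form \<Rightarrow>
     ('a \<Rightarrow> 'b) topology" where
  "legendrian_immersion_space L A \<alpha> =
     subtopology (smooth_topology L A) {f. legendrian_immersion L A \<alpha> f}"

definition legendrian_embedding_space ::
  "('a, 'e::euclidean_space) atlas \<Rightarrow> ('b, 'f::euclidean_space) atlas \<Rightarrow> ('b, 'f) form \<Rightarrow>
     ('a \<Rightarrow> 'b) topology" where
  "legendrian_embedding_space L A \<alpha> =
     subtopology (smooth_topology L A) {f. legendrian_embedding L A \<alpha> f}"

definition path_in ::
  "('a, 'e::euclidean_space) atlas \<Rightarrow> ('a \<Rightarrow> 'b) set \<Rightarrow> (real \<Rightarrow> 'a \<Rightarrow> 'b) \<Rightarrow> bool" where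
  "path_in L C \<phi> \<longleftrightarrow> (\<forall>t\<in>{0..1}. restrict (\<phi> t) (carrier L) \<in> C)"


section \<open>Euclidean space and the circle\<close>

definition euclidean_atlas :: "('e::euclidean_space, 'e) atlas" where
  "euclidean_atlas = {(UNIV, \<lambda>x. x)}"

definition circle_chart :: "real \<Rightarrow> (complex, real) chart" where
  "circle_chart a = (cis ` {a<..<a + 2 * pi}, inv_into {a<..<a + 2 * pi} cis)"

definition circle_atlas :: "(complex, real) atlas" where
  "circle_atlas = range circle_chart"


section \<open>Cotangent bundles and one-jets\<close>

definition cotangent_chart ::
  "('a, 'e::euclidean_space) atlas \<Rightarrow> ('a, 'e) chart \<Rightarrow> ('a \<times> ('a, 'e) covector, 'e \<times> 'e) chart" where
  "cotangent_chart A c =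
     ({(q, p). q \<in> fst c \<and> p \<in> cotangent_space A q}, \<lambda>(q, p). (snd c q, p c))"

definition cotangent_atlas ::
  "('a, 'e::euclidean_space) atlas \<Rightarrow> ('a \<times> ('a, 'e) covector, 'e \<times> 'e) atlas" where
  "cotangent_atlas A = cotangent_chart A ` A"

definition liouville_form ::
  "('a, 'e::euclidean_space) atlas \<Rightarrow> ('a \<times> ('a, 'e) covector, 'e \<times> 'e) form" where
  "liouville_form A z v =
     pairing A (fst z) (snd z) (differential (cotangent_atlas A) A fst z v)"

type_synonym ('a, 'e) jet = "('a \<times> ('a, 'e) covector) \<times> real"

definition jet_chart ::
  "('a, 'e::euclidean_space) atlas \<Rightarrow> ('a, 'e) chart \<Rightarrow> (('a, 'e) jet, ('e \<times> 'e) \<times> real) chart" where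
  "jet_chart A c =
     (fst (cotangent_chart A c) \<times> UNIV, \<lambda>(z, u). (snd (cotangent_chart A c) z, u))"

definition jet_atlas ::
  "('a, 'e::euclidean_space) atlas \<Rightarrow> (('a, 'e) jet, ('e \<times> 'e) \<times> real) atlas" where
  "jet_atlas A = jet_chart A ` A"

definition jet_form ::
  "('a, 'e::euclidean_space) atlas \<Rightarrow> (('a, 'e) jet, ('e \<times> 'e) \<times> real) form" where
  "jet_form A m v =
     differential (jet_atlas A) euclidean_atlas snd m v (UNIV, \<lambda>x. x)
     - liouville_form A (fst m) (differential (jet_atlas A) (cotangent_atlas A) fst m v)"

definition covector_of_function ::
  "('a, 'e::euclidean_space) atlas \<Rightarrow> ('a \<Rightarrow> real) \<Rightarrow> 'a \<Rightarrow> ('a, 'e) covector" where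
  "covector_of_function A f q =
     (\<lambda>c. if c \<in> charts_at A q
          then \<Sum>b\<in>Basis. frechet_derivative (f \<circ> chart_inv c) (at (snd c q)) b *\<^sub>R b else 0)"

definition jet_extension ::
  "('a, 'e::euclidean_space) atlas \<Rightarrow> ('a \<Rightarrow> real) \<Rightarrow> 'a \<Rightarrow> ('a, 'e) jet" where
  "jet_extension A f = (\<lambda>q\<in>carrier A. ((q, covector_of_function A f q), f q))"


section \<open>The spherization of the cotangent bundle of a surface\<close>

definition ray :: "('a, 'e::euclidean_space) covector \<Rightarrow> ('a, 'e) covector set" where
  "ray p = {\<lambda>c. s *\<^sub>R p c | s. s > 0}"

definition spherization ::
  "('a, 'e::euclidean_space) atlas \<Rightarrow> ('a \<times> ('a, 'e) covector set) set" where
  "spherization A =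
     {(q, ray p) | q p. q \<in> carrier A \<and> p \<in> cotangent_space A q \<and> p \<noteq> (\<lambda>c. 0)}"

definition unit_vector :: "real \<Rightarrow> real^2" where
  "unit_vector \<theta> = vector [cos \<theta>, sin \<theta>]"

text \<open>The coordinates of \<open>(q, [p])\<close> are those of \<open>q\<close>, and the polar angle of the components of \<open>p\<close>
  in the chart \<open>c\<close>. The angle is taken in the interval from \<open>a\<close> to \<open>a + 2\<pi>\<close>.\<close>

definition spherization_chart ::
  "('a, real^2) atlas \<Rightarrow> ('a, real^2) chart \<Rightarrow> real \<Rightarrow>
     ('a \<times> ('a, real^2) covector set, (real^2) \<times> real) chart" where
  "spherization_chart A c a =
     ({(q, P) \<in> spherization A. q \<in> fst c \<and>
         (\<exists>\<theta>\<in>{a<..<a + 2 * pi}. \<exists>p\<in>P. p c = unit_vector \<theta>)},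
      \<lambda>(q, P). (snd c q, THE \<theta>. \<theta> \<in> {a<..<a + 2 * pi} \<and> (\<exists>p\<in>P. p c = unit_vector \<theta>)))"

definition spherization_atlas ::
  "('a, real^2) atlas \<Rightarrow> ('a \<times> ('a, real^2) covector set, (real^2) \<times> real) atlas" where
  "spherization_atlas A = {spherization_chart A c a | c a. c \<in> A}"

text \<open>The representative \<open>p\<close> of the class only matters up to a positive factor.\<close>

definition spherization_form ::
  "('a, real^2) atlas \<Rightarrow> ('a \<times> ('a, real^2) covector set, (real^2) \<times> real) form" where
  "spherization_form A z v =
     (let p = (SOME p. p \<in> snd z) in
      pairing A (fst z) p (differential (spherization_atlas A) A fst z v))"

definition spherization_fiber ::
  "('a, 'e::euclidean_space) atlas \<Rightarrow> 'a \<Rightarrow> ('a \<times> ('a, 'e) covector set) set" where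
  "spherization_fiber A q = {z \<in> spherization A. fst z = q}"

end

theory Submission
  imports Defs
begin

text \<open>
  In local coordinates all motions are explicit. In \<open>J\<^sup>1(\<real>\<^sup>n)\<close> the lifts of translations along a large
  circle in a coordinate plane \<open>(q, p)\<close> form a closed path of contactomorphisms: its contact Hamiltonian
  is, up to terms bounded by radius times the size of the Legendrian, the area of the circle, hence
  positive on a given compact set. In \<open>J\<^sup>1(S\<^sup>1)\<close> the rotation of the circle has contact Hamiltonian \<open>- p\<close>,
  so a Legendrian of degree one inside \<open>p < 0\<close> gives a closed positive path of embeddings; its
  elements stay homotopic to the zero section because the homotopy class is locally constant. Every
  \<open>j\<^sup>1f\<close> is deformed to the zero section by scaling \<open>f\<close>, and the zero section to an immersed curve inside
  \<open>p < 0\<close> and back, by \<open>q = s - a sin s\<close> with \<open>a\<close> growing from \<open>0\<close> and returning to \<open>0\<close>; a fast rotation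
  pays for any vertical translation, which makes the whole motion as positive as desired. The hodograph
  transform carries this motion to \<open>ST\<^sup>*\<real>\<^sup>2\<close>, where it absorbs the translation from one fiber to another.
  Finally any two points of a connected surface lie in the image of a local diffeomorphism from the
  plane, by which Legendrians of \<open>ST\<^sup>*\<real>\<^sup>2\<close> are pushed forward.
\<close>

section \<open>Calculus of smooth maps\<close>

text \<open>Rotating the circle moves a curve in J^1(S^1) positively only where p < 0, and it does
  nothing to the zero section. A closed curve inside p < 0 must turn back in the base: u closes up
  only if the integral of p dq vanishes, so dq changes sign and the front has cusps. Creating these
  cusps from the zero section takes time during which p is not negative. Positivity is saved because
  vertical translation commutes with rotation: only the time integral of a lower bound for - p has
  to be positive, since a translation in u can lend height when - p is small and take it back when -
  p is large. The gain is proportional to the speed of rotation, while the cost of deforming the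
  shape of the curve does not depend on that speed; so every prescribed amount of positivity is
  reached. In ST*R^2 it pays for translating the plane, whose contact Hamiltonian is bounded by the
  length of the translation vector. Since the Legendrians between two fibers are only immersed, the
  plane may be immersed too: no embedded disk through both points has to be found.\<close>

lemma has_derivative_cong_open:
  assumes "open S" "x \<in> S" "\<And>y. y \<in> S \<Longrightarrow> f y = g y"
  shows "(f has_derivative D) (at x) \<longleftrightarrow> (g has_derivative D) (at x)"
  using assms by (metis has_derivative_transform_within_open)

lemma frechet_derivative_cong_open:
  assumes "open S" "x \<in> S" "\<And>y. y \<in> S \<Longrightarrow> f y = g y"
  shows "frechet_derivative f (at x) = frechet_derivative g (at x)"
  unfolding frechet_derivative_def using has_derivative_cong_open[OF assms] by simp

text \<open>Openness of \<open>S\<close> is essential: \<open>Ck_on\<close> differentiates in the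
  whole space, so values on \<open>S\<close> determine the derivatives only at interior
  points.\<close>

lemma Ck_on_cong:
  assumes "open S" "\<And>x. x \<in> S \<Longrightarrow> f x = g x"
  shows "Ck_on k f S \<longleftrightarrow> Ck_on k g S"
  using assms(2)
proof (induction k arbitrary: f g)
  case 0
  then show ?case by (auto cong: continuous_on_cong)
next
  case (Suc k)
  have d: "f differentiable (at x) \<longleftrightarrow> g differentiable (at x)" if "x \<in> S" for x
    unfolding differentiable_def using has_derivative_cong_open[OF assms(1) that, of f g] Suc.prems by auto
  have "Ck_on k (\<lambda>x. frechet_derivative f (at x) v) S \<longleftrightarrow> Ck_on k (\<lambda>x. frechet_derivative g (at x) v) S" for v
    by (rule Suc.IH) (metis frechet_derivative_cong_open[OF assms(1)] Suc.prems)
  with d show ?case by simp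
qed

lemma Ck_on_SucD: "Ck_on (Suc k) f S \<Longrightarrow> Ck_on k f S"
proof (induction k arbitrary: f)
  case 0
  then show ?case
    by (auto simp: continuous_on_eq_continuous_at intro!: continuous_at_imp_continuous_on differentiable_imp_continuous_within)
next
  case (Suc k)
  show ?case
    unfolding Ck_on.simps(2)[of k] using Suc.prems Suc.IH by (metis Ck_on.simps(2))
qed

lemma Ck_on_SucI:
  assumes "open S" "\<And>x. x \<in> S \<Longrightarrow> (f has_derivative f' x) (at x)"
    and "\<And>v. Ck_on k (\<lambda>x. f' x v) S"
  shows "Ck_on (Suc k) f S"
proof -
  have "Ck_on k (\<lambda>x. frechet_derivative f (at x) v) S" for v
    by (rule iffD1[OF Ck_on_cong[OF assms(1)] assms(3)]) (simp add: frechet_derivative_at[OF assms(2)])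
  moreover have "f differentiable (at x)" if "x \<in> S" for x
    using assms(2)[OF that] by (rule differentiableI)
  ultimately show ?thesis by simp
qed

lemma Ck_on_SucE:
  assumes "Ck_on (Suc k) f S" "x \<in> S"
  shows "(f has_derivative frechet_derivative f (at x)) (at x)"
  using assms by (simp add: frechet_derivative_works)

lemma Ck_on_SucV: "Ck_on (Suc k) f S \<Longrightarrow> Ck_on k (\<lambda>x. frechet_derivative f (at x) v) S"
  by simp

lemma Ck_on_subset: "Ck_on k f S \<Longrightarrow> T \<subseteq> S \<Longrightarrow> Ck_on k f T"
  by (induction k arbitrary: f) (auto intro: continuous_on_subset)

lemma Ck_on_const: "Ck_on k (\<lambda>x. c) S"
  by (induction k arbitrary: c) auto

lemma Ck_on_local:
  assumes "\<And>x. x \<in> S \<Longrightarrow> \<exists>U. open U \<and> x \<in> U \<and> Ck_on k f U"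
  shows "Ck_on k f S"
  using assms
proof (induction k arbitrary: f)
  case 0
  have "isCont f x" if "x \<in> S" for x
    using 0[OF that] continuous_on_eq_continuous_at by auto
  then show ?case by (simp add: continuous_at_imp_continuous_on)
next
  case (Suc k)
  have "f differentiable (at x)" if "x \<in> S" for x
    using Suc.prems[OF that] by auto
  moreover have "Ck_on k (\<lambda>x. frechet_derivative f (at x) v) S" for v
  proof (rule Suc.IH)
    fix x assume "x \<in> S"
    then obtain U where "open U" "x \<in> U" "Ck_on (Suc k) f U" using Suc.prems by blast
    then show "\<exists>U. open U \<and> x \<in> U \<and> Ck_on k (\<lambda>x. frechet_derivative f (at x) v) U"
      by (intro exI[of _ U] conjI Ck_on_SucV)
  qed
  ultimately show ?case by simp
qed

lemma Ck_on_add: "open S \<Longrightarrow> Ck_on k f S \<Longrightarrow> Ck_on k g S \<Longrightarrow> Ck_on k (\<lambda>x. f x + g x) S"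
proof (induction k arbitrary: f g)
  case 0
  then show ?case by (auto intro: continuous_intros)
next
  case (Suc k)
  show ?case
  proof (rule Ck_on_SucI[OF Suc.prems(1)])
    show "((\<lambda>x. f x + g x) has_derivative (\<lambda>v. frechet_derivative f (at x) v + frechet_derivative g (at x) v)) (at x)"
      if "x \<in> S" for x
      by (intro has_derivative_add Ck_on_SucE[OF Suc.prems(2) that] Ck_on_SucE[OF Suc.prems(3) that])
    show "Ck_on k (\<lambda>x. frechet_derivative f (at x) v + frechet_derivative g (at x) v) S" for v
      by (intro Suc.IH Ck_on_SucV Suc.prems)
  qed
qed

lemma Ck_on_sum:
  "open S \<Longrightarrow> (\<And>i. i \<in> I \<Longrightarrow> Ck_on k (f i) S) \<Longrightarrow> Ck_on k (\<lambda>x. \<Sum>i\<in>I. f i x) S"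
  by (induction I rule: infinite_finite_induct) (auto intro: Ck_on_const Ck_on_add)

text \<open>Both terms of the product rule are instances of the claim one order lower, because
  \<open>f\<close> and \<open>g\<close> are arbitrary in the induction. Scalar multiples, inner
  products and products are all special cases.\<close>

lemma Ck_on_bilinear:
  assumes "bounded_bilinear B" "open S"
  shows "Ck_on k f S \<Longrightarrow> Ck_on k g S \<Longrightarrow> Ck_on k (\<lambda>x. B (f x) (g x)) S"
proof (induction k arbitrary: f g)
  case 0
  then show ?case using bounded_bilinear.continuous_on[OF assms(1)] by auto
next
  case (Suc k)
  show ?case
  proof (rule Ck_on_SucI[OF assms(2)])
    show "((\<lambda>x. B (f x) (g x)) has_derivative
        (\<lambda>v. B (f x) (frechet_derivative g (at x) v) + B (frechet_derivative f (at x) v) (g x))) (at x)"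
      if "x \<in> S" for x
      by (intro bounded_bilinear.FDERIV[OF assms(1)] Ck_on_SucE[OF Suc.prems(1) that] Ck_on_SucE[OF Suc.prems(2) that])
    show "Ck_on k (\<lambda>x. B (f x) (frechet_derivative g (at x) v) + B (frechet_derivative f (at x) v) (g x)) S" for v
      by (intro Ck_on_add assms(2) Suc.IH Ck_on_SucV Ck_on_SucD[of k f] Ck_on_SucD[of k g] Suc.prems)
  qed
qed

lemma Ck_on_linear:
  assumes "bounded_linear h" "open S"
  shows "Ck_on k f S \<Longrightarrow> Ck_on k (\<lambda>x. h (f x)) S"
proof (induction k arbitrary: f)
  case 0
  then show ?case using bounded_linear.continuous_on[OF assms(1)] by auto
next
  case (Suc k)
  show ?case
  proof (rule Ck_on_SucI[OF assms(2)])
    show "((\<lambda>x. h (f x)) has_derivative (\<lambda>v. h (frechet_derivative f (at x) v))) (at x)"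
      if "x \<in> S" for x
      by (intro bounded_linear.has_derivative[OF assms(1)] Ck_on_SucE[OF Suc.prems(1) that])
    show "Ck_on k (\<lambda>x. h (frechet_derivative f (at x) v)) S" for v
      by (intro Suc.IH Ck_on_SucV Suc.prems)
  qed
qed

lemma Ck_on_compose:
  fixes g :: "'b::euclidean_space \<Rightarrow> 'c::real_normed_vector"
  assumes "open S" "open T"
  shows "Ck_on k f S \<Longrightarrow> Ck_on k g T \<Longrightarrow> f ` S \<subseteq> T \<Longrightarrow> Ck_on k (\<lambda>x. g (f x)) S"
proof (induction k arbitrary: g)
  case 0
  then show ?case using continuous_on_compose2[of T g S f] by auto
next
  case (Suc k)
  let ?F = "\<lambda>x. frechet_derivative f (at x)" and ?G = "\<lambda>x. frechet_derivative g (at x)"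
  have d: "((\<lambda>x. g (f x)) has_derivative (\<lambda>v. ?G (f x) (?F x v))) (at x)" if "x \<in> S" for x
  proof -
    have "f x \<in> T" using that Suc.prems by auto
    then show ?thesis
      by (intro has_derivative_compose[OF Ck_on_SucE[OF Suc.prems(1) that]] Ck_on_SucE[OF Suc.prems(2)])
  qed
  \<comment> \<open>\<open>Ck_on\<close> controls derivatives in a fixed direction, while here the
    direction \<open>?F x v\<close> moves with \<open>x\<close>. Expanding it in the finite basis of
    the middle space turns the chain rule into a sum of products of derivatives in fixed
    directions.\<close>
  have "?G (f x) (?F x v) = (\<Sum>b\<in>Basis. (?F x v \<bullet> b) *\<^sub>R ?G (f x) b)" if "x \<in> S" for x v
  proof -
    have "f x \<in> T" using that Suc.prems by auto
    then have l: "linear (?G (f x))"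
      using Ck_on_SucE[OF Suc.prems(2)] has_derivative_linear by blast
    show ?thesis
      by (subst euclidean_representation[symmetric, of "?F x v"])
         (simp only: linear_sum[OF l] linear_scale[OF l] o_def)
  qed
  note eq = this
  have "Ck_on k (\<lambda>x. \<Sum>b\<in>Basis. (?F x v \<bullet> b) *\<^sub>R ?G (f x) b) S" for v
    by (intro Ck_on_sum assms(1) Ck_on_bilinear[OF bounded_bilinear_scaleR]
        Ck_on_linear[OF bounded_linear_inner_left] Suc.IH Ck_on_SucD[OF Suc.prems(1)] Ck_on_SucV Suc.prems)
  then have r: "Ck_on k (\<lambda>x. ?G (f x) (?F x v)) S" for v
    by (subst Ck_on_cong[OF assms(1) eq[of _ v]]) auto
  show ?case by (rule Ck_on_SucI[OF assms(1) d r])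
qed

lemma Ck_on_real_SucI:
  fixes f :: "real \<Rightarrow> real"
  assumes "open S" "\<And>x. x \<in> S \<Longrightarrow> (f has_real_derivative f' x) (at x)" "Ck_on k f' S"
  shows "Ck_on (Suc k) f S"
proof (rule Ck_on_SucI[OF assms(1)])
  show "(f has_derivative (\<lambda>v. v * f' x)) (at x)" if "x \<in> S" for x
    using assms(2)[OF that] by (simp add: has_field_derivative_def mult_commute_abs)
  show "Ck_on k (\<lambda>x. v * f' x) S" for v
    by (rule Ck_on_linear[OF bounded_linear_mult_right assms(1,3)])
qed

section \<open>Smooth functions and their closure properties\<close>

lemma smooth_on_cong: "open S \<Longrightarrow> (\<And>x. x \<in> S \<Longrightarrow> f x = g x) \<Longrightarrow> smooth_on S f \<longleftrightarrow> smooth_on S g"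
  unfolding smooth_on_def using Ck_on_cong by metis

lemma smooth_on_subset: "smooth_on S f \<Longrightarrow> T \<subseteq> S \<Longrightarrow> smooth_on T f"
  unfolding smooth_on_def using Ck_on_subset by blast

lemma smooth_on_local:
  assumes "\<And>x. x \<in> S \<Longrightarrow> \<exists>U. open U \<and> x \<in> U \<and> smooth_on U f"
  shows "smooth_on S f"
  unfolding smooth_on_def
proof
  fix k show "Ck_on k f S" by (rule Ck_on_local) (use assms in \<open>unfold smooth_on_def, blast\<close>)
qed

lemma smooth_on_derivative: "smooth_on S f \<Longrightarrow> smooth_on S (\<lambda>x. frechet_derivative f (at x) v)"
  unfolding smooth_on_def by (metis Ck_on.simps(2))

lemma smooth_on_differentiable: "smooth_on S f \<Longrightarrow> x \<in> S \<Longrightarrow> f differentiable (at x)"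
  unfolding smooth_on_def by (metis Ck_on.simps(2))

lemma smooth_on_has_derivative:
  "smooth_on S f \<Longrightarrow> x \<in> S \<Longrightarrow> (f has_derivative frechet_derivative f (at x)) (at x)"
  using smooth_on_differentiable frechet_derivative_works by blast

lemma smooth_on_continuous: "smooth_on S f \<Longrightarrow> continuous_on S f"
  unfolding smooth_on_def by (metis Ck_on.simps(1))

lemma smooth_on_const: "smooth_on S (\<lambda>x. c)"
  unfolding smooth_on_def by (simp add: Ck_on_const)

lemma smooth_on_linear: "bounded_linear h \<Longrightarrow> open S \<Longrightarrow> smooth_on S f \<Longrightarrow> smooth_on S (\<lambda>x. h (f x))"
  unfolding smooth_on_def by (simp add: Ck_on_linear)

lemma smooth_on_id: "open S \<Longrightarrow> smooth_on S (\<lambda>x. x)"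
  unfolding smooth_on_def
proof
  fix k assume "open S"
  then show "Ck_on k (\<lambda>x. x) S"
    by (cases k) (auto intro!: Ck_on_SucI[of _ _ "\<lambda>x v. v"] Ck_on_const simp del: Ck_on.simps(2))
qed

lemma smooth_on_add: "open S \<Longrightarrow> smooth_on S f \<Longrightarrow> smooth_on S g \<Longrightarrow> smooth_on S (\<lambda>x. f x + g x)"
  unfolding smooth_on_def by (simp add: Ck_on_add)

lemma smooth_on_bilinear:
  "bounded_bilinear B \<Longrightarrow> open S \<Longrightarrow> smooth_on S f \<Longrightarrow> smooth_on S g \<Longrightarrow>
    smooth_on S (\<lambda>x. B (f x) (g x))"
  unfolding smooth_on_def by (simp add: Ck_on_bilinear)

lemmas smooth_on_scaleR = smooth_on_bilinear[OF bounded_bilinear_scaleR]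
lemmas smooth_on_inner = smooth_on_bilinear[OF bounded_bilinear_inner]
lemmas smooth_on_mult = smooth_on_bilinear[OF bounded_bilinear_mult]
lemmas smooth_on_fst = smooth_on_linear[OF bounded_linear_fst]
lemmas smooth_on_snd = smooth_on_linear[OF bounded_linear_snd]
lemmas smooth_on_minus = smooth_on_linear[OF bounded_linear_minus[OF bounded_linear_ident]]
lemmas smooth_on_nth = smooth_on_linear[OF bounded_linear_vec_nth]

lemma smooth_on_diff: "open S \<Longrightarrow> smooth_on S f \<Longrightarrow> smooth_on S g \<Longrightarrow> smooth_on S (\<lambda>x. f x - g x)"
  using smooth_on_add[of S f "\<lambda>x. - g x"] smooth_on_minus[of S g] by simp

lemma smooth_on_Pair: "open S \<Longrightarrow> smooth_on S f \<Longrightarrow> smooth_on S g \<Longrightarrow> smooth_on S (\<lambda>x. (f x, g x))"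
  using smooth_on_add[of S "\<lambda>x. (f x, 0)" "\<lambda>x. (0, g x)"]
    smooth_on_linear[of "\<lambda>x. (x, 0)" S f] smooth_on_linear[of "\<lambda>x. (0, x)" S g]
  by (simp add: bounded_linear_Pair bounded_linear_ident bounded_linear_zero)

lemma smooth_on_power:
  fixes f :: "_ \<Rightarrow> 'b::real_normed_algebra_1"
  shows "open S \<Longrightarrow> smooth_on S f \<Longrightarrow> smooth_on S (\<lambda>x. f x ^ n)"
  by (induction n) (auto intro: smooth_on_const smooth_on_mult)

lemma smooth_on_compose:
  fixes g :: "'b::euclidean_space \<Rightarrow> 'c::real_normed_vector"
  assumes "smooth_on T g" "smooth_on S f" "open S" "open T" "f ` S \<subseteq> T"
  shows "smooth_on S (\<lambda>x. g (f x))"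
  using assms Ck_on_compose unfolding smooth_on_def by blast

lemma smooth_on_sin_cos: "smooth_on UNIV (sin :: real \<Rightarrow> real)" "smooth_on UNIV (cos :: real \<Rightarrow> real)"
proof -
  have "Ck_on k (sin :: real \<Rightarrow> real) UNIV \<and> Ck_on k (cos :: real \<Rightarrow> real) UNIV" for k
  proof (induction k)
    case 0
    then show ?case by (auto intro: continuous_intros)
  next
    case (Suc k)
    then have "Ck_on k (\<lambda>x::real. - sin x) UNIV"
      using Ck_on_linear[OF bounded_linear_minus[OF bounded_linear_ident] open_UNIV] by blast
    with Suc show ?case
      by (auto intro!: Ck_on_real_SucI[of UNIV sin cos] Ck_on_real_SucI[of UNIV cos "\<lambda>x. - sin x"]
          derivative_eq_intros simp del: Ck_on.simps)
  qed
  then show "smooth_on UNIV (sin :: real \<Rightarrow> real)" "smooth_on UNIV (cos :: real \<Rightarrow> real)"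
    unfolding smooth_on_def by auto
qed

lemma smooth_on_inverse_real: "smooth_on (- {0}) (inverse :: real \<Rightarrow> real)"
proof -
  have o: "open (- {0 :: real})" by auto
  have "Ck_on k (inverse :: real \<Rightarrow> real) (- {0})" for k
  proof (induction k)
    case 0
    then show ?case by (auto intro!: continuous_intros)
  next
    case (Suc k)
    then have "Ck_on k (\<lambda>x::real. - (inverse x * inverse x)) (- {0})"
      using Ck_on_linear[OF bounded_linear_minus[OF bounded_linear_ident] o]
        Ck_on_bilinear[OF bounded_bilinear_mult o] by blast
    then show ?case
      by (rule Ck_on_real_SucI[OF o, rotated])
         (auto intro!: derivative_eq_intros simp: power2_eq_square divide_inverse)
  qed
  then show ?thesis unfolding smooth_on_def by auto
qed

lemma smooth_on_sin: "open S \<Longrightarrow> smooth_on S f \<Longrightarrow> smooth_on S (\<lambda>x. sin (f x :: real))"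
  by (rule smooth_on_compose[OF smooth_on_sin_cos(1)]) auto

lemma smooth_on_cos: "open S \<Longrightarrow> smooth_on S f \<Longrightarrow> smooth_on S (\<lambda>x. cos (f x :: real))"
  by (rule smooth_on_compose[OF smooth_on_sin_cos(2)]) auto

lemma smooth_on_inverse:
  "open S \<Longrightarrow> smooth_on S f \<Longrightarrow> (\<And>x. x \<in> S \<Longrightarrow> f x \<noteq> 0) \<Longrightarrow> smooth_on S (\<lambda>x. inverse (f x :: real))"
  by (rule smooth_on_compose[OF smooth_on_inverse_real]) auto

lemma smooth_on_divide:
  "open S \<Longrightarrow> smooth_on S f \<Longrightarrow> smooth_on S g \<Longrightarrow> (\<And>x. x \<in> S \<Longrightarrow> g x \<noteq> 0) \<Longrightarrow>
    smooth_on S (\<lambda>x. f x / g x :: real)"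
  unfolding divide_inverse by (intro smooth_on_mult smooth_on_inverse)

lemma smooth_on_sqrt:
  assumes "open S" "smooth_on S f" "\<And>x. x \<in> S \<Longrightarrow> f x > 0"
  shows "smooth_on S (\<lambda>x. sqrt (f x))"
proof -
  have "Ck_on k sqrt {0<..}" for k
  proof (induction k)
    case 0
    then show ?case by (auto intro!: continuous_intros)
  next
    case (Suc k)
    have "Ck_on k (\<lambda>x. inverse (2 * sqrt x)) {0<..}"
      using Ck_on_compose[OF open_greaterThan, of "- {0}" k "\<lambda>x. 2 * sqrt x" 0 inverse]
        smooth_on_inverse_real Ck_on_linear[OF bounded_linear_mult_right open_greaterThan Suc, of 2]
      unfolding smooth_on_def by force
    then show ?case
      by (rule Ck_on_real_SucI[OF open_greaterThan, rotated])
         (auto intro!: derivative_eq_intros simp: field_simps)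
  qed
  then have "smooth_on {0<..} sqrt" unfolding smooth_on_def by auto
  then show ?thesis by (rule smooth_on_compose) (use assms in auto)
qed

lemma smooth_on_arctan:
  assumes "open S" "smooth_on S f"
  shows "smooth_on S (\<lambda>x. arctan (f x))"
proof -
  have "1 + x * x \<noteq> 0" for x :: real
    using zero_le_square[of x] by linarith
  then have 1: "smooth_on UNIV (\<lambda>x. inverse (1 + x * x :: real))"
    by (intro smooth_on_inverse smooth_on_add smooth_on_mult smooth_on_const smooth_on_id) auto
  have "Ck_on k arctan UNIV" for k
  proof (cases k)
    case 0
    then show ?thesis by (auto intro!: continuous_intros)
  next
    case (Suc j)
    show ?thesis
      unfolding Suc using 1 unfolding smooth_on_def
      by (auto intro!: Ck_on_real_SucI[of _ _ "\<lambda>x. inverse (1 + x * x)"] derivative_eq_intros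
          simp del: Ck_on.simps simp: power2_eq_square divide_inverse)
  qed
  then have "smooth_on UNIV arctan" unfolding smooth_on_def by auto
  then show ?thesis by (rule smooth_on_compose) (use assms in auto)
qed

lemmas smooth_intros = smooth_on_const smooth_on_id smooth_on_add smooth_on_diff smooth_on_minus
  smooth_on_mult smooth_on_scaleR smooth_on_inner smooth_on_fst smooth_on_snd smooth_on_nth
  smooth_on_Pair smooth_on_power smooth_on_sin smooth_on_cos

lemma smooth_on_transform:
  "open S \<Longrightarrow> smooth_on S g \<Longrightarrow> (\<And>x. x \<in> S \<Longrightarrow> f x = g x) \<Longrightarrow> smooth_on S f"
  using smooth_on_cong by metis

section \<open>Charts and the manifold topology\<close>

text \<open>This form of the manifold axioms is shown to pass to the jet and spherization atlases by
  computing transition maps. Separation enters later, as a hypothesis on the surface or through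
  \<open>embedding_map_compact\<close>.\<close>

definition smooth_atlas :: "('a, 'e::euclidean_space) atlas \<Rightarrow> bool" where
  "smooth_atlas A \<longleftrightarrow>
     (\<forall>c\<in>A. inj_on (snd c) (fst c) \<and> open (snd c ` fst c)) \<and>
     (\<forall>c\<in>A. \<forall>d\<in>A. open (snd c ` (fst c \<inter> fst d)) \<and>
        smooth_on (snd c ` (fst c \<inter> fst d)) (transition c d))"

lemma smooth_manifold_imp_smooth_atlas: "smooth_manifold A \<Longrightarrow> smooth_atlas A"
  unfolding smooth_manifold_def smooth_atlas_def by blast

lemma smooth_atlasD:
  assumes "smooth_atlas A" "c \<in> A"
  shows "inj_on (snd c) (fst c)" "open (snd c ` fst c)"
    "d \<in> A \<Longrightarrow> open (snd c ` (fst c \<inter> fst d))"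
    "d \<in> A \<Longrightarrow> smooth_on (snd c ` (fst c \<inter> fst d)) (transition c d)"
  using assms unfolding smooth_atlas_def by blast+

lemma charts_at_iff: "c \<in> charts_at A x \<longleftrightarrow> c \<in> A \<and> x \<in> fst c"
  by (simp add: charts_at_def)

lemma carrierE: assumes "x \<in> carrier A" obtains c where "c \<in> charts_at A x"
  using assms unfolding carrier_def charts_at_def by force

lemma charts_at_carrier: "c \<in> charts_at A x \<Longrightarrow> x \<in> carrier A"
  unfolding carrier_def charts_at_def by force

lemma chart_inv_eq: "inj_on (snd c) (fst c) \<Longrightarrow> x \<in> fst c \<Longrightarrow> chart_inv c (snd c x) = x"
  by (simp add: chart_inv_def)

lemma chart_inv_in: "v \<in> snd c ` fst c \<Longrightarrow> chart_inv c v \<in> fst c"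
  by (simp add: chart_inv_def inv_into_into)

lemma chart_chart_inv: "v \<in> snd c ` fst c \<Longrightarrow> snd c (chart_inv c v) = v"
  by (simp add: chart_inv_def f_inv_into_f)

lemma transition_chart:
  "inj_on (snd c) (fst c) \<Longrightarrow> x \<in> fst c \<Longrightarrow> transition c d (snd c x) = snd d x"
  by (simp add: transition_def in_charts_def chart_inv_eq)

text \<open>\<open>manifold_topology\<close> is introduced through \<open>topology\<close>, which
  returns the intended open sets only for a predicate of this kind. Closure under intersection is
  where injectivity of the charts enters.\<close>

lemma istopology_manifold:
  assumes "\<And>c. c \<in> A \<Longrightarrow> inj_on (snd c) (fst c)"
  shows "istopology (\<lambda>W. W \<subseteq> carrier A \<and> (\<forall>c\<in>A. open (snd c ` (W \<inter> fst c))))"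
  unfolding istopology_def
proof (rule conjI; intro allI impI)
  fix S T
  assume S: "S \<subseteq> carrier A \<and> (\<forall>c\<in>A. open (snd c ` (S \<inter> fst c)))"
    and T: "T \<subseteq> carrier A \<and> (\<forall>c\<in>A. open (snd c ` (T \<inter> fst c)))"
  have "open (snd c ` (S \<inter> T \<inter> fst c))" if "c \<in> A" for c
  proof -
    have "snd c ` (S \<inter> T \<inter> fst c) = snd c ` (S \<inter> fst c) \<inter> snd c ` (T \<inter> fst c)"
      using assms[OF that] by (auto simp: inj_on_def image_iff)
    then show ?thesis using S T that by auto
  qed
  then show "S \<inter> T \<subseteq> carrier A \<and> (\<forall>c\<in>A. open (snd c ` (S \<inter> T \<inter> fst c)))" using S by auto
next
  fix K :: "'a set set"
  assume K: "\<forall>W\<in>K. W \<subseteq> carrier A \<and> (\<forall>c\<in>A. open (snd c ` (W \<inter> fst c)))"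
  have "open (snd c ` (\<Union> K \<inter> fst c))" if "c \<in> A" for c
  proof -
    have "snd c ` (\<Union> K \<inter> fst c) = (\<Union>W\<in>K. snd c ` (W \<inter> fst c))" by auto
    then show ?thesis using K that by auto
  qed
  then show "\<Union> K \<subseteq> carrier A \<and> (\<forall>c\<in>A. open (snd c ` (\<Union> K \<inter> fst c)))" using K by blast
qed

lemma openin_manifold:
  assumes "smooth_atlas A"
  shows "openin (manifold_topology A) W \<longleftrightarrow>
    W \<subseteq> carrier A \<and> (\<forall>c\<in>A. open (snd c ` (W \<inter> fst c)))"
  unfolding manifold_topology_def
  using istopology_manifold[of A] smooth_atlasD(1)[OF assms] by (simp add: topology_inverse')

lemma topspace_manifold: assumes "smooth_atlas A" shows "topspace (manifold_topology A) = carrier A"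
proof -
  have "carrier A \<inter> fst c = fst c" if "c \<in> A" for c using that by (auto simp: carrier_def)
  then have "openin (manifold_topology A) (carrier A)"
    using assms by (auto simp: openin_manifold smooth_atlasD)
  moreover have "topspace (manifold_topology A) \<subseteq> carrier A"
    using assms openin_manifold openin_topspace by blast
  ultimately show ?thesis using openin_subset by blast
qed

lemma openin_chart_vimage:
  assumes A: "smooth_atlas A" and c: "c \<in> A" and "open V"
  shows "openin (manifold_topology A) (fst c \<inter> snd c -` V)"
  unfolding openin_manifold[OF A]
proof (intro conjI ballI)
  show "fst c \<inter> snd c -` V \<subseteq> carrier A" using c by (auto simp: carrier_def)
  fix d assume d: "d \<in> A"
  let ?S = "snd d ` (fst d \<inter> fst c)"
  have "snd d ` (fst c \<inter> snd c -` V \<inter> fst d) = ?S \<inter> transition d c -` V"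
    using transition_chart[OF smooth_atlasD(1)[OF A d], of _ c] by auto
  moreover have "open (?S \<inter> transition d c -` V)"
    using smooth_on_continuous[OF smooth_atlasD(4)[OF A d c]] smooth_atlasD(3)[OF A d c] \<open>open V\<close>
    by (metis continuous_open_preimage)
  ultimately show "open (snd d ` (fst c \<inter> snd c -` V \<inter> fst d))" by simp
qed

lemma openin_chart: "smooth_atlas A \<Longrightarrow> c \<in> A \<Longrightarrow> openin (manifold_topology A) (fst c)"
  using openin_chart_vimage[of A c UNIV] by simp

lemma continuous_map_chart_inv:
  assumes A: "smooth_atlas A" and c: "c \<in> A"
  shows "continuous_map (top_of_set (snd c ` fst c)) (manifold_topology A) (chart_inv c)"
  unfolding continuous_map_def
proof (intro conjI allI impI)
  show "chart_inv c \<in> topspace (top_of_set (snd c ` fst c)) \<rightarrow> topspace (manifold_topology A)"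
    using chart_inv_in[of _ c] c by (auto simp: topspace_manifold[OF A] carrier_def chart_inv_eq smooth_atlasD(1)[OF A])
  fix U assume U: "openin (manifold_topology A) U"
  have "{x \<in> topspace (top_of_set (snd c ` fst c)). chart_inv c x \<in> U} = snd c ` (U \<inter> fst c)"
    using smooth_atlasD(1)[OF A c] by (auto simp: chart_inv_eq)
  moreover have "open (snd c ` (U \<inter> fst c))" using U c openin_manifold[OF A] by auto
  ultimately show "openin (top_of_set (snd c ` fst c)) {x \<in> topspace (top_of_set (snd c ` fst c)). chart_inv c x \<in> U}"
    by (auto intro: open_subset)
qed

lemma continuous_map_chart:
  assumes A: "smooth_atlas A" and c: "c \<in> A"
  shows "continuous_map (subtopology (manifold_topology A) (fst c)) euclidean (snd c)"
  unfolding continuous_map_def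
proof (intro conjI allI impI)
  fix U :: "'b set" assume "openin euclidean U"
  then have "openin (manifold_topology A) (fst c \<inter> snd c -` U)"
    using openin_chart_vimage[OF A c] by auto
  moreover have "{x \<in> topspace (subtopology (manifold_topology A) (fst c)). snd c x \<in> U} = fst c \<inter> (fst c \<inter> snd c -` U)"
    using c by (auto simp: topspace_manifold[OF A] carrier_def)
  ultimately show "openin (subtopology (manifold_topology A) (fst c))
     {x \<in> topspace (subtopology (manifold_topology A) (fst c)). snd c x \<in> U}"
    by (metis openin_subtopology_Int2)
qed auto

lemma continuous_map_from_manifold:
  assumes A: "smooth_atlas A"
    and f: "\<And>c. c \<in> A \<Longrightarrow> continuous_map (top_of_set (snd c ` fst c)) Y (\<lambda>v. f (chart_inv c v))"
  shows "continuous_map (manifold_topology A) Y f"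
  unfolding continuous_map_def
proof (intro conjI allI impI)
  have "f x \<in> topspace Y" if "c \<in> A" "x \<in> fst c" for x c
    using continuous_map_funspace[OF f[OF that(1)]] that chart_inv_eq[OF smooth_atlasD(1)[OF A that(1)] that(2)]
    by (force simp: Pi_iff)
  then show "f \<in> topspace (manifold_topology A) \<rightarrow> topspace Y"
    by (auto simp: topspace_manifold[OF A] carrier_def)
  fix U assume U: "openin Y U"
  have "open (snd c ` ({x \<in> carrier A. f x \<in> U} \<inter> fst c))" if c: "c \<in> A" for c
  proof -
    have "snd c ` ({x \<in> carrier A. f x \<in> U} \<inter> fst c) = {v \<in> snd c ` fst c. f (chart_inv c v) \<in> U}"
      using c by (auto simp: chart_inv_eq[OF smooth_atlasD(1)[OF A c]] carrier_def)
    moreover have "openin (top_of_set (snd c ` fst c)) {v \<in> snd c ` fst c. f (chart_inv c v) \<in> U}"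
      using openin_continuous_map_preimage[OF f[OF c] U] by simp
    ultimately show ?thesis
      using smooth_atlasD(2)[OF A c] openin_open_trans by auto
  qed
  then show "openin (manifold_topology A) {x \<in> topspace (manifold_topology A). f x \<in> U}"
    by (simp add: openin_manifold[OF A] topspace_manifold[OF A])
qed

text \<open>A continuous injection of a compact space into a Hausdorff space is an embedding. Here
  only the image has to be Hausdorff, and it is as soon as any two of its points lie in a common
  chart, where they are separated by coordinates.\<close>

lemma embedding_map_compact:
  assumes A: "smooth_atlas A" and "compact_space X" "continuous_map X (manifold_topology A) f"
    and "inj_on f (topspace X)"
    and ch: "\<And>x y. x \<in> topspace X \<Longrightarrow> y \<in> topspace X \<Longrightarrow> \<exists>d\<in>A. f x \<in> fst d \<and> f y \<in> fst d"
  shows "embedding_map X (manifold_topology A) f"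
proof -
  let ?Y = "subtopology (manifold_topology A) (f ` topspace X)"
  have "Hausdorff_space ?Y"
    unfolding Hausdorff_space_def
  proof (intro allI impI, elim conjE)
    fix u v assume "u \<in> topspace ?Y" "v \<in> topspace ?Y" "u \<noteq> v"
    then obtain x y where "x \<in> topspace X" "u = f x" "y \<in> topspace X" "v = f y" by auto
    then obtain d where d: "d \<in> A" "u \<in> fst d" "v \<in> fst d" using ch by blast
    then have "snd d u \<noteq> snd d v" using \<open>u \<noteq> v\<close> smooth_atlasD(1)[OF A d(1)] by (meson inj_onD)
    then obtain U V where UV: "open U" "open V" "snd d u \<in> U" "snd d v \<in> V" "U \<inter> V = {}"
      by (meson hausdorff)
    let ?U = "f ` topspace X \<inter> (fst d \<inter> snd d -` U)" and ?V = "f ` topspace X \<inter> (fst d \<inter> snd d -` V)"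
    have "openin ?Y ?U" "openin ?Y ?V"
      using openin_chart_vimage[OF A d(1)] UV by (auto intro: openin_subtopology_Int2)
    moreover have "u \<in> ?U" "v \<in> ?V" "disjnt ?U ?V"
      using \<open>u \<in> topspace ?Y\<close> \<open>v \<in> topspace ?Y\<close> d UV by (auto simp: disjnt_def)
    ultimately show "\<exists>U V. openin ?Y U \<and> openin ?Y V \<and> u \<in> U \<and> v \<in> V \<and> disjnt U V"
      by blast
  qed
  moreover have "continuous_map X ?Y f"
    using assms(3) by (simp add: continuous_map_in_subtopology)
  ultimately have "embedding_map X ?Y f"
    using continuous_imp_closed_map_gen[of X ?Y f] assms(2,4) Hausdorff_imp_kc_space
    by (intro injective_closed_imp_embedding_map) auto
  then show ?thesis using embedding_map_in_subtopology by blast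
qed

section \<open>Smooth paths\<close>

text \<open>One chart around each point suffices to check smoothness.\<close>

lemma smooth_pathI:
  assumes L: "smooth_atlas L" and A: "smooth_atlas A"
    and rep: "\<And>t x. t \<in> {0..1} \<Longrightarrow> x \<in> carrier L \<Longrightarrow>
      \<exists>c\<in>charts_at L x. \<exists>d\<in>charts_at A (\<phi> t x). \<exists>W G. open W \<and> (t, snd c x) \<in> W \<and> smooth_on W G \<and>
        (\<forall>s\<in>{0..1}. \<forall>y\<in>fst c. (s, snd c y) \<in> W \<longrightarrow> \<phi> s y \<in> fst d \<and> snd d (\<phi> s y) = G (s, snd c y))"
  shows "smooth_path L A \<phi>"
  unfolding smooth_path_def
proof (intro ballI conjI)
  fix t :: real and x assume t: "t \<in> {0..1}" and x: "x \<in> carrier L"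
  from rep[OF t x] obtain c d W G where c0: "c \<in> charts_at L x" and d0: "d \<in> charts_at A (\<phi> t x)"
    and W: "open W" "(t, snd c x) \<in> W" "smooth_on W G"
    and G0: "\<forall>s\<in>{0..1}. \<forall>y\<in>fst c. (s, snd c y) \<in> W \<longrightarrow> \<phi> s y \<in> fst d \<and> snd d (\<phi> s y) = G (s, snd c y)"
    by blast
  have c: "c \<in> L" "x \<in> fst c" and d: "d \<in> A" "\<phi> t x \<in> fst d" using c0 d0 by (auto simp: charts_at_iff)
  have G: "\<phi> s y \<in> fst d \<and> snd d (\<phi> s y) = G (s, snd c y)"
    if "s \<in> {0..1}" "y \<in> fst c" "(s, snd c y) \<in> W" for s y using G0 that by blast
  show "\<phi> t x \<in> carrier A" using d by (auto simp: carrier_def)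
  fix c' d' assume c': "c' \<in> charts_at L x" and d': "d' \<in> charts_at A (\<phi> t x)"
  then have c'L: "c' \<in> L" "x \<in> fst c'" and d'A: "d' \<in> A" "\<phi> t x \<in> fst d'" by (auto simp: charts_at_iff)
  note injc' = smooth_atlasD(1)[OF L c'L(1)] and injd = smooth_atlasD(1)[OF A d(1)]
    and injc = smooth_atlasD(1)[OF L c(1)]
  define O1 where "O1 = snd c' ` (fst c' \<inter> fst c)"
  define O2 where "O2 = snd d ` (fst d \<inter> fst d')"
  define \<tau> where "\<tau> = transition c' c"
  define H where "H = (\<lambda>z. (fst z, \<tau> (snd z)) :: real \<times> _)"
  have O1: "open O1" "smooth_on O1 \<tau>"
    unfolding O1_def \<tau>_def using smooth_atlasD(3,4)[OF L c'L(1) c(1)] by auto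
  have O2: "open O2" "smooth_on O2 (transition d d')"
    unfolding O2_def using smooth_atlasD(3,4)[OF A d(1) d'A(1)] by auto
  have U: "open (UNIV \<times> O1 :: (real \<times> _) set)" using O1 by (simp add: open_Times)
  have H: "smooth_on (UNIV \<times> O1) H"
    unfolding H_def by (intro smooth_intros U smooth_on_compose[OF O1(2)] O1) auto
  \<comment> \<open>\<open>W1\<close> keeps the source coordinates in the overlap of
    \<open>c'\<close> and \<open>c\<close>; \<open>W2\<close> below also keeps the values in the
    overlap of \<open>d\<close> and \<open>d'\<close>. On \<open>W2\<close> the new representative
    is \<open>G\<close> conjugated by transition maps.\<close>
  define W1 where "W1 = UNIV \<times> O1 \<inter> H -` W"
  have W1: "open W1"
    unfolding W1_def using smooth_on_continuous[OF H] U W(1) by (metis continuous_open_preimage)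
  have GH: "smooth_on W1 (\<lambda>z. G (H z))"
    by (rule smooth_on_compose[OF W(3) smooth_on_subset[OF H] W1 W(1)]) (auto simp: W1_def)
  define W2 where "W2 = W1 \<inter> (\<lambda>z. G (H z)) -` O2"
  have W2: "open W2"
    unfolding W2_def using smooth_on_continuous[OF GH] W1 O2(1) by (metis continuous_open_preimage)
  have \<tau>: "\<tau> (snd c' y) = snd c y" if "y \<in> fst c'" for y
    unfolding \<tau>_def using transition_chart[OF injc' that] .
  show "\<exists>W G. open W \<and> (t, snd c' x) \<in> W \<and> smooth_on W G \<and>
     (\<forall>s\<in>{0..1}. \<forall>y\<in>fst c'. (s, snd c' y) \<in> W \<longrightarrow> \<phi> s y \<in> fst d' \<and> snd d' (\<phi> s y) = G (s, snd c' y))"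
  proof (intro exI conjI ballI impI)
    show "open W2" by fact
    have "(t, snd c' x) \<in> W1" unfolding W1_def O1_def H_def using c c'L W(2) \<tau> by auto
    moreover have "G (H (t, snd c' x)) = snd d (\<phi> t x)"
      using G[OF t c(2) W(2)] \<tau>[OF c'L(2)] by (simp add: H_def)
    ultimately show "(t, snd c' x) \<in> W2" unfolding W2_def O2_def using d d'A by auto
    show "smooth_on W2 (\<lambda>z. transition d d' (G (H z)))"
      by (rule smooth_on_compose[OF O2(2) smooth_on_subset[OF GH] W2 O2(1)]) (auto simp: W2_def)
    fix s :: real and y assume s: "s \<in> {0..1}" and y: "y \<in> fst c'" and sy: "(s, snd c' y) \<in> W2"
    have "snd c' y \<in> O1" using sy by (auto simp: W2_def W1_def)
    then have yc: "y \<in> fst c" unfolding O1_def using injc' y by (auto simp: inj_on_def)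
    have "(s, snd c y) \<in> W" using sy \<tau>[OF y] by (auto simp: W2_def W1_def H_def)
    from G[OF s yc this] have *: "\<phi> s y \<in> fst d" "G (H (s, snd c' y)) = snd d (\<phi> s y)"
      using \<tau>[OF y] by (auto simp: H_def)
    then have "snd d (\<phi> s y) \<in> O2" using sy by (auto simp: W2_def)
    then show "\<phi> s y \<in> fst d'" unfolding O2_def using injd * by (auto simp: inj_on_def)
    show "snd d' (\<phi> s y) = transition d d' (G (H (s, snd c' y)))"
      unfolding *(2) using transition_chart[OF injd *(1)] by simp
  qed
qed

lemma smooth_slice:
  fixes G :: "real \<times> 'e::euclidean_space \<Rightarrow> 'f::real_normed_vector"
  assumes "open W" "smooth_on W G"
  shows "open {v. (t, v) \<in> W}" "smooth_on {v. (t, v) \<in> W} (\<lambda>v. G (t, v))"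
proof -
  have "{v. (t, v) \<in> W} = Pair t -` W" by auto
  then show o: "open {v. (t, v) \<in> W}" using assms(1) by (auto intro!: open_vimage continuous_intros)
  show "smooth_on {v. (t, v) \<in> W} (\<lambda>v. G (t, v))"
    by (intro smooth_on_compose[OF assms(2)] smooth_intros o assms(1)) auto
qed

text \<open>Shrinking \<open>W\<close> to the range of the chart turns the condition on points of
  \<open>fst c\<close> into one on coordinates \<open>v\<close>, the form in which derivatives can
  be taken.\<close>

lemma smooth_path_chartE:
  assumes "smooth_atlas L" "smooth_path L A \<phi>" "t \<in> {0..1}" "c \<in> charts_at L x" "d \<in> charts_at A (\<phi> t x)"
  obtains W G where "open W" "(t, snd c x) \<in> W" "smooth_on W G"
    "\<And>s v. s \<in> {0..1} \<Longrightarrow> (s, v) \<in> W \<Longrightarrow>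
      v \<in> snd c ` fst c \<and> \<phi> s (chart_inv c v) \<in> fst d \<and> in_charts c d (\<phi> s) v = G (s, v)"
proof -
  obtain W G where W: "open W" "(t, snd c x) \<in> W" "smooth_on W G"
    and G: "\<And>s y. s \<in> {0..1} \<Longrightarrow> y \<in> fst c \<Longrightarrow> (s, snd c y) \<in> W \<Longrightarrow> \<phi> s y \<in> fst d \<and> snd d (\<phi> s y) = G (s, snd c y)"
    using assms charts_at_carrier[OF assms(4)] unfolding smooth_path_def by metis
  have c: "c \<in> L" "x \<in> fst c" using assms(4) by (auto simp: charts_at_iff)
  note inj = smooth_atlasD(1)[OF assms(1) c(1)]
  show ?thesis
  proof (rule that)
    show "open (W \<inter> UNIV \<times> snd c ` fst c)"
      using W(1) smooth_atlasD(2)[OF assms(1) c(1)] by (intro open_Int open_Times) auto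
    show "smooth_on (W \<inter> UNIV \<times> snd c ` fst c) G" using W(3) smooth_on_subset by blast
    show "v \<in> snd c ` fst c \<and> \<phi> s (chart_inv c v) \<in> fst d \<and> in_charts c d (\<phi> s) v = G (s, v)"
      if s: "s \<in> {0..1}" "(s, v) \<in> W \<inter> UNIV \<times> snd c ` fst c" for s v
    proof -
      from s obtain y where y: "y \<in> fst c" "v = snd c y" by auto
      then show ?thesis using G[OF s(1) y(1)] s(2) chart_inv_eq[OF inj y(1)] by (auto simp: in_charts_def)
    qed
  qed (use W(2) c in auto)
qed

text \<open>Besides extracting the maps of a path, this is applied to constant paths: smoothness of
  a single map can then be checked with one pair of charts around each point.\<close>

lemma smooth_path_imp_smooth_map:
  assumes L: "smooth_atlas L" and A: "smooth_atlas A" and \<phi>: "smooth_path L A \<phi>" and t: "t \<in> {0..1}"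
  shows "smooth_map L A (\<phi> t)"
  unfolding smooth_map_def
proof (intro conjI ballI)
  have car: "\<phi> t x \<in> carrier A" if "x \<in> carrier L" for x using \<phi> t that unfolding smooth_path_def by auto
  show "continuous_map (manifold_topology L) (manifold_topology A) (\<phi> t)"
    unfolding continuous_map_def
  proof (intro conjI allI impI)
    show "\<phi> t \<in> topspace (manifold_topology L) \<rightarrow> topspace (manifold_topology A)"
      using car by (auto simp: topspace_manifold L A)
    fix U assume U: "openin (manifold_topology A) U"
    have "open (snd c ` ({x \<in> carrier L. \<phi> t x \<in> U} \<inter> fst c))" if c: "c \<in> L" for c
    proof (subst open_subopen, intro ballI)
      fix w assume "w \<in> snd c ` ({x \<in> carrier L. \<phi> t x \<in> U} \<inter> fst c)"
      then obtain x where x: "x \<in> carrier L" "\<phi> t x \<in> U" "x \<in> fst c" "w = snd c x" by auto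
      obtain d where d: "d \<in> charts_at A (\<phi> t x)" using car[OF x(1)] by (rule carrierE)
      obtain W G where W: "open W" "(t, snd c x) \<in> W" "smooth_on W G"
        and G: "\<And>s v. s \<in> {0..1} \<Longrightarrow> (s, v) \<in> W \<Longrightarrow>
          v \<in> snd c ` fst c \<and> \<phi> s (chart_inv c v) \<in> fst d \<and> in_charts c d (\<phi> s) v = G (s, v)"
        using smooth_path_chartE[OF L \<phi> t _ d] c x by (metis charts_at_iff)
      have dA: "d \<in> A" "\<phi> t x \<in> fst d" using d by (auto simp: charts_at_iff)
      let ?V = "{v. (t, v) \<in> W} \<inter> (\<lambda>v. G (t, v)) -` (snd d ` (U \<inter> fst d))"
      have "open ?V"
        using smooth_on_continuous[OF smooth_slice(2)[OF W(1,3)]] smooth_slice(1)[OF W(1,3)] U dA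
        unfolding openin_manifold[OF A] by (metis continuous_open_preimage)
      moreover have "w \<in> ?V"
        using W(2) G[OF t W(2)] x dA imageI[of "\<phi> t x" "U \<inter> fst d" "snd d"]
        by (auto simp: in_charts_def chart_inv_eq[OF smooth_atlasD(1)[OF L c]])
      moreover have "?V \<subseteq> snd c ` ({x \<in> carrier L. \<phi> t x \<in> U} \<inter> fst c)"
      proof
        fix v assume v: "v \<in> ?V"
        then have "(t, v) \<in> W" by simp
        from G[OF t this] have g: "v \<in> snd c ` fst c" "\<phi> t (chart_inv c v) \<in> fst d" "in_charts c d (\<phi> t) v = G (t, v)"
          by auto
        from g(1) obtain y where y: "y \<in> fst c" "v = snd c y" by auto
        have yi: "chart_inv c v = y" using y chart_inv_eq[OF smooth_atlasD(1)[OF L c]] by simp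
        have "snd d (\<phi> t y) \<in> snd d ` (U \<inter> fst d)" using v g(3) yi by (auto simp: in_charts_def)
        then have "\<phi> t y \<in> U" using g(2) yi smooth_atlasD(1)[OF A dA(1)] by (auto simp: inj_on_def)
        then show "v \<in> snd c ` ({x \<in> carrier L. \<phi> t x \<in> U} \<inter> fst c)" using y c by (auto simp: carrier_def)
      qed
      ultimately show "\<exists>T. open T \<and> w \<in> T \<and> T \<subseteq> snd c ` ({x \<in> carrier L. \<phi> t x \<in> U} \<inter> fst c)" by blast
    qed
    then show "openin (manifold_topology L) {x \<in> topspace (manifold_topology L). \<phi> t x \<in> U}"
      by (simp add: openin_manifold[OF L] topspace_manifold[OF L])
  qed
  fix c d assume c: "c \<in> L" and d: "d \<in> A"
  show "smooth_on (snd c ` (fst c \<inter> \<phi> t -` fst d)) (in_charts c d (\<phi> t))"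
  proof (rule smooth_on_local)
    fix w assume "w \<in> snd c ` (fst c \<inter> \<phi> t -` fst d)"
    then obtain x where x: "x \<in> fst c" "\<phi> t x \<in> fst d" "w = snd c x" by auto
    have "c \<in> charts_at L x" "d \<in> charts_at A (\<phi> t x)" using c d x by (auto simp: charts_at_iff)
    from smooth_path_chartE[OF L \<phi> t this] obtain W G where W: "open W" "(t, snd c x) \<in> W" "smooth_on W G"
        and G: "\<And>s v. s \<in> {0..1} \<Longrightarrow> (s, v) \<in> W \<Longrightarrow>
          v \<in> snd c ` fst c \<and> \<phi> s (chart_inv c v) \<in> fst d \<and> in_charts c d (\<phi> s) v = G (s, v)" by metis
    show "\<exists>U. open U \<and> w \<in> U \<and> smooth_on U (in_charts c d (\<phi> t))"
    proof (intro exI conjI)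
      show "smooth_on {v. (t, v) \<in> W} (in_charts c d (\<phi> t))"
        using smooth_slice[OF W(1,3), of t] G[OF t] smooth_on_cong[of "{v. (t, v) \<in> W}" "in_charts c d (\<phi> t)" "\<lambda>v. G (t, v)"]
        by blast
    qed (use smooth_slice(1)[OF W(1,3)] W(2) x in auto)
  qed
qed

section \<open>The smooth topology\<close>

lemma iterated_derivative_cong:
  assumes "open V" "\<And>y. y \<in> V \<Longrightarrow> f y = g y"
  shows "x \<in> V \<Longrightarrow> iterated_derivative vs f x = iterated_derivative vs g x"
proof (induction vs arbitrary: x)
  case (Cons v vs)
  show ?case
    using frechet_derivative_cong_open[OF assms(1) Cons.prems, of "iterated_derivative vs f" "iterated_derivative vs g"]
      Cons.IH by simp
qed (simp add: assms)

lemma smooth_on_iterated_derivative: "smooth_on S f \<Longrightarrow> smooth_on S (iterated_derivative vs f)"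
  by (induction vs) (auto intro: smooth_on_derivative)

text \<open>Derivatives of a slice are partial derivatives of \<open>G\<close> in the directions
  \<open>(0, v)\<close>. Hence they are jointly continuous in time and position, which is what
  continuity of a path in the smooth topology requires.\<close>

lemma iterated_derivative_slice:
  fixes G :: "real \<times> 'e::euclidean_space \<Rightarrow> 'f::real_normed_vector"
  assumes W: "open W" and G: "smooth_on W G"
  shows "(t, v) \<in> W \<Longrightarrow>
    iterated_derivative vs (\<lambda>v. G (t, v)) v = iterated_derivative (map (Pair 0) vs) G (t, v)"
proof (induction vs arbitrary: v)
  case (Cons u vs)
  let ?H = "iterated_derivative (map (Pair 0) vs) G"
  have "frechet_derivative (iterated_derivative vs (\<lambda>v. G (t, v))) (at v) = frechet_derivative (\<lambda>v. ?H (t, v)) (at v)"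
    by (rule frechet_derivative_cong_open[OF smooth_slice(1)[OF W G, of t]]) (use Cons in auto)
  moreover have "((\<lambda>v. ?H (t, v)) has_derivative (\<lambda>u. frechet_derivative ?H (at (t, v)) (0, u))) (at v)"
    by (rule has_derivative_compose[of "Pair t" "Pair 0", OF _
          smooth_on_has_derivative[OF smooth_on_iterated_derivative[OF G] Cons.prems]])
       (intro derivative_eq_intros | simp)+
  ultimately show ?case by (simp add: frechet_derivative_at[symmetric])
qed simp

lemma smooth_maps_openin:
  assumes "smooth_atlas A" "smooth_atlas B" "f \<in> smooth_maps A B" "c \<in> A" "d \<in> B"
  shows "open (snd c ` (fst c \<inter> f -` fst d))"
    and "smooth_on (snd c ` (fst c \<inter> f -` fst d)) (in_charts c d f)"
proof -
  have f: "continuous_map (manifold_topology A) (manifold_topology B) f"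
    and s: "smooth_on (snd c ` (fst c \<inter> f -` fst d)) (in_charts c d f)"
    using assms(3-5) unfolding smooth_maps_def smooth_map_def by auto
  have "openin (manifold_topology A) {x \<in> carrier A. f x \<in> fst d}"
    using openin_continuous_map_preimage[OF f openin_chart[OF assms(2,5)]] by (simp add: topspace_manifold[OF assms(1)])
  then have "open (snd c ` ({x \<in> carrier A. f x \<in> fst d} \<inter> fst c))"
    using assms(4) openin_manifold[OF assms(1)] by auto
  moreover have "{x \<in> carrier A. f x \<in> fst d} \<inter> fst c = fst c \<inter> f -` fst d"
    using assms(4) by (auto simp: carrier_def)
  ultimately show "open (snd c ` (fst c \<inter> f -` fst d))" by simp
  show "smooth_on (snd c ` (fst c \<inter> f -` fst d)) (in_charts c d f)" by fact
qed

lemma topspace_smooth_topology: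
  assumes "smooth_atlas A" "A \<noteq> {}" "B \<noteq> {}"
  shows "topspace (smooth_topology A B) = smooth_maps A B"
proof -
  obtain c d where cd: "c \<in> A" "d \<in> B" using assms by blast
  \<comment> \<open>With the empty compact set every condition in \<open>smooth_nbhd\<close> except
    membership is void, so this one neighbourhood is all of \<open>smooth_maps A B\<close>.\<close>
  have "f \<in> topspace (smooth_topology A B)" if "f \<in> smooth_maps A B" for f
    unfolding smooth_topology_def topology_generated_by_topspace
    by (intro UnionI[of "smooth_nbhd A B c d {} [] 1 f"] CollectI exI conjI, rule refl)
       (use cd that in \<open>auto simp: smooth_nbhd_def\<close>)
  then show ?thesis
    unfolding smooth_topology_def topology_generated_by_topspace by (auto simp: smooth_nbhd_def)
qed

lemma compact_chart_image:
  assumes "smooth_atlas A" "c \<in> A" "compactin (manifold_topology A) K" "K \<subseteq> fst c"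
  shows "compact (snd c ` K)"
  using image_compactin[OF _ continuous_map_chart[OF assms(1,2)], of K] assms(3,4)
  by (simp add: compactin_subtopology)

text \<open>A tube argument: for each \<open>x\<close> in the compact set \<open>K\<close>, joint
  continuity of the derivative gives a box \<open>I x \<times> V x\<close> on which the estimate
  holds. Finitely many \<open>V x\<close> cover the coordinates of \<open>K\<close>, and the
  intersection of the corresponding \<open>I x\<close> is the required neighbourhood of
  \<open>t\<close>.\<close>

lemma smooth_path_continuous_map:
  assumes L: "smooth_atlas L" "L \<noteq> {}" and A: "smooth_atlas A" "A \<noteq> {}"
    and \<phi>: "smooth_path L A \<phi>" and ext: "\<And>t. t \<in> {0..1} \<Longrightarrow> \<phi> t \<in> extensional (carrier L)"
  shows "continuous_map (top_of_set {0..1}) (smooth_topology L A) \<phi>"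
proof -
  have sm: "\<phi> t \<in> smooth_maps L A" if "t \<in> {0..1}" for t
    using ext[OF that] smooth_path_imp_smooth_map[OF L(1) A(1) \<phi> that] by (simp add: smooth_maps_def)
  have op: "openin (top_of_set {0..1}) (\<phi> -` smooth_nbhd L A c d K vs \<epsilon> f \<inter> {0..1})"
    if c: "c \<in> L" and d: "d \<in> A" and K: "compactin (manifold_topology L) K" "K \<subseteq> fst c"
      and \<epsilon>: "\<epsilon> > 0" and f: "f \<in> smooth_maps L A" "f ` K \<subseteq> fst d" for c d K vs \<epsilon> f
  proof (subst openin_subopen, intro ballI)
    fix t assume "t \<in> \<phi> -` smooth_nbhd L A c d K vs \<epsilon> f \<inter> {0..1}"
    then have t: "t \<in> {0..1}" and tK: "\<phi> t ` K \<subseteq> fst d"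
      and te: "\<And>x. x \<in> K \<Longrightarrow> norm (iterated_derivative vs (in_charts c d (\<phi> t)) (snd c x)
                    - iterated_derivative vs (in_charts c d f) (snd c x)) < \<epsilon>"
      by (auto simp: smooth_nbhd_def)
    let ?F = "iterated_derivative vs (in_charts c d f)"
    let ?O = "snd c ` (fst c \<inter> f -` fst d)"
    have "\<exists>I V. open I \<and> t \<in> I \<and> open V \<and> snd c x \<in> V \<and>
      (\<forall>s\<in>I \<inter> {0..1}. \<forall>v\<in>V. \<phi> s (chart_inv c v) \<in> fst d \<and>
          norm (iterated_derivative vs (in_charts c d (\<phi> s)) v - ?F v) < \<epsilon>)" if x: "x \<in> K" for x
    proof -
      have xc: "c \<in> charts_at L x" "d \<in> charts_at A (\<phi> t x)" using x K(2) tK c d by (auto simp: charts_at_iff)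
      from smooth_path_chartE[OF L(1) \<phi> t xc] obtain W G where W: "open W" "(t, snd c x) \<in> W" "smooth_on W G"
        and G: "\<And>s v. s \<in> {0..1} \<Longrightarrow> (s, v) \<in> W \<Longrightarrow>
          v \<in> snd c ` fst c \<and> \<phi> s (chart_inv c v) \<in> fst d \<and> in_charts c d (\<phi> s) v = G (s, v)" by metis
      let ?H = "iterated_derivative (map (Pair 0) vs) G"
      have eq: "iterated_derivative vs (in_charts c d (\<phi> s)) v = ?H (s, v)"
        if "s \<in> {0..1}" "(s, v) \<in> W" for s v
        using iterated_derivative_cong[OF smooth_slice(1)[OF W(1,3)], of s "in_charts c d (\<phi> s)" "\<lambda>v. G (s, v)" v vs]
          G[OF that(1)] that(2) iterated_derivative_slice[OF W(1,3) that(2)] by auto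
      have oO: "open ?O" and sO: "smooth_on ?O ?F"
        using smooth_maps_openin[OF L(1) A(1) f(1) c d] smooth_on_iterated_derivative by blast+
      let ?R = "\<lambda>z. norm (?H z - ?F (snd z))"
      let ?Z = "W \<inter> UNIV \<times> ?O"
      have oZ: "open ?Z" using W(1) oO by (intro open_Int open_Times) auto
      have cH: "continuous_on ?Z ?H"
        using smooth_on_continuous[OF smooth_on_iterated_derivative[OF W(3)]] continuous_on_subset by blast
      have cF: "continuous_on ?Z (\<lambda>z. ?F (snd z))"
        by (rule continuous_on_compose2[OF smooth_on_continuous[OF sO]]) (auto intro!: continuous_intros)
      have "open (?Z \<inter> ?R -` {..<\<epsilon>})"
        by (rule continuous_open_preimage[OF continuous_on_norm[OF continuous_on_diff[OF cH cF]] oZ open_lessThan])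
      moreover have "(t, snd c x) \<in> ?Z \<inter> ?R -` {..<\<epsilon>}"
        using W(2) te[OF x] eq[OF t W(2)] f(2) x K(2) by auto
      ultimately obtain I V where IV: "open I" "open V" "(t, snd c x) \<in> I \<times> V" "I \<times> V \<subseteq> ?Z \<inter> ?R -` {..<\<epsilon>}"
        by (rule open_prod_elim)
      have "\<phi> s (chart_inv c v) \<in> fst d \<and>
          norm (iterated_derivative vs (in_charts c d (\<phi> s)) v - ?F v) < \<epsilon>"
        if s: "s \<in> I \<inter> {0..1}" and v: "v \<in> V" for s v
      proof -
        have "(s, v) \<in> W" "?R (s, v) < \<epsilon>" using IV(4) s v by auto
        then show ?thesis using eq[of s v] G[of s v] s by auto
      qed
      then show ?thesis using IV by blast
    qed
    then obtain I V where IV: "\<And>x. x \<in> K \<Longrightarrow> open (I x) \<and> t \<in> I x \<and> open (V x) \<and> snd c x \<in> V x \<and>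
      (\<forall>s\<in>I x \<inter> {0..1}. \<forall>v\<in>V x. \<phi> s (chart_inv c v) \<in> fst d \<and>
          norm (iterated_derivative vs (in_charts c d (\<phi> s)) v - ?F v) < \<epsilon>)" by metis
    have "snd c ` K \<subseteq> (\<Union>x\<in>K. V x)" using IV by blast
    then obtain K' where K': "K' \<subseteq> K" "finite K'" "snd c ` K \<subseteq> (\<Union>x\<in>K'. V x)"
      using compactE_image[OF compact_chart_image[OF L(1) c K], of K V] IV by blast
    have "(\<Inter>x\<in>K'. I x) \<inter> {0..1} \<subseteq> \<phi> -` smooth_nbhd L A c d K vs \<epsilon> f"
    proof
      fix s assume s: "s \<in> (\<Inter>x\<in>K'. I x) \<inter> {0..1}"
      have "\<phi> s y \<in> fst d \<and> norm (iterated_derivative vs (in_charts c d (\<phi> s)) (snd c y) - ?F (snd c y)) < \<epsilon>"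
        if y: "y \<in> K" for y
      proof -
        obtain x where x: "x \<in> K'" "snd c y \<in> V x" using K'(3) y by blast
        have xK: "x \<in> K" using x(1) K'(1) by blast
        have "s \<in> I x \<inter> {0..1}" using s x by blast
        then have "\<phi> s (chart_inv c (snd c y)) \<in> fst d \<and>
          norm (iterated_derivative vs (in_charts c d (\<phi> s)) (snd c y) - ?F (snd c y)) < \<epsilon>"
          using IV[OF xK] x(2) by blast
        moreover have "chart_inv c (snd c y) = y"
          using chart_inv_eq[OF smooth_atlasD(1)[OF L(1) c]] y K(2) by blast
        ultimately show ?thesis by simp
      qed
      then show "s \<in> \<phi> -` smooth_nbhd L A c d K vs \<epsilon> f"
        using sm[of s] s by (auto simp: smooth_nbhd_def)
    qed
    moreover have "open (\<Inter>x\<in>K'. I x)" using K' IV by (intro open_INT) blast+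
    moreover have "t \<in> (\<Inter>x\<in>K'. I x)" using IV K'(1) by blast
    ultimately show "\<exists>T. openin (top_of_set {0..1}) T \<and> t \<in> T \<and> T \<subseteq> \<phi> -` smooth_nbhd L A c d K vs \<epsilon> f \<inter> {0..1}"
      using t by (intro exI[of _ "{0..1} \<inter> (\<Inter>x\<in>K'. I x)"]) (auto intro: openin_open_Int)
  qed
  show ?thesis
    unfolding smooth_topology_def continuous_on_generated_topo_iff
  proof (intro conjI allI impI)
    fix U assume "U \<in> {smooth_nbhd L A c d K vs \<epsilon> f |c d K vs \<epsilon> f.
             c \<in> L \<and> d \<in> A \<and> compactin (manifold_topology L) K \<and> K \<subseteq> fst c \<and> 0 < \<epsilon> \<and>
             f \<in> smooth_maps L A \<and> f ` K \<subseteq> fst d}"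
    then obtain c d K vs \<epsilon> f where "U = smooth_nbhd L A c d K vs \<epsilon> f"
      "c \<in> L" "d \<in> A" "compactin (manifold_topology L) K" "K \<subseteq> fst c" "0 < \<epsilon>" "f \<in> smooth_maps L A" "f ` K \<subseteq> fst d"
      by blast
    then show "openin (top_of_set {0..1}) (\<phi> -` U \<inter> topspace (top_of_set {0..1}))"
      using op[of c d K \<epsilon> f vs] by simp
  next
    show "\<phi> ` topspace (top_of_set {0..1}) \<subseteq> \<Union> {smooth_nbhd L A c d K vs \<epsilon> f |c d K vs \<epsilon> f.
             c \<in> L \<and> d \<in> A \<and> compactin (manifold_topology L) K \<and> K \<subseteq> fst c \<and> 0 < \<epsilon> \<and>
             f \<in> smooth_maps L A \<and> f ` K \<subseteq> fst d}"
      using topspace_smooth_topology[OF L A(2)] sm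
      unfolding smooth_topology_def topology_generated_by_topspace by auto
  qed
qed

lemma smooth_path_connected_component:
  assumes "smooth_atlas L" "L \<noteq> {}" "smooth_atlas A" "A \<noteq> {}" "smooth_path L A \<phi>"
    and "\<And>t. t \<in> {0..1} \<Longrightarrow> \<phi> t \<in> extensional (carrier L) \<inter> P" "s \<in> {0..1}" "t \<in> {0..1}"
  shows "connected_component_of (subtopology (smooth_topology L A) P) (\<phi> s) (\<phi> t)"
proof -
  have "continuous_map (top_of_set {0..1}) (subtopology (smooth_topology L A) P) \<phi>"
    using smooth_path_continuous_map[OF assms(1-5)] assms(6) by (auto simp: continuous_map_in_subtopology)
  moreover have "connectedin (top_of_set {0..1::real}) {0..1}"
    by (simp add: connectedin_subtopology)
  ultimately have "connectedin (subtopology (smooth_topology L A) P) (\<phi> ` {0..1})"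
    by (rule connectedin_continuous_map_image)
  then show ?thesis using assms(7,8) by (auto simp: connected_component_of_def)
qed

section \<open>The circle\<close>

lemma cis_eqE:
  assumes "cis x = cis y" obtains n :: int where "x = y + 2 * pi * of_int n"
proof -
  have "cis (x - y) = 1" using assms by (simp add: cis_divide[symmetric])
  then have "cos (x - y) = 1" by (simp add: complex_eq_iff)
  then obtain n :: int where "x - y = of_int n * 2 * pi" using cos_one_2pi_int by auto
  then show ?thesis using that[of n] by (simp add: algebra_simps)
qed

lemma cis_add_2pi_int: "cis (x + 2 * pi * of_int k) = cis x"
  by (simp add: cis_mult[symmetric] cis_multiple_2pi)

lemma inj_on_cis: "inj_on cis {a<..<a + 2 * pi}"
proof (rule inj_onI)
  fix x y assume xy: "x \<in> {a<..<a + 2 * pi}" "y \<in> {a<..<a + 2 * pi}" "cis x = cis y"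
  from xy(3) obtain n :: int where n: "x = y + 2 * pi * of_int n" by (rule cis_eqE)
  with xy have "\<bar>2 * pi * of_int n\<bar> < 2 * pi * 1" by auto
  then have "\<bar>of_int n :: real\<bar> < 1" by (simp add: abs_mult)
  then show "x = y" using n by simp
qed

lemma cis_shift_into: obtains k :: int where "x + 2 * pi * of_int k \<in> {a..<a + 2 * pi}"
proof -
  let ?k = "- \<lfloor>(x - a) / (2 * pi)\<rfloor>"
  have "x + 2 * pi * of_int ?k \<in> {a..<a + 2 * pi}"
    using floor_divide_lower[of "2 * pi" "x - a"] floor_divide_upper[of "2 * pi" "x - a"]
    by (auto simp: algebra_simps)
  then show ?thesis by (rule that)
qed

lemma sphere_cisE: assumes "z \<in> sphere 0 (1::real)" obtains s where "z = cis s"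
  using assms cis_Arg[of z] by (metis sgn_eq dist_0_norm mem_sphere norm_zero scaleR_one div_by_1 zero_neq_one of_real_1)

lemma fst_circle_chart: "fst (circle_chart a) = sphere 0 1 - {cis a}"
proof (intro equalityI subsetI)
  fix z assume "z \<in> fst (circle_chart a)"
  then obtain x where x: "z = cis x" "a < x" "x < a + 2 * pi" by (auto simp: circle_chart_def)
  have "cis x \<noteq> cis a"
  proof
    assume "cis x = cis a"
    then obtain n :: int where n: "x = a + 2 * pi * of_int n" by (rule cis_eqE)
    with x have "0 < of_int n * (2 * pi)" "of_int n * (2 * pi) < 1 * (2 * pi)" by (auto simp: mult.commute)
    then have "0 < (of_int n :: real)" "(of_int n :: real) < 1"
      using zero_less_mult_pos2[of "of_int n" "2 * pi"] mult_less_cancel_right_pos[of "2 * pi" "of_int n" 1] by auto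
    then show False by simp
  qed
  then show "z \<in> sphere 0 1 - {cis a}" using x by simp
next
  fix z assume z: "z \<in> sphere 0 1 - {cis a}"
  then obtain s where s: "z = cis s" using sphere_cisE by blast
  obtain k :: int where k: "s + 2 * pi * of_int k \<in> {a..<a + 2 * pi}" by (rule cis_shift_into)
  have "s + 2 * pi * of_int k \<noteq> a" using z s cis_add_2pi_int[of s k] by auto
  then show "z \<in> fst (circle_chart a)"
    using k s cis_add_2pi_int[of s k] by (force simp: circle_chart_def intro: image_eqI[of _ _ "s + 2 * pi * of_int k"])
qed

lemma snd_circle_chart: "x \<in> {a<..<a + 2 * pi} \<Longrightarrow> snd (circle_chart a) (cis x) = x"
  by (simp add: circle_chart_def inv_into_f_f[OF inj_on_cis])

lemma circle_chart_cis: "x \<in> {a<..<a + 2 * pi} \<Longrightarrow> cis x \<in> fst (circle_chart a)"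
  by (auto simp: circle_chart_def)

lemma circle_chart_image: "snd (circle_chart a) ` fst (circle_chart a) = {a<..<a + 2 * pi}"
  by (simp add: circle_chart_def inj_on_cis)

lemma circle_chart_inv: "x \<in> {a<..<a + 2 * pi} \<Longrightarrow> chart_inv (circle_chart a) x = cis x"
  by (metis chart_inv_eq circle_chart_cis circle_chart_def inj_on_cis inj_on_inv_into fst_conv snd_circle_chart snd_conv subset_refl)

lemma inj_on_circle_chart: "inj_on (snd (circle_chart a)) (fst (circle_chart a))"
  by (simp add: circle_chart_def inj_on_inv_into)

lemma circle_chart_shift:
  assumes "cis x \<in> fst (circle_chart a)"
  obtains k :: int where "x + 2 * pi * of_int k \<in> {a<..<a + 2 * pi}"
proof -
  obtain k :: int where k: "x + 2 * pi * of_int k \<in> {a..<a + 2 * pi}" by (rule cis_shift_into)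
  moreover have "x + 2 * pi * of_int k \<noteq> a"
    using assms cis_add_2pi_int[of x k] by (auto simp: fst_circle_chart)
  ultimately show ?thesis by (intro that[of k]) auto
qed

lemma circle_chartE:
  assumes "z \<in> fst (circle_chart a)"
  obtains x where "x \<in> {a<..<a + 2 * pi}" "z = cis x" "snd (circle_chart a) z = x"
  using assms snd_circle_chart by (auto simp: circle_chart_def)

lemma some_chart_at: "x \<in> carrier A \<Longrightarrow> (SOME c. c \<in> charts_at A x) \<in> charts_at A x"
  by (rule someI_ex) (meson carrierE)

lemma carrier_circle: "carrier circle_atlas = sphere 0 1"
proof -
  have "cis x \<in> fst (circle_chart (x - pi))" for x by (rule circle_chart_cis) auto
  then show ?thesis
    unfolding carrier_def circle_atlas_def by (auto simp: fst_circle_chart elim!: sphere_cisE)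
qed

text \<open>The formula is only local: the overlap of two arcs can have two components, with
  different integers \<open>k\<close>.\<close>

lemma circle_transition:
  assumes "z \<in> fst (circle_chart a)" "z \<in> fst (circle_chart b)"
  obtains k :: int and U where "open U" "snd (circle_chart a) z \<in> U"
    "\<And>w. w \<in> U \<Longrightarrow> transition (circle_chart a) (circle_chart b) w = w + 2 * pi * of_int k"
proof -
  obtain v where v: "v \<in> {a<..<a + 2 * pi}" "z = cis v" "snd (circle_chart a) z = v"
    using assms(1) by (rule circle_chartE)
  obtain k :: int where k: "v + 2 * pi * of_int k \<in> {b<..<b + 2 * pi}"
    using circle_chart_shift assms(2) v(2) by blast
  let ?U = "{a<..<a + 2 * pi} \<inter> {b - 2 * pi * of_int k<..<b + 2 * pi - 2 * pi * of_int k}"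
  show ?thesis
  proof (rule that)
    show "open ?U" "snd (circle_chart a) z \<in> ?U" using v k by auto
    fix w assume "w \<in> ?U"
    then have "w \<in> {a<..<a + 2 * pi}" "w + 2 * pi * of_int k \<in> {b<..<b + 2 * pi}" by auto
    then show "transition (circle_chart a) (circle_chart b) w = w + 2 * pi * of_int k"
      using snd_circle_chart[of "w + 2 * pi * of_int k" b]
      by (simp add: transition_def in_charts_def circle_chart_inv cis_add_2pi_int)
  qed
qed

lemma smooth_atlas_circle: "smooth_atlas circle_atlas"
proof -
  have *: "open (snd c ` (fst c \<inter> fst d)) \<and> smooth_on (snd c ` (fst c \<inter> fst d)) (transition c d)"
    if cd: "c = circle_chart a" "d = circle_chart b" for c d a b
  proof
    have eq: "snd c ` (fst c \<inter> fst d) = {a<..<a + 2 * pi} \<inter> (\<lambda>x. cis x) -` (- {cis b})"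
    proof (intro equalityI subsetI)
      fix v assume "v \<in> snd c ` (fst c \<inter> fst d)"
      then obtain z where z: "z \<in> fst c" "z \<in> fst d" "v = snd c z" by auto
      obtain x where "x \<in> {a<..<a + 2 * pi}" "z = cis x" "snd c z = x"
        using z(1) unfolding cd(1) by (rule circle_chartE)
      then show "v \<in> {a<..<a + 2 * pi} \<inter> (\<lambda>x. cis x) -` (- {cis b})"
        using cd z by (auto simp: fst_circle_chart)
    next
      fix v assume "v \<in> {a<..<a + 2 * pi} \<inter> (\<lambda>x. cis x) -` (- {cis b})"
      then show "v \<in> snd c ` (fst c \<inter> fst d)"
        using cd snd_circle_chart[of v a] circle_chart_cis[of v a]
        by (intro image_eqI[of _ _ "cis v"]) (auto simp: fst_circle_chart)
    qed
    show o: "open (snd c ` (fst c \<inter> fst d))"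
      unfolding eq by (intro continuous_open_preimage continuous_intros open_Compl closed_singleton open_greaterThanLessThan)
    show "smooth_on (snd c ` (fst c \<inter> fst d)) (transition c d)"
    proof (rule smooth_on_local)
      fix v assume "v \<in> snd c ` (fst c \<inter> fst d)"
      then obtain z where z: "z \<in> fst (circle_chart a)" "z \<in> fst (circle_chart b)" "v = snd c z" using cd by auto
      obtain k :: int and U where U: "open U" "v \<in> U" and tr: "\<And>w. w \<in> U \<Longrightarrow> transition c d w = w + 2 * pi * of_int k"
        using circle_transition[OF z(1,2)] z(3) cd by metis
      have "smooth_on U (transition c d)"
        by (rule smooth_on_transform[OF U(1) _ tr]) (intro smooth_intros U(1))+
      then show "\<exists>U. open U \<and> v \<in> U \<and> smooth_on U (transition c d)"
        using U by blast
    qed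
  qed
  show ?thesis
    unfolding smooth_atlas_def
  proof (intro conjI ballI)
    fix c assume "c \<in> circle_atlas"
    then show "inj_on (snd c) (fst c)" "open (snd c ` fst c)"
      by (auto simp: circle_atlas_def inj_on_circle_chart circle_chart_image)
  next
    fix c d assume "c \<in> circle_atlas" "d \<in> circle_atlas"
    then obtain a b where "c = circle_chart a" "d = circle_chart b" by (auto simp: circle_atlas_def)
    from *[OF this] show "open (snd c ` (fst c \<inter> fst d))" "smooth_on (snd c ` (fst c \<inter> fst d)) (transition c d)"
      by auto
  qed
qed

text \<open>The charts only show that the preimage under \<open>cis\<close> of an open set is open
  on the line. To descend to the circle one uses that \<open>cis\<close> on the compact interval
  from \<open>0\<close> to \<open>2 * pi\<close> is a quotient map onto it.\<close>

lemma manifold_topology_circle: "manifold_topology circle_atlas = top_of_set (sphere 0 1)"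
proof (rule topology_eq[THEN iffD2], intro allI iffI)
  fix W assume W: "openin (manifold_topology circle_atlas) W"
  then have Ws: "W \<subseteq> sphere 0 1"
    using openin_manifold[OF smooth_atlas_circle] carrier_circle by auto
  have "open (cis -` W)"
  proof (subst open_subopen, intro ballI)
    fix x assume x: "x \<in> cis -` W"
    let ?c = "circle_chart (x - pi)"
    have "open (snd ?c ` (W \<inter> fst ?c))"
      using W openin_manifold[OF smooth_atlas_circle] by (auto simp: circle_atlas_def)
    moreover have "x \<in> snd ?c ` (W \<inter> fst ?c)"
      using x snd_circle_chart[of x "x - pi"] circle_chart_cis[of x "x - pi"]
      by (intro image_eqI[of _ _ "cis x"]) auto
    moreover have "snd ?c ` (W \<inter> fst ?c) \<subseteq> cis -` W"
    proof
      fix v assume "v \<in> snd ?c ` (W \<inter> fst ?c)"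
      then obtain z where z: "z \<in> W" "z \<in> fst ?c" "v = snd ?c z" by auto
      from z(2) obtain y where "z = cis y" "snd ?c z = y" by (rule circle_chartE)
      then show "v \<in> cis -` W" using z by auto
    qed
    ultimately show "\<exists>T. open T \<and> x \<in> T \<and> T \<subseteq> cis -` W" by blast
  qed
  then have "openin (top_of_set {0..2 * pi}) ({0..2 * pi} \<inter> cis -` W)" by (rule openin_open_Int)
  moreover have "cis ` {0..2 * pi} = sphere 0 1"
  proof (intro equalityI subsetI)
    fix z assume "z \<in> sphere (0::complex) 1"
    then obtain s where s: "z = cis s" by (rule sphere_cisE)
    obtain k :: int where "s + 2 * pi * of_int k \<in> {0..<0 + 2 * pi}" by (rule cis_shift_into)
    then show "z \<in> cis ` {0..2 * pi}"
      using s cis_add_2pi_int[of s k] by (intro image_eqI[of _ _ "s + 2 * pi * of_int k"]) auto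
  qed auto
  ultimately show "openin (top_of_set (sphere 0 1)) W"
    using Abstract_Topology_2.continuous_imp_quotient_map[OF _ _ compact_Icc Ws, of 0 "2 * pi" cis]
    by (simp add: continuous_on_cis continuous_on_id)
next
  fix W :: "complex set" assume W: "openin (top_of_set (sphere 0 1)) W"
  then obtain U where U: "open U" "W = sphere 0 1 \<inter> U" by (auto simp: openin_open)
  show "openin (manifold_topology circle_atlas) W"
    unfolding openin_manifold[OF smooth_atlas_circle]
  proof (intro conjI ballI)
    show "W \<subseteq> carrier circle_atlas" using U by (auto simp: carrier_circle)
    fix c assume "c \<in> circle_atlas"
    then obtain a where c: "c = circle_chart a" by (auto simp: circle_atlas_def)
    have "snd c ` (W \<inter> fst c) = {a<..<a + 2 * pi} \<inter> cis -` U"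
    proof (intro equalityI subsetI)
      fix v assume "v \<in> snd c ` (W \<inter> fst c)"
      then obtain z where z: "z \<in> W" "z \<in> fst c" "v = snd c z" by auto
      obtain y where "y \<in> {a<..<a + 2 * pi}" "z = cis y" "snd c z = y"
        using z(2) unfolding c by (rule circle_chartE)
      then show "v \<in> {a<..<a + 2 * pi} \<inter> cis -` U" using z U by auto
    next
      fix v assume "v \<in> {a<..<a + 2 * pi} \<inter> cis -` U"
      then show "v \<in> snd c ` (W \<inter> fst c)"
        using snd_circle_chart[of v a] circle_chart_cis[of v a] U c
        by (intro image_eqI[of _ _ "cis v"]) auto
    qed
    moreover have "open ({a<..<a + 2 * pi} \<inter> cis -` U)"
      using U(1) by (intro continuous_open_preimage continuous_intros) auto
    ultimately show "open (snd c ` (W \<inter> fst c))" by simp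
  qed
qed

lemma circle_smooth_pathI:
  assumes A: "smooth_atlas A"
    and rep: "\<And>t s. t \<in> {0..1} \<Longrightarrow> \<exists>d\<in>charts_at A (\<phi> t (cis s)). \<exists>W G. open W \<and> (t, s) \<in> W \<and> smooth_on W G \<and>
      (\<forall>t'\<in>{0..1}. \<forall>s'. (t', s') \<in> W \<longrightarrow> \<phi> t' (cis s') \<in> fst d \<and> snd d (\<phi> t' (cis s')) = G (t', s'))"
  shows "smooth_path circle_atlas A \<phi>"
proof (rule smooth_pathI[OF smooth_atlas_circle A])
  fix t :: real and x assume t: "t \<in> {0..1}" and x: "x \<in> carrier circle_atlas"
  obtain s where s: "x = cis s" using x carrier_circle sphere_cisE by auto
  let ?c = "circle_chart (s - pi)"
  have I: "s \<in> {s - pi<..<s - pi + 2 * pi}" by auto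
  have c: "?c \<in> charts_at circle_atlas x" "snd ?c x = s"
    using circle_chart_cis[OF I] snd_circle_chart[OF I] s by (auto simp: charts_at_iff circle_atlas_def)
  obtain d W G where d: "d \<in> charts_at A (\<phi> t x)" and W: "open W" "(t, s) \<in> W" "smooth_on W G"
    and G: "\<forall>t'\<in>{0..1}. \<forall>s'. (t', s') \<in> W \<longrightarrow> \<phi> t' (cis s') \<in> fst d \<and> snd d (\<phi> t' (cis s')) = G (t', s')"
    using rep[OF t, of s] s by blast
  have "\<phi> t' y \<in> fst d \<and> snd d (\<phi> t' y) = G (t', snd ?c y)"
    if t': "t' \<in> {0..1}" and y: "y \<in> fst ?c" "(t', snd ?c y) \<in> W" for t' y
  proof -
    obtain s' where "y = cis s'" "snd ?c y = s'" using y(1) by (rule circle_chartE)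
    then show ?thesis using G t' y(2) by auto
  qed
  then show "\<exists>c\<in>charts_at circle_atlas x. \<exists>d\<in>charts_at A (\<phi> t x). \<exists>W G. open W \<and> (t, snd c x) \<in> W \<and> smooth_on W G \<and>
        (\<forall>s\<in>{0..1}. \<forall>y\<in>fst c. (s, snd c y) \<in> W \<longrightarrow> \<phi> s y \<in> fst d \<and> snd d (\<phi> s y) = G (s, snd c y))"
    using c d W by (intro bexI[OF _ c(1)] bexI[OF _ d] exI[of _ W] exI[of _ G]) auto
qed

text \<open>The tangent vector enters through its component in the chart that
  \<open>differential\<close> happens to choose. Charts of the circle differ from the angle
  \<open>s\<close> by translations, so the derivative along \<open>s\<close> is the derivative in
  that chart.\<close>

lemma circle_differential:
  assumes d: "d \<in> charts_at A (f (cis s))" and g: "((\<lambda>s. snd d (f (cis s))) has_vector_derivative \<gamma>) (at s)"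
  shows "differential circle_atlas A f (cis s) v d = v (SOME c. c \<in> charts_at circle_atlas (cis s)) *\<^sub>R \<gamma>"
proof -
  let ?c = "SOME c. c \<in> charts_at circle_atlas (cis s)"
  have c: "?c \<in> charts_at circle_atlas (cis s)"
    using some_chart_at[of "cis s" circle_atlas] carrier_circle by simp
  then obtain a where a: "?c = circle_chart a" "cis s \<in> fst (circle_chart a)"
    by (auto simp: charts_at_iff circle_atlas_def)
  then obtain k :: int where k: "s + 2 * pi * of_int k \<in> {a<..<a + 2 * pi}" using circle_chart_shift by blast
  let ?x = "s + 2 * pi * of_int k"
  have x: "snd ?c (cis s) = ?x" using snd_circle_chart[OF k] a by (simp add: cis_add_2pi_int)
  have "((\<lambda>x. snd d (f (cis (x + 2 * pi * of_int (- k))))) has_vector_derivative 1 *\<^sub>R \<gamma>) (at ?x)"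
    using g by (intro vector_diff_chain_at[unfolded o_def, of "\<lambda>x. x + 2 * pi * of_int (- k)" 1])
       (auto intro!: derivative_eq_intros)
  then have "((\<lambda>x. snd d (f (cis x))) has_derivative (\<lambda>h. h *\<^sub>R \<gamma>)) (at ?x)"
    unfolding cis_add_2pi_int has_vector_derivative_def by simp
  then have "(in_charts ?c d f has_derivative (\<lambda>h. h *\<^sub>R \<gamma>)) (at ?x)"
    by (rule has_derivative_transform_within_open[of _ _ _ _ "{a<..<a + 2 * pi}"])
       (use k a(1) in \<open>auto simp: in_charts_def circle_chart_inv\<close>)
  then show ?thesis
    using d x by (simp add: differential_def Let_def frechet_derivative_at[symmetric])
qed

lemma tangent_space_eqI:
  assumes v: "v \<in> tangent_space A x" and w: "w \<in> tangent_space A x" and c: "c \<in> charts_at A x" and "v c = w c"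
  shows "v = w"
proof
  fix d
  have *: "u d = (if d \<in> charts_at A x then frechet_derivative (transition c d) (at (snd c x)) (u c) else 0)"
    if "u \<in> tangent_space A x" for u
  proof -
    note h = that[unfolded tangent_space_def, THEN CollectD]
    show ?thesis
    proof (cases "d \<in> charts_at A x")
      case True
      show ?thesis using bspec[OF bspec[OF conjunct1[OF h] c] True] True by (simp only: if_True)
    next
      case False
      show ?thesis using conjunct2[OF h, rule_format, OF False] False by (simp only: if_False)
    qed
  qed
  show "v d = w d" using *[OF v] *[OF w] assms(4) by simp
qed

text \<open>The source is one-dimensional: a tangent vector is a single number, and a nonzero
  velocity in one target chart already tells two of them apart.\<close>

lemma circle_immersionI:
  assumes f: "smooth_map circle_atlas A f"
    and imm: "\<And>s. \<exists>d \<gamma>. d \<in> charts_at A (f (cis s)) \<and> \<gamma> \<noteq> 0 \<and> ((\<lambda>s. snd d (f (cis s))) has_vector_derivative \<gamma>) (at s)"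
  shows "immersion circle_atlas A f"
  unfolding immersion_def
proof (intro conjI ballI inj_onI)
  fix x v w
  assume x: "x \<in> carrier circle_atlas" and v: "v \<in> tangent_space circle_atlas x"
    and w: "w \<in> tangent_space circle_atlas x" and eq: "differential circle_atlas A f x v = differential circle_atlas A f x w"
  obtain s where s: "x = cis s" using x carrier_circle sphere_cisE by auto
  obtain d \<gamma> where "d \<in> charts_at A (f (cis s))" "\<gamma> \<noteq> 0"
    "((\<lambda>s. snd d (f (cis s))) has_vector_derivative \<gamma>) (at s)" using imm[of s] by blast
  then have vw: "v (SOME c. c \<in> charts_at circle_atlas x) = w (SOME c. c \<in> charts_at circle_atlas x)"
    using circle_differential[of d A f s \<gamma> v] circle_differential[of d A f s \<gamma> w] fun_cong[OF eq, of d]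
    unfolding s by (simp only: scaleR_cancel_right) simp
  have c: "(SOME c. c \<in> charts_at circle_atlas x) \<in> charts_at circle_atlas x"
    using some_chart_at[OF x] .
  show "v = w" by (rule tangent_space_eqI[OF v w c vw])
qed (rule f)

text \<open>The restriction puts the map into \<open>extensional\<close>, as membership in
  \<open>smooth_maps\<close> demands. For \<open>2 * pi\<close>-periodic \<open>F\<close> the branch
  taken by \<open>Arg\<close> does not matter.\<close>

definition circle_lift :: "(real \<Rightarrow> 'b) \<Rightarrow> complex \<Rightarrow> 'b" where
  "circle_lift F = (\<lambda>z\<in>sphere 0 1. F (Arg z))"

lemma circle_lift_cis:
  assumes "\<And>s. F (s + 2 * pi) = F s"
  shows "circle_lift F (cis s) = F s"
proof -
  have nat: "F (s + 2 * pi * of_nat n) = F s" for n s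
  proof (induction n)
    case (Suc n)
    have "s + 2 * pi * of_nat (Suc n) = (s + 2 * pi * of_nat n) + 2 * pi" by (simp add: algebra_simps)
    then show ?case using Suc assms by metis
  qed simp
  have "cis (Arg (cis s)) = cis s" using cis_Arg[of "cis s"] by (simp add: sgn_eq)
  then obtain n :: int where n: "Arg (cis s) = s + 2 * pi * of_int n" by (rule cis_eqE)
  have "F (Arg (cis s)) = F s"
  proof (cases "n \<ge> 0")
    case True
    then show ?thesis using n nat[of s "nat n"] by simp
  next
    case False
    then have "s = Arg (cis s) + 2 * pi * of_nat (nat (- n))" using n by simp
    then show ?thesis using nat[of "Arg (cis s)" "nat (- n)"] by simp
  qed
  then show ?thesis by (simp add: circle_lift_def)
qed

lemma circle_lift_extensional: "circle_lift F \<in> extensional (carrier circle_atlas)"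
  by (simp add: circle_lift_def carrier_circle)

lemma diffeomorphism_rotation: "diffeomorphism circle_atlas circle_atlas (\<lambda>z. cis K * z)"
proof -
  \<comment> \<open>Stated for every \<open>h\<close> that agrees with a rotation on the circle,
    because the inverse occurs as \<open>inv_into\<close>, which is known only there.\<close>
  have rot: "smooth_map circle_atlas circle_atlas h" if h: "\<And>s. h (cis s) = cis (s + K)" for h :: "complex \<Rightarrow> complex" and K
  proof -
    have "smooth_path circle_atlas circle_atlas (\<lambda>_. h)"
    proof (rule circle_smooth_pathI[OF smooth_atlas_circle])
      fix t s :: real
      let ?a = "s + K - pi"
      let ?W = "UNIV \<times> {s - pi<..<s + pi} :: (real \<times> real) set"
      have I: "s' + K \<in> {?a<..<?a + 2 * pi}" if "s' \<in> {s - pi<..<s + pi}" for s' using that by auto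
      have "circle_chart ?a \<in> charts_at circle_atlas (h (cis s))"
        using circle_chart_cis[OF I] by (auto simp: h charts_at_iff circle_atlas_def)
      moreover have "open ?W" "(t, s) \<in> ?W" "smooth_on ?W (\<lambda>z. snd z + K)"
        by (auto intro!: smooth_intros open_Times)
      moreover have "\<forall>t'\<in>{0..1}. \<forall>s'. (t', s') \<in> ?W \<longrightarrow> h (cis s') \<in> fst (circle_chart ?a) \<and>
          snd (circle_chart ?a) (h (cis s')) = snd (t', s') + K"
        using I circle_chart_cis[OF I] snd_circle_chart[OF I] by (auto simp: h)
      ultimately show "\<exists>d\<in>charts_at circle_atlas (h (cis s)). \<exists>W G. open W \<and> (t, s) \<in> W \<and> smooth_on W G \<and>
          (\<forall>t'\<in>{0..1}. \<forall>s'. (t', s') \<in> W \<longrightarrow> h (cis s') \<in> fst d \<and> snd d (h (cis s')) = G (t', s'))"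
        by blast
    qed
    then show ?thesis using smooth_path_imp_smooth_map[OF smooth_atlas_circle smooth_atlas_circle, of "\<lambda>_. h" 0] by simp
  qed
  have inj: "inj_on (\<lambda>z. cis K * z) (sphere 0 1)" by (auto simp: inj_on_def)
  have img: "(\<lambda>z. cis K * z) ` sphere 0 1 = sphere 0 1"
  proof (intro equalityI subsetI)
    fix z :: complex assume "z \<in> sphere 0 1"
    then show "z \<in> (\<lambda>z. cis K * z) ` sphere 0 1"
      by (intro image_eqI[of _ _ "cis (- K) * z"]) (auto simp: norm_mult cis_mult mult.assoc[symmetric])
  qed (auto simp: norm_mult)
  have inv: "inv_into (sphere 0 1) (\<lambda>z. cis K * z) (cis s) = cis (s + - K)" for s
  proof -
    have "cis s = cis K * cis (s + - K)" by (simp add: cis_mult)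
    then show ?thesis using inv_into_f_f[OF inj, of "cis (s + - K)"] by simp
  qed
  show ?thesis
    unfolding diffeomorphism_def carrier_circle
    using inj img rot[of "\<lambda>z. cis K * z" K] rot[OF inv] by (auto simp: bij_betw_def cis_mult add.commute)
qed

lemma diffeomorphism_id:
  assumes L: "smooth_atlas L"
  shows "diffeomorphism L L (\<lambda>x. x)"
proof -
  have id: "smooth_map L L h" if h: "\<And>x. x \<in> carrier L \<Longrightarrow> h x = x" for h
  proof -
    have "smooth_path L L (\<lambda>_. h)"
    proof (rule smooth_pathI[OF L L])
      fix t :: real and x assume "x \<in> carrier L"
      then obtain c where c: "c \<in> charts_at L x" by (rule carrierE)
      have hx: "h x = x" using h \<open>x \<in> carrier L\<close> by blast
      have o: "open (UNIV \<times> snd c ` fst c :: (real \<times> _) set)"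
        using c smooth_atlasD(2)[OF L] by (auto simp: charts_at_iff intro!: open_Times)
      have s: "smooth_on (UNIV \<times> snd c ` fst c :: (real \<times> _) set) snd"
        by (intro smooth_intros o)
      have "h y = y" if "y \<in> fst c" for y using h c that by (auto simp: charts_at_iff carrier_def)
      then show "\<exists>c\<in>charts_at L x. \<exists>d\<in>charts_at L (h x). \<exists>W G. open W \<and> (t, snd c x) \<in> W \<and> smooth_on W G \<and>
        (\<forall>s\<in>{0..1}. \<forall>y\<in>fst c. (s, snd c y) \<in> W \<longrightarrow> h y \<in> fst d \<and> snd d (h y) = G (s, snd c y))"
        using c o s unfolding hx
        by (intro bexI[OF _ c] exI[of _ "UNIV \<times> snd c ` fst c"] exI[of _ snd]) (auto simp: charts_at_iff)
    qed
    then show ?thesis using smooth_path_imp_smooth_map[OF L L, of "\<lambda>_. h" 0] by simp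
  qed
  have "inv_into (carrier L) (\<lambda>x. x) x = x" if "x \<in> carrier L" for x
    using inv_into_f_f[of "\<lambda>x. x" "carrier L"] that by simp
  then show ?thesis using id by (simp add: diffeomorphism_def bij_betw_def)
qed

text \<open>\<open>velocity\<close> is a derivative within the unit interval, hence one-sided at its
  ends. It can be computed from any two-sided differentiable function \<open>g\<close> that
  represents the coordinates near \<open>t\<close>.\<close>

lemma velocity_eq:
  assumes "t \<in> {0..1}" "d \<in> charts_at A (\<gamma> t)" "open I" "t \<in> I"
    and "\<And>s. s \<in> I \<inter> {0..1} \<Longrightarrow> snd d (\<gamma> s) = g s" "(g has_vector_derivative v) (at t)"
  shows "velocity A \<gamma> t d = v"
proof -
  obtain e where e: "e > 0" "ball t e \<subseteq> I" using assms(3,4) openE by blast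
  have "(g has_vector_derivative v) (at t within {0..1})" using assms(6) has_vector_derivative_at_within by blast
  then have "((\<lambda>s. snd d (\<gamma> s)) has_vector_derivative v) (at t within {0..1})"
    by (rule has_vector_derivative_transform_within[OF _ e(1) assms(1)])
       (use assms(5) e(2) in \<open>auto simp: subset_eq dist_commute\<close>)
  then show ?thesis
    using assms(1,2) vector_derivative_within_closed_interval[of 0 1 t] by (simp add: velocity_def)
qed

section \<open>One-jets over a flat atlas\<close>

text \<open>When all transition maps have derivative 1 (as for \<open>euclidean_atlas\<close> and \<open>circle_atlas\<close>) a
  covector has the same components in all charts.\<close>

definition flat_atlas :: "('a, 'e::euclidean_space) atlas \<Rightarrow> bool" where
  "flat_atlas A \<longleftrightarrow> smooth_atlas A \<and> (\<forall>c\<in>A. \<forall>d\<in>A. \<forall>x\<in>fst c \<inter> fst d.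
     (transition c d has_derivative (\<lambda>v. v)) (at (snd c x)))"

definition flat_covector :: "('a, 'e::euclidean_space) atlas \<Rightarrow> 'a \<Rightarrow> 'e \<Rightarrow> ('a, 'e) covector" where
  "flat_covector A q P = (\<lambda>c. if c \<in> charts_at A q then P else 0)"

definition jet_point :: "('a, 'e::euclidean_space) atlas \<Rightarrow> 'a \<Rightarrow> 'e \<Rightarrow> real \<Rightarrow> ('a, 'e) jet" where
  "jet_point A q P u = ((q, flat_covector A q P), u)"

lemma flat_atlas_smooth: "flat_atlas A \<Longrightarrow> smooth_atlas A"
  by (simp add: flat_atlas_def)

lemma flat_transition:
  assumes "flat_atlas A" "c \<in> charts_at A x" "d \<in> charts_at A x"
  shows "(transition c d has_derivative (\<lambda>v. v)) (at (snd c x))"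
  using assms by (auto simp: flat_atlas_def charts_at_iff)

lemma transition_euclidean: "transition (UNIV, \<lambda>x. x) (UNIV, \<lambda>x. x) = (\<lambda>x. x)"
  by (rule ext) (simp add: transition_def in_charts_def chart_inv_def inv_into_f_f)

lemma smooth_atlas_euclidean: "smooth_atlas euclidean_atlas"
  by (auto simp: smooth_atlas_def euclidean_atlas_def transition_euclidean intro: smooth_on_id)

lemma flat_atlas_euclidean: "flat_atlas euclidean_atlas"
  unfolding flat_atlas_def
  by (rule conjI[OF smooth_atlas_euclidean]) (simp add: euclidean_atlas_def transition_euclidean)

lemma flat_atlas_circle: "flat_atlas circle_atlas"
  unfolding flat_atlas_def
proof (intro conjI ballI smooth_atlas_circle)
  fix c d x assume "c \<in> circle_atlas" "d \<in> circle_atlas" and x: "x \<in> fst c \<inter> fst d"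
  then obtain a b where ab: "c = circle_chart a" "d = circle_chart b" by (auto simp: circle_atlas_def)
  obtain k :: int and U where U: "open U" "snd c x \<in> U" and tr: "\<And>w. w \<in> U \<Longrightarrow> transition c d w = w + 2 * pi * of_int k"
    using circle_transition[OF IntD1[OF x[unfolded ab]] IntD2[OF x[unfolded ab]]] ab by metis
  have "((\<lambda>w. w + 2 * pi * of_int k) has_derivative (\<lambda>v. v)) (at (snd c x))"
    by (auto intro!: derivative_eq_intros)
  then show "(transition c d has_derivative (\<lambda>v. v)) (at (snd c x))"
    by (rule has_derivative_transform_within_open[OF _ U]) (simp add: tr)
qed

lemma cotangent_space_flat:
  assumes A: "flat_atlas A" and q: "q \<in> carrier A"
  shows "p \<in> cotangent_space A q \<longleftrightarrow> (\<exists>P. p = flat_covector A q P)"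
proof
  have *: "frechet_derivative (transition c d) (at (snd c q)) w = w"
    if "c \<in> charts_at A q" "d \<in> charts_at A q" for c d w
    using frechet_derivative_at[OF flat_transition[OF A that]] by metis
  obtain c where c: "c \<in> charts_at A q" using q by (rule carrierE)
  {
    assume "p \<in> cotangent_space A q"
    note h = this[unfolded cotangent_space_def, THEN CollectD]
    have 1: "p c \<bullet> w = p d \<bullet> w" if "c \<in> charts_at A q" "d \<in> charts_at A q" for c d w
      using bspec[OF bspec[OF conjunct1[OF h] that(1)] that(2)] *[OF that] by simp
    have 2: "p c = 0" if "c \<notin> charts_at A q" for c using conjunct2[OF h] that by blast
    have "p d = p c" if "d \<in> charts_at A q" for d
      using 1[OF c that] by (metis vector_eq_rdot)
    then have "p = flat_covector A q (p c)"
      using 2 by (auto simp: flat_covector_def fun_eq_iff)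
    then show "\<exists>P. p = flat_covector A q P" by blast
  }
  show "p \<in> cotangent_space A q" if "\<exists>P. p = flat_covector A q P"
    using that * by (auto simp: cotangent_space_def flat_covector_def)
qed

lemma fst_cotangent_chart:
  assumes "flat_atlas A" "c \<in> A"
  shows "fst (cotangent_chart A c) = {(q, flat_covector A q P) |q P. q \<in> fst c}"
proof -
  have "p \<in> cotangent_space A q \<longleftrightarrow> (\<exists>P. p = flat_covector A q P)" if "q \<in> fst c" for p q
    using that assms(2) by (intro cotangent_space_flat[OF assms(1)]) (auto simp: carrier_def)
  then show ?thesis unfolding cotangent_chart_def by auto
qed

lemma snd_cotangent_chart:
  "c \<in> charts_at A q \<Longrightarrow> snd (cotangent_chart A c) (q, flat_covector A q P) = (snd c q, P)"
  by (simp add: cotangent_chart_def flat_covector_def)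

lemma fst_jet_chart:
  assumes "flat_atlas A" "c \<in> A"
  shows "fst (jet_chart A c) = {jet_point A q P u |q P u. q \<in> fst c}"
  unfolding jet_chart_def fst_conv fst_cotangent_chart[OF assms] by (auto simp: jet_point_def)

lemma snd_jet_chart:
  "c \<in> charts_at A q \<Longrightarrow> snd (jet_chart A c) (jet_point A q P u) = ((snd c q, P), u)"
  using snd_cotangent_chart[of c A q P] by (simp add: jet_chart_def jet_point_def)

lemma fst_jet_point [simp]: "fst (fst (jet_point A q P u)) = q"
  by (simp add: jet_point_def)

lemma jet_point_in_chart:
  assumes "flat_atlas A" "c \<in> A"
  shows "jet_point A q P u \<in> fst (jet_chart A c) \<longleftrightarrow> q \<in> fst c"
  unfolding fst_jet_chart[OF assms] by (auto simp: jet_point_def)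

lemma jet_chartE:
  assumes "flat_atlas A" "c \<in> A" "m \<in> fst (jet_chart A c)"
  obtains q P u where "m = jet_point A q P u" "q \<in> fst c" "c \<in> charts_at A q"
  using assms(2,3) unfolding fst_jet_chart[OF assms(1,2)] charts_at_iff by blast

lemma cotangent_chartE:
  assumes "flat_atlas A" "c \<in> A" "m \<in> fst (cotangent_chart A c)"
  obtains q P where "m = (q, flat_covector A q P)" "q \<in> fst c" "c \<in> charts_at A q"
  using assms(2,3) unfolding fst_cotangent_chart[OF assms(1,2)] charts_at_iff by blast

lemma charts_at_jet:
  assumes "flat_atlas A"
  shows "charts_at (jet_atlas A) (jet_point A q P u) = jet_chart A ` charts_at A q"
  unfolding charts_at_def jet_atlas_def using jet_point_in_chart[OF assms] by blast

lemma charts_at_cotangent: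
  assumes "flat_atlas A"
  shows "charts_at (cotangent_atlas A) (q, flat_covector A q P) = cotangent_chart A ` charts_at A q"
proof -
  have "(q, flat_covector A q P) \<in> fst (cotangent_chart A c) \<longleftrightarrow> q \<in> fst c" if "c \<in> A" for c
    unfolding fst_cotangent_chart[OF assms that] by auto
  then show ?thesis unfolding charts_at_def cotangent_atlas_def by blast
qed

lemma inj_on_jet_chart:
  assumes A: "flat_atlas A" and c: "c \<in> A"
  shows "inj_on (snd (jet_chart A c)) (fst (jet_chart A c))"
    and "inj_on (snd (cotangent_chart A c)) (fst (cotangent_chart A c))"
proof -
  note i = smooth_atlasD(1)[OF flat_atlas_smooth[OF A] c]
  show "inj_on (snd (jet_chart A c)) (fst (jet_chart A c))"
  proof (rule inj_onI)
    fix m n assume "m \<in> fst (jet_chart A c)" "n \<in> fst (jet_chart A c)"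
      and eq: "snd (jet_chart A c) m = snd (jet_chart A c) n"
    then obtain q P u q' P' u' where m: "m = jet_point A q P u" "q \<in> fst c" "c \<in> charts_at A q"
      and n: "n = jet_point A q' P' u'" "q' \<in> fst c" "c \<in> charts_at A q'"
      using jet_chartE[OF A c] by metis
    show "m = n" using eq inj_onD[OF i _ m(2) n(2)] unfolding m(1) n(1) by (simp add: snd_jet_chart m n)
  qed
  show "inj_on (snd (cotangent_chart A c)) (fst (cotangent_chart A c))"
  proof (rule inj_onI)
    fix m n assume "m \<in> fst (cotangent_chart A c)" "n \<in> fst (cotangent_chart A c)"
      and eq: "snd (cotangent_chart A c) m = snd (cotangent_chart A c) n"
    then obtain q P q' P' where m: "m = (q, flat_covector A q P)" "q \<in> fst c" "c \<in> charts_at A q"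
      and n: "n = (q', flat_covector A q' P')" "q' \<in> fst c" "c \<in> charts_at A q'"
      using cotangent_chartE[OF A c] by metis
    show "m = n" using eq inj_onD[OF i _ m(2) n(2)] unfolding m(1) n(1) by (simp add: snd_cotangent_chart m n)
  qed
qed

lemma jet_chart_image:
  assumes A: "flat_atlas A" and "c \<in> A" "d \<in> A"
  shows "snd (jet_chart A c) ` (fst (jet_chart A c) \<inter> fst (jet_chart A d)) = (snd c ` (fst c \<inter> fst d) \<times> UNIV) \<times> UNIV"
proof (intro equalityI subsetI)
  fix z assume "z \<in> snd (jet_chart A c) ` (fst (jet_chart A c) \<inter> fst (jet_chart A d))"
  then obtain m where m: "m \<in> fst (jet_chart A c)" "m \<in> fst (jet_chart A d)" "z = snd (jet_chart A c) m" by blast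
  obtain q P u where "m = jet_point A q P u" "q \<in> fst c"
    using jet_chartE[OF A assms(2) m(1)] by metis
  then have "q \<in> fst c" "q \<in> fst d" "z = snd (jet_chart A c) (jet_point A q P u)"
    using m jet_point_in_chart[OF A] assms(2,3) by auto
  then show "z \<in> (snd c ` (fst c \<inter> fst d) \<times> UNIV) \<times> UNIV"
    using assms by (simp add: snd_jet_chart charts_at_iff)
next
  fix z :: "('b \<times> 'b) \<times> real" assume "z \<in> (snd c ` (fst c \<inter> fst d) \<times> UNIV) \<times> UNIV"
  then obtain q P u where "q \<in> fst c" "q \<in> fst d" "z = ((snd c q, P), u)" by auto
  then show "z \<in> snd (jet_chart A c) ` (fst (jet_chart A c) \<inter> fst (jet_chart A d))"
    using assms by (intro image_eqI[of _ _ "jet_point A q P u"])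
      (auto simp: snd_jet_chart charts_at_iff fst_jet_chart)
qed

lemma jet_chart_inv:
  assumes A: "flat_atlas A" and c: "c \<in> A" "x \<in> snd c ` fst c"
  shows "chart_inv (jet_chart A c) ((x, P), u) = jet_point A (chart_inv c x) P u"
    and "chart_inv (cotangent_chart A c) (x, P) = (chart_inv c x, flat_covector A (chart_inv c x) P)"
proof -
  let ?q = "chart_inv c x"
  have q: "c \<in> charts_at A ?q" using chart_inv_in[OF c(2)] c(1) by (simp add: charts_at_iff)
  have "snd (jet_chart A c) (jet_point A ?q P u) = ((x, P), u)"
    "snd (cotangent_chart A c) (?q, flat_covector A ?q P) = (x, P)"
    using chart_chart_inv[OF c(2)] by (simp_all add: snd_jet_chart[OF q] snd_cotangent_chart[OF q])
  moreover have "jet_point A ?q P u \<in> fst (jet_chart A c)"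
    "(?q, flat_covector A ?q P) \<in> fst (cotangent_chart A c)"
    using chart_inv_in[OF c(2)] unfolding fst_jet_chart[OF A c(1)] fst_cotangent_chart[OF A c(1)] by blast+
  ultimately show "chart_inv (jet_chart A c) ((x, P), u) = jet_point A ?q P u"
    "chart_inv (cotangent_chart A c) (x, P) = (?q, flat_covector A ?q P)"
    using chart_inv_eq[OF inj_on_jet_chart(1)[OF A c(1)]] chart_inv_eq[OF inj_on_jet_chart(2)[OF A c(1)]] by metis+
qed

lemma smooth_atlas_jet:
  assumes A: "flat_atlas A"
  shows "smooth_atlas (jet_atlas A)"
  unfolding smooth_atlas_def
proof (intro conjI ballI)
  note sA = flat_atlas_smooth[OF A]
  fix C assume "C \<in> jet_atlas A"
  then obtain c where c: "c \<in> A" "C = jet_chart A c" by (auto simp: jet_atlas_def)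
  show "inj_on (snd C) (fst C)" using inj_on_jet_chart(1)[OF A c(1)] c by simp
  show "open (snd C ` fst C)"
    using jet_chart_image[OF A c(1) c(1)] smooth_atlasD(2)[OF sA c(1)] c by (simp add: open_Times)
  fix D assume "D \<in> jet_atlas A"
  then obtain d where d: "d \<in> A" "D = jet_chart A d" by (auto simp: jet_atlas_def)
  show o: "open (snd C ` (fst C \<inter> fst D))"
    using jet_chart_image[OF A c(1) d(1)] smooth_atlasD(3)[OF sA c(1) d(1)] c d by (simp add: open_Times)
  have tr: "transition C D z = ((transition c d (fst (fst z)), snd (fst z)), snd z)"
    if z: "z \<in> snd C ` (fst C \<inter> fst D)" for z
  proof -
    obtain m where m: "m \<in> fst (jet_chart A c)" "m \<in> fst (jet_chart A d)" "z = snd C m"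
      using z c d by blast
    obtain q P u where "m = jet_point A q P u" "q \<in> fst c"
      using jet_chartE[OF A c(1) m(1)] by metis
    then have q: "q \<in> fst c" "q \<in> fst d" "z = snd C (jet_point A q P u)"
      using m jet_point_in_chart[OF A] c d by auto
    have "transition C D z = snd D (jet_point A q P u)"
      unfolding q(3) c(2)
      by (rule transition_chart[OF inj_on_jet_chart(1)[OF A c(1)]]) (use q(1) in \<open>auto simp: fst_jet_chart[OF A c(1)]\<close>)
    then show ?thesis
      using q c d transition_chart[OF smooth_atlasD(1)[OF sA c(1)] q(1)] by (simp add: snd_jet_chart charts_at_iff)
  qed
  have sm: "smooth_on (snd C ` (fst C \<inter> fst D)) (\<lambda>z. ((transition c d (fst (fst z)), snd (fst z)), snd z))"
    by (intro smooth_intros o smooth_on_compose[OF smooth_atlasD(4)[OF sA c(1) d(1)]] smooth_atlasD(3)[OF sA c(1) d(1)])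
       (use jet_chart_image[OF A c(1) d(1)] c d in auto)
  show "smooth_on (snd C ` (fst C \<inter> fst D)) (transition C D)"
    by (rule smooth_on_transform[OF o sm tr])
qed

text \<open>\<open>jet_form\<close> passes through several charts taken by choice: on the one-jets,
  on the cotangent bundle and on the base. All transition maps have derivative 1, so the choices
  collapse to \<open>du - p dq\<close> read in the single chart chosen on the one-jets.\<close>

lemma jet_form_flat:
  assumes A: "flat_atlas A" and q: "q \<in> carrier A"
  shows "\<exists>C\<in>charts_at (jet_atlas A) (jet_point A q P u).
    \<forall>v. jet_form A (jet_point A q P u) v = snd (v C) - P \<bullet> fst (fst (v C))"
proof -
  note sA = flat_atlas_smooth[OF A]
  let ?m = "jet_point A q P u" and ?p = "flat_covector A q P"
  define C where "C = (SOME C. C \<in> charts_at (jet_atlas A) ?m)"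
  define C1 where "C1 = (SOME C. C \<in> charts_at (cotangent_atlas A) (q, ?p))"
  define c0 where "c0 = (SOME c. c \<in> charts_at A q)"
  obtain c' where c': "c' \<in> charts_at A q" using q by (rule carrierE)
  have "C \<in> charts_at (jet_atlas A) ?m"
    unfolding C_def by (rule someI[of _ "jet_chart A c'"]) (use c' charts_at_jet[OF A] in auto)
  then obtain c where c: "c \<in> charts_at A q" "C = jet_chart A c" and C: "C \<in> charts_at (jet_atlas A) ?m"
    using charts_at_jet[OF A, of q P u] by auto
  have "C1 \<in> charts_at (cotangent_atlas A) (q, ?p)"
    unfolding C1_def by (rule someI[of _ "cotangent_chart A c'"]) (use c' charts_at_cotangent[OF A] in auto)
  then obtain c1 where c1: "c1 \<in> charts_at A q" "C1 = cotangent_chart A c1"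
    and C1: "C1 \<in> charts_at (cotangent_atlas A) (q, ?p)"
    using charts_at_cotangent[OF A, of q P] by auto
  have c0: "c0 \<in> charts_at A q" unfolding c0_def using some_chart_at[OF q] .
  have sC: "snd C ?m = ((snd c q, P), u)" "snd C1 (q, ?p) = (snd c1 q, P)"
    unfolding c c1 using snd_jet_chart[OF c(1)] snd_cotangent_chart[OF c1(1)] by auto
  have open_overlap: "open (snd b ` (fst b \<inter> fst d))" and in_overlap: "snd b q \<in> snd b ` (fst b \<inter> fst d)"
    if "b \<in> charts_at A q" "d \<in> charts_at A q" for b d
    using that smooth_atlasD(3)[OF sA] by (auto simp: charts_at_iff)
  have tr: "transition b d x = snd d (chart_inv b x)" for b d x
    by (simp add: transition_def in_charts_def)
  have "(in_charts C (UNIV, \<lambda>x. x) snd has_derivative snd) (at (snd C ?m))"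
  proof (rule has_derivative_transform_within_open[of snd])
    show "open ((snd c ` (fst c \<inter> fst c) \<times> UNIV) \<times> (UNIV :: real set))"
      using open_overlap[OF c(1) c(1)] by (intro open_Times open_UNIV)
    show "snd C ?m \<in> (snd c ` (fst c \<inter> fst c) \<times> UNIV) \<times> UNIV"
      using in_overlap[OF c(1) c(1)] by (simp add: sC)
    fix z :: "('b \<times> 'b) \<times> real" assume "z \<in> (snd c ` (fst c \<inter> fst c) \<times> UNIV) \<times> UNIV"
    then show "snd z = in_charts C (UNIV, \<lambda>x. x) snd z"
      using jet_chart_inv(1)[OF A, of c "fst (fst z)" "snd (fst z)" "snd z"] c
      by (auto simp: in_charts_def charts_at_iff jet_point_def)
  qed (intro derivative_eq_intros | simp)+
  then have 1: "differential (jet_atlas A) euclidean_atlas snd ?m v (UNIV, \<lambda>x. x) = snd (v C)" for v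
    unfolding differential_def Let_def C_def[symmetric]
    by (simp add: charts_at_iff euclidean_atlas_def frechet_derivative_at[symmetric])
  have "(in_charts C C1 fst has_derivative fst) (at (snd C ?m))"
  proof (rule has_derivative_transform_within_open[of "\<lambda>z. (transition c c1 (fst (fst z)), snd (fst z))"])
    show "((\<lambda>z. (transition c c1 (fst (fst z)), snd (fst z))) has_derivative fst) (at (snd C ?m))"
    proof -
      have ff: "((\<lambda>z. fst (fst z)) has_derivative (\<lambda>z. fst (fst z))) (at (snd C ?m))"
        and sf: "((\<lambda>z. snd (fst z)) has_derivative (\<lambda>z. snd (fst z))) (at (snd C ?m))"
        by (intro derivative_intros)+
      have "((\<lambda>z. transition c c1 (fst (fst z))) has_derivative (\<lambda>z. fst (fst z))) (at (snd C ?m))"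
        by (rule has_derivative_compose[OF ff]) (simp add: sC flat_transition[OF A c(1) c1(1)])
      from has_derivative_Pair[OF this sf] show ?thesis by simp
    qed
    show "open ((snd c ` (fst c \<inter> fst c1) \<times> UNIV) \<times> (UNIV :: real set))"
      using open_overlap[OF c(1) c1(1)] by (intro open_Times open_UNIV)
    fix z :: "('b \<times> 'b) \<times> real" assume z: "z \<in> (snd c ` (fst c \<inter> fst c1) \<times> UNIV) \<times> UNIV"
    then obtain q' where q': "q' \<in> fst c" "q' \<in> fst c1" "fst (fst z) = snd c q'" by auto
    have zz: "((snd c q', snd (fst z)), snd z) = z" using q'(3) by (metis prod.collapse)
    have "chart_inv C z = jet_point A q' (snd (fst z)) (snd z)"
      using jet_chart_inv(1)[OF A, of c "fst (fst z)" "snd (fst z)" "snd z"] c q'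
        chart_inv_eq[OF smooth_atlasD(1)[OF sA] q'(1)] zz by (simp add: charts_at_iff)
    then show "(transition c c1 (fst (fst z)), snd (fst z)) = in_charts C C1 fst z"
      using q' c c1 snd_cotangent_chart[of c1 A q' "snd (fst z)"] transition_chart[OF smooth_atlasD(1)[OF sA] q'(1)]
      by (simp add: in_charts_def jet_point_def charts_at_iff)
  qed (use in_overlap[OF c(1) c1(1)] in \<open>auto simp: sC\<close>)
  then have 2: "differential (jet_atlas A) (cotangent_atlas A) fst ?m v C1 = fst (v C)" for v
    using C1 unfolding differential_def Let_def C_def[symmetric]
    by (simp add: jet_point_def frechet_derivative_at[symmetric])
  have "(in_charts C1 c0 fst has_derivative fst) (at (snd C1 (q, ?p)))"
  proof (rule has_derivative_transform_within_open[of "\<lambda>z. transition c1 c0 (fst z)"])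
    show "((\<lambda>z. transition c1 c0 (fst z)) has_derivative fst) (at (snd C1 (q, ?p)))"
      by (rule has_derivative_compose[of fst fst]) (auto simp: sC flat_transition[OF A c1(1) c0] intro!: derivative_intros)
    show "open (snd c1 ` (fst c1 \<inter> fst c0) \<times> (UNIV :: 'b set))"
      using open_overlap[OF c1(1) c0] by (intro open_Times open_UNIV)
    fix z assume z: "z \<in> snd c1 ` (fst c1 \<inter> fst c0) \<times> (UNIV :: 'b set)"
    then have "chart_inv C1 z = (chart_inv c1 (fst z), flat_covector A (chart_inv c1 (fst z)) (snd z))"
      using jet_chart_inv(2)[OF A, of c1 "fst z" "snd z"] c1 by (auto simp: charts_at_iff)
    then show "transition c1 c0 (fst z) = in_charts C1 c0 fst z"
      by (simp add: in_charts_def tr)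
  qed (use in_overlap[OF c1(1) c0] in \<open>auto simp: sC\<close>)
  then have 3: "differential (cotangent_atlas A) A fst (q, ?p) w c0 = fst (w C1)" for w
    using c0 unfolding differential_def Let_def C1_def[symmetric]
    by (simp add: frechet_derivative_at[symmetric])
  have fc: "?p c0 = P" using c0 by (simp add: flat_covector_def)
  have "jet_form A ?m v = snd (v C) - P \<bullet> fst (fst (v C))" for v
    using c0 unfolding jet_form_def liouville_form_def pairing_def Let_def 1
    by (simp add: jet_point_def c0_def[symmetric] 3 2[unfolded jet_point_def] fc)
  then show ?thesis using C by blast
qed

text \<open>The chart of the preceding lemma is unknown, so the condition is asked in every chart
  around the point. The parameter \<open>R\<close> covers both uses: vanishing on tangent vectors
  and positivity on velocities.\<close>

lemma jet_form_zero:
  "flat_atlas A \<Longrightarrow> q \<in> carrier A \<Longrightarrow> (\<And>C. C \<in> charts_at (jet_atlas A) (jet_point A q P u) \<Longrightarrow>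
    R (snd (v C) - P \<bullet> fst (fst (v C)))) \<Longrightarrow> R (jet_form A (jet_point A q P u) v)"
  using jet_form_flat[of A q P u] by metis

section \<open>Families of closed curves in the one-jets of the circle\<close>

abbreviation "cjet \<equiv> jet_atlas circle_atlas"
abbreviation "cpoint x P u \<equiv> jet_point circle_atlas (cis x) P u"

lemmas smooth_atlas_cjet = smooth_atlas_jet[OF flat_atlas_circle]

lemma cis_carrier: "cis x \<in> carrier circle_atlas"
  by (simp add: carrier_circle)

lemma cpoint_chart:
  assumes "x \<in> {a<..<a + 2 * pi}"
  shows "jet_chart circle_atlas (circle_chart a) \<in> charts_at cjet (cpoint x P u)"
    and "snd (jet_chart circle_atlas (circle_chart a)) (cpoint x P u) = ((x, P), u)"
proof -
  have c: "circle_chart a \<in> charts_at circle_atlas (cis x)"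
    using circle_chart_cis[OF assms] by (simp add: charts_at_iff circle_atlas_def)
  then show "jet_chart circle_atlas (circle_chart a) \<in> charts_at cjet (cpoint x P u)"
    using charts_at_jet[OF flat_atlas_circle] by blast
  show "snd (jet_chart circle_atlas (circle_chart a)) (cpoint x P u) = ((x, P), u)"
    unfolding snd_jet_chart[OF c] snd_circle_chart[OF assms] ..
qed

text \<open>The coordinate of \<open>cis (x r)\<close> is \<open>x r\<close> up to a multiple of
  \<open>2 * pi\<close>, which by continuity can be kept fixed near \<open>r\<close>. So the lifted
  functions can be differentiated without regard to the chart.\<close>

lemma cpoint_vector_derivative:
  assumes C: "C \<in> charts_at cjet (cpoint (x r) (P r) (u r))"
    and d: "(x has_real_derivative x') (at r)" "(P has_real_derivative P') (at r)" "(u has_real_derivative u') (at r)"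
  shows "((\<lambda>r. snd C (cpoint (x r) (P r) (u r))) has_vector_derivative ((x', P'), u')) (at r)"
proof -
  obtain a where a: "C = jet_chart circle_atlas (circle_chart a)" "cis (x r) \<in> fst (circle_chart a)"
    using C unfolding charts_at_jet[OF flat_atlas_circle] unfolding charts_at_def circle_atlas_def by blast
  obtain k :: int where k: "x r + 2 * pi * of_int k \<in> {a<..<a + 2 * pi}" using a(2) by (rule circle_chart_shift)
  have "isCont (\<lambda>r. x r + 2 * pi * of_int k) r"
    using DERIV_isCont[OF d(1)] by (intro continuous_intros)
  then have "\<forall>\<^sub>F r' in at r. x r' + 2 * pi * of_int k \<in> {a<..<a + 2 * pi}"
    using k topological_tendstoD[of "\<lambda>r. x r + 2 * pi * of_int k"] unfolding isCont_def by (metis open_greaterThanLessThan)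
  then obtain U where U: "open U" "r \<in> U" "\<And>r'. r' \<in> U \<Longrightarrow> r' \<noteq> r \<Longrightarrow> x r' + 2 * pi * of_int k \<in> {a<..<a + 2 * pi}"
    unfolding eventually_at_topological by auto
  have eq: "((x r' + 2 * pi * of_int k, P r'), u r') = snd C (cpoint (x r') (P r') (u r'))" if "r' \<in> U" for r'
    using cpoint_chart(2)[of "x r' + 2 * pi * of_int k" a "P r'" "u r'"] U(3)[OF that] k
    unfolding a(1) by (cases "r' = r") (simp_all add: cis_add_2pi_int)
  have "((\<lambda>r. x r + 2 * pi * of_int k) has_vector_derivative x') (at r)"
    using d(1) by (auto simp: has_real_derivative_iff_has_vector_derivative[symmetric] intro!: derivative_eq_intros)
  then have "((\<lambda>r. ((x r + 2 * pi * of_int k, P r), u r)) has_vector_derivative ((x', P'), u')) (at r)"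
    using d(2,3) unfolding has_real_derivative_iff_has_vector_derivative
    by (intro has_vector_derivative_Pair)
  then show ?thesis
    by (rule has_vector_derivative_transform_within_open[OF _ U(1,2)]) (use eq in auto)
qed

lemma cjet_smooth_path:
  assumes \<phi>: "\<And>t s. \<phi> t (cis s) = cpoint (q t s) (p t s) (u t s)"
    and "smooth_on UNIV (\<lambda>z. q (fst z) (snd z))" "smooth_on UNIV (\<lambda>z. p (fst z) (snd z))"
      "smooth_on UNIV (\<lambda>z. u (fst z) (snd z))"
  shows "smooth_path circle_atlas cjet \<phi>"
proof (rule circle_smooth_pathI[OF smooth_atlas_cjet])
  fix t s :: real
  let ?a = "q t s - pi" and ?Q = "\<lambda>z. q (fst z) (snd z)"
  let ?W = "?Q -` {?a<..<?a + 2 * pi}"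
  let ?G = "\<lambda>z. ((?Q z, p (fst z) (snd z)), u (fst z) (snd z))"
  have "open ?W"
    using smooth_on_continuous[OF assms(2)] by (intro open_vimage) auto
  moreover have "smooth_on ?W ?G"
    by (rule smooth_on_subset[of UNIV]) (intro smooth_intros assms open_UNIV subset_UNIV)+
  moreover have "\<forall>t'\<in>{0..1}. \<forall>s'. (t', s') \<in> ?W \<longrightarrow> \<phi> t' (cis s') \<in> fst (jet_chart circle_atlas (circle_chart ?a)) \<and>
      snd (jet_chart circle_atlas (circle_chart ?a)) (\<phi> t' (cis s')) = ?G (t', s')"
    using cpoint_chart[of _ ?a] by (simp add: \<phi> charts_at_iff)
  moreover have "jet_chart circle_atlas (circle_chart ?a) \<in> charts_at cjet (\<phi> t (cis s))" "(t, s) \<in> ?W"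
    using cpoint_chart(1)[of "q t s" ?a] by (auto simp: \<phi>)
  ultimately show "\<exists>d\<in>charts_at cjet (\<phi> t (cis s)). \<exists>W G. open W \<and> (t, s) \<in> W \<and> smooth_on W G \<and>
      (\<forall>t'\<in>{0..1}. \<forall>s'. (t', s') \<in> W \<longrightarrow> \<phi> t' (cis s') \<in> fst d \<and> snd d (\<phi> t' (cis s')) = G (t', s'))"
    by blast
qed

lemma cjet_legendrian_immersion:
  assumes f: "smooth_map circle_atlas cjet f" "\<And>s. f (cis s) = cpoint (q s) (p s) (u s)"
    and d: "\<And>s. (q has_real_derivative q' s) (at s)" "\<And>s. (p has_real_derivative p' s) (at s)"
      "\<And>s. (u has_real_derivative p s * q' s) (at s)"
    and n: "\<And>s. q' s \<noteq> 0 \<or> p' s \<noteq> 0"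
  shows "legendrian_immersion circle_atlas cjet (jet_form circle_atlas) f"
proof -
  have der: "((\<lambda>s. snd C (f (cis s))) has_vector_derivative ((q' s, p' s), p s * q' s)) (at s)"
    if "C \<in> charts_at cjet (f (cis s))" for C s
    using that unfolding f(2) by (rule cpoint_vector_derivative[OF _ d])
  have "immersion circle_atlas cjet f"
  proof (rule circle_immersionI[OF f(1)])
    fix s
    have "jet_chart circle_atlas (circle_chart (q s - pi)) \<in> charts_at cjet (f (cis s))"
      using cpoint_chart(1)[of "q s" "q s - pi" "p s" "u s"] unfolding f(2) by simp
    then obtain C where "C \<in> charts_at cjet (f (cis s))" by blast
    then show "\<exists>d \<gamma>. d \<in> charts_at cjet (f (cis s)) \<and> \<gamma> \<noteq> 0 \<and> ((\<lambda>s. snd d (f (cis s))) has_vector_derivative \<gamma>) (at s)"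
      using der n[of s] by (intro exI[of _ C] exI[of _ "((q' s, p' s), p s * q' s)"]) (auto simp: zero_prod_def)
  qed
  moreover have "jet_form circle_atlas (f x) (differential circle_atlas cjet f x v) = 0"
    if "x \<in> carrier circle_atlas" for x v
  proof -
    obtain s where s: "x = cis s" using \<open>x \<in> carrier circle_atlas\<close> carrier_circle sphere_cisE by auto
    show ?thesis
      unfolding s f(2)
    proof (rule jet_form_zero[OF flat_atlas_circle cis_carrier])
      fix C assume "C \<in> charts_at cjet (cpoint (q s) (p s) (u s))"
      then have "C \<in> charts_at cjet (f (cis s))" by (simp add: f(2))
      from circle_differential[OF this der[OF this], of v]
      show "snd (differential circle_atlas cjet f (cis s) v C) - p s \<bullet> fst (fst (differential circle_atlas cjet f (cis s) v C)) = 0"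
        by simp
    qed
  qed
  ultimately show ?thesis unfolding legendrian_immersion_def by simp
qed

lemma cjet_positive_path:
  assumes \<phi>: "\<And>t s. \<phi> t (cis s) = cpoint (q t s) (p t s) (u t s)"
    and d: "\<And>t s. ((\<lambda>t. q t s) has_real_derivative q' t s) (at t)" "\<And>t s. ((\<lambda>t. p t s) has_real_derivative p' t s) (at t)"
      "\<And>t s. ((\<lambda>t. u t s) has_real_derivative u' t s) (at t)"
    and pos: "\<And>t s. t \<in> {0..1} \<Longrightarrow> u' t s - p t s * q' t s > 0"
  shows "positive_path circle_atlas cjet (jet_form circle_atlas) \<phi>"
  unfolding positive_path_def
proof (intro ballI)
  fix t :: real and x assume t: "t \<in> {0..1}" and x: "x \<in> carrier circle_atlas"
  obtain s where s: "x = cis s" using x carrier_circle sphere_cisE by auto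
  show "0 < jet_form circle_atlas (\<phi> t x) (velocity cjet (\<lambda>s. \<phi> s x) t)"
    unfolding s \<phi>
  proof (rule jet_form_zero[OF flat_atlas_circle cis_carrier, where R = "\<lambda>x. 0 < x"])
    fix C assume C: "C \<in> charts_at cjet (cpoint (q t s) (p t s) (u t s))"
    have "velocity cjet (\<lambda>t. cpoint (q t s) (p t s) (u t s)) t C = ((q' t s, p' t s), u' t s)"
      by (rule velocity_eq[OF t C open_UNIV UNIV_I refl cpoint_vector_derivative[OF C d]])
    then show "0 < snd (velocity cjet (\<lambda>t. cpoint (q t s) (p t s) (u t s)) t C) -
        p t s \<bullet> fst (fst (velocity cjet (\<lambda>t. cpoint (q t s) (p t s) (u t s)) t C))"
      using pos[OF t, of s] by simp
  qed
qed

text \<open>A chart omits one point of the circle. Among three candidates for that point at least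
  one differs from both \<open>z\<close> and \<open>w\<close>.\<close>

lemma two_points_circle_chart:
  assumes "z \<in> sphere 0 1" "w \<in> sphere 0 1"
  obtains a where "z \<in> fst (circle_chart a)" "w \<in> fst (circle_chart a)"
proof -
  have "cis 0 \<noteq> cis pi" "cis 0 \<noteq> cis (pi / 2)" "cis pi \<noteq> cis (pi / 2)"
    by (simp_all add: complex_eq_iff)
  then have "\<exists>a\<in>{0, pi, pi / 2}. cis a \<noteq> z \<and> cis a \<noteq> w" by auto
  then obtain a where "cis a \<noteq> z" "cis a \<noteq> w" by blast
  then show ?thesis using that[of a] assms by (auto simp: fst_circle_chart)
qed

section \<open>A closed positive path through the zero section\<close>

text \<open>The curve \<open>s \<mapsto> (s - a sin s, p, u)\<close> is the one-jet of a function for small \<open>a\<close>; for \<open>a > 10\<close>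
  the momentum \<open>p\<close> is negative, so that rotating the circle is a positive motion. The integral of
  \<open>a (a / 2 - 5)\<close>, a lower bound for \<open>- p\<close>, is \<open>10\<close>; rotation at the speed \<open>E / 10\<close> therefore pays
  for a vertical translation at the mean speed \<open>E\<close>.\<close>

definition loop_a :: "real \<Rightarrow> real" where
  "loop_a t = 60 * t * (1 - t)"

definition loop_q :: "real \<Rightarrow> real \<Rightarrow> real \<Rightarrow> real" where
  "loop_q E t s = s - loop_a t * sin s + E / 10 * t"

text \<open>Write \<open>a = loop_a t\<close>. The constant \<open>- a / 2\<close> is fixed by the
  integral of \<open>p * (1 - a * cos s)\<close> over a period: against the term
  \<open>- cos s\<close> it makes this integral vanish, so that \<open>u\<close> closes up. The
  remaining terms are odd in \<open>s\<close> and do not disturb this. They keep \<open>p'\<close>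
  from vanishing together with \<open>q'\<close>, which would happen with \<open>- cos s\<close>
  alone at \<open>a = 1\<close>, \<open>s = 0\<close>.\<close>

definition loop_p :: "real \<Rightarrow> real \<Rightarrow> real" where
  "loop_p t s = loop_a t * (- loop_a t / 2 - cos s - 2 * sin s * cos s + 3 * sin s)"

text \<open>The multiple of \<open>loop_a t\<close> is a periodic primitive in \<open>s\<close> of
  \<open>p * q'\<close>; the rest depends on \<open>t\<close> only. Its polynomial is the integral
  from \<open>0\<close> to \<open>t\<close> of \<open>a * (a / 2 - 5)\<close>, with value
  \<open>10\<close> at \<open>t = 1\<close>, so that the height \<open>E * t\<close> is then fully
  returned.\<close>

definition loop_u :: "real \<Rightarrow> real \<Rightarrow> real \<Rightarrow> real" where
  "loop_u E t s = loop_a t * ((loop_a t ^ 2 / 2 - 1) * sin s + loop_a t / 2 * sin s * cos s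
      + (1 / 2 + 3 * loop_a t / 4) * (1 - 2 * sin s ^ 2) - 3 * cos s - 2 * loop_a t / 3 * cos s ^ 3)
     + E * t - E / 10 * (1800 * (t ^ 3 / 3 - t ^ 4 / 2 + t ^ 5 / 5) - 300 * (t ^ 2 / 2 - t ^ 3 / 3))"

definition loop_q' :: "real \<Rightarrow> real \<Rightarrow> real" where
  "loop_q' t s = 1 - loop_a t * cos s"

definition loop_p' :: "real \<Rightarrow> real \<Rightarrow> real" where
  "loop_p' t s = loop_a t * (sin s + 2 - 4 * cos s ^ 2 + 3 * cos s)"

definition loop_a_dot :: "real \<Rightarrow> real" where
  "loop_a_dot t = 60 * (1 - 2 * t)"

text \<open>The \<open>a\<close>-derivative of \<open>u\<close>, as a function of \<open>a\<close>, \<open>S = sin s\<close> and \<open>C = cos s\<close>.\<close>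

definition loop_ua :: "real \<Rightarrow> real \<Rightarrow> real \<Rightarrow> real" where
  "loop_ua a S C = ((a ^ 2 / 2 - 1) * S + a / 2 * S * C + (1 / 2 + 3 * a / 4) * (1 - 2 * S ^ 2)
      - 3 * C - 2 * a / 3 * C ^ 3) + a * (a * S + S * C / 2 + 3 / 4 * (1 - 2 * S ^ 2) - 2 / 3 * C ^ 3)"

definition loop_pa :: "real \<Rightarrow> real \<Rightarrow> real \<Rightarrow> real" where
  "loop_pa a S C = (- a / 2 - C - 2 * S * C + 3 * S) - a / 2"

definition loop_u_dot :: "real \<Rightarrow> real \<Rightarrow> real \<Rightarrow> real" where
  "loop_u_dot E t s = loop_a_dot t * loop_ua (loop_a t) (sin s) (cos s)
     + E - E / 10 * (loop_a t * (loop_a t / 2 - 5))"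

lemma loop_endpoints [simp]: "loop_a 0 = 0" "loop_a 1 = 0" "loop_q E 0 s = s" "loop_q E 1 s = s + E / 10"
  "loop_p 0 s = 0" "loop_p 1 s = 0" "loop_u E 0 s = 0" "loop_u E 1 s = 0"
  by (simp_all add: loop_a_def loop_q_def loop_p_def loop_u_def)

lemma loop_periodic: "loop_q E t (s + 2 * pi) = loop_q E t s + 2 * pi" "loop_p t (s + 2 * pi) = loop_p t s"
  "loop_u E t (s + 2 * pi) = loop_u E t s"
  by (simp_all add: loop_q_def loop_p_def loop_u_def)

lemma loop_smooth: "smooth_on UNIV (\<lambda>z. loop_q E (fst z) (snd z))" "smooth_on UNIV (\<lambda>z. loop_p (fst z) (snd z))"
  "smooth_on UNIV (\<lambda>z. loop_u E (fst z) (snd z))"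
  unfolding loop_q_def loop_p_def loop_u_def loop_a_def divide_inverse by (intro smooth_intros open_UNIV)+

lemma loop_ds: "((\<lambda>s. loop_q E t s) has_real_derivative loop_q' t s) (at s)"
  "((\<lambda>s. loop_p t s) has_real_derivative loop_p' t s) (at s)"
  "((\<lambda>s. loop_u E t s) has_real_derivative loop_p t s * loop_q' t s) (at s)"
proof -
  \<comment> \<open>Used as rewrite rules, this and its variant remove all squares of the sine; both
    sides then become polynomials in the cosine that are linear in the sine.\<close>
  have S: "sin s * sin s = 1 - cos s * cos s"
    using sin_cos_squared_add[of s] by (simp add: power2_eq_square)
  then have S3: "sin s * (sin s * x) = (1 - cos s * cos s) * x" for x
    by (metis mult.assoc)
  show "((\<lambda>s. loop_q E t s) has_real_derivative loop_q' t s) (at s)"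
    unfolding loop_q_def loop_q'_def by (auto intro!: derivative_eq_intros)
  show "((\<lambda>s. loop_p t s) has_real_derivative loop_p' t s) (at s)"
    unfolding loop_p_def loop_p'_def
    by (auto intro!: derivative_eq_intros simp: algebra_simps power2_eq_square S S3)
  show "((\<lambda>s. loop_u E t s) has_real_derivative loop_p t s * loop_q' t s) (at s)"
    unfolding loop_u_def loop_p_def loop_q'_def
    by (auto intro!: derivative_eq_intros simp: field_simps power2_eq_square power3_eq_cube S S3)
qed

lemma loop_a_dt: "(loop_a has_real_derivative loop_a_dot t) (at t)"
  unfolding loop_a_def[abs_def] loop_a_dot_def by (auto intro!: derivative_eq_intros)

lemma loop_dt: "((\<lambda>t. loop_q E t s) has_real_derivative - loop_a_dot t * sin s + E / 10) (at t)"
  "((\<lambda>t. loop_p t s) has_real_derivative loop_a_dot t * loop_pa (loop_a t) (sin s) (cos s)) (at t)"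
  "((\<lambda>t. loop_u E t s) has_real_derivative loop_u_dot E t s) (at t)"
proof -
  note [derivative_intros] = DERIV_chain2[OF loop_a_dt]
  show "((\<lambda>t. loop_q E t s) has_real_derivative - loop_a_dot t * sin s + E / 10) (at t)"
    unfolding loop_q_def by (auto intro!: derivative_eq_intros)
  show "((\<lambda>t. loop_p t s) has_real_derivative loop_a_dot t * loop_pa (loop_a t) (sin s) (cos s)) (at t)"
    unfolding loop_p_def loop_pa_def by (auto intro!: derivative_eq_intros simp: field_simps)
  have M: "((\<lambda>t. E * t - E / 10 * (1800 * (t ^ 3 / 3 - t ^ 4 / 2 + t ^ 5 / 5) - 300 * (t ^ 2 / 2 - t ^ 3 / 3)))
    has_real_derivative E - E / 10 * (loop_a t * (loop_a t / 2 - 5))) (at t)"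
    unfolding loop_a_def by (auto intro!: derivative_eq_intros simp: field_simps power_numeral_reduce)
  have U: "((\<lambda>t. loop_a t * ((loop_a t ^ 2 / 2 - 1) * S + loop_a t / 2 * S * C
      + (1 / 2 + 3 * loop_a t / 4) * (1 - 2 * S ^ 2) - 3 * C - 2 * loop_a t / 3 * C ^ 3))
     has_real_derivative loop_a_dot t * loop_ua (loop_a t) S C) (at t)" for S C
    unfolding loop_ua_def by (auto intro!: derivative_eq_intros simp: field_simps power_numeral_reduce)
  show "((\<lambda>t. loop_u E t s) has_real_derivative loop_u_dot E t s) (at t)"
    using DERIV_add[OF U M, of "sin s" "cos s"] unfolding loop_u_def loop_u_dot_def by (simp only: add_diff_eq)
qed

lemma loop_immersed:
  assumes t: "t \<in> {0..1}"
  shows "loop_q' t s \<noteq> 0 \<or> loop_p' t s \<noteq> 0"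
proof (rule ccontr)
  assume "\<not> ?thesis"
  then have q: "loop_a t * cos s = 1" and p: "loop_a t * (sin s + 2 - 4 * cos s ^ 2 + 3 * cos s) = 0"
    by (auto simp: loop_q'_def loop_p'_def)
  have "loop_a t \<ge> 0" using t by (auto simp: loop_a_def)
  with q have a: "loop_a t > 0" by (cases "loop_a t = 0") auto
  with q have c: "cos s > 0" by (metis zero_less_mult_pos zero_less_one)
  \<comment> \<open>From \<open>0 < cos s \<le> 1\<close> the right side of the equation for
    \<open>sin s\<close> is at most \<open>cos s - 2\<close>, hence at most \<open>- 1\<close>. This
    forces \<open>cos s = 1\<close> and then \<open>sin s = - 1\<close>, which is absurd.\<close>
  have "cos s * cos s \<le> cos s * 1" using c by (intro mult_left_mono) auto
  moreover have "sin s = 4 * (cos s * cos s) - 2 - 3 * cos s" using p a by (simp add: power2_eq_square)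
  moreover have "sin s \<ge> -1" by simp
  ultimately have "cos s = 1" using cos_le_one[of s] by linarith
  then show False using p a sin_cos_squared_add[of s] by simp
qed

text \<open>Changing the shape of the curve contributes \<open>R\<close>, in which \<open>E\<close>
  does not occur. Let \<open>m\<close> be the lower bound \<open>a * (a / 2 - 5)\<close> for
  \<open>- p\<close>: the rotation contributes at least \<open>E / 10 * m\<close> and the
  translation exactly \<open>E - E / 10 * m\<close>, so together at least \<open>E\<close>.\<close>

lemma loop_positive:
  obtains E where "\<And>t s. t \<in> {0..1} \<Longrightarrow>
    loop_u_dot E t s - loop_p t s * (- loop_a_dot t * sin s + E / 10) > B"
proof -
  \<comment> \<open>Sine and cosine are replaced by independent variables in the interval from
    \<open>- 1\<close> to \<open>1\<close>; boundedness for all \<open>s\<close> then follows from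
    continuity on a compact box.\<close>
  define R where "R = (\<lambda>(t, S, C). loop_a_dot t * loop_ua (loop_a t) S C
      + loop_a t * (- loop_a t / 2 - C - 2 * S * C + 3 * S) * loop_a_dot t * S)"
  let ?K = "{0..1::real} \<times> {-1..1::real} \<times> {-1..1::real}"
  have "continuous_on ?K R"
    unfolding R_def loop_a_dot_def loop_ua_def loop_a_def case_prod_beta by (intro continuous_intros) auto
  moreover have "compact ?K" by (intro compact_Times) auto
  ultimately have "bounded (R ` ?K)" by (intro compact_imp_bounded compact_continuous_image)
  then obtain D where D: "\<And>z. z \<in> ?K \<Longrightarrow> \<bar>R z\<bar> \<le> D"
    unfolding bounded_iff by auto
  define E where "E = max 0 (B + D + 1)"
  have E: "E \<ge> 0" "E > B + D" by (auto simp: E_def)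
  have "loop_u_dot E t s - loop_p t s * (- loop_a_dot t * sin s + E / 10) > B" if t: "t \<in> {0..1}" for t s
  proof -
    let ?a = "loop_a t"
    have a: "?a \<ge> 0" using t by (auto simp: loop_a_def)
    have "\<bar>R (t, sin s, cos s)\<bar> \<le> D" by (rule D) (use t in auto)
    moreover have "- loop_p t s \<ge> ?a * (?a / 2 - 5)"
    proof -
      \<comment> \<open>The square bounds \<open>2 * sin s * cos s\<close> from below by
        \<open>- 1\<close>. With \<open>cos s \<ge> - 1\<close> and \<open>sin s \<le> 1\<close>
        this gives the constant \<open>5 = 1 + 1 + 3\<close>.\<close>
      have "0 \<le> (sin s + cos s)\<^sup>2" by simp
      then have "- 1 \<le> 2 * sin s * cos s" using sin_cos_squared_add[of s] by (simp add: power2_sum)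
      then have "?a / 2 - 5 \<le> - (- ?a / 2 - cos s - 2 * sin s * cos s + 3 * sin s)"
        using cos_ge_minus_one[of s] sin_le_one[of s] cos_le_one[of s] by linarith
      from mult_left_mono[OF this a] show ?thesis unfolding loop_p_def by (simp add: algebra_simps)
    qed
    then have "E / 10 * (- loop_p t s) \<ge> E / 10 * (?a * (?a / 2 - 5))"
      using E(1) by (intro mult_left_mono) auto
    moreover have "loop_u_dot E t s - loop_p t s * (- loop_a_dot t * sin s + E / 10)
      = R (t, sin s, cos s) + E + (E / 10 * (- loop_p t s) - E / 10 * (?a * (?a / 2 - 5)))"
    proof -
      have "R (t, sin s, cos s) = loop_a_dot t * loop_ua ?a (sin s) (cos s) + loop_p t s * loop_a_dot t * sin s"
        by (simp add: R_def loop_p_def)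
      then show ?thesis unfolding loop_u_dot_def by (simp add: algebra_simps)
    qed
    ultimately show ?thesis using E(2) by linarith
  qed
  then show ?thesis by (rule that)
qed

section \<open>Smooth functions on the circle\<close>

lemma smooth_on_real_derivative:
  fixes f :: "real \<Rightarrow> real"
  assumes "smooth_on S f" "x \<in> S"
  shows "(f has_real_derivative frechet_derivative f (at x) 1) (at x)"
proof -
  define F where "F = frechet_derivative f (at x)"
  have d: "(f has_derivative F) (at x)" unfolding F_def by (rule smooth_on_has_derivative[OF assms])
  have "F = (*) (F 1)"
  proof
    show "F h = F 1 * h" for h
      using linear_scale[OF has_derivative_linear[OF d], of h 1] by simp
  qed
  with d show ?thesis by (simp add: has_field_derivative_def F_def)
qed

lemma circle_function_lift:
  assumes f: "smooth_map circle_atlas euclidean_atlas (f :: complex \<Rightarrow> real)"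
  defines "g \<equiv> \<lambda>s. f (cis s)" and "g' \<equiv> \<lambda>s. frechet_derivative (\<lambda>s. f (cis s)) (at s) 1"
  shows "smooth_on UNIV g" "smooth_on UNIV g'" "(g has_real_derivative g' s) (at s)"
    "g (s + 2 * pi * of_int k) = g s" "g' (s + 2 * pi * of_int k) = g' s"
proof -
  show "smooth_on UNIV g"
  proof (rule smooth_on_local)
    fix s
    let ?c = "circle_chart (s - pi)"
    let ?I = "{s - pi<..<s - pi + 2 * pi}"
    have "smooth_on (snd ?c ` (fst ?c \<inter> f -` UNIV)) (in_charts ?c (UNIV, \<lambda>x. x) f)"
      using f unfolding smooth_map_def by (force simp: circle_atlas_def euclidean_atlas_def)
    then have "smooth_on ?I (in_charts ?c (UNIV, \<lambda>x. x) f)" by (simp add: circle_chart_image)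
    then have "smooth_on ?I g"
      by (rule smooth_on_transform[rotated]) (auto simp: in_charts_def circle_chart_inv g_def)
    then show "\<exists>U. open U \<and> s \<in> U \<and> smooth_on U g" by (intro exI[of _ ?I]) auto
  qed
  then show "smooth_on UNIV g'" unfolding g_def g'_def by (rule smooth_on_derivative)
  have d: "(g has_real_derivative g' s) (at s)" for s
    using smooth_on_real_derivative[OF \<open>smooth_on UNIV g\<close>] by (simp add: g_def g'_def)
  then show "(g has_real_derivative g' s) (at s)" .
  show p: "g (s + 2 * pi * of_int k) = g s" for s by (simp add: g_def cis_add_2pi_int)
  have "((\<lambda>s. g (s + 2 * pi * of_int k)) has_real_derivative g' (s + 2 * pi * of_int k) * 1) (at s)"
    by (rule DERIV_chain2[OF d]) (auto intro!: derivative_eq_intros)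
  then show "g' (s + 2 * pi * of_int k) = g' s"
    unfolding p using d[of s] DERIV_unique by fastforce
qed

lemma jet_extension_circle:
  assumes f: "smooth_map circle_atlas euclidean_atlas (f :: complex \<Rightarrow> real)"
  shows "jet_extension circle_atlas f (cis s) = cpoint s (frechet_derivative (\<lambda>s. f (cis s)) (at s) 1) (f (cis s))"
proof -
  let ?g = "\<lambda>s. f (cis s)"
  have "frechet_derivative (f \<circ> chart_inv c) (at (snd c (cis s))) 1 = frechet_derivative ?g (at s) 1"
    if c: "c \<in> charts_at circle_atlas (cis s)" for c
  proof -
    obtain a where a: "c = circle_chart a" "cis s \<in> fst (circle_chart a)"
      using c unfolding charts_at_def circle_atlas_def by blast
    obtain k :: int where k: "s + 2 * pi * of_int k \<in> {a<..<a + 2 * pi}" using a(2) by (rule circle_chart_shift)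
    have "snd c (cis s) = s + 2 * pi * of_int k"
      using snd_circle_chart[OF k] a by (simp add: cis_add_2pi_int)
    then show ?thesis
      using frechet_derivative_cong_open[of "{a<..<a + 2 * pi}" "s + 2 * pi * of_int k" "f \<circ> chart_inv c" ?g] k a
        circle_function_lift(5)[OF f, of s k]
      by (simp add: circle_chart_inv)
  qed
  then show ?thesis
    by (auto simp: jet_extension_def cis_carrier covector_of_function_def jet_point_def flat_covector_def fun_eq_iff carrier_circle)
qed

lemma jet_extension_lift:
  assumes f: "smooth_map circle_atlas euclidean_atlas (f :: complex \<Rightarrow> real)"
  shows "jet_extension circle_atlas f =
    circle_lift (\<lambda>s. cpoint s (frechet_derivative (\<lambda>s. f (cis s)) (at s) 1) (f (cis s)))"
proof (rule extensionalityI)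
  show "jet_extension circle_atlas f \<in> extensional (carrier circle_atlas)"
    unfolding jet_extension_def by (rule restrict_extensional)
  fix z assume "z \<in> carrier circle_atlas"
  then obtain s where s: "z = cis s" using carrier_circle sphere_cisE by auto
  show "jet_extension circle_atlas f z =
    circle_lift (\<lambda>s. cpoint s (frechet_derivative (\<lambda>s. f (cis s)) (at s) 1) (f (cis s))) z"
    unfolding s jet_extension_circle[OF f]
    using circle_lift_cis[of "\<lambda>s. cpoint s (frechet_derivative (\<lambda>s. f (cis s)) (at s) 1) (f (cis s))" s]
      circle_function_lift(4,5)[OF f, of _ 1] cis_add_2pi_int[of _ 1]
    by simp
qed (rule circle_lift_extensional)

lemma smooth_map_zero: "smooth_map circle_atlas euclidean_atlas (\<lambda>_. 0 :: real)"
proof -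
  have "smooth_path circle_atlas euclidean_atlas (\<lambda>_ _. 0 :: real)"
  proof (rule circle_smooth_pathI[OF smooth_atlas_euclidean])
    show "\<exists>d\<in>charts_at euclidean_atlas (0::real). \<exists>W G. open W \<and> (t, s) \<in> W \<and> smooth_on W G \<and>
        (\<forall>t'\<in>{0..1}. \<forall>s'. (t', s') \<in> W \<longrightarrow> 0 \<in> fst d \<and> snd d 0 = G (t', s'))" for t s :: real
      by (intro bexI[of _ "(UNIV, \<lambda>x. x)"] exI[of _ UNIV] exI[of _ "\<lambda>_. 0"])
         (auto simp: charts_at_iff euclidean_atlas_def smooth_on_const)
  qed
  then show ?thesis
    using smooth_path_imp_smooth_map[OF smooth_atlas_circle smooth_atlas_euclidean, of "\<lambda>_ _. 0" 0] by simp
qed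

lemma jet_extension_zero: "jet_extension circle_atlas (\<lambda>_. 0) = circle_lift (\<lambda>s. cpoint s 0 0)"
  using jet_extension_lift[OF smooth_map_zero] by (simp add: frechet_derivative_at[OF has_derivative_const, symmetric])

section \<open>Connected components of Legendrian immersions and embeddings\<close>

lemma circle_lift_restrict: "restrict (circle_lift F) (carrier circle_atlas) = circle_lift F"
  by (simp add: circle_lift_def carrier_circle)

lemma cjet_nonempty: "circle_atlas \<noteq> {}" "cjet \<noteq> {}"
  by (auto simp: circle_atlas_def jet_atlas_def)

lemma cjet_legendrian_immersion_path:
  fixes q p u :: "real \<Rightarrow> real \<Rightarrow> real"
  defines "\<phi> \<equiv> \<lambda>t. circle_lift (\<lambda>s. cpoint (q t s) (p t s) (u t s))"
  assumes per: "\<And>t s. q t (s + 2 * pi) = q t s + 2 * pi" "\<And>t s. p t (s + 2 * pi) = p t s" "\<And>t s. u t (s + 2 * pi) = u t s"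
    and sm: "smooth_on UNIV (\<lambda>z. q (fst z) (snd z))" "smooth_on UNIV (\<lambda>z. p (fst z) (snd z))"
      "smooth_on UNIV (\<lambda>z. u (fst z) (snd z))"
    and d: "\<And>t s. (q t has_real_derivative q' t s) (at s)" "\<And>t s. (p t has_real_derivative p' t s) (at s)"
      "\<And>t s. (u t has_real_derivative p t s * q' t s) (at s)"
    and n: "\<And>t s. t \<in> {0..1} \<Longrightarrow> q' t s \<noteq> 0 \<or> p' t s \<noteq> 0"
  shows "\<And>t s. \<phi> t (cis s) = cpoint (q t s) (p t s) (u t s)"
    and "legendrian_immersion_path circle_atlas cjet (jet_form circle_atlas) \<phi>"
proof -
  show \<phi>: "\<phi> t (cis s) = cpoint (q t s) (p t s) (u t s)" for t s
    unfolding \<phi>_def by (rule circle_lift_cis) (use per cis_add_2pi_int[of _ 1] in simp)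
  have path: "smooth_path circle_atlas cjet \<phi>" by (rule cjet_smooth_path[OF \<phi> sm])
  show "legendrian_immersion_path circle_atlas cjet (jet_form circle_atlas) \<phi>"
    unfolding legendrian_immersion_path_def
  proof (intro conjI ballI path)
    fix t :: real assume t: "t \<in> {0..1}"
    show "legendrian_immersion circle_atlas cjet (jet_form circle_atlas) (\<phi> t)"
      by (rule cjet_legendrian_immersion[OF
            smooth_path_imp_smooth_map[OF smooth_atlas_circle smooth_atlas_cjet path t] \<phi> d n[OF t]])
  qed
qed

lemma legendrian_immersion_path_component:
  assumes "legendrian_immersion_path circle_atlas cjet \<alpha> \<phi>" "\<And>t. \<phi> t \<in> extensional (carrier circle_atlas)"
    and "s \<in> {0..1}" "t \<in> {0..1}"
  shows "connected_component_of (legendrian_immersion_space circle_atlas cjet \<alpha>) (\<phi> s) (\<phi> t)"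
  unfolding legendrian_immersion_space_def
  by (rule smooth_path_connected_component[OF smooth_atlas_circle cjet_nonempty(1) smooth_atlas_cjet cjet_nonempty(2)])
     (use assms in \<open>auto simp: legendrian_immersion_path_def\<close>)

lemma legendrian_embedding_path_component:
  assumes "legendrian_embedding_path circle_atlas cjet \<alpha> \<phi>" "\<And>t. \<phi> t \<in> extensional (carrier circle_atlas)"
    and "s \<in> {0..1}" "t \<in> {0..1}"
  shows "connected_component_of (legendrian_embedding_space circle_atlas cjet \<alpha>) (\<phi> s) (\<phi> t)"
  unfolding legendrian_embedding_space_def
  by (rule smooth_path_connected_component[OF smooth_atlas_circle cjet_nonempty(1) smooth_atlas_cjet cjet_nonempty(2)])
     (use assms in \<open>auto simp: legendrian_embedding_path_def\<close>)

lemma connected_component_of_set_member: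
  "connected_component_of X x y \<Longrightarrow> connected_component_of_set X x \<in> connected_components_of X"
  by (metis connected_component_in_connected_components_of connected_component_of_equiv)

theorem closed_positive_path_of_immersions:
  "\<exists>C \<in> connected_components_of (legendrian_immersion_space circle_atlas cjet (jet_form circle_atlas)).
        (\<forall>f. smooth_map circle_atlas euclidean_atlas f \<longrightarrow> jet_extension circle_atlas f \<in> C) \<and>
        (\<exists>\<phi>. legendrian_immersion_path circle_atlas cjet (jet_form circle_atlas) \<phi> \<and>
             positive_path circle_atlas cjet (jet_form circle_atlas) \<phi> \<and>
             closed_legendrian_path circle_atlas \<phi> \<and> path_in circle_atlas C \<phi>)"
proof -
  let ?X = "legendrian_immersion_space circle_atlas cjet (jet_form circle_atlas)"
  let ?z = "circle_lift (\<lambda>s. cpoint s 0 0)"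
  obtain E where E: "\<And>t s. t \<in> {0..1} \<Longrightarrow> loop_u_dot E t s - loop_p t s * (- loop_a_dot t * sin s + E / 10) > 0"
    using loop_positive[of 0] by metis
  define \<phi> where "\<phi> = (\<lambda>t. circle_lift (\<lambda>s. cpoint (loop_q E t s) (loop_p t s) (loop_u E t s)))"
  have path: "\<phi> t (cis s) = cpoint (loop_q E t s) (loop_p t s) (loop_u E t s)"
    "legendrian_immersion_path circle_atlas cjet (jet_form circle_atlas) \<phi>" for t s
    unfolding \<phi>_def
    by (rule cjet_legendrian_immersion_path[OF loop_periodic loop_smooth loop_ds loop_immersed], assumption)+
  have \<phi>0: "\<phi> 0 = ?z" by (simp add: \<phi>_def)
  have comp: "connected_component_of ?X ?z (\<phi> t)" if "t \<in> {0..1}" for t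
    using legendrian_immersion_path_component[OF path(2), of 0 t] that \<phi>0
    by (simp add: \<phi>_def circle_lift_extensional)
  show ?thesis
  proof (intro bexI conjI allI impI exI)
    show "connected_component_of_set ?X ?z \<in> connected_components_of ?X"
      using connected_component_of_set_member comp[of 0] by auto
    show "legendrian_immersion_path circle_atlas cjet (jet_form circle_atlas) \<phi>" by (rule path(2))
    show "positive_path circle_atlas cjet (jet_form circle_atlas) \<phi>"
      by (rule cjet_positive_path[where u' = "loop_u_dot E", OF path(1) loop_dt(1,2,3) E])
    show "closed_legendrian_path circle_atlas \<phi>"
      unfolding closed_legendrian_path_def
    proof (intro exI conjI ballI)
      \<comment> \<open>At time 1 the curve is the zero section turned by the angle
        \<open>E / 10\<close>: the same Legendrian with another parametrization.\<close>
      show "diffeomorphism circle_atlas circle_atlas (\<lambda>z. cis (E / 10) * z)" by (rule diffeomorphism_rotation)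
      fix x assume "x \<in> carrier circle_atlas"
      then obtain s where s: "x = cis s" using carrier_circle sphere_cisE by auto
      then show "\<phi> 1 x = \<phi> 0 (cis (E / 10) * x)" by (simp add: path(1) cis_mult add.commute)
    qed
    show "path_in circle_atlas (connected_component_of_set ?X ?z) \<phi>"
      unfolding path_in_def using comp by (simp add: \<phi>_def circle_lift_restrict)
  next
    fix f :: "complex \<Rightarrow> real" assume f: "smooth_map circle_atlas euclidean_atlas f"
    define g where "g = (\<lambda>s. f (cis s))"
    define g' where "g' = (\<lambda>s. frechet_derivative (\<lambda>s. f (cis s)) (at s) 1)"
    have fl: "smooth_on UNIV g" "smooth_on UNIV g'" "(g has_real_derivative g' s) (at s)"
      "g (s + 2 * pi * of_int k) = g s" "g' (s + 2 * pi * of_int k) = g' s" for s k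
      unfolding g_def g'_def by (rule circle_function_lift[OF f])+
    define \<psi> where "\<psi> = (\<lambda>t. circle_lift (\<lambda>s. cpoint s (t * g' s) (t * g s)))"
    have "legendrian_immersion_path circle_atlas cjet (jet_form circle_atlas) \<psi>"
      unfolding \<psi>_def
    proof (rule cjet_legendrian_immersion_path(2)[where q' = "\<lambda>_ _. 1" and p' = "\<lambda>t s. t * frechet_derivative g' (at s) 1"])
      show "((\<lambda>s. t * g' s) has_real_derivative t * frechet_derivative g' (at s) 1) (at s)" for t s
        by (rule DERIV_cmult[OF smooth_on_real_derivative[OF fl(2)]]) simp
      show "((\<lambda>s. t * g s) has_real_derivative t * g' s * 1) (at s)" for t s
        using DERIV_cmult[OF fl(3)] by simp
      show "smooth_on UNIV (\<lambda>z::real \<times> real. snd z)" by (intro smooth_intros open_UNIV)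
      show "smooth_on UNIV (\<lambda>z. fst z * g' (snd z))" "smooth_on UNIV (\<lambda>z. fst z * g (snd z))"
        by (rule smooth_on_mult[OF open_UNIV], intro smooth_intros open_UNIV,
            rule smooth_on_compose[OF fl(2)] smooth_on_compose[OF fl(1)], intro smooth_intros open_UNIV, auto)+
      show "((\<lambda>s. s) has_real_derivative 1) (at s)" for s :: real by (rule DERIV_ident)
      show "t * g' (s + 2 * pi) = t * g' s" "t * g (s + 2 * pi) = t * g s" for t s
        using fl(4,5)[of s 1] by simp_all
    qed auto
    from legendrian_immersion_path_component[OF this, of 0 1]
    have "connected_component_of ?X (\<psi> 0) (\<psi> 1)"
      by (simp add: \<psi>_def circle_lift_extensional)
    moreover have "\<psi> 0 = ?z" "\<psi> 1 = jet_extension circle_atlas f"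
      unfolding jet_extension_lift[OF f] by (simp_all add: \<psi>_def g_def g'_def)
    ultimately show "jet_extension circle_atlas f \<in> connected_component_of_set ?X ?z" by simp
  qed
qed

section \<open>Homotopy classes of curves in the one-jets of the circle\<close>

text \<open>A flat covector has the same component in every chart around its base point, so reading
  it in an unspecified chart gives a continuous function on the one-jets.\<close>

definition jet_momentum :: "(complex, real) jet \<Rightarrow> real" where
  "jet_momentum m = snd (fst m) (SOME c. c \<in> charts_at circle_atlas (fst (fst m)))"

lemma jet_momentum_point: "z \<in> sphere 0 1 \<Longrightarrow> jet_momentum (jet_point circle_atlas z P u) = P"
  using some_chart_at[of z circle_atlas] by (simp add: jet_momentum_def jet_point_def flat_covector_def carrier_circle)

lemma carrier_cjetE:
  assumes "m \<in> carrier cjet"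
  obtains q P u where "m = jet_point circle_atlas q P u" "q \<in> sphere 0 1"
proof -
  obtain C where "C \<in> charts_at cjet m" using assms by (rule carrierE)
  then obtain c where c: "c \<in> circle_atlas" "m \<in> fst (jet_chart circle_atlas c)"
    unfolding charts_at_def jet_atlas_def by blast
  obtain q P u where "m = jet_point circle_atlas q P u" "q \<in> fst c"
    using c(2) by (rule jet_chartE[OF flat_atlas_circle c(1)])
  then show ?thesis using that c(1) carrier_circle unfolding carrier_def by blast
qed

lemma continuous_map_cjet_projections:
  assumes f: "continuous_map (top_of_set S) (manifold_topology cjet) f"
  shows "continuous_on S (\<lambda>x. fst (fst (f x)))" "continuous_on S (\<lambda>x. jet_momentum (f x))" "continuous_on S (\<lambda>x. snd (f x))"
proof -
  have inv: "chart_inv (jet_chart circle_atlas (circle_chart a)) v = cpoint (fst (fst v)) (snd (fst v)) (snd v)"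
    if "v \<in> snd (jet_chart circle_atlas (circle_chart a)) ` fst (jet_chart circle_atlas (circle_chart a))" for a v
  proof -
    have "circle_chart a \<in> circle_atlas" by (simp add: circle_atlas_def)
    from jet_chart_image[OF flat_atlas_circle this this] that
    have "fst (fst v) \<in> {a<..<a + 2 * pi}" by (auto simp: circle_chart_image)
    then show ?thesis
      using jet_chart_inv(1)[OF flat_atlas_circle \<open>circle_chart a \<in> circle_atlas\<close>, of "fst (fst v)" "snd (fst v)" "snd v"]
      by (simp add: circle_chart_image circle_chart_inv)
  qed
  have *: "continuous_map (manifold_topology cjet) euclidean h"
    if h: "\<And>x P u. h (cpoint x P u) = k ((x, P), u)" and k: "continuous_on UNIV k"
    for h :: "(complex, real) jet \<Rightarrow> 'b::topological_space" and k
  proof (rule continuous_map_from_manifold[OF smooth_atlas_cjet])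
    fix C assume "C \<in> cjet"
    then obtain a where C: "C = jet_chart circle_atlas (circle_chart a)" by (auto simp: jet_atlas_def circle_atlas_def)
    have "continuous_on (snd C ` fst C) (\<lambda>v. h (chart_inv C v))"
      using continuous_on_subset[OF k, of "snd C ` fst C"]
      by (rule continuous_on_eq) (simp_all add: C inv h)
    then show "continuous_map (top_of_set (snd C ` fst C)) euclidean (\<lambda>v. h (chart_inv C v))" by simp
  qed
  have c1: "continuous_map (manifold_topology cjet) euclidean (\<lambda>m. fst (fst m))"
    by (rule *[of _ "\<lambda>z. cis (fst (fst z))"]) (auto intro!: continuous_intros)
  have c2: "continuous_map (manifold_topology cjet) euclidean jet_momentum"
    by (rule *[of _ "\<lambda>z. snd (fst z)"]) (auto simp: jet_momentum_point intro!: continuous_intros)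
  have c3: "continuous_map (manifold_topology cjet) euclidean snd"
    by (rule *[of _ snd]) (auto simp: jet_point_def intro!: continuous_intros)
  show "continuous_on S (\<lambda>x. fst (fst (f x)))" "continuous_on S (\<lambda>x. jet_momentum (f x))" "continuous_on S (\<lambda>x. snd (f x))"
    using continuous_map_compose[OF f c1] continuous_map_compose[OF f c2] continuous_map_compose[OF f c3]
    by (simp_all add: o_def)
qed

text \<open>On the open set where \<open>z\<close> avoids \<open>cis a\<close>, the map is the
  inverse of a jet chart applied to continuous coordinates. Two such sets already cover
  \<open>S\<close>, and the local maps are pasted.\<close>

lemma continuous_map_cjetI:
  assumes z: "continuous_on S z" "z ` S \<subseteq> sphere 0 1" and P: "continuous_on S P" and u: "continuous_on S u"
  shows "continuous_map (top_of_set S) (manifold_topology cjet) (\<lambda>x. jet_point circle_atlas (z x) (P x) (u x))"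
proof (rule pasting_lemma[where I = UNIV and T = "\<lambda>a. {x \<in> S. z x \<noteq> cis a}"
      and f = "\<lambda>_ x. jet_point circle_atlas (z x) (P x) (u x)"])
  fix a
  let ?c = "circle_chart a"
  let ?S = "{x \<in> S. z x \<noteq> cis a}"
  have c: "?c \<in> circle_atlas" by (simp add: circle_atlas_def)
  have zS: "z ` ?S \<subseteq> fst ?c" using z(2) by (auto simp: fst_circle_chart)
  have eq: "?S = S \<inter> z -` (- {cis a})" by auto
  show "openin (top_of_set S) ?S"
    unfolding eq by (rule continuous_openin_preimage_gen[OF z(1)]) auto
  have "sphere 0 1 \<inter> fst ?c = fst ?c" by (auto simp: fst_circle_chart)
  then have "continuous_on (fst ?c) (snd ?c)"
    using continuous_map_chart[OF smooth_atlas_circle c]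
    unfolding manifold_topology_circle subtopology_subtopology by simp
  then have "continuous_on ?S (\<lambda>x. snd ?c (z x))"
    by (rule continuous_on_compose2[OF _ continuous_on_subset[OF z(1)] zS]) auto
  then have "continuous_on ?S (\<lambda>x. ((snd ?c (z x), P x), u x))"
    using continuous_on_subset[OF P, of ?S] continuous_on_subset[OF u, of ?S] by (intro continuous_intros) auto
  moreover have im: "snd (jet_chart circle_atlas ?c) ` fst (jet_chart circle_atlas ?c) = (snd ?c ` fst ?c \<times> UNIV) \<times> UNIV"
    using jet_chart_image[OF flat_atlas_circle c c] by simp
  ultimately have "continuous_map (top_of_set ?S)
      (top_of_set (snd (jet_chart circle_atlas ?c) ` fst (jet_chart circle_atlas ?c))) (\<lambda>x. ((snd ?c (z x), P x), u x))"
    unfolding im using zS by auto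
  from continuous_map_compose[OF this continuous_map_chart_inv[OF smooth_atlas_cjet, of "jet_chart circle_atlas ?c"]]
  have "continuous_map (top_of_set ?S) (manifold_topology cjet)
      (\<lambda>x. chart_inv (jet_chart circle_atlas ?c) ((snd ?c (z x), P x), u x))"
    using c by (simp add: o_def jet_atlas_def)
  then have "continuous_map (top_of_set ?S) (manifold_topology cjet) (\<lambda>x. jet_point circle_atlas (z x) (P x) (u x))"
  proof (rule continuous_map_eq)
    fix x assume "x \<in> topspace (top_of_set ?S)"
    then have "z x \<in> fst ?c" using zS by auto
    then show "chart_inv (jet_chart circle_atlas ?c) ((snd ?c (z x), P x), u x) = jet_point circle_atlas (z x) (P x) (u x)"
      using jet_chart_inv(1)[OF flat_atlas_circle c, of "snd ?c (z x)"] chart_inv_eq[OF inj_on_circle_chart] by simp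
  qed
  moreover have "S \<inter> ?S = ?S" by auto
  ultimately show "continuous_map (subtopology (top_of_set S) ?S) (manifold_topology cjet) (\<lambda>x. jet_point circle_atlas (z x) (P x) (u x))"
    by (simp add: subtopology_subtopology)
next
  fix x assume "x \<in> topspace (top_of_set S)"
  moreover have "cis 0 \<noteq> cis pi" by (simp add: complex_eq_iff)
  ultimately show "\<exists>j. j \<in> UNIV \<and> x \<in> {x \<in> S. z x \<noteq> cis j} \<and>
      jet_point circle_atlas (z x) (P x) (u x) = jet_point circle_atlas (z x) (P x) (u x)"
    by (metis (mono_tags, lifting) UNIV_I mem_Collect_eq topspace_euclidean_subtopology)
qed simp

abbreviation "circle_homotopic \<equiv> homotopic_with (\<lambda>_. True) (manifold_topology circle_atlas) (manifold_topology cjet)"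

lemma circle_homotopicI:
  assumes cont: "continuous_on ({0..1::real} \<times> sphere (0::complex) 1) z" "z ` ({0..1::real} \<times> sphere (0::complex) 1) \<subseteq> sphere 0 1"
      "continuous_on ({0..1::real} \<times> sphere (0::complex) 1) P" "continuous_on ({0..1::real} \<times> sphere (0::complex) 1) u"
    and f: "\<And>x. x \<in> sphere 0 1 \<Longrightarrow> f x = jet_point circle_atlas (z (0, x)) (P (0, x)) (u (0, x))"
    and g: "\<And>x. x \<in> sphere 0 1 \<Longrightarrow> g x = jet_point circle_atlas (z (1, x)) (P (1, x)) (u (1, x))"
  shows "circle_homotopic f g"
proof -
  have "prod_topology (top_of_set {0..1::real}) (top_of_set (sphere 0 (1::real))) = top_of_set ({0..1} \<times> sphere (0::complex) 1)"
    by simp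
  then show ?thesis
    using continuous_map_cjetI[OF cont] f g
    by (subst homotopic_with, simp)
       (intro exI[of _ "\<lambda>x. jet_point circle_atlas (z x) (P x) (u x)"], auto simp: manifold_topology_circle)
qed

text \<open>Momentum and height are interpolated linearly. The segment between the two base points
  misses the centre, because they are not antipodal, and is projected radially to the
  circle.\<close>

lemma circle_homotopic_not_antipodal:
  assumes f: "continuous_map (manifold_topology circle_atlas) (manifold_topology cjet) f"
    and g: "continuous_map (manifold_topology circle_atlas) (manifold_topology cjet) g"
    and na: "\<And>x. x \<in> sphere 0 1 \<Longrightarrow> fst (fst (f x)) \<noteq> - fst (fst (g x))"
  shows "circle_homotopic f g"
proof -
  let ?X = "{0..1::real} \<times> sphere (0::complex) 1"
  have pt: "h x = jet_point circle_atlas (fst (fst (h x))) (jet_momentum (h x)) (snd (h x))" "fst (fst (h x)) \<in> sphere 0 1"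
    if h: "continuous_map (manifold_topology circle_atlas) (manifold_topology cjet) h" and x: "x \<in> sphere 0 1" for h x
  proof -
    have "h x \<in> carrier cjet"
      using continuous_map_funspace[OF h] x
      by (auto simp: topspace_manifold[OF smooth_atlas_cjet] manifold_topology_circle Pi_iff)
    then obtain q P u where "h x = jet_point circle_atlas q P u" "q \<in> sphere 0 1" by (rule carrier_cjetE)
    then show "h x = jet_point circle_atlas (fst (fst (h x))) (jet_momentum (h x)) (snd (h x))" "fst (fst (h x)) \<in> sphere 0 1"
      by (auto simp: jet_momentum_point) (simp add: jet_point_def)
  qed
  have cont: "continuous_on ?X (\<lambda>w. fst (fst (h (snd w))))" "continuous_on ?X (\<lambda>w. jet_momentum (h (snd w)))"
      "continuous_on ?X (\<lambda>w. snd (h (snd w)))"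
    if h: "continuous_map (manifold_topology circle_atlas) (manifold_topology cjet) h" for h
    by (rule continuous_on_compose2[OF continuous_map_cjet_projections(1)[OF h[unfolded manifold_topology_circle]]]
          continuous_on_compose2[OF continuous_map_cjet_projections(2)[OF h[unfolded manifold_topology_circle]]]
          continuous_on_compose2[OF continuous_map_cjet_projections(3)[OF h[unfolded manifold_topology_circle]]],
        rule continuous_on_snd[OF continuous_on_id], auto)+
  note cont = cont[OF f] cont[OF g]
  let ?Z = "\<lambda>w. (1 - fst w) *\<^sub>R fst (fst (f (snd w))) + fst w *\<^sub>R fst (fst (g (snd w)))"
  have Z: "?Z w \<noteq> 0" if w: "w \<in> ?X" for w
  proof
    assume "?Z w = 0"
    then have eq: "(1 - fst w) *\<^sub>R fst (fst (f (snd w))) = - (fst w *\<^sub>R fst (fst (g (snd w))))"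
      by (simp add: eq_neg_iff_add_eq_0)
    from arg_cong[OF this, of norm] have "1 - fst w = fst w"
      using w pt(2)[OF f, of "snd w"] pt(2)[OF g, of "snd w"] by auto
    then have fw: "fst w = 1 / 2" by simp
    have "fst (fst (f (snd w))) = 2 *\<^sub>R ((1 - fst w) *\<^sub>R fst (fst (f (snd w))))" unfolding fw by simp
    also have "\<dots> = - fst (fst (g (snd w)))" unfolding eq unfolding fw by simp
    finally have "fst (fst (f (snd w))) = - fst (fst (g (snd w)))" .
    then show False using na w by auto
  qed
  show ?thesis
  proof (rule circle_homotopicI)
    show "continuous_on ?X (\<lambda>w. ?Z w /\<^sub>R norm (?Z w))"
      by (intro continuous_intros cont) (use Z in auto)
    show "(\<lambda>w. ?Z w /\<^sub>R norm (?Z w)) ` ?X \<subseteq> sphere 0 1"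
      using Z by auto
    show "continuous_on ?X (\<lambda>w. (1 - fst w) * jet_momentum (f (snd w)) + fst w * jet_momentum (g (snd w)))"
      "continuous_on ?X (\<lambda>w. (1 - fst w) * snd (f (snd w)) + fst w * snd (g (snd w)))"
      by (intro continuous_intros cont)+
  qed (use pt[OF f] pt[OF g] in auto)
qed

text \<open>The distance is in fact at least \<open>pi\<close>. The bound \<open>1\<close> fits the
  radius of the neighbourhoods used below.\<close>

lemma cis_antipodal:
  assumes "cis a = - cis b" shows "\<bar>a - b\<bar> \<ge> 1"
proof -
  have "cis a = cis (b + pi)" using assms by (simp add: cis_mult[symmetric])
  then obtain n :: int where n: "a = b + pi + 2 * pi * of_int n" by (rule cis_eqE)
  have "1 + 2 * n \<noteq> 0" by presburger
  then have "\<bar>1 + 2 * n\<bar> \<ge> 1" by presburger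
  then have "\<bar>1 + 2 * of_int n :: real\<bar> \<ge> 1" by linarith
  then have "pi * \<bar>1 + 2 * of_int n\<bar> \<ge> pi * 1" by (intro mult_left_mono) auto
  moreover have "\<bar>a - b\<bar> = pi * \<bar>1 + 2 * of_int n\<bar>"
    using n abs_mult[of pi "1 + 2 * of_int n"] by (simp add: algebra_simps)
  ultimately show ?thesis using pi_gt3 by linarith
qed

text \<open>Control of values suffices, without derivatives: maps whose coordinates differ by less
  than \<open>1\<close> have base points that are never antipodal. The circle is covered by finitely
  many short arcs, each sent by \<open>g\<close> into one chart.\<close>

lemma smooth_nbhd_homotopic:
  assumes g: "g \<in> smooth_maps circle_atlas cjet"
  obtains V where "openin (smooth_topology circle_atlas cjet) V" "g \<in> V" "\<And>h. h \<in> V \<Longrightarrow> circle_homotopic g h"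
proof -
  have cg: "continuous_map (manifold_topology circle_atlas) (manifold_topology cjet) g"
    using g by (auto simp: smooth_maps_def smooth_map_def)
  have "\<exists>\<delta> c d. \<delta> > 0 \<and> c \<in> circle_atlas \<and> d \<in> circle_atlas \<and> cis ` {s - \<delta>..s + \<delta>} \<subseteq> fst c \<and>
      g ` cis ` {s - \<delta>..s + \<delta>} \<subseteq> fst (jet_chart circle_atlas d)" for s
  proof -
    have "g (cis s) \<in> carrier cjet"
      using continuous_map_funspace[OF cg] by (auto simp: topspace_manifold[OF smooth_atlas_cjet] manifold_topology_circle Pi_iff)
    then obtain D where D: "D \<in> charts_at cjet (g (cis s))" by (rule carrierE)
    then obtain d where d: "d \<in> circle_atlas" "D = jet_chart circle_atlas d"
      unfolding charts_at_def jet_atlas_def by blast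
    have "openin (top_of_set (sphere 0 1)) {x \<in> sphere 0 1. g x \<in> fst D}"
      using openin_continuous_map_preimage[OF cg openin_chart[OF smooth_atlas_cjet, of D]] D
      by (simp add: manifold_topology_circle charts_at_iff)
    then obtain U where U: "open U" "{x \<in> sphere 0 1. g x \<in> fst D} = sphere 0 1 \<inter> U"
      by (auto simp: openin_open)
    have "open (cis -` U)" by (rule open_vimage[OF U(1) continuous_on_cis[OF continuous_on_id]])
    moreover have "s \<in> cis -` U"
    proof -
      have "cis s \<in> {x \<in> sphere 0 1. g x \<in> fst D}" using D by (simp add: charts_at_iff)
      then show ?thesis unfolding U(2) by simp
    qed
    ultimately obtain e where e: "e > 0" "cball s e \<subseteq> cis -` U" using open_contains_cball by blast
    \<comment> \<open>At most \<open>1\<close>, hence less than \<open>pi\<close>, so the closed arc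
      misses the point opposite to \<open>cis s\<close> and stays in one chart.\<close>
    let ?\<delta> = "min e 1"
    have sub: "{s - ?\<delta>..s + ?\<delta>} \<subseteq> cball s e" by (auto simp: dist_real_def)
    have "cis ` {s - ?\<delta>..s + ?\<delta>} \<subseteq> fst (circle_chart (s - pi))"
    proof clarify
      fix r assume "r \<in> {s - ?\<delta>..s + ?\<delta>}"
      then show "cis r \<in> fst (circle_chart (s - pi))" using pi_gt3 by (intro circle_chart_cis) auto
    qed
    moreover have "g ` cis ` {s - ?\<delta>..s + ?\<delta>} \<subseteq> fst D"
    proof
      fix y assume "y \<in> g ` cis ` {s - ?\<delta>..s + ?\<delta>}"
      then obtain r where r: "r \<in> {s - ?\<delta>..s + ?\<delta>}" "y = g (cis r)" by blast
      then have "r \<in> cis -` U" using sub e(2) by blast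
      then have "cis r \<in> sphere 0 1 \<inter> U" by simp
      then show "y \<in> fst D" unfolding r(2) U(2)[symmetric] by simp
    qed
    ultimately show ?thesis
      using e(1) d by (intro exI[of _ ?\<delta>] exI[of _ "circle_chart (s - pi)"] exI[of _ d]) (auto simp: circle_atlas_def)
  qed
  then obtain \<delta> c d where \<delta>: "\<And>s. \<delta> s > (0::real)" and c: "\<And>s. c s \<in> circle_atlas" and d: "\<And>s. d s \<in> circle_atlas"
    and K: "\<And>s. cis ` {s - \<delta> s..s + \<delta> s} \<subseteq> fst (c s)"
    and gK: "\<And>s. g ` cis ` {s - \<delta> s..s + \<delta> s} \<subseteq> fst (jet_chart circle_atlas (d s))" by metis
  have "{0..2 * pi} \<subseteq> (\<Union>s\<in>{0..2 * pi}. {s - \<delta> s<..<s + \<delta> s})" using \<delta> by fastforce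
  then obtain F where F: "F \<subseteq> {0..2 * pi}" "finite F" "{0..2 * pi} \<subseteq> (\<Union>s\<in>F. {s - \<delta> s<..<s + \<delta> s})"
    using compactE_image[of "{0..2 * pi}" "{0..2 * pi}" "\<lambda>s. {s - \<delta> s<..<s + \<delta> s}"] by auto
  let ?N = "\<lambda>s. smooth_nbhd circle_atlas cjet (c s) (jet_chart circle_atlas (d s)) (cis ` {s - \<delta> s..s + \<delta> s}) [] 1 g"
  have F0: "F \<noteq> {}" using F(3) by force
  show ?thesis
  proof (rule that)
    show "openin (smooth_topology circle_atlas cjet) (\<Inter>s\<in>F. ?N s)"
    proof (rule openin_INT2[OF F(2) F0])
      fix s
      have comp: "compactin (manifold_topology circle_atlas) (cis ` {s - \<delta> s..s + \<delta> s})"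
        unfolding manifold_topology_circle compactin_subtopology
        by (auto intro!: compact_continuous_image continuous_intros)
      show "openin (smooth_topology circle_atlas cjet) (?N s)"
        unfolding smooth_topology_def
        by (intro topology_generated_by_Basis CollectI exI conjI, rule refl)
           (use comp c d K gK g in \<open>auto simp: jet_atlas_def\<close>)
    qed
    show "g \<in> (\<Inter>s\<in>F. ?N s)" using g gK by (auto simp: smooth_nbhd_def)
    fix h assume h: "h \<in> (\<Inter>s\<in>F. ?N s)"
    then have "h \<in> smooth_maps circle_atlas cjet" using F0 by (auto simp: smooth_nbhd_def)
    then have ch: "continuous_map (manifold_topology circle_atlas) (manifold_topology cjet) h"
      by (auto simp: smooth_maps_def smooth_map_def)
    show "circle_homotopic g h"
    proof (rule circle_homotopic_not_antipodal[OF cg ch])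
      fix x :: complex assume x: "x \<in> sphere 0 1"
      then obtain r where r: "x = cis r" by (rule sphere_cisE)
      obtain k :: int where k: "r + 2 * pi * of_int k \<in> {0..<0 + 2 * pi}" by (rule cis_shift_into)
      then have "r + 2 * pi * of_int k \<in> {0..2 * pi}" by auto
      with F(3) obtain s where s: "s \<in> F" "r + 2 * pi * of_int k \<in> {s - \<delta> s<..<s + \<delta> s}" by blast
      then have xK: "x \<in> cis ` {s - \<delta> s..s + \<delta> s}"
        using r cis_add_2pi_int[of r k] by (intro image_eqI[of _ _ "r + 2 * pi * of_int k"]) auto
      let ?D = "jet_chart circle_atlas (d s)"
      have hs: "h x \<in> fst ?D" "norm (in_charts (c s) ?D h (snd (c s) x) - in_charts (c s) ?D g (snd (c s) x)) < 1"
        using h s(1) xK by (auto simp: smooth_nbhd_def)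
      have gs: "g x \<in> fst ?D" using gK xK by blast
      have "chart_inv (c s) (snd (c s) x) = x"
        using K xK by (intro chart_inv_eq smooth_atlasD(1)[OF smooth_atlas_circle c]) blast
      then have n: "norm (snd ?D (h x) - snd ?D (g x)) < 1" using hs(2) by (simp add: in_charts_def)
      obtain a where a: "d s = circle_chart a" using d[of s] by (auto simp: circle_atlas_def)
      obtain q P u where hp: "h x = jet_point circle_atlas q P u" "q \<in> fst (d s)" "d s \<in> charts_at circle_atlas q"
        using hs(1) by (rule jet_chartE[OF flat_atlas_circle d])
      obtain q' P' u' where gp: "g x = jet_point circle_atlas q' P' u'" "q' \<in> fst (d s)" "d s \<in> charts_at circle_atlas q'"
        using gs by (rule jet_chartE[OF flat_atlas_circle d])
      obtain y where y: "q = cis y" "snd (d s) q = y" using hp(2) unfolding a by (rule circle_chartE)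
      obtain y' where y': "q' = cis y'" "snd (d s) q' = y'" using gp(2) unfolding a by (rule circle_chartE)
      have "snd ?D (h x) - snd ?D (g x) = ((y - y', P - P'), u - u')"
        by (simp add: hp(1) gp(1) snd_jet_chart[OF hp(3)] snd_jet_chart[OF gp(3)] y(2) y'(2))
      then have "\<bar>y - y'\<bar> < 1"
        using n norm_fst_le[of "(y - y', P - P')" "u - u'"] norm_fst_le[of "y - y'" "P - P'"] by simp
      then have "cis y' \<noteq> - cis y" using cis_antipodal[of y' y] by (auto simp: abs_minus_commute)
      then show "fst (fst (g x)) \<noteq> - fst (fst (h x))" by (simp add: hp(1) gp(1) y y')
    qed
  qed
qed

text \<open>By the previous lemma the homotopy class is locally constant, so the maps homotopic to
  \<open>f\<close> form an open and closed set, which contains the component of \<open>f\<close>.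
  The truth value \<open>b\<close> below treats the class and its complement at once.\<close>

lemma homotopic_in_component:
  assumes C: "C \<in> connected_components_of (subtopology (smooth_topology circle_atlas cjet) Q)"
    and "f \<in> C" "g \<in> C"
  shows "circle_homotopic f g"
proof -
  let ?X = "subtopology (smooth_topology circle_atlas cjet) Q"
  have top: "topspace ?X \<subseteq> smooth_maps circle_atlas cjet"
    using topspace_smooth_topology[OF smooth_atlas_circle cjet_nonempty] by auto
  have conn: "connectedin ?X C" using C by (rule connectedin_connected_components_of)
  then have CX: "C \<subseteq> topspace ?X" by (rule connectedin_subset_topspace)
  have open_class: "openin ?X {h \<in> topspace ?X. circle_homotopic f h \<longleftrightarrow> b}" for b
  proof (subst openin_subopen, intro ballI)
    fix h assume h: "h \<in> {h \<in> topspace ?X. circle_homotopic f h \<longleftrightarrow> b}"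
    then have "h \<in> smooth_maps circle_atlas cjet" using top by blast
    then obtain V where V: "openin (smooth_topology circle_atlas cjet) V" "h \<in> V" "\<And>k. k \<in> V \<Longrightarrow> circle_homotopic h k"
      by (rule smooth_nbhd_homotopic) blast
    have "circle_homotopic f k \<longleftrightarrow> b" if "k \<in> V" for k
      using h V(3)[OF that] homotopic_with_trans homotopic_with_symD by blast
    moreover have "openin ?X (V \<inter> Q)" using V(1) by (auto simp: openin_subtopology)
    ultimately show "\<exists>T. openin ?X T \<and> h \<in> T \<and> T \<subseteq> {h \<in> topspace ?X. circle_homotopic f h \<longleftrightarrow> b}"
      using h V(2) openin_subset[of ?X "V \<inter> Q"] by (intro exI[of _ "V \<inter> Q"]) (auto simp: subset_eq)
  qed
  let ?T = "{h \<in> topspace ?X. circle_homotopic f h}"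
  have "topspace ?X - ?T = {h \<in> topspace ?X. circle_homotopic f h \<longleftrightarrow> False}" by auto
  then have "closedin ?X ?T" using open_class[of False] by (auto simp: closedin_def)
  moreover have "openin ?X ?T" using open_class[of True] by simp
  ultimately have "C \<subseteq> ?T \<or> disjnt C ?T" by (intro connectedin_clopen_cases[OF conn])
  moreover have "f \<in> ?T"
  proof -
    have "f \<in> smooth_maps circle_atlas cjet" using assms(2) CX top by blast
    then show ?thesis using assms(2) CX by (auto simp: smooth_maps_def smooth_map_def)
  qed
  ultimately show ?thesis using assms(2,3) by (auto simp: disjnt_iff)
qed

section \<open>A closed positive path of embeddings homotopic to the zero section\<close>

text \<open>The curve below has \<open>p < 0\<close> and degree one, so that rotating the circle moves it positively.
  It has two cusps in the front projection, which allow \<open>p\<close> to have integral zero.\<close>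

theorem closed_positive_path_of_embeddings:
  "\<exists>C \<in> connected_components_of (legendrian_embedding_space circle_atlas cjet (jet_form circle_atlas)).
        (\<forall>f\<in>C. circle_homotopic f (jet_extension circle_atlas (\<lambda>_. 0))) \<and>
        (\<exists>\<phi>. legendrian_embedding_path circle_atlas cjet (jet_form circle_atlas) \<phi> \<and>
             positive_path circle_atlas cjet (jet_form circle_atlas) \<phi> \<and>
             closed_legendrian_path circle_atlas \<phi> \<and> path_in circle_atlas C \<phi>)"
proof -
  let ?X = "legendrian_embedding_space circle_atlas cjet (jet_form circle_atlas)"
  \<comment> \<open>The coefficient \<open>4\<close> gives
    \<open>(2 + cos s) * (4 * cos s - 1)\<close> the mean \<open>2 - 2 = 0\<close>, so that
    \<open>u\<close> is periodic; being larger than \<open>1\<close> it produces the two cusps. The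
    rotation \<open>2 * pi * t\<close> is one full turn.\<close>
  define q where "q = (\<lambda>t s :: real. s - 4 * sin s + 2 * pi * t)"
  define p where "p = (\<lambda>(t :: real) s :: real. - 2 - cos s)"
  define u where "u = (\<lambda>(t :: real) s :: real. 7 * sin s + 2 * sin s * cos s)"
  define \<phi> where "\<phi> = (\<lambda>t. circle_lift (\<lambda>s. cpoint (q t s) (p t s) (u t s)))"
  have per: "q t (s + 2 * pi) = q t s + 2 * pi" "p t (s + 2 * pi) = p t s" "u t (s + 2 * pi) = u t s" for t s
    by (simp_all add: q_def p_def u_def)
  have sm: "smooth_on UNIV (\<lambda>z. q (fst z) (snd z))" "smooth_on UNIV (\<lambda>z. p (fst z) (snd z))"
    "smooth_on UNIV (\<lambda>z. u (fst z) (snd z))"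
    unfolding q_def p_def u_def by (intro smooth_intros open_UNIV)+
  have d: "(q t has_real_derivative 1 - 4 * cos s) (at s)" "(p t has_real_derivative sin s) (at s)"
    "(u t has_real_derivative p t s * (1 - 4 * cos s)) (at s)" for t s
  proof -
    have S: "sin s * sin s = 1 - cos s * cos s"
      using sin_cos_squared_add[of s] by (simp add: power2_eq_square)
    then have S2: "sin s * (sin s * x) = (1 - cos s * cos s) * x" for x by (metis mult.assoc)
    show "(q t has_real_derivative 1 - 4 * cos s) (at s)" "(p t has_real_derivative sin s) (at s)"
      unfolding q_def p_def by (auto intro!: derivative_eq_intros)
    show "(u t has_real_derivative p t s * (1 - 4 * cos s)) (at s)"
      unfolding u_def p_def by (auto intro!: derivative_eq_intros simp: algebra_simps S S2)
  qed
  have n: "1 - 4 * cos s \<noteq> 0 \<or> sin s \<noteq> 0" for s :: real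
  proof (rule ccontr)
    assume "\<not> ?thesis"
    then have cs: "cos s = 1 / 4" "sin s = 0" by auto
    show False using sin_cos_squared_add[of s] unfolding cs by (simp add: power2_eq_square)
  qed
  have path: "\<phi> t (cis s) = cpoint (q t s) (p t s) (u t s)"
    "legendrian_immersion_path circle_atlas cjet (jet_form circle_atlas) \<phi>" for t s
    unfolding \<phi>_def by (rule cjet_legendrian_immersion_path[OF per sm d n])+
  have "legendrian_embedding circle_atlas cjet (jet_form circle_atlas) (\<phi> t)" if t: "t \<in> {0..1}" for t
    unfolding legendrian_embedding_def
  proof
    show i: "legendrian_immersion circle_atlas cjet (jet_form circle_atlas) (\<phi> t)"
      using path(2) t by (auto simp: legendrian_immersion_path_def)
    show "embedding_map (manifold_topology circle_atlas) (manifold_topology cjet) (\<phi> t)"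
    proof (rule embedding_map_compact[OF smooth_atlas_cjet])
      show "compact_space (manifold_topology circle_atlas)"
        by (simp add: manifold_topology_circle compact_space_subtopology)
      show "continuous_map (manifold_topology circle_atlas) (manifold_topology cjet) (\<phi> t)"
        using i by (auto simp: legendrian_immersion_def immersion_def smooth_map_def)
      show "inj_on (\<phi> t) (topspace (manifold_topology circle_atlas))"
      proof (rule inj_onI)
        fix x y assume "x \<in> topspace (manifold_topology circle_atlas)" "y \<in> topspace (manifold_topology circle_atlas)"
          and eq: "\<phi> t x = \<phi> t y"
        then have "x \<in> sphere 0 1" "y \<in> sphere 0 1" by (simp_all add: manifold_topology_circle)
        then obtain s r where sr: "x = cis s" "y = cis r" using sphere_cisE by metis
        have "jet_momentum (\<phi> t x) = jet_momentum (\<phi> t y)" "snd (\<phi> t x) = snd (\<phi> t y)" using eq by simp_all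
        then have "p t s = p t r" "u t s = u t r"
          unfolding sr path(1) by (simp_all add: jet_momentum_point) (simp add: jet_point_def)
        \<comment> \<open>The momentum determines the cosine, and then
          \<open>u = sin s * (7 + 2 * cos s)\<close> determines the sine. These two coordinates
          alone already separate the points of the curve.\<close>
        then have c: "cos s = cos r" and "sin s * (7 + 2 * cos s) = sin r * (7 + 2 * cos r)"
          by (auto simp: p_def u_def algebra_simps)
        moreover have "7 + 2 * cos r \<noteq> 0" using cos_ge_minus_one[of r] by linarith
        ultimately have "sin s = sin r" by simp
        with c show "x = y" by (simp add: sr complex_eq_iff)
      qed
      fix x y assume "x \<in> topspace (manifold_topology circle_atlas)" "y \<in> topspace (manifold_topology circle_atlas)"
      then have "x \<in> sphere 0 1" "y \<in> sphere 0 1" by (simp_all add: manifold_topology_circle)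
      then obtain s r where sr: "x = cis s" "y = cis r" using sphere_cisE by metis
      obtain a where "cis (q t s) \<in> fst (circle_chart a)" "cis (q t r) \<in> fst (circle_chart a)"
        using two_points_circle_chart[of "cis (q t s)" "cis (q t r)"] by auto
      then show "\<exists>D\<in>cjet. \<phi> t x \<in> fst D \<and> \<phi> t y \<in> fst D"
        unfolding sr path(1) jet_atlas_def circle_atlas_def
        using jet_point_in_chart[OF flat_atlas_circle, of "circle_chart a"] by (auto simp: circle_atlas_def)
    qed
  qed
  then have epath: "legendrian_embedding_path circle_atlas cjet (jet_form circle_atlas) \<phi>"
    using path(2) by (auto simp: legendrian_embedding_path_def legendrian_immersion_path_def)
  have comp: "connected_component_of ?X (\<phi> 0) (\<phi> t)" if "t \<in> {0..1}" for t
    using legendrian_embedding_path_component[OF epath, of 0 t] that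
    by (simp add: \<phi>_def circle_lift_extensional)
  let ?C = "connected_component_of_set ?X (\<phi> 0)"
  have C: "?C \<in> connected_components_of ?X"
    using connected_component_of_set_member comp[of 0] by auto
  have "circle_homotopic (\<phi> 0) (jet_extension circle_atlas (\<lambda>_. 0))"
  \<comment> \<open>The angle \<open>s - 4 * sin s\<close> is deformed linearly to \<open>s\<close>,
    momentum and height linearly to \<open>0\<close>. Everything is written through
    \<open>Re\<close> and \<open>Im\<close> of the point, so that continuity on the circle needs no
    lift.\<close>
  proof (rule circle_homotopicI[where z = "\<lambda>w. snd w * cis (- ((1 - fst w) * (4 * Im (snd w))))"
        and P = "\<lambda>w. (1 - fst w) * (- 2 - Re (snd w))"
        and u = "\<lambda>w. (1 - fst w) * (7 * Im (snd w) + 2 * Im (snd w) * Re (snd w))"])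
    fix x :: complex assume "x \<in> sphere 0 1"
    then obtain s where s: "x = cis s" by (rule sphere_cisE)
    show "\<phi> 0 x = jet_point circle_atlas (snd (0, x) * cis (- ((1 - fst (0, x)) * (4 * Im (snd (0, x))))))
        ((1 - fst (0, x)) * (- 2 - Re (snd (0, x)))) ((1 - fst (0, x)) * (7 * Im (snd (0, x)) + 2 * Im (snd (0, x)) * Re (snd (0, x))))"
      unfolding s path(1) by (simp add: q_def p_def u_def cis_mult)
    show "jet_extension circle_atlas (\<lambda>_. 0) x = jet_point circle_atlas (snd (1, x) * cis (- ((1 - fst (1, x)) * (4 * Im (snd (1, x))))))
        ((1 - fst (1, x)) * (- 2 - Re (snd (1, x)))) ((1 - fst (1, x)) * (7 * Im (snd (1, x)) + 2 * Im (snd (1, x)) * Re (snd (1, x))))"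
      unfolding s jet_extension_zero
      using circle_lift_cis[of "\<lambda>s. cpoint s 0 0" s] cis_add_2pi_int[of _ 1] by simp
  qed (auto intro!: continuous_intros simp: norm_mult)
  moreover have "\<phi> 0 \<in> ?C" using comp[of 0] by simp
  ultimately have "circle_homotopic f (jet_extension circle_atlas (\<lambda>_. 0))" if "f \<in> ?C" for f
    using homotopic_in_component[OF C[unfolded legendrian_embedding_space_def], of f "\<phi> 0"] that
      homotopic_with_trans unfolding legendrian_embedding_space_def by blast
  moreover have "positive_path circle_atlas cjet (jet_form circle_atlas) \<phi>"
  proof (rule cjet_positive_path[where q = q and p = p and u = u
        and q' = "\<lambda>_ _. 2 * pi" and p' = "\<lambda>_ _. 0" and u' = "\<lambda>_ _. 0"])
    show "\<phi> t (cis s) = cpoint (q t s) (p t s) (u t s)" for t s by (rule path(1))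
    show "((\<lambda>t. q t s) has_real_derivative 2 * pi) (at t)" "((\<lambda>t. p t s) has_real_derivative 0) (at t)"
      "((\<lambda>t. u t s) has_real_derivative 0) (at t)" for t s
      unfolding q_def p_def u_def by (auto intro!: derivative_eq_intros)
    show "0 < 0 - p t s * (2 * pi)" for t s
    proof -
      have "0 < 2 + cos s" using cos_ge_minus_one[of s] by linarith
      then have "0 < (2 + cos s) * (2 * pi)" by simp
      then show ?thesis by (simp add: p_def algebra_simps)
    qed
  qed
  moreover have "closed_legendrian_path circle_atlas \<phi>"
    unfolding closed_legendrian_path_def
  proof (intro exI conjI ballI)
    show "diffeomorphism circle_atlas circle_atlas (\<lambda>x. x)" by (rule diffeomorphism_id[OF smooth_atlas_circle])
    fix x assume "x \<in> carrier circle_atlas"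
    then obtain s where s: "x = cis s" using carrier_circle sphere_cisE by auto
    show "\<phi> 1 x = \<phi> 0 x" unfolding s path(1)
      using cis_add_2pi_int[of "s - 4 * sin s" 1] by (simp add: q_def p_def u_def)
  qed
  moreover have "path_in circle_atlas ?C \<phi>"
    unfolding path_in_def using comp by (simp add: \<phi>_def circle_lift_restrict)
  ultimately show ?thesis using C epath by blast
qed

section \<open>Compact Legendrians in the one-jets of Euclidean space\<close>

text \<open>The motion \<open>translate_jet e \<rho> t\<close> acts by translation along a circle of radius \<open>\<rho>\<close> in the plane
  spanned by \<open>q \<bullet> e\<close> and \<open>p \<bullet> e\<close>, lifted to a contactomorphism. The vertical displacement \<open>c\<close> closes
  up because it spreads the area of the circle evenly; the contact Hamiltonian is
  \<open>2 \<pi> (\<rho>\<^sup>2 / 2 + \<rho> (cos T (q \<bullet> e) + sin T (p \<bullet> e)))\<close> with \<open>T = 2 \<pi> t\<close>.\<close>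

abbreviation "ejet \<equiv> jet_atlas euclidean_atlas"
abbreviation "ejet_chart \<equiv> jet_chart euclidean_atlas (UNIV, \<lambda>x. x)"
abbreviation "ejet_coords \<equiv> snd ejet_chart"

definition translate_jet ::
  "'e::euclidean_space \<Rightarrow> real \<Rightarrow> real \<Rightarrow> ('e \<times> 'e) \<times> real \<Rightarrow> ('e \<times> 'e) \<times> real" where
  "translate_jet e \<rho> t z =
    ((fst (fst z) + (\<rho> * (cos (2 * pi * t) - 1)) *\<^sub>R e, snd (fst z) + (\<rho> * sin (2 * pi * t)) *\<^sub>R e),
     snd z + \<rho> * sin (2 * pi * t) * (fst (fst z) \<bullet> e) + \<rho>\<^sup>2 / 2 * sin (2 * pi * t) * cos (2 * pi * t))"

definition translate_jet_derivative ::
  "'e::euclidean_space \<Rightarrow> real \<Rightarrow> real \<Rightarrow> ('e \<times> 'e) \<times> real \<Rightarrow> ('e \<times> 'e) \<times> real" where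
  "translate_jet_derivative e \<rho> t w = (fst w, snd w + \<rho> * sin (2 * pi * t) * (fst (fst w) \<bullet> e))"

lemma translate_jet_periodic: "translate_jet e \<rho> 0 z = z" "translate_jet e \<rho> 1 z = z"
  by (simp_all add: translate_jet_def)

lemma inj_translate_jet: "inj (translate_jet e \<rho> t)" "inj (translate_jet_derivative e \<rho> t)"
  by (auto intro!: injI simp: translate_jet_def translate_jet_derivative_def prod_eq_iff)

lemma translate_jet_has_derivative:
  "(translate_jet e \<rho> t has_derivative translate_jet_derivative e \<rho> t) (at z)"
  unfolding translate_jet_def[abs_def] translate_jet_derivative_def[abs_def]
  by (auto intro!: derivative_eq_intros simp: prod_eq_iff)

lemma translate_jet_smooth:
  assumes "open W" "smooth_on W f" "smooth_on W \<tau>"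
  shows "smooth_on W (\<lambda>z. translate_jet e \<rho> (\<tau> z) (f z))"
  unfolding translate_jet_def by (intro smooth_intros assms)

lemma translate_jet_velocity:
  "((\<lambda>t. translate_jet e \<rho> t z) has_vector_derivative
     (((- (2 * pi * \<rho> * sin (2 * pi * t))) *\<^sub>R e, (2 * pi * \<rho> * cos (2 * pi * t)) *\<^sub>R e),
      2 * pi * \<rho> * cos (2 * pi * t) * (fst (fst z) \<bullet> e)
       + \<rho>\<^sup>2 / 2 * (2 * pi) * (cos (2 * pi * t) * cos (2 * pi * t) - sin (2 * pi * t) * sin (2 * pi * t)))) (at t)"
proof -
  have s: "((\<lambda>t. sin (2 * pi * t)) has_real_derivative 2 * pi * cos (2 * pi * t)) (at t)"
    and c: "((\<lambda>t. cos (2 * pi * t)) has_real_derivative - (2 * pi * sin (2 * pi * t))) (at t)"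
    by (auto intro!: derivative_eq_intros)
  have 1: "((\<lambda>t. fst (fst z) + (\<rho> * (cos (2 * pi * t) - 1)) *\<^sub>R e) has_vector_derivative (- (2 * pi * \<rho> * sin (2 * pi * t))) *\<^sub>R e) (at t)"
    by (auto intro!: derivative_eq_intros c[unfolded has_real_derivative_iff_has_vector_derivative] c)
  have 2: "((\<lambda>t. snd (fst z) + (\<rho> * sin (2 * pi * t)) *\<^sub>R e) has_vector_derivative (2 * pi * \<rho> * cos (2 * pi * t)) *\<^sub>R e) (at t)"
    by (auto intro!: derivative_eq_intros)
  have 3: "((\<lambda>t. snd z + \<rho> * sin (2 * pi * t) * (fst (fst z) \<bullet> e) + \<rho>\<^sup>2 / 2 * sin (2 * pi * t) * cos (2 * pi * t)) has_vector_derivative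
    2 * pi * \<rho> * cos (2 * pi * t) * (fst (fst z) \<bullet> e)
       + \<rho>\<^sup>2 / 2 * (2 * pi) * (cos (2 * pi * t) * cos (2 * pi * t) - sin (2 * pi * t) * sin (2 * pi * t))) (at t)"
    unfolding has_real_derivative_iff_has_vector_derivative[symmetric]
    by (auto intro!: derivative_eq_intros simp: field_simps)
  show ?thesis unfolding translate_jet_def by (intro has_vector_derivative_Pair 1 2 3)
qed

lemma euclidean_chart: "(UNIV, \<lambda>x. x) \<in> charts_at euclidean_atlas q"
  by (simp add: charts_at_iff euclidean_atlas_def)

lemma ejet_eq: "ejet = {ejet_chart}"
  by (simp add: jet_atlas_def euclidean_atlas_def)

lemma ejet_coords_point: "ejet_coords (jet_point euclidean_atlas q P u) = ((q, P), u)"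
  using snd_jet_chart[OF euclidean_chart, of q P u] by simp

lemma euclidean_chart_member: "(UNIV, \<lambda>x. x) \<in> euclidean_atlas"
  by (simp add: euclidean_atlas_def)

lemma euclidean_chart_inv: "chart_inv (UNIV, \<lambda>x. x) x = x"
  by (simp add: chart_inv_def inv_into_f_f)

lemma ejet_inv: "chart_inv ejet_chart z = jet_point euclidean_atlas (fst (fst z)) (snd (fst z)) (snd z)"
  using jet_chart_inv(1)[OF flat_atlas_euclidean euclidean_chart_member, of "fst (fst z)" "snd (fst z)" "snd z"]
  by (simp add: euclidean_chart_inv)

lemma ejet_coords_inv: "ejet_coords (chart_inv ejet_chart z) = z"
  by (simp add: ejet_inv ejet_coords_point)

lemma ejet_inv_in: "chart_inv ejet_chart z \<in> fst ejet_chart"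
  using jet_point_in_chart[OF flat_atlas_euclidean euclidean_chart_member] by (simp add: ejet_inv)

lemmas smooth_atlas_ejet = smooth_atlas_jet[OF flat_atlas_euclidean]

theorem closed_positive_path_euclidean:
  fixes L :: "(('e::euclidean_space, 'e) jet, 'e) atlas"
  assumes leg: "legendrian_submanifold L ejet (jet_form euclidean_atlas)"
    and compact: "compact_space (manifold_topology L)"
  shows "\<exists>\<phi>. legendrian_embedding_path L ejet (jet_form euclidean_atlas) \<phi> \<and>
             positive_path L ejet (jet_form euclidean_atlas) \<phi> \<and>
             closed_legendrian_path L \<phi> \<and> (\<exists>t\<in>{0..1}. \<phi> t ` carrier L = carrier L)"
proof -
  let ?\<alpha> = "jet_form (euclidean_atlas :: ('e, 'e) atlas)"
  let ?C = "ejet_chart :: (('e, 'e) jet, ('e \<times> 'e) \<times> real) chart"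
  have L: "smooth_atlas L"
    using leg smooth_manifold_imp_smooth_atlas by (auto simp: legendrian_submanifold_def)
  have imm: "immersion L ejet (\<lambda>x. x)" and dim: "DIM(('e \<times> 'e) \<times> real) = 2 * DIM('e) + 1"
    and isotropic: "\<And>x v. x \<in> carrier L \<Longrightarrow> v \<in> tangent_space L x \<Longrightarrow> ?\<alpha> x (differential L ejet (\<lambda>x. x) x v) = 0"
    using leg by (auto simp: legendrian_submanifold_def legendrian_embedding_def legendrian_immersion_def)
  have id: "smooth_map L ejet (\<lambda>x. x)" using imm by (auto simp: immersion_def)
  then have cont: "continuous_map (manifold_topology L) (manifold_topology ejet) (\<lambda>x. x)"
    and sm: "\<And>c. c \<in> L \<Longrightarrow> smooth_on (snd c ` (fst c \<inter> (\<lambda>x. x) -` fst ?C)) (in_charts c ?C (\<lambda>x. x))"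
    by (auto simp: smooth_map_def ejet_eq)
  have car: "carrier L \<subseteq> fst ?C"
    using continuous_map_funspace[OF cont] topspace_manifold[OF L] topspace_manifold[OF smooth_atlas_ejet]
    by (auto simp: ejet_eq carrier_def Pi_iff)
  have fstc: "fst c \<inter> (\<lambda>x. x) -` fst ?C = fst c" if "c \<in> L" for c
    using car that by (auto simp: carrier_def)
  have charts: "charts_at ejet m = {?C}" if "m \<in> fst ?C" for m :: "('e, 'e) jet"
    using that by (auto simp: charts_at_def ejet_eq)
  have point: "m = jet_point euclidean_atlas (fst (fst (snd ?C m))) (snd (fst (snd ?C m))) (snd (snd ?C m))"
    if m: "m \<in> fst ?C" for m :: "('e, 'e) jet"
  proof -
    obtain q P u where "m = jet_point euclidean_atlas q P u"
      using m by (rule jet_chartE[OF flat_atlas_euclidean euclidean_chart_member])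
    then show ?thesis by (simp add: ejet_coords_point)
  qed
  have form: "?\<alpha> m v = snd (v ?C) - snd (fst (snd ?C m)) \<bullet> fst (fst (v ?C))" if m: "m \<in> fst ?C" for m v
  proof -
    have "fst (fst (snd ?C m)) \<in> carrier euclidean_atlas" by (auto simp: carrier_def euclidean_atlas_def)
    from jet_form_flat[OF flat_atlas_euclidean this, of "snd (fst (snd ?C m))" "snd (snd ?C m)"]
    show ?thesis unfolding point[OF m, symmetric] charts[OF m] by simp
  qed
  \<comment> \<open>A single direction in the base is enough, and this is where positive dimension
    enters.\<close>
  obtain e :: 'e where e: "e \<in> Basis" using nonempty_Basis by blast
  have "compactin (manifold_topology ejet) (carrier L)"
    using image_compactin[OF _ cont, of "carrier L"] compact by (simp add: compact_space_def topspace_manifold[OF L])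
  then have "compact (snd ?C ` carrier L)"
    using compact_chart_image[OF smooth_atlas_ejet, of ?C] car by (simp add: ejet_eq)
  then have "bounded (snd ?C ` carrier L)" by (rule compact_imp_bounded)
  then obtain R where R: "\<And>x. x \<in> carrier L \<Longrightarrow> norm (snd ?C x) \<le> R" by (auto simp: bounded_iff)
  have R': "\<bar>fst (fst (snd ?C x)) \<bullet> e\<bar> \<le> R" "\<bar>snd (fst (snd ?C x)) \<bullet> e\<bar> \<le> R" if "x \<in> carrier L" for x
  proof -
    have "norm (fst (snd ?C x)) \<le> R" using R[OF that] norm_fst_le[of "fst (snd ?C x)" "snd (snd ?C x)"] by simp
    then have "norm (fst (fst (snd ?C x))) \<le> R" "norm (snd (fst (snd ?C x))) \<le> R"
      using norm_fst_le[of "fst (fst (snd ?C x))" "snd (fst (snd ?C x))"]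
        norm_snd_le[of "snd (fst (snd ?C x))" "fst (fst (snd ?C x))"] by auto
    then show "\<bar>fst (fst (snd ?C x)) \<bullet> e\<bar> \<le> R" "\<bar>snd (fst (snd ?C x)) \<bullet> e\<bar> \<le> R"
      using Basis_le_norm[OF e] order_trans by blast+
  qed
  \<comment> \<open>The Hamiltonian is \<open>2 * pi * \<rho>\<close> times the sum of
    \<open>\<rho> / 2\<close> and two terms of size at most \<open>R\<close>, hence the condition
    \<open>\<rho> > 4 * R\<close>.\<close>
  define \<rho> where "\<rho> = max 0 (4 * R) + 1"
  have \<rho>: "\<rho> > 0" "\<rho> > 4 * R" by (auto simp: \<rho>_def)
  define \<phi> where "\<phi> = (\<lambda>t m. chart_inv ?C (translate_jet e \<rho> t (snd ?C m)))"
  have \<phi>C: "\<phi> t m \<in> fst ?C" "snd ?C (\<phi> t m) = translate_jet e \<rho> t (snd ?C m)" for t m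
    unfolding \<phi>_def by (rule ejet_inv_in, rule ejet_coords_inv)
  have in\<phi>: "in_charts c ?C (\<phi> t) v = translate_jet e \<rho> t (in_charts c ?C (\<lambda>x. x) v)" for c t v
    by (simp add: in_charts_def \<phi>C)
  have path: "smooth_path L ejet \<phi>"
  proof (rule smooth_pathI[OF L smooth_atlas_ejet])
    fix t :: real and x assume "x \<in> carrier L"
    then obtain c where c: "c \<in> charts_at L x" by (rule carrierE)
    then have cL: "c \<in> L" "x \<in> fst c" by (auto simp: charts_at_iff)
    let ?O = "snd c ` fst c"
    have o: "open (UNIV \<times> ?O :: (real \<times> 'e) set)"
      using smooth_atlasD(2)[OF L cL(1)] by (intro open_Times) auto
    show "\<exists>c\<in>charts_at L x. \<exists>d\<in>charts_at ejet (\<phi> t x). \<exists>W G. open W \<and> (t, snd c x) \<in> W \<and> smooth_on W G \<and>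
        (\<forall>s\<in>{0..1}. \<forall>y\<in>fst c. (s, snd c y) \<in> W \<longrightarrow> \<phi> s y \<in> fst d \<and> snd d (\<phi> s y) = G (s, snd c y))"
    proof (intro bexI[OF _ c] bexI[of _ ?C] exI conjI ballI impI)
      show "smooth_on (UNIV \<times> ?O) (\<lambda>z. translate_jet e \<rho> (fst z) (in_charts c ?C (\<lambda>x. x) (snd z)))"
      proof (intro translate_jet_smooth o smooth_intros)
        show "smooth_on (UNIV \<times> ?O :: (real \<times> 'e) set) (\<lambda>z. in_charts c ?C (\<lambda>x. x) (snd z))"
          by (rule smooth_on_compose[OF sm[OF cL(1), unfolded fstc[OF cL(1)]] _ o smooth_atlasD(2)[OF L cL(1)]])
             (auto intro!: smooth_intros o)
      qed
      show "\<phi> s y \<in> fst ?C" for s y by (rule \<phi>C)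
      show "snd ?C (\<phi> s y) = translate_jet e \<rho> (fst (s, snd c y)) (in_charts c ?C (\<lambda>x. x) (snd (s, snd c y)))"
        if "y \<in> fst c" for s y
        using chart_inv_eq[OF smooth_atlasD(1)[OF L cL(1)] that] by (simp add: \<phi>C in_charts_def)
    qed (use o cL charts[OF \<phi>C(1)] in auto)
  qed
  have diff: "differential L ejet (\<phi> t) x v ?C = translate_jet_derivative e \<rho> t (differential L ejet (\<lambda>x. x) x v ?C)"
    if x: "x \<in> carrier L" for t x v
  proof -
    define c where "c = (SOME c. c \<in> charts_at L x)"
    have c: "c \<in> L" "x \<in> fst c" using some_chart_at[OF x] by (auto simp: c_def charts_at_iff)
    let ?f = "in_charts c ?C (\<lambda>x. x)"
    have "(?f has_derivative frechet_derivative ?f (at (snd c x))) (at (snd c x))"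
      using smooth_on_has_derivative[OF sm[OF c(1), unfolded fstc[OF c(1)]]] c by blast
    from has_derivative_compose[OF this translate_jet_has_derivative]
    have "(in_charts c ?C (\<phi> t) has_derivative (\<lambda>w. translate_jet_derivative e \<rho> t (frechet_derivative ?f (at (snd c x)) w))) (at (snd c x))"
      unfolding in\<phi>[abs_def] .
    then show ?thesis
      using car x charts[OF \<phi>C(1), of t x] charts[of x]
      by (auto simp: differential_def Let_def c_def[symmetric] frechet_derivative_at[symmetric])
  qed
  have outside: "differential L ejet (\<lambda>x. x) x v d = 0" if "x \<in> carrier L" "d \<noteq> ?C" for x v d
    using that car charts[of x] by (auto simp: differential_def Let_def)
  have legt: "legendrian_embedding L ejet ?\<alpha> (\<phi> t)" if t: "t \<in> {0..1}" for t
    unfolding legendrian_embedding_def legendrian_immersion_def immersion_def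
  proof (intro conjI ballI dim)
    show sm\<phi>: "smooth_map L ejet (\<phi> t)" by (rule smooth_path_imp_smooth_map[OF L smooth_atlas_ejet path t])
    fix x assume x: "x \<in> carrier L"
    show "inj_on (differential L ejet (\<phi> t) x) (tangent_space L x)"
    proof (rule inj_onI)
      fix v w assume v: "v \<in> tangent_space L x" "w \<in> tangent_space L x"
        and "differential L ejet (\<phi> t) x v = differential L ejet (\<phi> t) x w"
      then have "differential L ejet (\<lambda>x. x) x v ?C = differential L ejet (\<lambda>x. x) x w ?C"
        using diff[OF x] inj_translate_jet(2) by (metis injD)
      then have "differential L ejet (\<lambda>x. x) x v d = differential L ejet (\<lambda>x. x) x w d" for d
        using outside[OF x] by (cases "d = ?C") auto
      then have "differential L ejet (\<lambda>x. x) x v = differential L ejet (\<lambda>x. x) x w" by (rule ext)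
      then show "v = w" using imm v x unfolding immersion_def by (meson inj_onD)
    qed
    fix v assume "v \<in> tangent_space L x"
    then have "?\<alpha> x (differential L ejet (\<lambda>x. x) x v) = 0" using isotropic[OF x] by blast
    then show "?\<alpha> (\<phi> t x) (differential L ejet (\<phi> t) x v) = 0"
      unfolding form[OF \<phi>C(1)] form[OF subsetD[OF car x]] \<phi>C(2) diff[OF x]
      by (simp add: translate_jet_def translate_jet_derivative_def inner_add_left inner_commute[of e])
  next
    show "embedding_map (manifold_topology L) (manifold_topology ejet) (\<phi> t)"
    proof (rule embedding_map_compact[OF smooth_atlas_ejet compact])
      show "continuous_map (manifold_topology L) (manifold_topology ejet) (\<phi> t)"
        using smooth_path_imp_smooth_map[OF L smooth_atlas_ejet path t] by (simp add: smooth_map_def)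
      show "inj_on (\<phi> t) (topspace (manifold_topology L))"
      proof (rule inj_onI)
        fix x y assume xy: "x \<in> topspace (manifold_topology L)" "y \<in> topspace (manifold_topology L)" "\<phi> t x = \<phi> t y"
        from arg_cong[OF xy(3), of "snd ?C"] have "snd ?C x = snd ?C y"
          unfolding \<phi>C using inj_translate_jet(1) by (metis injD)
        then show "x = y"
          using xy(1,2) car inj_on_jet_chart(1)[OF flat_atlas_euclidean, of "(UNIV, \<lambda>x. x)"]
          unfolding topspace_manifold[OF L] by (auto simp: euclidean_atlas_def inj_on_def subset_eq)
      qed
    qed (use \<phi>C(1) in \<open>auto simp: ejet_eq\<close>)
  qed
  have pos: "positive_path L ejet ?\<alpha> \<phi>"
    unfolding positive_path_def
  proof (intro ballI)
    fix t :: real and x assume t: "t \<in> {0..1}" and x: "x \<in> carrier L"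
    let ?T = "2 * pi * t"
    let ?q = "fst (fst (snd ?C x)) \<bullet> e" and ?p = "snd (fst (snd ?C x)) \<bullet> e"
    have vel: "velocity ejet (\<lambda>s. \<phi> s x) t ?C = (((- (2 * pi * \<rho> * sin ?T)) *\<^sub>R e, (2 * pi * \<rho> * cos ?T) *\<^sub>R e),
      2 * pi * \<rho> * cos ?T * ?q + \<rho>\<^sup>2 / 2 * (2 * pi) * (cos ?T * cos ?T - sin ?T * sin ?T))"
      by (rule velocity_eq[OF t _ open_UNIV UNIV_I \<phi>C(2) translate_jet_velocity]) (simp add: charts[OF \<phi>C(1)])
    have ee: "e \<bullet> e = 1" using e by simp
    have S: "sin ?T * sin ?T = 1 - cos ?T * cos ?T"
      using sin_cos_squared_add[of ?T] by (simp add: power2_eq_square)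
    have "?\<alpha> (\<phi> t x) (velocity ejet (\<lambda>s. \<phi> s x) t) = 2 * pi * \<rho> * (\<rho> / 2 + cos ?T * ?q + sin ?T * ?p)"
    proof -
      \<comment> \<open>The area term: \<open>y * y - x * x\<close> from the vertical speed and
        \<open>2 * x * x\<close> from the momentum add up to \<open>1\<close>, leaving the constant
        \<open>pi * \<rho>\<^sup>2\<close>.\<close>
      have alg: "2 * pi * \<rho> * y * a + \<rho>\<^sup>2 / 2 * (2 * pi) * (y * y - x * x) - (b + \<rho> * x) * (- (2 * pi * \<rho> * x))
        = 2 * pi * \<rho> * (\<rho> / 2 + y * a + x * b)" if "x * x = 1 - y * y" for x y a b :: real
      proof -
        have "2 * pi * \<rho> * y * a + \<rho>\<^sup>2 / 2 * (2 * pi) * (y * y - x * x) - (b + \<rho> * x) * (- (2 * pi * \<rho> * x))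
          = 2 * pi * \<rho> * (\<rho> / 2 + y * a + x * b) + pi * \<rho>\<^sup>2 * (x * x - (1 - y * y))"
          by (simp add: algebra_simps power2_eq_square)
        then show ?thesis using that by simp
      qed
      have pe: "(snd (fst (snd ?C x)) + (\<rho> * sin ?T) *\<^sub>R e) \<bullet> ((- (2 * pi * \<rho> * sin ?T)) *\<^sub>R e)
        = (?p + \<rho> * sin ?T) * (- (2 * pi * \<rho> * sin ?T))"
        unfolding inner_add_left inner_scaleR_left inner_scaleR_right ee by simp
      show ?thesis
        unfolding form[OF \<phi>C(1)] vel \<phi>C(2) translate_jet_def fst_conv snd_conv pe by (rule alg[OF S])
    qed
    moreover have "\<rho> / 2 + cos ?T * ?q + sin ?T * ?p > 0"
    proof -
      have "\<bar>cos ?T * ?q\<bar> \<le> 1 * R" "\<bar>sin ?T * ?p\<bar> \<le> 1 * R"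
        unfolding abs_mult using R'[OF x] by (intro mult_mono; simp)+
      then show ?thesis using \<rho>(2) by linarith
    qed
    ultimately show "?\<alpha> (\<phi> t x) (velocity ejet (\<lambda>s. \<phi> s x) t) > 0"
      using \<rho>(1) by simp
  qed
  have id01: "\<phi> 0 x = x" "\<phi> 1 x = x" if "x \<in> carrier L" for x
    using chart_inv_eq[OF inj_on_jet_chart(1)[OF flat_atlas_euclidean euclidean_chart_member] subsetD[OF car that]]
    by (simp_all add: \<phi>_def translate_jet_periodic)
  have "closed_legendrian_path L \<phi>"
    unfolding closed_legendrian_path_def
    by (intro exI[of _ "\<lambda>x. x"] conjI diffeomorphism_id[OF L]) (simp add: id01)
  moreover have "\<phi> 0 ` carrier L = carrier L" using id01(1) by simp
  ultimately show ?thesis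
    using path legt pos by (intro exI[of _ \<phi>]) (auto simp: legendrian_embedding_path_def intro: bexI[of _ 0])
qed

section \<open>Angles and covectors in the plane\<close>

lemma vector_2_axis: "vector [a, b] = (a *\<^sub>R axis 1 1 + b *\<^sub>R axis 2 (1::real) :: real^2)" for a b :: real
  by (simp add: vec_eq_iff forall_2 axis_def)

lemma vec2_axis: "v = v $ 1 *\<^sub>R axis 1 1 + v $ 2 *\<^sub>R axis 2 (1::real)" for v :: "real^2"
  by (simp add: vec_eq_iff forall_2 axis_def)

lemma inner_2: "v \<bullet> w = v $ 1 * w $ 1 + v $ 2 * w $ 2" for v w :: "real^2"
  by (simp add: inner_vec_def sum_2)

lemma unit_vector_nth [simp]: "unit_vector \<theta> $ 1 = cos \<theta>" "unit_vector \<theta> $ 2 = sin \<theta>"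
  by (simp_all add: unit_vector_def)

lemma unit_vector_inner: "unit_vector x \<bullet> unit_vector y = cos (x - y)"
  by (simp add: inner_2 cos_diff)

lemma norm_unit_vector [simp]: "norm (unit_vector \<theta>) = 1"
  by (simp add: norm_eq_sqrt_inner unit_vector_inner)

lemma unit_vector_nonzero [simp]: "unit_vector \<theta> \<noteq> 0"
  using norm_unit_vector[of \<theta>] by (metis norm_zero zero_neq_one)

lemma unit_vector_eq_iff: "unit_vector x = unit_vector y \<longleftrightarrow> cis x = cis y"
  by (simp add: vec_eq_iff forall_2 complex_eq_iff)

lemma unit_vector_add_2pi_int: "unit_vector (x + 2 * pi * of_int k) = unit_vector x"
  by (simp add: unit_vector_eq_iff cis_add_2pi_int)

lemma unit_vector_scale_eq:
  assumes "r *\<^sub>R unit_vector x = r' *\<^sub>R unit_vector y" "r > 0" "r' > 0"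
  shows "r = r'" "cis x = cis y"
proof -
  show "r = r'" using arg_cong[OF assms(1), of norm] assms(2,3) by simp
  then show "cis x = cis y" using assms(1,2) by (simp add: unit_vector_eq_iff)
qed

lemma polarE:
  fixes P :: "real^2"
  assumes "P \<noteq> 0"
  obtains \<theta> where "P = norm P *\<^sub>R unit_vector \<theta>"
proof -
  let ?r = "norm P"
  have r: "?r > 0" using assms by simp
  have "?r\<^sup>2 = (P $ 1)\<^sup>2 + (P $ 2)\<^sup>2" by (simp only: power2_norm_eq_inner inner_2) (simp add: power2_eq_square)
  then have "(P $ 1 / ?r)\<^sup>2 + (P $ 2 / ?r)\<^sup>2 = ?r\<^sup>2 / ?r\<^sup>2"
    by (simp only: power_divide add_divide_distrib[symmetric])
  then have "(P $ 1 / ?r)\<^sup>2 + (P $ 2 / ?r)\<^sup>2 = 1" using r by simp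
  then obtain \<theta> where "P $ 1 / ?r = cos \<theta>" "P $ 2 / ?r = sin \<theta>" by (rule sincos_total_2pi)
  then have "P $ 1 = cos \<theta> * ?r" "P $ 2 = sin \<theta> * ?r"
    using r by (metis nonzero_divide_eq_eq less_irrefl)+
  then have "P = ?r *\<^sub>R unit_vector \<theta>" by (simp only: vec_eq_iff forall_2) simp
  then show ?thesis by (rule that)
qed

lemma smooth_on_unit_vector: "open S \<Longrightarrow> smooth_on S f \<Longrightarrow> smooth_on S (\<lambda>z. unit_vector (f z))"
  unfolding unit_vector_def vector_2_axis by (intro smooth_intros)

text \<open>The angle of \<open>P\<close> in the interval from \<open>a\<close> to \<open>a + 2 \<pi>\<close>, by the half-angle formula for the
  tangent; it is smooth off the ray of angle \<open>a\<close>.\<close>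

definition slit_plane :: "real \<Rightarrow> (real^2) set" where
  "slit_plane a = {P. norm P + P \<bullet> unit_vector (a + pi) > 0}"

definition angle_from :: "real \<Rightarrow> real^2 \<Rightarrow> real" where
  "angle_from a P = a + pi +
     2 * arctan ((P \<bullet> unit_vector (a + pi + pi / 2)) / (norm P + P \<bullet> unit_vector (a + pi)))"

lemma angle_from_polar:
  assumes r: "r > 0" and \<theta>: "\<theta> \<in> {a<..<a + 2 * pi}"
  shows "r *\<^sub>R unit_vector \<theta> \<in> slit_plane a" "angle_from a (r *\<^sub>R unit_vector \<theta>) = \<theta>"
proof -
  \<comment> \<open>Half the angle measured from the direction opposite to the slit. It lies
    strictly between \<open>- pi / 2\<close> and \<open>pi / 2\<close>, where \<open>arctan\<close>
    inverts \<open>tan\<close>.\<close>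
  define \<phi> where "\<phi> = (\<theta> - a - pi) / 2"
  have \<phi>: "- (pi / 2) < \<phi>" "\<phi> < pi / 2" "\<theta> = a + pi + 2 * \<phi>" using \<theta> by (auto simp: \<phi>_def field_simps)
  have c: "unit_vector \<theta> \<bullet> unit_vector (a + pi) = cos (2 * \<phi>)"
    "unit_vector \<theta> \<bullet> unit_vector (a + pi + pi / 2) = sin (2 * \<phi>)"
    unfolding unit_vector_inner \<phi>(3) by (simp, simp add: cos_diff)
  have "cos \<phi> > 0" using \<phi> by (intro cos_gt_zero_pi) auto
  then have pos: "1 + cos (2 * \<phi>) > 0" by (simp add: cos_double_cos)
  then have "r * (1 + cos (2 * \<phi>)) > 0" using r by simp
  then show "r *\<^sub>R unit_vector \<theta> \<in> slit_plane a"
    using r by (simp add: slit_plane_def c distrib_left)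
  have "angle_from a (r *\<^sub>R unit_vector \<theta>) = a + pi + 2 * arctan (r * sin (2 * \<phi>) / (r * (1 + cos (2 * \<phi>))))"
    unfolding angle_from_def inner_scaleR_left c norm_scaleR norm_unit_vector using r by (simp add: distrib_left)
  also have "r * sin (2 * \<phi>) / (r * (1 + cos (2 * \<phi>))) = tan \<phi>"
    using r by (simp add: tan_half add.commute)
  also have "arctan (tan \<phi>) = \<phi>" using \<phi> by (intro arctan_tan) auto
  finally show "angle_from a (r *\<^sub>R unit_vector \<theta>) = \<theta>" using \<phi>(3) by simp
qed

lemma slit_planeE:
  assumes "P \<in> slit_plane a"
  obtains \<theta> where "\<theta> \<in> {a<..<a + 2 * pi}" "P = norm P *\<^sub>R unit_vector \<theta>" "norm P > 0"
proof -
  have P: "P \<noteq> 0" using assms by (auto simp: slit_plane_def)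
  then obtain t where t: "P = norm P *\<^sub>R unit_vector t" by (rule polarE)
  obtain k :: int where k: "t + 2 * pi * of_int k \<in> {a..<a + 2 * pi}" by (rule cis_shift_into)
  let ?\<theta> = "t + 2 * pi * of_int k"
  have t': "P = norm P *\<^sub>R unit_vector ?\<theta>" using t by (simp add: unit_vector_add_2pi_int)
  have "?\<theta> \<noteq> a"
  proof
    assume "?\<theta> = a"
    then have "P \<bullet> unit_vector (a + pi) = norm P * (unit_vector a \<bullet> unit_vector (a + pi))"
      using t' by (metis inner_scaleR_left)
    then have "norm P + P \<bullet> unit_vector (a + pi) = 0" by (simp add: unit_vector_inner)
    then show False using assms by (simp add: slit_plane_def)
  qed
  then show ?thesis using that[of ?\<theta>] k t' P by auto
qed

lemma open_slit_plane: "open (slit_plane a)"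
  unfolding slit_plane_def by (intro open_Collect_less continuous_intros)

lemma smooth_on_norm:
  fixes f :: "'a::real_normed_vector \<Rightarrow> 'b::real_inner"
  assumes "open S" "smooth_on S f" "\<And>x. x \<in> S \<Longrightarrow> f x \<noteq> 0"
  shows "smooth_on S (\<lambda>x. norm (f x))"
  unfolding norm_eq_sqrt_inner using assms by (intro smooth_on_sqrt smooth_on_inner) auto

lemma smooth_on_angle_from:
  assumes "open S" "smooth_on S f" "f ` S \<subseteq> slit_plane a"
  shows "smooth_on S (\<lambda>z. angle_from a (f z))"
proof -
  have "norm (f x) + f x \<bullet> unit_vector (a + pi) > 0" if "x \<in> S" for x
    using assms(3) that by (auto simp: slit_plane_def)
  then have "norm (f x) + f x \<bullet> unit_vector (a + pi) \<noteq> 0" "f x \<noteq> 0" if "x \<in> S" for x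
    using that by force+
  then show ?thesis
    unfolding angle_from_def
    by (intro smooth_on_add smooth_on_const smooth_on_mult smooth_on_arctan smooth_on_divide smooth_on_inner
        smooth_on_norm assms)
qed

section \<open>Linear maps of the plane and their inverse transposes\<close>

definition det2 :: "real^2 \<Rightarrow> real^2 \<Rightarrow> real" where
  "det2 m n = m $ 1 * n $ 2 - m $ 2 * n $ 1"

text \<open>The inverse transpose of the matrix with columns \<open>m\<close> and \<open>n\<close>, applied to \<open>v\<close>.\<close>

definition cotransform :: "real^2 \<Rightarrow> real^2 \<Rightarrow> real^2 \<Rightarrow> real^2" where
  "cotransform m n v = vector [(v $ 1 * n $ 2 - v $ 2 * m $ 2) / det2 m n, (v $ 2 * m $ 1 - v $ 1 * n $ 1) / det2 m n]"

lemma linear_axis: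
  fixes M :: "real^2 \<Rightarrow> real^2"
  assumes "linear M"
  shows "M w = w $ 1 *\<^sub>R M (axis 1 1) + w $ 2 *\<^sub>R M (axis 2 1)"
  by (subst vec2_axis[of w]) (simp only: linear_add[OF assms] linear_scale[OF assms])

lemma det2_nonzero:
  fixes M :: "real^2 \<Rightarrow> real^2"
  assumes M: "linear M" and "inj M"
  shows "det2 (M (axis 1 1)) (M (axis 2 1)) \<noteq> 0"
proof
  let ?m = "M (axis 1 1)" and ?n = "M (axis 2 1)"
  assume 0: "det2 ?m ?n = 0"
  have inj0: "w = 0" if "M w = 0" for w
    using that assms linear_injective_0 by blast
  \<comment> \<open>The columns of the adjugate matrix are mapped to \<open>0\<close> when the
    determinant vanishes. By injectivity they are \<open>0\<close> themselves, which makes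
    \<open>?m\<close> vanish.\<close>
  have "M (vector [?n $ 1, - ?m $ 1]) = 0" "M (vector [?n $ 2, - ?m $ 2]) = 0"
    unfolding linear_axis[OF M, of "vector [_, _]"] using 0
    by (simp_all add: vec_eq_iff forall_2 det2_def algebra_simps)
  then have "(vector [?n $ 1, - ?m $ 1] :: real^2) = 0" "(vector [?n $ 2, - ?m $ 2] :: real^2) = 0"
    using inj0 by blast+
  then have "?m = 0" by (simp add: vec_eq_iff forall_2)
  then have "axis 1 (1::real) = (0 :: real^2)" by (rule inj0)
  then show False by (simp add: axis_eq_0_iff)
qed

lemma cotransform_inner:
  fixes M :: "real^2 \<Rightarrow> real^2"
  assumes "linear M" "inj M"
  shows "cotransform (M (axis 1 1)) (M (axis 2 1)) v \<bullet> M w = v \<bullet> w"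
proof -
  let ?m = "M (axis 1 1)" and ?n = "M (axis 2 1)"
  have d: "det2 ?m ?n \<noteq> 0" by (rule det2_nonzero[OF assms])
  have "cotransform ?m ?n v \<bullet> ?m = v $ 1" "cotransform ?m ?n v \<bullet> ?n = v $ 2"
    using d by (simp_all add: cotransform_def inner_2 divide_simps) (simp_all add: det2_def algebra_simps)
  moreover have "cotransform ?m ?n v \<bullet> M w = w $ 1 * (cotransform ?m ?n v \<bullet> ?m) + w $ 2 * (cotransform ?m ?n v \<bullet> ?n)"
    by (subst linear_axis[OF assms(1), of w]) (simp only: inner_add_right inner_scaleR_right)
  ultimately show ?thesis by (simp only: inner_2[of v w]) simp
qed

lemma linear_inj_surj:
  fixes M :: "'e::euclidean_space \<Rightarrow> 'e"
  assumes "linear M" "inj M" obtains w where "u = M w"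
  using linear_injective_imp_surjective[OF assms] by (meson surjD)

lemma smooth_on_cotransform:
  assumes "open S" "smooth_on S m" "smooth_on S n" "smooth_on S v" "\<And>z. z \<in> S \<Longrightarrow> det2 (m z) (n z) \<noteq> 0"
  shows "smooth_on S (\<lambda>z. cotransform (m z) (n z) (v z))"
  using assms(5) unfolding cotransform_def vector_2_axis det2_def
  by (intro smooth_on_add smooth_on_scaleR smooth_on_divide smooth_on_diff smooth_on_mult smooth_on_nth smooth_on_const assms(1-4))

section \<open>Local parametrizations of a surface\<close>

text \<open>Local diffeomorphisms; both the inverse of a chart and an immersed plane are examples.\<close>

definition local_param :: "('a, real^2) atlas \<Rightarrow> (real^2 \<Rightarrow> 'a) \<Rightarrow> real^2 \<Rightarrow> bool" where
  "local_param N \<Psi> a \<longleftrightarrow> (\<exists>c\<in>charts_at N (\<Psi> a). \<exists>W. open W \<and> a \<in> W \<and> \<Psi> ` W \<subseteq> fst c \<and>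
     smooth_on W (\<lambda>x. snd c (\<Psi> x)) \<and> inj (frechet_derivative (\<lambda>x. snd c (\<Psi> x)) (at a)))"

abbreviation param_derivative :: "('a, real^2) chart \<Rightarrow> (real^2 \<Rightarrow> 'a) \<Rightarrow> real^2 \<Rightarrow> real^2 \<Rightarrow> real^2" where
  "param_derivative c \<Psi> a \<equiv> frechet_derivative (\<lambda>x. snd c (\<Psi> x)) (at a)"

lemma transition_has_derivative:
  assumes "smooth_atlas N" "c \<in> charts_at N q" "d \<in> charts_at N q"
  shows "(transition c d has_derivative frechet_derivative (transition c d) (at (snd c q))) (at (snd c q))"
  using assms by (intro smooth_on_has_derivative[OF smooth_atlasD(4)]) (auto simp: charts_at_iff)

lemma inj_transition_derivative:
  assumes N: "smooth_atlas N" and c: "c \<in> charts_at N q" and d: "d \<in> charts_at N q"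
  shows "inj (frechet_derivative (transition c d) (at (snd c q)))"
proof -
  have cN: "c \<in> N" "q \<in> fst c" "d \<in> N" "q \<in> fst d" using c d by (auto simp: charts_at_iff)
  have q: "transition c d (snd c q) = snd d q" by (rule transition_chart[OF smooth_atlasD(1)[OF N cN(1)] cN(2)])
  let ?D = "frechet_derivative (transition c d) (at (snd c q))" and ?E = "frechet_derivative (transition d c) (at (snd d q))"
  have "((\<lambda>x. transition d c (transition c d x)) has_derivative (\<lambda>w. ?E (?D w))) (at (snd c q))"
    by (rule has_derivative_compose[OF transition_has_derivative[OF N c d]])
       (simp add: q transition_has_derivative[OF N d c])
  moreover have "((\<lambda>x. transition d c (transition c d x)) has_derivative (\<lambda>w. w)) (at (snd c q))"
  proof (rule has_derivative_transform_within_open[OF has_derivative_ident])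
    show "open (snd c ` (fst c \<inter> fst d))" by (rule smooth_atlasD(3)[OF N cN(1,3)])
    show "snd c q \<in> snd c ` (fst c \<inter> fst d)" using cN by auto
    show "x = transition d c (transition c d x)" if "x \<in> snd c ` (fst c \<inter> fst d)" for x
      using that by (auto simp: transition_chart[OF smooth_atlasD(1)[OF N cN(1)]] transition_chart[OF smooth_atlasD(1)[OF N cN(3)]])
  qed
  ultimately have "(\<lambda>w. ?E (?D w)) = (\<lambda>w. w)" by (rule has_derivative_unique)
  then show ?thesis by (metis injI)
qed

text \<open>\<open>local_param\<close> provides one chart. Composing with a transition map, whose
  derivative is injective, gives the same in every chart around the point.\<close>

lemma local_paramE:
  assumes N: "smooth_atlas N" and l: "local_param N \<Psi> a" and d: "d \<in> charts_at N (\<Psi> a)"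
  obtains W where "open W" "a \<in> W" "\<Psi> ` W \<subseteq> fst d" "smooth_on W (\<lambda>x. snd d (\<Psi> x))" "inj (param_derivative d \<Psi> a)"
proof -
  obtain c W where c: "c \<in> charts_at N (\<Psi> a)" and W: "open W" "a \<in> W" "\<Psi> ` W \<subseteq> fst c"
    "smooth_on W (\<lambda>x. snd c (\<Psi> x))" and i: "inj (param_derivative c \<Psi> a)"
    using l unfolding local_param_def by blast
  have cN: "c \<in> N" "\<Psi> a \<in> fst c" "d \<in> N" "\<Psi> a \<in> fst d" using c d by (auto simp: charts_at_iff)
  let ?O = "snd c ` (fst c \<inter> fst d)"
  have oO: "open ?O" by (rule smooth_atlasD(3)[OF N cN(1,3)])
  define V where "V = W \<inter> (\<lambda>x. snd c (\<Psi> x)) -` ?O"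
  have oV: "open V"
    unfolding V_def by (rule continuous_open_preimage[OF smooth_on_continuous[OF W(4)] W(1) oO])
  have aV: "a \<in> V" using W(2) cN by (auto simp: V_def)
  have \<Psi>V: "\<Psi> x \<in> fst c \<inter> fst d" if x: "x \<in> V" for x
  proof -
    have "\<Psi> x \<in> fst c" using x W(3) by (auto simp: V_def)
    moreover obtain y where "y \<in> fst c \<inter> fst d" "snd c (\<Psi> x) = snd c y" using x unfolding V_def by blast
    ultimately show ?thesis using inj_onD[OF smooth_atlasD(1)[OF N cN(1)]] by (metis Int_iff)
  qed
  have eq: "snd d (\<Psi> x) = transition c d (snd c (\<Psi> x))" if "x \<in> V" for x
    using transition_chart[OF smooth_atlasD(1)[OF N cN(1)]] \<Psi>V[OF that] by simp
  have "smooth_on V (\<lambda>x. transition c d (snd c (\<Psi> x)))"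
    by (rule smooth_on_compose[OF smooth_atlasD(4)[OF N cN(1,3)] smooth_on_subset[OF W(4)] oV oO]) (auto simp: V_def)
  then have s: "smooth_on V (\<lambda>x. snd d (\<Psi> x))" by (rule smooth_on_transform[OF oV]) (rule eq)
  have "((\<lambda>x. transition c d (snd c (\<Psi> x))) has_derivative
      (\<lambda>w. frechet_derivative (transition c d) (at (snd c (\<Psi> a))) (param_derivative c \<Psi> a w))) (at a)"
    by (rule has_derivative_compose[OF smooth_on_has_derivative[OF W(4,2)] transition_has_derivative[OF N c d]])
  then have "((\<lambda>x. snd d (\<Psi> x)) has_derivative
      (\<lambda>w. frechet_derivative (transition c d) (at (snd c (\<Psi> a))) (param_derivative c \<Psi> a w))) (at a)"
    by (rule has_derivative_transform_within_open[OF _ oV aV]) (simp add: eq)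
  then have "param_derivative d \<Psi> a = (\<lambda>w. frechet_derivative (transition c d) (at (snd c (\<Psi> a))) (param_derivative c \<Psi> a w))"
    by (rule frechet_derivative_at[symmetric])
  then have "inj (param_derivative d \<Psi> a)"
    using inj_compose[OF inj_transition_derivative[OF N c d] i] by (simp add: o_def)
  then show ?thesis using that[OF oV aV _ s] \<Psi>V by blast
qed

lemma param_derivative_transition:
  assumes N: "smooth_atlas N" and l: "local_param N \<Psi> a" and c: "c \<in> charts_at N (\<Psi> a)" and d: "d \<in> charts_at N (\<Psi> a)"
  shows "param_derivative d \<Psi> a w = frechet_derivative (transition c d) (at (snd c (\<Psi> a))) (param_derivative c \<Psi> a w)"
proof -
  obtain W where W: "open W" "a \<in> W" "\<Psi> ` W \<subseteq> fst c" "smooth_on W (\<lambda>x. snd c (\<Psi> x))"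
    using local_paramE[OF N l c] by metis
  obtain V where V: "open V" "a \<in> V" "\<Psi> ` V \<subseteq> fst d" using local_paramE[OF N l d] by metis
  have "((\<lambda>x. transition c d (snd c (\<Psi> x))) has_derivative
      (\<lambda>w. frechet_derivative (transition c d) (at (snd c (\<Psi> a))) (param_derivative c \<Psi> a w))) (at a)"
    by (rule has_derivative_compose[OF smooth_on_has_derivative[OF W(4,2)] transition_has_derivative[OF N c d]])
  then have "((\<lambda>x. snd d (\<Psi> x)) has_derivative
      (\<lambda>w. frechet_derivative (transition c d) (at (snd c (\<Psi> a))) (param_derivative c \<Psi> a w))) (at a)"
  proof (rule has_derivative_transform_within_open[OF _ W(1,2)])
    fix x assume "x \<in> W"
    then have "\<Psi> x \<in> fst c" using W(3) by blast
    then show "transition c d (snd c (\<Psi> x)) = snd d (\<Psi> x)"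
      using transition_chart[OF smooth_atlasD(1)[OF N]] c unfolding charts_at_iff by blast
  qed
  from frechet_derivative_at[OF this] show ?thesis by metis
qed

lemma param_has_derivative:
  assumes "smooth_atlas N" "local_param N \<Psi> a" "c \<in> charts_at N (\<Psi> a)"
  shows "((\<lambda>x. snd c (\<Psi> x)) has_derivative param_derivative c \<Psi> a) (at a)"
  using local_paramE[OF assms] smooth_on_has_derivative by metis

lemma param_derivative_props:
  assumes "smooth_atlas N" "local_param N \<Psi> a" "c \<in> charts_at N (\<Psi> a)"
  shows "linear (param_derivative c \<Psi> a)" "inj (param_derivative c \<Psi> a)"
  using local_paramE[OF assms] has_derivative_linear[OF param_has_derivative[OF assms]] by blast+

lemma chart_inv_param_derivative:
  assumes N: "smooth_atlas N" and c: "c \<in> N" and x: "x \<in> snd c ` fst c"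
  shows "param_derivative c (chart_inv c) x = (\<lambda>w. w)"
proof -
  have "((\<lambda>x. snd c (chart_inv c x)) has_derivative (\<lambda>w. w)) (at x)"
    by (rule has_derivative_transform_within_open[OF has_derivative_ident smooth_atlasD(2)[OF N c] x])
       (simp add: chart_chart_inv)
  then show ?thesis by (rule frechet_derivative_at[symmetric])
qed

lemma local_param_chart_inv:
  assumes N: "smooth_atlas N" and c: "c \<in> N" and x: "x \<in> snd c ` fst c"
  shows "local_param N (chart_inv c) x"
  unfolding local_param_def
proof (intro bexI[of _ c] exI[of _ "snd c ` fst c"] conjI)
  have o: "open (snd c ` fst c)" by (rule smooth_atlasD(2)[OF N c])
  then show "open (snd c ` fst c)" .
  show "x \<in> snd c ` fst c" by fact
  show "chart_inv c ` (snd c ` fst c) \<subseteq> fst c" by (rule image_subsetI) (rule chart_inv_in)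
  show "smooth_on (snd c ` fst c) (\<lambda>x. snd c (chart_inv c x))"
    by (rule smooth_on_transform[OF o smooth_on_id[OF o]]) (rule chart_chart_inv)
  show "inj (param_derivative c (chart_inv c) x)"
    unfolding chart_inv_param_derivative[OF N c x] by (simp add: inj_def)
  show "c \<in> charts_at N (chart_inv c x)" using chart_inv_in[OF x] c by (simp add: charts_at_iff)
qed

section \<open>Cotangent lifts of local parametrizations\<close>

definition push_covector :: "('a, real^2) atlas \<Rightarrow> (real^2 \<Rightarrow> 'a) \<Rightarrow> real^2 \<Rightarrow> real^2 \<Rightarrow> ('a, real^2) covector" where
  "push_covector N \<Psi> a v = (\<lambda>c. if c \<in> charts_at N (\<Psi> a)
     then cotransform (param_derivative c \<Psi> a (axis 1 1)) (param_derivative c \<Psi> a (axis 2 1)) v else 0)"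

text \<open>This identity characterizes the pushed covector. It makes the contact condition and its
  sign in the surface equal to those in the plane.\<close>

lemma push_covector_inner:
  assumes "smooth_atlas N" "local_param N \<Psi> a" "c \<in> charts_at N (\<Psi> a)"
  shows "push_covector N \<Psi> a v c \<bullet> param_derivative c \<Psi> a w = v \<bullet> w"
  using cotransform_inner[OF param_derivative_props[OF assms]] assms(3) by (simp add: push_covector_def)

lemma push_covector_in:
  assumes N: "smooth_atlas N" and l: "local_param N \<Psi> a"
  shows "push_covector N \<Psi> a v \<in> cotangent_space N (\<Psi> a)"
  unfolding cotangent_space_def
proof (intro CollectI conjI ballI allI impI)
  fix c d w assume c: "c \<in> charts_at N (\<Psi> a)" and d: "d \<in> charts_at N (\<Psi> a)"
  obtain w' where w: "w = param_derivative c \<Psi> a w'" using linear_inj_surj[OF param_derivative_props[OF N l c]] by metis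
  show "push_covector N \<Psi> a v c \<bullet> w = push_covector N \<Psi> a v d \<bullet> frechet_derivative (transition c d) (at (snd c (\<Psi> a))) w"
    unfolding w param_derivative_transition[OF N l c d, symmetric]
    using push_covector_inner[OF N l c] push_covector_inner[OF N l d] by simp
qed (simp add: push_covector_def)

lemma cotangentD:
  assumes "p \<in> cotangent_space A q" "c \<in> charts_at A q" "d \<in> charts_at A q"
  shows "p c \<bullet> w = p d \<bullet> frechet_derivative (transition c d) (at (snd c q)) w"
  using assms unfolding cotangent_space_def by blast

lemma cotangent_eqI:
  assumes N: "smooth_atlas N" and p: "p \<in> cotangent_space N q" and p': "p' \<in> cotangent_space N q"
    and c: "c \<in> charts_at N q" and "p c = p' c"
  shows "p = (p' :: ('a, real^2) covector)"
proof
  fix d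
  show "p d = p' d"
  proof (cases "d \<in> charts_at N q")
    case True
    let ?D = "frechet_derivative (transition c d) (at (snd c q))"
    have "p d \<bullet> u = p' d \<bullet> u" for u
    proof -
      obtain w where "u = ?D w"
        using linear_inj_surj[OF has_derivative_linear[OF transition_has_derivative[OF N c True]]
            inj_transition_derivative[OF N c True]] by metis
      then show ?thesis using cotangentD[OF p c True, of w] cotangentD[OF p' c True, of w] assms(5) by simp
    qed
    then show ?thesis by (metis vector_eq_rdot)
  next
    case False
    have "p d = 0" "p' d = 0" using p p' False unfolding cotangent_space_def by blast+
    then show ?thesis by simp
  qed
qed

lemma scale_covector_in:
  assumes "p \<in> cotangent_space N q"
  shows "(\<lambda>c. s *\<^sub>R p c) \<in> cotangent_space N q"
  unfolding cotangent_space_def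
proof (intro CollectI conjI ballI allI impI)
  show "(s *\<^sub>R p c) \<bullet> w = (s *\<^sub>R p d) \<bullet> frechet_derivative (transition c d) (at (snd c q)) w"
    if "c \<in> charts_at N q" "d \<in> charts_at N q" for c d w
    using cotangentD[OF assms that, of w] by simp
  show "s *\<^sub>R p c = 0" if "c \<notin> charts_at N q" for c
  proof -
    have "p c = 0" using assms that unfolding cotangent_space_def by blast
    then show ?thesis by simp
  qed
qed

lemma covector_pulled_back:
  assumes N: "smooth_atlas N" and l: "local_param N \<Psi> a" and p: "p \<in> cotangent_space N (\<Psi> a)"
  obtains v where "p = push_covector N \<Psi> a v"
proof -
  obtain c where c: "c \<in> charts_at N (\<Psi> a)" using l unfolding local_param_def by blast
  let ?M = "param_derivative c \<Psi> a"
  let ?v = "vector [p c \<bullet> ?M (axis 1 1), p c \<bullet> ?M (axis 2 1)] :: real^2"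
  have "push_covector N \<Psi> a ?v c \<bullet> u = p c \<bullet> u" for u
  proof -
    obtain w where u: "u = ?M w" using linear_inj_surj[OF param_derivative_props[OF N l c]] by metis
    have "p c \<bullet> ?M w = ?v \<bullet> w"
      by (subst linear_axis[OF param_derivative_props(1)[OF N l c], of w])
         (simp add: inner_2[of ?v] inner_add_right algebra_simps)
    then show ?thesis unfolding u push_covector_inner[OF N l c] by simp
  qed
  then have "p c = push_covector N \<Psi> a ?v c" by (metis vector_eq_rdot)
  then have "p = push_covector N \<Psi> a ?v" by (rule cotangent_eqI[OF N p push_covector_in[OF N l] c])
  then show ?thesis by (rule that)
qed

text \<open>With the inverse of a chart as parametrization, a pushed covector has prescribed
  components in this chart and smoothly varying components in the others. The transition maps of the
  spherization are obtained in this way.\<close>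

lemma push_covector_chart_inv:
  assumes N: "smooth_atlas N" and c: "c \<in> N" and x: "x \<in> snd c ` fst c"
  shows "push_covector N (chart_inv c) x v c = v"
proof -
  have c': "c \<in> charts_at N (chart_inv c x)" using chart_inv_in[OF x] c by (simp add: charts_at_iff)
  have "push_covector N (chart_inv c) x v c \<bullet> w = v \<bullet> w" for w
    using push_covector_inner[OF N local_param_chart_inv[OF N c x] c', of v w]
    unfolding chart_inv_param_derivative[OF N c x] .
  then show ?thesis by (metis vector_eq_rdot)
qed

lemma push_covector_scale:
  "push_covector N \<Psi> a (s *\<^sub>R v) = (\<lambda>c. s *\<^sub>R push_covector N \<Psi> a v c)"
  by (auto simp: push_covector_def cotransform_def vec_eq_iff forall_2 algebra_simps diff_divide_distrib)

lemma push_covector_nonzero: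
  assumes "smooth_atlas N" "local_param N \<Psi> a" "c \<in> charts_at N (\<Psi> a)" "v \<noteq> 0"
  shows "push_covector N \<Psi> a v c \<noteq> 0"
  using push_covector_inner[OF assms(1-3), of v v] assms(4) by auto

lemma smooth_on_push:
  assumes N: "smooth_atlas N" and c: "c \<in> N" and W: "open W" "\<Psi> ` W \<subseteq> fst c" "smooth_on W (\<lambda>x. snd c (\<Psi> x))"
    and l: "\<And>x. x \<in> W \<Longrightarrow> local_param N \<Psi> x"
    and S: "open S" "smooth_on S A" "A ` S \<subseteq> W" "smooth_on S v"
  shows "smooth_on S (\<lambda>z. push_covector N \<Psi> (A z) (v z) c)"
proof -
  have c': "c \<in> charts_at N (\<Psi> (A z))" if "z \<in> S" for z using that S(3) W(2) c by (auto simp: charts_at_iff)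
  have "smooth_on S (\<lambda>z. cotransform (param_derivative c \<Psi> (A z) (axis 1 1)) (param_derivative c \<Psi> (A z) (axis 2 1)) (v z))"
  proof -
    have D: "smooth_on S (\<lambda>z. param_derivative c \<Psi> (A z) u)" for u
      by (rule smooth_on_compose[OF smooth_on_derivative[OF W(3)] S(2) S(1) W(1) S(3)])
    show ?thesis
    proof (rule smooth_on_cotransform[OF S(1) D D S(4)])
    show "det2 (param_derivative c \<Psi> (A z) (axis 1 1)) (param_derivative c \<Psi> (A z) (axis 2 1)) \<noteq> 0" if "z \<in> S" for z
      using param_derivative_props[OF N l c'[OF that]] S(3) that by (intro det2_nonzero) auto
    qed
  qed
  then show ?thesis by (rule smooth_on_transform[OF S(1)]) (simp add: push_covector_def c')
qed

section \<open>The atlas of the spherization\<close>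

lemma ray_scale: "s > 0 \<Longrightarrow> ray (\<lambda>c. s *\<^sub>R p c) = ray p"
proof (intro equalityI subsetI)
  fix x assume "s > 0" "x \<in> ray p"
  then obtain r where "r > 0" "x = (\<lambda>c. r *\<^sub>R p c)" by (auto simp: ray_def)
  then show "x \<in> ray (\<lambda>c. s *\<^sub>R p c)"
    using \<open>s > 0\<close> by (auto simp: ray_def intro!: exI[of _ "r / s"])
next
  fix x assume "s > 0" "x \<in> ray (\<lambda>c. s *\<^sub>R p c)"
  then obtain r where "r > 0" "x = (\<lambda>c. r *\<^sub>R s *\<^sub>R p c)" by (auto simp: ray_def)
  then show "x \<in> ray p" using \<open>s > 0\<close> by (auto simp: ray_def intro!: exI[of _ "r * s"])
qed

lemma ray_self: "p \<in> ray p"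
  by (auto simp: ray_def intro!: exI[of _ 1])

lemma spherization_chart_polar:
  assumes c: "c \<in> charts_at N q" and p: "p \<in> cotangent_space N q" and pc: "p c = r *\<^sub>R unit_vector \<theta>" "r > 0"
    and \<theta>: "\<theta> \<in> {a<..<a + 2 * pi}"
  shows "(q, ray p) \<in> fst (spherization_chart N c a)" "snd (spherization_chart N c a) (q, ray p) = (snd c q, \<theta>)"
proof -
  let ?I = "{a<..<a + 2 * pi}"
  have "p \<noteq> (\<lambda>c. 0)"
  proof
    assume "p = (\<lambda>c. 0)"
    then show False using pc by simp
  qed
  then have "(q, ray p) \<in> spherization N"
    using charts_at_carrier[OF c] p unfolding spherization_def by blast
  moreover have rep: "\<exists>p'\<in>ray p. p' c = unit_vector \<theta>"
    using pc by (intro bexI[of _ "\<lambda>c. (1 / r) *\<^sub>R p c"]) (auto simp: ray_def intro!: exI[of _ "1 / r"])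
  ultimately show "(q, ray p) \<in> fst (spherization_chart N c a)"
    using c \<theta> by (auto simp: spherization_chart_def charts_at_iff)
  have "(THE \<theta>. \<theta> \<in> ?I \<and> (\<exists>p'\<in>ray p. p' c = unit_vector \<theta>)) = \<theta>"
  proof (rule the_equality)
    show "\<theta> \<in> ?I \<and> (\<exists>p'\<in>ray p. p' c = unit_vector \<theta>)" using \<theta> rep by blast
    fix \<theta>' assume "\<theta>' \<in> ?I \<and> (\<exists>p'\<in>ray p. p' c = unit_vector \<theta>')"
    then obtain s where s: "s > 0" "s *\<^sub>R p c = unit_vector \<theta>'" "\<theta>' \<in> ?I" by (auto simp: ray_def)
    then have "(s * r) *\<^sub>R unit_vector \<theta> = 1 *\<^sub>R unit_vector \<theta>'" using pc by simp
    then have "cis \<theta> = cis \<theta>'" using s(1) pc(2) unit_vector_scale_eq(2)[of "s * r" \<theta> 1 \<theta>'] by simp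
    then show "\<theta>' = \<theta>" using inj_on_cis s(3) \<theta> by (metis inj_onD)
  qed
  then show "snd (spherization_chart N c a) (q, ray p) = (snd c q, \<theta>)"
    by (simp add: spherization_chart_def)
qed

lemma spherization_chartE:
  assumes c: "c \<in> N" and z: "z \<in> fst (spherization_chart N c a)"
  obtains q p \<theta> where "z = (q, ray p)" "c \<in> charts_at N q" "p \<in> cotangent_space N q" "\<theta> \<in> {a<..<a + 2 * pi}"
    "p c = unit_vector \<theta>" "snd (spherization_chart N c a) z = (snd c q, \<theta>)"
proof -
  obtain q P \<theta> p where z1: "z = (q, P)" "(q, P) \<in> spherization N" "q \<in> fst c" "\<theta> \<in> {a<..<a + 2 * pi}" "p \<in> P" "p c = unit_vector \<theta>"
    using z by (auto simp: spherization_chart_def)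
  from z1(2) obtain p0 where p0: "P = ray p0" "p0 \<in> cotangent_space N q" by (auto simp: spherization_def)
  then obtain s where s: "s > 0" "p = (\<lambda>c. s *\<^sub>R p0 c)" using z1(5) by (auto simp: ray_def)
  have P: "P = ray p" unfolding p0(1) s(2) ray_scale[OF s(1)] ..
  have c': "c \<in> charts_at N q" using c z1(3) by (simp add: charts_at_iff)
  have p: "p \<in> cotangent_space N q" unfolding s(2) by (rule scale_covector_in[OF p0(2)])
  have "snd (spherization_chart N c a) (q, ray p) = (snd c q, \<theta>)"
    by (rule spherization_chart_polar(2)[OF c' p, of 1]) (use z1 in auto)
  then show ?thesis using that[of q p \<theta>] z1 P c' p by simp
qed

text \<open>Replaces the existential and the definite description in
  \<open>spherization_chart\<close> by the explicit smooth function \<open>angle_from\<close>,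
  applied to any representative of the ray.\<close>

lemma spherization_chart_slit:
  assumes c: "c \<in> charts_at N q" and p: "p \<in> cotangent_space N q"
  shows "(q, ray p) \<in> fst (spherization_chart N c a) \<longleftrightarrow> p c \<in> slit_plane a"
    and "p c \<in> slit_plane a \<Longrightarrow> snd (spherization_chart N c a) (q, ray p) = (snd c q, angle_from a (p c))"
proof -
  have *: "(q, ray p) \<in> fst (spherization_chart N c a) \<and> snd (spherization_chart N c a) (q, ray p) = (snd c q, angle_from a (p c))"
    if pc: "p c \<in> slit_plane a"
  proof -
    obtain \<theta> where \<theta>: "\<theta> \<in> {a<..<a + 2 * pi}" "p c = norm (p c) *\<^sub>R unit_vector \<theta>" "norm (p c) > 0"
      using pc by (rule slit_planeE)
    then have "angle_from a (p c) = \<theta>" using angle_from_polar(2)[OF \<theta>(3,1)] by metis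
    then show ?thesis using spherization_chart_polar[OF c p \<theta>(2,3,1)] by simp
  qed
  show "p c \<in> slit_plane a \<Longrightarrow> snd (spherization_chart N c a) (q, ray p) = (snd c q, angle_from a (p c))"
    using * by blast
  have "p c \<in> slit_plane a" if z: "(q, ray p) \<in> fst (spherization_chart N c a)"
  proof -
    obtain q' p' \<theta> where e: "(q, ray p) = (q', ray p')" "\<theta> \<in> {a<..<a + 2 * pi}" "p' c = unit_vector \<theta>"
      using spherization_chartE[OF conjunct1[OF c[unfolded charts_at_iff]] z] by metis
    then have "p \<in> ray p'" using ray_self[of p] by simp
    then obtain s where "s > 0" "p c = s *\<^sub>R unit_vector \<theta>" using e(3) by (auto simp: ray_def)
    then show ?thesis using angle_from_polar(1)[OF _ e(2)] by simp
  qed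
  then show "(q, ray p) \<in> fst (spherization_chart N c a) \<longleftrightarrow> p c \<in> slit_plane a" using * by blast
qed

lemma inj_on_spherization_chart:
  assumes N: "smooth_atlas N" and c: "c \<in> N"
  shows "inj_on (snd (spherization_chart N c a)) (fst (spherization_chart N c a))"
proof (rule inj_onI)
  fix z w assume z: "z \<in> fst (spherization_chart N c a)" and w: "w \<in> fst (spherization_chart N c a)"
    and eq: "snd (spherization_chart N c a) z = snd (spherization_chart N c a) w"
  obtain q p \<theta> where z1: "z = (q, ray p)" "c \<in> charts_at N q" "p \<in> cotangent_space N q" "p c = unit_vector \<theta>"
    "snd (spherization_chart N c a) z = (snd c q, \<theta>)" using spherization_chartE[OF c z] by metis
  obtain q' p' \<theta>' where w1: "w = (q', ray p')" "c \<in> charts_at N q'" "p' \<in> cotangent_space N q'" "p' c = unit_vector \<theta>'"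
    "snd (spherization_chart N c a) w = (snd c q', \<theta>')" using spherization_chartE[OF c w] by metis
  have "q = q'" using eq z1(2,5) w1(2,5) inj_onD[OF smooth_atlasD(1)[OF N c]] by (simp add: charts_at_iff)
  moreover have "p = p'"
    by (rule cotangent_eqI[OF N z1(3) _ z1(2)]) (use w1 z1 eq \<open>q = q'\<close> in auto)
  ultimately show "z = w" using z1 w1 by simp
qed

lemma spherization_chart_inv:
  assumes N: "smooth_atlas N" and c: "c \<in> N" and x: "x \<in> snd c ` fst c" and \<theta>: "\<theta> \<in> {a<..<a + 2 * pi}"
  defines "z \<equiv> (chart_inv c x, ray (push_covector N (chart_inv c) x (unit_vector \<theta>)))"
  shows "z \<in> fst (spherization_chart N c a)" "snd (spherization_chart N c a) z = (x, \<theta>)"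
    "chart_inv (spherization_chart N c a) (x, \<theta>) = z"
proof -
  have c': "c \<in> charts_at N (chart_inv c x)" using chart_inv_in[OF x] c by (simp add: charts_at_iff)
  have 1: "push_covector N (chart_inv c) x (unit_vector \<theta>) c = 1 *\<^sub>R unit_vector \<theta>"
    using push_covector_chart_inv[OF N c x] by simp
  note s = spherization_chart_polar[OF c' push_covector_in[OF N local_param_chart_inv[OF N c x]] 1 zero_less_one \<theta>]
  show z: "z \<in> fst (spherization_chart N c a)" "snd (spherization_chart N c a) z = (x, \<theta>)"
    using s chart_chart_inv[OF x] by (simp_all add: z_def)
  show "chart_inv (spherization_chart N c a) (x, \<theta>) = z"
    using chart_inv_eq[OF inj_on_spherization_chart[OF N c] z(1)] z(2) by simp
qed

lemma spherization_chart_image: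
  assumes N: "smooth_atlas N" and c: "c \<in> N"
  shows "snd (spherization_chart N c a) ` fst (spherization_chart N c a) = snd c ` fst c \<times> {a<..<a + 2 * pi}"
proof (intro equalityI subsetI)
  fix w assume "w \<in> snd (spherization_chart N c a) ` fst (spherization_chart N c a)"
  then obtain z where z: "z \<in> fst (spherization_chart N c a)" "w = snd (spherization_chart N c a) z" by auto
  obtain q \<theta> where "c \<in> charts_at N q" "\<theta> \<in> {a<..<a + 2 * pi}" "w = (snd c q, \<theta>)"
    using spherization_chartE[OF c z(1)] z(2) by metis
  then show "w \<in> snd c ` fst c \<times> {a<..<a + 2 * pi}" by (auto simp: charts_at_iff)
next
  fix w assume "w \<in> snd c ` fst c \<times> {a<..<a + 2 * pi}"
  then obtain x \<theta> where "w = (x, \<theta>)" "x \<in> snd c ` fst c" "\<theta> \<in> {a<..<a + 2 * pi}" by auto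
  then show "w \<in> snd (spherization_chart N c a) ` fst (spherization_chart N c a)"
    using spherization_chart_inv(1,2)[OF N c] by (metis image_eqI)
qed

lemma smooth_atlas_spherization:
  assumes N: "smooth_atlas N"
  shows "smooth_atlas (spherization_atlas N)"
  unfolding smooth_atlas_def
proof (intro conjI ballI)
  fix C assume "C \<in> spherization_atlas N"
  then obtain c a where c: "c \<in> N" "C = spherization_chart N c a" by (auto simp: spherization_atlas_def)
  show inj: "inj_on (snd C) (fst C)" unfolding c(2) by (rule inj_on_spherization_chart[OF N c(1)])
  show "open (snd C ` fst C)"
    unfolding c(2) spherization_chart_image[OF N c(1)] by (intro open_Times smooth_atlasD(2)[OF N c(1)]) auto
  fix D assume "D \<in> spherization_atlas N"
  then obtain d b where d: "d \<in> N" "D = spherization_chart N d b" by (auto simp: spherization_atlas_def)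
  let ?W = "snd c ` (fst c \<inter> fst d)"
  let ?S = "?W \<times> {a<..<a + 2 * pi}"
  let ?p = "\<lambda>w. push_covector N (chart_inv c) (fst w) (unit_vector (snd w))"
  have oW: "open ?W" by (rule smooth_atlasD(3)[OF N c(1) d(1)])
  have oS: "open ?S" by (intro open_Times oW) auto
  have Wc: "x \<in> snd c ` fst c" if "x \<in> ?W" for x using that by auto
  have Wd: "chart_inv c x \<in> fst d" if "x \<in> ?W" for x
    using that chart_inv_eq[OF smooth_atlasD(1)[OF N c(1)]] by auto
  have sd: "smooth_on ?W (\<lambda>x. snd d (chart_inv c x))"
    using smooth_atlasD(4)[OF N c(1) d(1)] by (simp add: transition_def in_charts_def o_def)
  have sT: "smooth_on ?S (\<lambda>w. ?p w d)"
    by (rule smooth_on_push[OF N d(1) oW _ sd _ oS])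
       (use Wd local_param_chart_inv[OF N c(1) Wc] in \<open>auto intro!: smooth_on_unit_vector smooth_intros oS\<close>)
  \<comment> \<open>The overlap in the coordinates of \<open>C\<close>: base point common to
    \<open>c\<close> and \<open>d\<close>, and a covector that, seen in \<open>d\<close>, avoids the
    slit of the second chart.\<close>
  define V where "V = ?S \<inter> (\<lambda>w. ?p w d) -` slit_plane b"
  have oV: "open V"
    unfolding V_def by (rule continuous_open_preimage[OF smooth_on_continuous[OF sT] oS open_slit_plane])
  have d': "d \<in> charts_at N (chart_inv c x)" if "x \<in> ?W" for x using Wd[OF that] d by (simp add: charts_at_iff)
  have inD: "chart_inv C w \<in> fst D \<longleftrightarrow> ?p w d \<in> slit_plane b"
    "?p w d \<in> slit_plane b \<Longrightarrow> snd D (chart_inv C w) = (snd d (chart_inv c (fst w)), angle_from b (?p w d))"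
    if w: "w \<in> ?S" for w
  proof -
    have x: "fst w \<in> ?W" "snd w \<in> {a<..<a + 2 * pi}" using w by auto
    have eq: "chart_inv C w = (chart_inv c (fst w), ray (?p w))"
      using spherization_chart_inv(3)[OF N c(1) Wc[OF x(1)] x(2)] c(2) by simp
    note s = spherization_chart_slit[OF d'[OF x(1)] push_covector_in[OF N local_param_chart_inv[OF N c(1) Wc[OF x(1)]]], of "unit_vector (snd w)" b]
    show "chart_inv C w \<in> fst D \<longleftrightarrow> ?p w d \<in> slit_plane b"
      "?p w d \<in> slit_plane b \<Longrightarrow> snd D (chart_inv C w) = (snd d (chart_inv c (fst w)), angle_from b (?p w d))"
      unfolding eq d(2) using s by auto
  qed
  have V: "snd C ` (fst C \<inter> fst D) = V"
  proof (intro equalityI subsetI)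
    fix w assume "w \<in> snd C ` (fst C \<inter> fst D)"
    then obtain z where z: "z \<in> fst C" "z \<in> fst D" "w = snd C z" by auto
    obtain q p \<theta> where e: "z = (q, ray p)" "c \<in> charts_at N q" "\<theta> \<in> {a<..<a + 2 * pi}" "w = (snd c q, \<theta>)"
      using spherization_chartE[OF c(1) z(1)[unfolded c(2)]] z(3) c(2) by metis
    have "q \<in> fst d" using spherization_chartE[OF d(1) z(2)[unfolded d(2)]] e(1) by (metis Pair_inject charts_at_iff)
    then have wS: "w \<in> ?S" using e by (auto simp: charts_at_iff)
    moreover have "chart_inv C w = z" using chart_inv_eq[OF inj z(1)] z(3) by simp
    ultimately show "w \<in> V" using inD(1)[OF wS] z(2) by (simp add: V_def)
  next
    fix w assume w: "w \<in> V"
    then have wS: "w \<in> ?S" by (simp add: V_def)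
    then have "w \<in> snd C ` fst C" unfolding c(2) spherization_chart_image[OF N c(1)] using Wc by auto
    then show "w \<in> snd C ` (fst C \<inter> fst D)"
      using inD(1)[OF wS] w chart_inv_in[of w C] chart_chart_inv[of w C]
      by (intro image_eqI[of _ _ "chart_inv C w"]) (auto simp: V_def)
  qed
  show "open (snd C ` (fst C \<inter> fst D))" unfolding V by (rule oV)
  have "smooth_on V (\<lambda>w. (snd d (chart_inv c (fst w)), angle_from b (?p w d)))"
  proof (intro smooth_on_Pair oV)
    show "smooth_on V (\<lambda>w. snd d (chart_inv c (fst w)))"
      by (rule smooth_on_compose[OF sd smooth_on_fst[OF oV smooth_on_id[OF oV]] oV oW]) (auto simp: V_def)
    show "smooth_on V (\<lambda>w. angle_from b (?p w d))"
      by (rule smooth_on_angle_from[OF oV smooth_on_subset[OF sT]]) (auto simp: V_def)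
  qed
  then show "smooth_on (snd C ` (fst C \<inter> fst D)) (transition C D)"
    unfolding V by (rule smooth_on_transform[OF oV]) (use inD(2) in \<open>auto simp: V_def transition_def in_charts_def\<close>)
qed

section \<open>Paths of Legendrians in the spherization\<close>

lemma charts_at_spherizationE:
  assumes N: "smooth_atlas N" and p: "p \<in> cotangent_space N q" and C: "C \<in> charts_at (spherization_atlas N) (q, ray p)"
  obtains c a where "C = spherization_chart N c a" "c \<in> charts_at N q" "p c \<in> slit_plane a"
proof -
  obtain c a where c: "C = spherization_chart N c a" "c \<in> N" "(q, ray p) \<in> fst (spherization_chart N c a)"
    using C unfolding charts_at_def spherization_atlas_def by blast
  have c': "c \<in> charts_at N q" using spherization_chartE[OF c(2,3)] by (metis Pair_inject)
  then have "p c \<in> slit_plane a" using spherization_chart_slit(1)[OF c' p] c(3) by simp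
  then show ?thesis using that c(1) c' by blast
qed

lemma spherization_chart_in_charts_at:
  assumes "c \<in> charts_at N q" "p \<in> cotangent_space N q" "p c \<in> slit_plane a"
  shows "spherization_chart N c a \<in> charts_at (spherization_atlas N) (q, ray p)"
  using spherization_chart_slit(1)[OF assms(1,2)] assms unfolding charts_at_iff spherization_atlas_def by blast

lemma slit_plane_exists:
  assumes "P \<noteq> 0" obtains a where "P \<in> slit_plane a"
proof -
  obtain \<theta> where "P = norm P *\<^sub>R unit_vector \<theta>" using assms by (rule polarE)
  then have "P \<in> slit_plane (\<theta> - pi)"
    using angle_from_polar(1)[of "norm P" \<theta> "\<theta> - pi"] assms by simp
  then show ?thesis by (rule that)
qed

lemma two_points_slit_plane:
  assumes "P \<noteq> 0" "P' \<noteq> 0" obtains a where "P \<in> slit_plane a" "P' \<in> slit_plane a"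
proof -
  obtain \<theta> \<theta>' where e: "P = norm P *\<^sub>R unit_vector \<theta>" "P' = norm P' *\<^sub>R unit_vector \<theta>'"
    using polarE assms by metis
  obtain a where a: "cis \<theta> \<in> fst (circle_chart a)" "cis \<theta>' \<in> fst (circle_chart a)"
    using two_points_circle_chart[of "cis \<theta>" "cis \<theta>'"] by auto
  have "r *\<^sub>R unit_vector x \<in> slit_plane a" if "cis x \<in> fst (circle_chart a)" "r > 0" for x r
  proof -
    obtain k :: int where "x + 2 * pi * of_int k \<in> {a<..<a + 2 * pi}" using \<open>cis x \<in> _\<close> by (rule circle_chart_shift)
    from angle_from_polar(1)[OF \<open>r > 0\<close> this] show ?thesis by (simp add: unit_vector_add_2pi_int)
  qed
  then have "P \<in> slit_plane a" "P' \<in> slit_plane a" using e a assms by (metis zero_less_norm_iff)+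
  then show ?thesis by (rule that)
qed

text \<open>The factor \<open>r\<close> comes from the arbitrary representative of the ray, the
  chart from the choice inside \<open>differential\<close>. The transformation rule of covectors
  removes the third choice, the base chart used in \<open>pairing\<close>.\<close>

lemma spherization_form_eq:
  assumes N: "smooth_atlas N" and q: "q \<in> carrier N" and p: "p \<in> cotangent_space N q"
    and nz: "\<And>c. c \<in> charts_at N q \<Longrightarrow> p c \<noteq> 0"
  obtains r c a where "r > 0" "c \<in> charts_at N q" "p c \<in> slit_plane a"
    "\<forall>v. spherization_form N (q, ray p) v = r * (p c \<bullet> fst (v (spherization_chart N c a)))"
proof -
  let ?z = "(q, ray p)"
  define C where "C = (SOME C. C \<in> charts_at (spherization_atlas N) ?z)"
  define c0 where "c0 = (SOME c. c \<in> charts_at N q)"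
  define p0 where "p0 = (SOME p0. p0 \<in> ray p)"
  obtain c1 where c1: "c1 \<in> charts_at N q" using q by (rule carrierE)
  obtain a1 where "p c1 \<in> slit_plane a1" using slit_plane_exists[OF nz[OF c1]] .
  then have "C \<in> charts_at (spherization_atlas N) ?z"
    unfolding C_def using spherization_chart_in_charts_at[OF c1 p] by (meson someI)
  then obtain c a where c: "C = spherization_chart N c a" "c \<in> charts_at N q" "p c \<in> slit_plane a"
    by (rule charts_at_spherizationE[OF N p])
  have cN: "c \<in> N" "q \<in> fst c" using c(2) by (auto simp: charts_at_iff)
  have c0: "c0 \<in> charts_at N q" unfolding c0_def by (rule some_chart_at[OF q])
  have "p0 \<in> ray p" unfolding p0_def by (rule someI[of "\<lambda>p0. p0 \<in> ray p", OF ray_self])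
  then obtain r where r: "r > 0" "p0 = (\<lambda>c. r *\<^sub>R p c)" by (auto simp: ray_def)
  let ?D = "frechet_derivative (transition c c0) (at (snd c q))"
  have sC: "snd C ?z = (snd c q, angle_from a (p c))"
    unfolding c(1) by (rule spherization_chart_slit(2)[OF c(2) p c(3)])
  have "(in_charts C c0 fst has_derivative (\<lambda>w. ?D (fst w))) (at (snd C ?z))"
  proof (rule has_derivative_transform_within_open[of "\<lambda>w. transition c c0 (fst w)"])
    show "((\<lambda>w. transition c c0 (fst w)) has_derivative (\<lambda>w. ?D (fst w))) (at (snd C ?z))"
      by (rule has_derivative_compose[of fst fst]) (auto simp: sC transition_has_derivative[OF N c(2) c0] intro!: derivative_intros)
    show "open (snd C ` fst C)"
      unfolding c(1) spherization_chart_image[OF N cN(1)] by (intro open_Times smooth_atlasD(2)[OF N cN(1)]) auto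
    show "snd C ?z \<in> snd C ` fst C"
      using spherization_chart_slit(1)[OF c(2) p] c by auto
    fix w assume "w \<in> snd C ` fst C"
    then have "fst w \<in> snd c ` fst c" "snd w \<in> {a<..<a + 2 * pi}"
      unfolding c(1) spherization_chart_image[OF N cN(1)] by auto
    from spherization_chart_inv(3)[OF N cN(1) this] show "transition c c0 (fst w) = in_charts C c0 fst w"
      by (simp add: in_charts_def transition_def c(1))
  qed
  then have diff: "differential (spherization_atlas N) N fst ?z v c0 = ?D (fst (v C))" for v
    using c0 unfolding differential_def Let_def C_def[symmetric] by (simp add: frechet_derivative_at[symmetric])
  have "spherization_form N ?z v = r * (p c \<bullet> fst (v C))" for v
    unfolding spherization_form_def Let_def snd_conv fst_conv p0_def[symmetric] pairing_def c0_def[symmetric] diff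
    by (simp add: r(2) cotangentD[OF p c(2) c0, symmetric])
  then show ?thesis using that[OF r(1) c(2,3)] c(1) by simp
qed

text \<open>A family of closed curves of cooriented line elements in the plane: \<open>Q\<close> is
  the base point and \<open>q\<close> the angle of the conormal, which turns once along the curve.
  The local diffeomorphism carries it to the surface by its cotangent lift.\<close>

locale pushed_family =
  fixes N :: "('a, real^2) atlas" and \<Psi> :: "real^2 \<Rightarrow> 'a" and Q :: "real \<Rightarrow> real \<Rightarrow> real^2" and q :: "real \<Rightarrow> real \<Rightarrow> real"
  assumes N: "smooth_atlas N" and param: "\<And>x. local_param N \<Psi> x"
    and smooth_Q: "smooth_on UNIV (\<lambda>z. Q (fst z) (snd z))" and smooth_q: "smooth_on UNIV (\<lambda>z. q (fst z) (snd z))"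
    and periodic: "\<And>t s. Q t (s + 2 * pi) = Q t s" "\<And>t s. q t (s + 2 * pi) = q t s + 2 * pi"
begin

definition covec :: "real \<times> real \<Rightarrow> ('a, real^2) covector" where
  "covec z = push_covector N \<Psi> (Q (fst z) (snd z)) (unit_vector (q (fst z) (snd z)))"

definition point :: "real \<Rightarrow> real \<Rightarrow> 'a \<times> ('a, real^2) covector set" where
  "point t s = (\<Psi> (Q t s), ray (covec (t, s)))"

definition family :: "real \<Rightarrow> complex \<Rightarrow> 'a \<times> ('a, real^2) covector set" where
  "family t = circle_lift (point t)"

abbreviation "STN \<equiv> spherization_atlas N"

lemmas smooth_STN = smooth_atlas_spherization[OF N]

lemma family_cis: "family t (cis s) = point t s"
  unfolding family_def
proof (rule circle_lift_cis)
  fix s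
  have "unit_vector (q t s + 2 * pi) = unit_vector (q t s)" using unit_vector_add_2pi_int[of "q t s" 1] by simp
  then show "point t (s + 2 * pi) = point t s" by (simp add: point_def covec_def periodic)
qed

lemma covec_in: "covec (t, s) \<in> cotangent_space N (\<Psi> (Q t s))"
  unfolding covec_def fst_conv snd_conv by (rule push_covector_in[OF N param])

lemma covec_nonzero: "c \<in> charts_at N (\<Psi> (Q t s)) \<Longrightarrow> covec (t, s) c \<noteq> 0"
  unfolding covec_def fst_conv snd_conv by (rule push_covector_nonzero[OF N param]) auto

lemma base_in: "\<Psi> x \<in> carrier N"
proof -
  obtain c where "c \<in> charts_at N (\<Psi> x)" using param[of x, unfolded local_param_def] by (rule bexE)
  then show ?thesis by (rule charts_at_carrier)
qed

lemma chart_rep: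
  assumes c: "c \<in> charts_at N (\<Psi> (Q t s))" and a: "covec (t, s) c \<in> slit_plane a"
  obtains W U where "open W" "(t, s) \<in> W" "open U" "smooth_on U (\<lambda>x. snd c (\<Psi> x))"
    "smooth_on W (\<lambda>z. snd c (\<Psi> (Q (fst z) (snd z))))" "smooth_on W (\<lambda>z. covec z c)"
    "\<forall>t' s'. (t', s') \<in> W \<longrightarrow> Q t' s' \<in> U \<and> c \<in> charts_at N (\<Psi> (Q t' s')) \<and> covec (t', s') c \<in> slit_plane a"
proof -
  let ?Q = "\<lambda>z. Q (fst z) (snd z)" and ?v = "\<lambda>z. unit_vector (q (fst z) (snd z))"
  obtain U where U: "open U" "Q t s \<in> U" "\<Psi> ` U \<subseteq> fst c" "smooth_on U (\<lambda>x. snd c (\<Psi> x))"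
    using local_paramE[OF N param c] by metis
  have cN: "c \<in> N" using c by (simp add: charts_at_iff)
  define V where "V = ?Q -` U"
  have oV: "open V" unfolding V_def using smooth_on_continuous[OF smooth_Q] by (intro open_vimage U(1)) auto
  have sQ: "smooth_on V ?Q" by (rule smooth_on_subset[OF smooth_Q]) simp
  have sv: "smooth_on V ?v" by (intro smooth_on_unit_vector oV smooth_on_subset[OF smooth_q]) simp
  have sc: "smooth_on V (\<lambda>z. covec z c)"
    unfolding covec_def by (rule smooth_on_push[OF N cN U(1,3,4) param oV sQ _ sv]) (auto simp: V_def)
  define W where "W = V \<inter> (\<lambda>z. covec z c) -` slit_plane a"
  have oW: "open W"
    unfolding W_def by (rule continuous_open_preimage[OF smooth_on_continuous[OF sc] oV open_slit_plane])
  have WV: "W \<subseteq> V" by (auto simp: W_def)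
  show ?thesis
  proof (rule that[OF oW _ U(1,4) _ smooth_on_subset[OF sc WV]])
    show "(t, s) \<in> W" using U(2) a by (simp add: W_def V_def)
    show "smooth_on W (\<lambda>z. snd c (\<Psi> (?Q z)))"
      by (rule smooth_on_compose[OF U(4) smooth_on_subset[OF sQ WV] oW U(1)]) (auto simp: W_def V_def)
    show "\<forall>t' s'. (t', s') \<in> W \<longrightarrow> Q t' s' \<in> U \<and> c \<in> charts_at N (\<Psi> (Q t' s')) \<and> covec (t', s') c \<in> slit_plane a"
    proof (intro allI impI)
      fix t' s' assume w: "(t', s') \<in> W"
      then have "Q t' s' \<in> U" by (simp add: W_def V_def)
      then show "Q t' s' \<in> U \<and> c \<in> charts_at N (\<Psi> (Q t' s')) \<and> covec (t', s') c \<in> slit_plane a"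
        using w U(3) cN by (auto simp: W_def charts_at_iff)
    qed
  qed
qed

lemma smooth_family: "smooth_path circle_atlas STN family"
proof (rule circle_smooth_pathI[OF smooth_STN])
  fix t s :: real
  obtain c where c: "c \<in> charts_at N (\<Psi> (Q t s))" using base_in by (rule carrierE)
  obtain a where a: "covec (t, s) c \<in> slit_plane a" using slit_plane_exists[OF covec_nonzero[OF c]] .
  obtain W U where W: "open W" "(t, s) \<in> W" and U: "open U" "smooth_on U (\<lambda>x. snd c (\<Psi> x))"
    and sW: "smooth_on W (\<lambda>z. snd c (\<Psi> (Q (fst z) (snd z))))" "smooth_on W (\<lambda>z. covec z c)"
    and in_slit': "\<forall>t' s'. (t', s') \<in> W \<longrightarrow> Q t' s' \<in> U \<and> c \<in> charts_at N (\<Psi> (Q t' s')) \<and> covec (t', s') c \<in> slit_plane a"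
    by (rule chart_rep[OF c a])
  have in_slit: "Q t' s' \<in> U \<and> c \<in> charts_at N (\<Psi> (Q t' s')) \<and> covec (t', s') c \<in> slit_plane a"
    if "(t', s') \<in> W" for t' s' using in_slit' that by blast
  let ?G = "\<lambda>z. (snd c (\<Psi> (Q (fst z) (snd z))), angle_from a (covec z c))"
  have "smooth_on W ?G"
    using in_slit by (intro smooth_on_Pair smooth_on_angle_from W(1) sW) auto
  moreover have "\<forall>t'\<in>{0..1}. \<forall>s'. (t', s') \<in> W \<longrightarrow> family t' (cis s') \<in> fst (spherization_chart N c a) \<and>
      snd (spherization_chart N c a) (family t' (cis s')) = ?G (t', s')"
    using spherization_chart_slit[OF _ covec_in] in_slit by (simp add: family_cis point_def)
  moreover have "spherization_chart N c a \<in> charts_at STN (family t (cis s))"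
    unfolding family_cis point_def by (rule spherization_chart_in_charts_at[OF c covec_in a])
  ultimately show "\<exists>d\<in>charts_at STN (family t (cis s)). \<exists>W G. open W \<and> (t, s) \<in> W \<and> smooth_on W G \<and>
      (\<forall>t'\<in>{0..1}. \<forall>s'. (t', s') \<in> W \<longrightarrow> family t' (cis s') \<in> fst d \<and> snd d (family t' (cis s')) = G (t', s'))"
    using W(1,2) by blast
qed

text \<open>The auxiliary path \<open>l\<close> in the parameter plane lets one computation serve
  twice: along \<open>s\<close> it gives the tangent of a curve, along \<open>t\<close> the velocity
  of the motion.\<close>

lemma curve_derivative:
  assumes c: "c \<in> charts_at N (\<Psi> (Q t s))" and a: "covec (t, s) c \<in> slit_plane a"
    and l: "continuous_on UNIV l" "l r = (t, s)" "(l has_vector_derivative d) (at r)"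
    and dQ: "((\<lambda>r. Q (fst (l r)) (snd (l r))) has_vector_derivative Q') (at r)"
  obtains \<gamma> where "((\<lambda>r. snd (spherization_chart N c a) (point (fst (l r)) (snd (l r)))) has_vector_derivative \<gamma>) (at r)"
    "fst \<gamma> = param_derivative c \<Psi> (Q t s) Q'"
    "((\<lambda>r. angle_from a (covec (l r) c)) has_vector_derivative snd \<gamma>) (at r)"
proof -
  obtain W U where W: "open W" "(t, s) \<in> W" and U: "open U" "smooth_on U (\<lambda>x. snd c (\<Psi> x))"
    and sW: "smooth_on W (\<lambda>z. snd c (\<Psi> (Q (fst z) (snd z))))" "smooth_on W (\<lambda>z. covec z c)"
    and in_slit': "\<forall>t' s'. (t', s') \<in> W \<longrightarrow> Q t' s' \<in> U \<and> c \<in> charts_at N (\<Psi> (Q t' s')) \<and> covec (t', s') c \<in> slit_plane a"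
    by (rule chart_rep[OF c a])
  have in_slit: "Q t' s' \<in> U \<and> c \<in> charts_at N (\<Psi> (Q t' s')) \<and> covec (t', s') c \<in> slit_plane a"
    if "(t', s') \<in> W" for t' s' using in_slit' that by blast
  let ?A = "\<lambda>z. angle_from a (covec z c)"
  have "smooth_on W ?A" using in_slit by (intro smooth_on_angle_from W(1) sW) auto
  then have dA: "(?A has_derivative frechet_derivative ?A (at (t, s))) (at (t, s))"
    using W(2) by (rule smooth_on_has_derivative)
  let ?\<theta>' = "frechet_derivative ?A (at (t, s)) d"
  have 1: "((\<lambda>r. ?A (l r)) has_vector_derivative ?\<theta>') (at r)"
    using has_derivative_compose[OF l(3)[unfolded has_vector_derivative_def], of ?A "frechet_derivative ?A (at (t, s))"]
      dA l(2) linear_scale[OF has_derivative_linear[OF dA]]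
    unfolding has_vector_derivative_def by simp
  have 2: "((\<lambda>r. snd c (\<Psi> (Q (fst (l r)) (snd (l r))))) has_vector_derivative param_derivative c \<Psi> (Q t s) Q') (at r)"
    using has_derivative_compose[OF dQ[unfolded has_vector_derivative_def], of "\<lambda>x. snd c (\<Psi> x)" "param_derivative c \<Psi> (Q t s)"]
      param_has_derivative[OF N param c] l(2) linear_scale[OF param_derivative_props(1)[OF N param c]]
    unfolding has_vector_derivative_def by simp
  have "((\<lambda>r. (snd c (\<Psi> (Q (fst (l r)) (snd (l r)))), ?A (l r))) has_vector_derivative (param_derivative c \<Psi> (Q t s) Q', ?\<theta>')) (at r)"
    by (rule has_vector_derivative_Pair[OF 2 1])
  then have "((\<lambda>r. snd (spherization_chart N c a) (point (fst (l r)) (snd (l r)))) has_vector_derivative (param_derivative c \<Psi> (Q t s) Q', ?\<theta>')) (at r)"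
  proof (rule has_vector_derivative_transform_within_open)
    show "open (l -` W)" using l(1) by (intro open_vimage W(1))
    show "r \<in> l -` W" using l(2) W(2) by simp
    fix r' assume "r' \<in> l -` W"
    then have "(fst (l r'), snd (l r')) \<in> W" by simp
    note sl = in_slit[OF this]
    show "(snd c (\<Psi> (Q (fst (l r')) (snd (l r')))), ?A (l r')) = snd (spherization_chart N c a) (point (fst (l r')) (snd (l r')))"
      unfolding point_def spherization_chart_slit(2)[OF conjunct1[OF conjunct2[OF sl]] covec_in conjunct2[OF conjunct2[OF sl]]]
      by simp
  qed
  then show ?thesis using that[of "(param_derivative c \<Psi> (Q t s) Q', ?\<theta>')"] 1 by simp
qed

text \<open>If the base point and the direction in a chart are both stationary, then so is the direction
  \<open>q\<close> in the plane: \<open>sin (q - q\<^sub>0)\<close> is the norm of the covector times a function which vanishes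
  together with its derivative.\<close>

lemma angle_stationary:
  assumes c: "c \<in> charts_at N (\<Psi> (Q t s))" and a: "covec (t, s) c \<in> slit_plane a"
    and dQ: "((\<lambda>s. Q t s) has_vector_derivative 0) (at s)" and dq: "((\<lambda>s. q t s) has_real_derivative q') (at s)"
    and dA: "((\<lambda>s. angle_from a (covec (t, s) c)) has_vector_derivative 0) (at s)"
  shows "q' = 0"
proof -
  obtain W U where W: "open W" "(t, s) \<in> W" and U: "open U" "smooth_on U (\<lambda>x. snd c (\<Psi> x))"
    and sW: "smooth_on W (\<lambda>z. snd c (\<Psi> (Q (fst z) (snd z))))" "smooth_on W (\<lambda>z. covec z c)"
    and in_slit': "\<forall>t' s'. (t', s') \<in> W \<longrightarrow> Q t' s' \<in> U \<and> c \<in> charts_at N (\<Psi> (Q t' s')) \<and> covec (t', s') c \<in> slit_plane a"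
    by (rule chart_rep[OF c a])
  have in_slit: "Q t' s' \<in> U \<and> c \<in> charts_at N (\<Psi> (Q t' s')) \<and> covec (t', s') c \<in> slit_plane a"
    if "(t', s') \<in> W" for t' s' using in_slit' that by blast
  \<comment> \<open>A vector annihilated by the conormal at parameter \<open>s\<close>; its pairing
    with the conormal at \<open>r\<close> is \<open>sin (q t r - q t s)\<close>, which detects the
    rotation of the direction.\<close>
  let ?e = "unit_vector (q t s + pi / 2)"
  let ?A = "\<lambda>r. angle_from a (covec (t, r) c)"
  let ?m = "\<lambda>x. param_derivative c \<Psi> x ?e"
  define k where "k = (\<lambda>r. unit_vector (?A r) \<bullet> ?m (Q t r))"
  define n where "n = (\<lambda>r. norm (covec (t, r) c))"
  have slice: "open {r. (t, r) \<in> W}" "s \<in> {r. (t, r) \<in> W}"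
    using smooth_slice(1)[OF W(1) sW(2)] W(2) by auto
  have polar: "covec (t, r) c = n r *\<^sub>R unit_vector (?A r)" "n r > 0" if r: "(t, r) \<in> W" for r
  proof -
    have "covec (t, r) c \<in> slit_plane a" using in_slit[OF r] by blast
    then obtain \<theta> where \<theta>: "\<theta> \<in> {a<..<a + 2 * pi}" "covec (t, r) c = n r *\<^sub>R unit_vector \<theta>" "n r > 0"
      unfolding n_def by (rule slit_planeE)
    then show "covec (t, r) c = n r *\<^sub>R unit_vector (?A r)" "n r > 0"
      using angle_from_polar(2)[OF \<theta>(3,1)] by simp_all
  qed
  have eq: "sin (q t r - q t s) = n r * k r" if r: "r \<in> {r. (t, r) \<in> W}" for r
  proof -
    have "covec (t, r) c \<bullet> ?m (Q t r) = unit_vector (q t r) \<bullet> ?e"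
      using push_covector_inner[OF N param] in_slit[of t r] r by (simp add: covec_def)
    also have "\<dots> = sin (q t r - q t s)" unfolding unit_vector_inner by (simp add: diff_diff_eq[symmetric] cos_diff)
    finally have "covec (t, r) c \<bullet> ?m (Q t r) = sin (q t r - q t s)" .
    moreover have "covec (t, r) c \<bullet> ?m (Q t r) = n r * k r"
      using arg_cong[OF polar(1)[of r], of "\<lambda>v. v \<bullet> ?m (Q t r)"] r by (simp add: k_def)
    ultimately show ?thesis by simp
  qed
  have k0: "k s = 0" using eq[OF slice(2)] polar(2)[OF W(2)] by simp
  have dk: "(k has_vector_derivative 0) (at s)"
  proof -
    have "Q t s \<in> U" using in_slit[OF W(2)] by blast
    then have "(?m has_derivative frechet_derivative ?m (at (Q t s))) (at (Q t s))"
      by (rule smooth_on_has_derivative[OF smooth_on_derivative[OF U(2)]])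
    from has_derivative_compose[OF dQ[unfolded has_vector_derivative_def] this] linear_0[OF has_derivative_linear[OF this]]
    have 1: "((\<lambda>r. ?m (Q t r)) has_derivative (\<lambda>h. 0)) (at s)" by simp
    have "(unit_vector has_derivative frechet_derivative unit_vector (at (?A s))) (at (?A s))"
      by (rule smooth_on_has_derivative[OF smooth_on_unit_vector[OF open_UNIV smooth_on_id[OF open_UNIV]]]) simp
    from has_derivative_compose[OF dA[unfolded has_vector_derivative_def] this] linear_0[OF has_derivative_linear[OF this]]
    have 2: "((\<lambda>r. unit_vector (?A r)) has_derivative (\<lambda>h. 0)) (at s)" by simp
    show ?thesis
      unfolding k_def has_vector_derivative_def using has_derivative_inner[OF 2 1] by simp
  qed
  then have dk': "(k has_real_derivative 0) (at s)" by (simp add: has_real_derivative_iff_has_vector_derivative)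
  have "smooth_on {r. (t, r) \<in> W} n"
    unfolding n_def
  proof (rule smooth_on_norm[OF slice(1) smooth_slice(2)[OF W(1) sW(2)]])
    show "covec (t, r) c \<noteq> 0" if "r \<in> {r. (t, r) \<in> W}" for r
      using polar(2)[of r] that by (auto simp: n_def)
  qed
  from smooth_on_real_derivative[OF this slice(2)]
  have "((\<lambda>r. n r * k r) has_real_derivative 0) (at s)"
    using DERIV_mult[OF _ dk', of n "frechet_derivative n (at s) 1"] k0 by simp
  then have "((\<lambda>r. sin (q t r - q t s)) has_real_derivative 0) (at s)"
    by (rule has_field_derivative_transform_within_open[OF _ slice]) (simp add: eq)
  moreover have "((\<lambda>r. sin (q t r - q t s)) has_real_derivative q') (at s)"
    using dq by (auto intro!: derivative_eq_intros)
  ultimately show ?thesis using DERIV_unique by blast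
qed

lemma form_at_point:
  obtains r c a where "r > 0" "c \<in> charts_at N (\<Psi> (Q t s))" "covec (t, s) c \<in> slit_plane a"
    "\<forall>v. spherization_form N (point t s) v = r * (covec (t, s) c \<bullet> fst (v (spherization_chart N c a)))"
proof -
  obtain r c a where "r > 0" "c \<in> charts_at N (\<Psi> (Q t s))" "covec (t, s) c \<in> slit_plane a"
    "\<forall>v. spherization_form N (\<Psi> (Q t s), ray (covec (t, s))) v = r * (covec (t, s) c \<bullet> fst (v (spherization_chart N c a)))"
    by (rule spherization_form_eq[OF N base_in covec_in covec_nonzero])
  then show ?thesis using that unfolding point_def by blast
qed

lemma legendrian_family:
  assumes t: "t \<in> {0..1}"
    and dQ: "\<And>s. ((\<lambda>s. Q t s) has_vector_derivative Q' s) (at s)"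
    and dq: "\<And>s. ((\<lambda>s. q t s) has_real_derivative q' s) (at s)"
    and leg: "\<And>s. unit_vector (q t s) \<bullet> Q' s = 0" and imm: "\<And>s. Q' s \<noteq> 0 \<or> q' s \<noteq> 0"
  shows "legendrian_immersion circle_atlas STN (spherization_form N) (family t)"
proof -
  have curve: "\<exists>\<gamma>. ((\<lambda>s. snd (spherization_chart N c a) (family t (cis s))) has_vector_derivative \<gamma>) (at s) \<and>
      fst \<gamma> = param_derivative c \<Psi> (Q t s) (Q' s) \<and> \<gamma> \<noteq> 0"
    if c: "c \<in> charts_at N (\<Psi> (Q t s))" and a: "covec (t, s) c \<in> slit_plane a" for c a s
  proof -
    have l: "continuous_on UNIV (Pair t)" "(Pair t has_vector_derivative (0, 1)) (at s)"
      by (auto intro!: continuous_intros derivative_eq_intros has_vector_derivative_Pair)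
    have dQ': "((\<lambda>r. Q (fst (t, r)) (snd (t, r))) has_vector_derivative Q' s) (at s)" using dQ by simp
    obtain \<gamma> where \<gamma>': "((\<lambda>r. snd (spherization_chart N c a) (point (fst (t, r)) (snd (t, r)))) has_vector_derivative \<gamma>) (at s)"
      "fst \<gamma> = param_derivative c \<Psi> (Q t s) (Q' s)" "((\<lambda>r. angle_from a (covec (t, r) c)) has_vector_derivative snd \<gamma>) (at s)"
      by (rule curve_derivative[OF c a l(1) refl l(2) dQ'])
    note \<gamma> = \<gamma>'[unfolded fst_conv snd_conv]
    have "\<gamma> \<noteq> 0"
    proof
      assume 0: "\<gamma> = 0"
      then have "param_derivative c \<Psi> (Q t s) (Q' s) = 0" using \<gamma>(2) by simp
      then have "Q' s = 0" using param_derivative_props[OF N param c] linear_injective_0 by blast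
      moreover from this have "q' s = 0"
        using angle_stationary[OF c a _ dq] dQ[of s] \<gamma>(3) 0 by simp
      ultimately show False using imm by blast
    qed
    then show ?thesis using \<gamma> by (intro exI[of _ \<gamma>]) (simp add: family_cis)
  qed
  have "immersion circle_atlas STN (family t)"
  proof (rule circle_immersionI[OF smooth_path_imp_smooth_map[OF smooth_atlas_circle smooth_STN smooth_family t]])
    fix s
    obtain r c a where c: "c \<in> charts_at N (\<Psi> (Q t s))" "covec (t, s) c \<in> slit_plane a" using form_at_point by metis
    obtain \<gamma> where "((\<lambda>s. snd (spherization_chart N c a) (family t (cis s))) has_vector_derivative \<gamma>) (at s)" "\<gamma> \<noteq> 0"
      using curve[OF c] by blast
    moreover have "spherization_chart N c a \<in> charts_at STN (family t (cis s))"
      unfolding family_cis point_def by (rule spherization_chart_in_charts_at[OF c(1) covec_in c(2)])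
    ultimately show "\<exists>d \<gamma>. d \<in> charts_at STN (family t (cis s)) \<and> \<gamma> \<noteq> 0 \<and> ((\<lambda>s. snd d (family t (cis s))) has_vector_derivative \<gamma>) (at s)"
      by blast
  qed
  moreover have "spherization_form N (family t x) (differential circle_atlas STN (family t) x v) = 0"
    if x: "x \<in> carrier circle_atlas" for x v
  proof -
    obtain s where s: "x = cis s" using x carrier_circle sphere_cisE by auto
    obtain r c a where "r > 0" and c: "c \<in> charts_at N (\<Psi> (Q t s))" "covec (t, s) c \<in> slit_plane a"
      and form: "\<forall>v. spherization_form N (point t s) v = r * (covec (t, s) c \<bullet> fst (v (spherization_chart N c a)))"
      by (rule form_at_point)
    obtain \<gamma> where \<gamma>: "((\<lambda>s. snd (spherization_chart N c a) (family t (cis s))) has_vector_derivative \<gamma>) (at s)"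
      "fst \<gamma> = param_derivative c \<Psi> (Q t s) (Q' s)" using curve[OF c] by blast
    have "spherization_chart N c a \<in> charts_at STN (family t (cis s))"
      unfolding family_cis point_def by (rule spherization_chart_in_charts_at[OF c(1) covec_in c(2)])
    note d = circle_differential[OF this \<gamma>(1), of v]
    have "covec (t, s) c \<bullet> fst \<gamma> = 0"
      unfolding \<gamma>(2) covec_def fst_conv snd_conv push_covector_inner[OF N param c(1)] by (rule leg)
    then show ?thesis unfolding s family_cis form[rule_format] d[unfolded family_cis] by simp
  qed
  ultimately show ?thesis unfolding legendrian_immersion_def by simp
qed

lemma positive_family:
  assumes dQ: "\<And>t s. ((\<lambda>t. Q t s) has_vector_derivative Q' t s) (at t)"
    and pos: "\<And>t s. t \<in> {0..1} \<Longrightarrow> unit_vector (q t s) \<bullet> Q' t s > 0"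
  shows "positive_path circle_atlas STN (spherization_form N) family"
  unfolding positive_path_def
proof (intro ballI)
  fix t :: real and x assume t: "t \<in> {0..1}" and "x \<in> carrier circle_atlas"
  then obtain s where s: "x = cis s" using carrier_circle sphere_cisE by auto
  obtain r c a where r: "r > 0" and c: "c \<in> charts_at N (\<Psi> (Q t s))" "covec (t, s) c \<in> slit_plane a"
    and form: "\<forall>v. spherization_form N (point t s) v = r * (covec (t, s) c \<bullet> fst (v (spherization_chart N c a)))"
    by (rule form_at_point)
  let ?l = "\<lambda>t. (t, s)"
  have l: "continuous_on UNIV ?l" "(?l has_vector_derivative (1, 0)) (at t)"
    by (auto intro!: continuous_intros derivative_eq_intros has_vector_derivative_Pair)
  have dQ': "((\<lambda>r. Q (fst (r, s)) (snd (r, s))) has_vector_derivative Q' t s) (at t)" using dQ by simp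
  obtain \<gamma> where \<gamma>': "((\<lambda>r. snd (spherization_chart N c a) (point (fst (r, s)) (snd (r, s)))) has_vector_derivative \<gamma>) (at t)"
    "fst \<gamma> = param_derivative c \<Psi> (Q t s) (Q' t s)" "((\<lambda>r. angle_from a (covec (r, s) c)) has_vector_derivative snd \<gamma>) (at t)"
    by (rule curve_derivative[OF c l(1) refl l(2) dQ'])
  note \<gamma> = \<gamma>'[unfolded fst_conv snd_conv]
  have "spherization_chart N c a \<in> charts_at STN (point t s)"
    unfolding point_def by (rule spherization_chart_in_charts_at[OF c(1) covec_in c(2)])
  from velocity_eq[OF t this open_UNIV UNIV_I refl \<gamma>(1)]
  have v: "velocity STN (\<lambda>t. point t s) t (spherization_chart N c a) = \<gamma>" .
  have "covec (t, s) c \<bullet> fst \<gamma> > 0"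
    unfolding \<gamma>(2) covec_def fst_conv snd_conv push_covector_inner[OF N param c(1)] by (rule pos[OF t])
  then show "0 < spherization_form N (family t x) (velocity STN (\<lambda>t. family t x) t)"
    unfolding s family_cis form[rule_format] v using r by simp
qed

text \<open>The base point is fixed and the angle runs once around, so every ray at the base point
  is met exactly once; injectivity and surjectivity of the cotangent lift do the rest.\<close>

lemma fiber_family:
  assumes t: "t \<in> {0..1}" and Q: "\<And>s. Q t s = x" and q: "\<And>s. q t s = s + k"
  shows "embedding_map (manifold_topology circle_atlas) (manifold_topology STN) (family t)"
    and "family t ` carrier circle_atlas = spherization_fiber N (\<Psi> x)"
proof -
  let ?p = "\<lambda>v. push_covector N \<Psi> x v"
  have F: "family t (cis s) = (\<Psi> x, ray (?p (unit_vector (s + k))))" for s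
    by (simp add: family_cis point_def covec_def Q q)
  obtain c where c: "c \<in> charts_at N (\<Psi> x)" using base_in by (rule carrierE)
  have inj: "cis s = cis s'" if eq: "ray (?p (unit_vector (s + k))) = ray (?p (unit_vector (s' + k)))" for s s'
  proof -
    have "?p (unit_vector (s + k)) \<in> ray (?p (unit_vector (s' + k)))" using ray_self eq by blast
    then obtain r where r: "r > 0" "?p (unit_vector (s + k)) = ?p (r *\<^sub>R unit_vector (s' + k))"
      unfolding push_covector_scale by (auto simp: ray_def)
    have "unit_vector (s + k) \<bullet> w = (r *\<^sub>R unit_vector (s' + k)) \<bullet> w" for w
      using push_covector_inner[OF N param c] r(2) by metis
    then have "1 *\<^sub>R unit_vector (s + k) = r *\<^sub>R unit_vector (s' + k)" by (metis vector_eq_rdot scaleR_one)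
    then have "cis (s + k) = cis (s' + k)" using r(1) unit_vector_scale_eq(2)[of 1 "s + k" r "s' + k"] by simp
    then show ?thesis by (simp add: cis_mult[symmetric])
  qed
  show "embedding_map (manifold_topology circle_atlas) (manifold_topology STN) (family t)"
  proof (rule embedding_map_compact[OF smooth_STN])
    show "compact_space (manifold_topology circle_atlas)"
      by (simp add: manifold_topology_circle compact_space_subtopology)
    show "continuous_map (manifold_topology circle_atlas) (manifold_topology STN) (family t)"
      using smooth_path_imp_smooth_map[OF smooth_atlas_circle smooth_STN smooth_family t] by (simp add: smooth_map_def)
    show "inj_on (family t) (topspace (manifold_topology circle_atlas))"
    proof (rule inj_onI)
      fix y z assume yz: "y \<in> topspace (manifold_topology circle_atlas)" "z \<in> topspace (manifold_topology circle_atlas)"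
        "family t y = family t z"
      then have "y \<in> sphere 0 1" "z \<in> sphere 0 1" by (simp_all add: manifold_topology_circle)
      then obtain s s' where s: "y = cis s" "z = cis s'" using sphere_cisE by metis
      have "ray (?p (unit_vector (s + k))) = ray (?p (unit_vector (s' + k)))" using yz(3) unfolding s F by simp
      then show "y = z" unfolding s by (rule inj)
    qed
    fix y z assume "y \<in> topspace (manifold_topology circle_atlas)" "z \<in> topspace (manifold_topology circle_atlas)"
    then have "y \<in> sphere 0 1" "z \<in> sphere 0 1" by (simp_all add: manifold_topology_circle)
    then obtain s s' where s: "y = cis s" "z = cis s'" using sphere_cisE by metis
    have "?p (unit_vector (s + k)) c \<noteq> 0" "?p (unit_vector (s' + k)) c \<noteq> 0"
      by (rule push_covector_nonzero[OF N param c], simp)+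
    then obtain a where a: "?p (unit_vector (s + k)) c \<in> slit_plane a" "?p (unit_vector (s' + k)) c \<in> slit_plane a"
      by (rule two_points_slit_plane)
    then have "spherization_chart N c a \<in> charts_at STN (family t y)" "spherization_chart N c a \<in> charts_at STN (family t z)"
      unfolding s F using spherization_chart_in_charts_at[OF c push_covector_in[OF N param]] by blast+
    then show "\<exists>d\<in>STN. family t y \<in> fst d \<and> family t z \<in> fst d" unfolding charts_at_iff by blast
  qed
  show "family t ` carrier circle_atlas = spherization_fiber N (\<Psi> x)"
  proof (intro equalityI subsetI)
    fix z assume "z \<in> family t ` carrier circle_atlas"
    then obtain y where "z = family t y" "y \<in> sphere 0 1" using carrier_circle by auto
    then obtain s where s: "z = family t (cis s)" using sphere_cisE by metis
    have "?p (unit_vector (s + k)) \<noteq> (\<lambda>c. 0)"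
      using push_covector_nonzero[OF N param c, of "unit_vector (s + k)"] by auto
    then show "z \<in> spherization_fiber N (\<Psi> x)"
      unfolding s F spherization_fiber_def spherization_def using base_in push_covector_in[OF N param] by auto
  next
    fix z assume "z \<in> spherization_fiber N (\<Psi> x)"
    then obtain p where p: "z = (\<Psi> x, ray p)" "p \<in> cotangent_space N (\<Psi> x)" "p \<noteq> (\<lambda>c. 0)"
      by (auto simp: spherization_fiber_def spherization_def)
    obtain v where v: "p = ?p v" using covector_pulled_back[OF N param p(2)] .
    have "v \<noteq> 0"
    proof
      assume "v = 0"
      then show False using p(3) v push_covector_scale[of N \<Psi> x 0 v] by simp
    qed
    then obtain \<theta> where \<theta>: "v = norm v *\<^sub>R unit_vector \<theta>" by (rule polarE)
    have "p = (\<lambda>c. norm v *\<^sub>R ?p (unit_vector \<theta>) c)"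
      unfolding v push_covector_scale[symmetric] \<theta>[symmetric] ..
    then have "ray p = ray (?p (unit_vector (\<theta> - k + k)))" using ray_scale[of "norm v"] \<open>v \<noteq> 0\<close> by simp
    then have "z = family t (cis (\<theta> - k))" unfolding F p(1) by simp
    then show "z \<in> family t ` carrier circle_atlas" using cis_carrier by blast
  qed
qed

end

section \<open>Immersed planes through two points of a connected surface\<close>

text \<open>Up to linear combinations the functions \<open>y\<^sup>n exp (- y)\<close> of \<open>y = 1 / x\<close> are closed under
  differentiation, so smoothness at \<open>0\<close> follows for all \<open>n\<close> at once by induction on the order.\<close>

definition flat_exp :: "nat \<Rightarrow> real \<Rightarrow> real" where
  "flat_exp n x = (if x > 0 then inverse x ^ n * exp (- inverse x) else 0)"

lemma flat_exp_tendsto: "((flat_exp n) \<longlongrightarrow> 0) (at 0)"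
proof (rule filterlim_split_at)
  show "(flat_exp n \<longlongrightarrow> 0) (at_left 0)"
    by (rule tendsto_eventually) (auto simp: eventually_at_filter flat_exp_def)
  have "((\<lambda>x::real. inverse x ^ n / exp (inverse x)) \<longlongrightarrow> 0) (at_right 0)"
    by (rule filterlim_compose[OF tendsto_power_div_exp_0 filterlim_inverse_at_top_right])
  then show "(flat_exp n \<longlongrightarrow> 0) (at_right 0)"
    by (rule Lim_transform_eventually) (auto simp: eventually_at_filter flat_exp_def exp_minus divide_inverse)
qed

lemma flat_exp_derivative:
  "(flat_exp n has_real_derivative flat_exp (n + 2) x - of_nat n * flat_exp (n + 1) x) (at x)"
proof -
  consider "x > 0" | "x < 0" | "x = 0" by linarith
  then show ?thesis
  proof cases
    case 1
    have "((\<lambda>x. inverse x ^ n * exp (- inverse x)) has_real_derivative flat_exp (n + 2) x - of_nat n * flat_exp (n + 1) x) (at x)"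
    proof (cases n)
      case 0
      show ?thesis using 1 unfolding 0 by (auto intro!: derivative_eq_intros simp: flat_exp_def power2_eq_square)
    next
      case (Suc m)
      show ?thesis using 1 unfolding Suc
        by (auto intro!: derivative_eq_intros simp: flat_exp_def power2_eq_square algebra_simps)
          (cases m, simp_all)
    qed
    then show ?thesis
      by (rule has_field_derivative_transform_within_open[of _ _ _ "{0<..}"]) (use 1 in \<open>auto simp: flat_exp_def\<close>)
  next
    case 2
    have "((\<lambda>x. 0) has_real_derivative flat_exp (n + 2) x - of_nat n * flat_exp (n + 1) x) (at x)"
      using 2 by (auto simp: flat_exp_def)
    then show ?thesis
      by (rule has_field_derivative_transform_within_open[of _ _ _ "{..<0}"]) (use 2 in \<open>auto simp: flat_exp_def\<close>)
  next
    case 3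
    \<comment> \<open>For \<open>h > 0\<close> the difference quotient is
      \<open>flat_exp (Suc n) h\<close>, and for \<open>h < 0\<close> both are
      \<open>0\<close>.\<close>
    have "((\<lambda>h. (flat_exp n (0 + h) - flat_exp n 0) / h) \<longlongrightarrow> 0) (at 0)"
      using flat_exp_tendsto[of "Suc n"]
      by (rule Lim_transform_eventually) (auto simp: eventually_at_filter flat_exp_def divide_inverse)
    then show ?thesis using 3 by (simp add: DERIV_def flat_exp_def)
  qed
qed

lemma smooth_flat_exp: "smooth_on UNIV (flat_exp n)"
  unfolding smooth_on_def
proof
  fix k show "Ck_on k (flat_exp n) UNIV"
  proof (induction k arbitrary: n)
    case 0
    have "isCont (flat_exp n) x" for x by (rule DERIV_isCont[OF flat_exp_derivative])
    then show ?case by (simp add: continuous_at_imp_continuous_on)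
  next
    case (Suc k)
    have "Ck_on k (\<lambda>x. flat_exp (n + 2) x + (- of_nat n) * flat_exp (n + 1) x) UNIV"
      by (intro Ck_on_add Suc.IH Ck_on_linear[OF bounded_linear_mult_right] open_UNIV)
    then show ?case
      by (intro Ck_on_real_SucI[OF open_UNIV flat_exp_derivative]) simp
  qed
qed

text \<open>The factor \<open>exp 1\<close> normalizes the value at the centre to \<open>1\<close>,
  so that \<open>shift_map\<close> moves its centre by exactly \<open>v\<close>.\<close>

definition bump :: "real^2 \<Rightarrow> real" where
  "bump x = exp 1 * flat_exp 0 (1 - x \<bullet> x)"

lemma bump_zero: "bump 0 = 1"
  by (simp add: bump_def flat_exp_def exp_minus)

lemma bump_outside: "norm x \<ge> 1 \<Longrightarrow> bump x = 0"
  using power_mono[of 1 "norm x" 2] by (simp add: bump_def flat_exp_def power2_norm_eq_inner)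

lemma bump_bounds: "0 \<le> bump x" "bump x \<le> 1"
proof -
  show "0 \<le> bump x" by (simp add: bump_def flat_exp_def)
  have "exp 1 * exp (- inverse (1 - x \<bullet> x)) \<le> 1" if "1 - x \<bullet> x > 0"
  proof -
    have "1 \<le> inverse (1 - x \<bullet> x)" using that by (intro one_le_inverse) auto
    then show ?thesis by (simp add: exp_add[symmetric])
  qed
  then show "bump x \<le> 1" by (simp add: bump_def flat_exp_def)
qed

lemma smooth_bump: "smooth_on UNIV bump"
  unfolding bump_def[abs_def]
  by (intro smooth_on_mult smooth_on_const smooth_on_compose[OF smooth_flat_exp] smooth_intros open_UNIV) auto

text \<open>\<open>flat_exp 2\<close> is the derivative of \<open>flat_exp 0\<close>; the bound is
  \<open>y^2 / 2 \<le> exp y\<close> for \<open>y = 1 / x\<close>. An explicit constant makes the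
  admissible length of a shift uniform.\<close>

lemma flat_exp_2_bound: "0 \<le> flat_exp 2 x" "flat_exp 2 x \<le> 2"
proof -
  show "0 \<le> flat_exp 2 x" by (simp add: flat_exp_def)
  have "inverse x ^ 2 * exp (- inverse x) \<le> 2" if "x > 0"
  proof -
    have "1 + inverse x + inverse x ^ 2 / 2 \<le> exp (inverse x)"
      using that by (intro exp_lower_Taylor_quadratic) simp
    moreover have "0 < inverse x" using that by simp
    ultimately have "inverse x ^ 2 \<le> 2 * exp (inverse x)" by linarith
    then show ?thesis by (simp add: exp_minus divide_inverse[symmetric] divide_le_eq)
  qed
  then show "flat_exp 2 x \<le> 2" by (simp add: flat_exp_def)
qed

lemma bump_derivative:
  "(bump has_derivative (\<lambda>h. - (exp 1 * flat_exp 2 (1 - x \<bullet> x) * (2 * (x \<bullet> h))))) (at x)"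
proof -
  have 1: "((\<lambda>x. 1 - x \<bullet> x) has_derivative (\<lambda>h. - (2 * (x \<bullet> h)))) (at x)"
    by (auto intro!: derivative_eq_intros simp: inner_commute)
  have 2: "(flat_exp 0 has_derivative (*) (flat_exp 2 (1 - x \<bullet> x))) (at (1 - x \<bullet> x))"
    using flat_exp_derivative[of 0 "1 - x \<bullet> x"] by (simp add: has_field_derivative_def numeral_2_eq_2)
  show ?thesis
    unfolding bump_def[abs_def]
    using has_derivative_mult_right[OF has_derivative_compose[OF 1 2], of "exp 1"] by (simp add: algebra_simps)
qed

lemma bump_derivative_bound: "\<bar>exp 1 * flat_exp 2 (1 - x \<bullet> x) * (2 * (x \<bullet> h))\<bar> \<le> 4 * exp 1 * norm h"
proof (cases "norm x \<le> 1")
  case True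
  have "\<bar>x \<bullet> h\<bar> \<le> 1 * norm h"
    using Cauchy_Schwarz_ineq2[of x h] mult_right_mono[OF True norm_ge_zero[of h]] by linarith
  then have "flat_exp 2 (1 - x \<bullet> x) * \<bar>x \<bullet> h\<bar> \<le> 2 * norm h"
    using flat_exp_2_bound[of "1 - x \<bullet> x"] by (intro mult_mono) auto
  then have "exp 1 * (2 * (flat_exp 2 (1 - x \<bullet> x) * \<bar>x \<bullet> h\<bar>)) \<le> exp 1 * (2 * (2 * norm h))"
    by (intro mult_left_mono) auto
  then show ?thesis using flat_exp_2_bound(1)[of "1 - x \<bullet> x"] by (simp add: abs_mult algebra_simps)
next
  case False
  then have "1 \<le> x \<bullet> x" using power_mono[of 1 "norm x" 2] by (simp add: power2_norm_eq_inner)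
  then have "flat_exp 2 (1 - x \<bullet> x) = 0" by (simp add: flat_exp_def)
  then show ?thesis by simp
qed

definition shift_map :: "real^2 \<Rightarrow> real \<Rightarrow> real^2 \<Rightarrow> real^2 \<Rightarrow> real^2" where
  "shift_map y r v b = b + bump ((b - y) /\<^sub>R r) *\<^sub>R v"

lemma shift_map_centre: "shift_map y r v y = y + v"
  by (simp add: shift_map_def bump_zero)

lemma norm_divideR: "r > 0 \<Longrightarrow> norm (x /\<^sub>R r) = norm x / r"
  by (simp add: divide_inverse mult.commute)

lemma scaled_in_ball:
  fixes b w :: "'v::real_normed_vector"
  shows "r > 0 \<Longrightarrow> (b - w) /\<^sub>R r \<in> ball 0 1 \<longleftrightarrow> b \<in> ball w r"
  using norm_divideR[of r "b - w"] by (simp only: mem_ball dist_norm norm_minus_commute[of w b]) (simp add: divide_less_eq)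

lemma shift_map_outside:
  assumes "r > 0" "norm (b - y) \<ge> r" shows "shift_map y r v b = b"
proof -
  have "norm ((b - y) /\<^sub>R r) \<ge> 1" unfolding norm_divideR[OF assms(1)] using assms by (simp add: le_divide_eq)
  then show ?thesis by (simp add: shift_map_def bump_outside)
qed

lemma shift_map_dist: "norm (shift_map y r v b - b) \<le> norm v"
  using bump_bounds[of "(b - y) /\<^sub>R r"] mult_right_mono[of "bump ((b - y) /\<^sub>R r)" 1 "norm v"]
  by (simp add: shift_map_def)

lemma smooth_shift_map: "smooth_on UNIV (shift_map y r v)"
  unfolding shift_map_def[abs_def]
  by (intro smooth_on_add smooth_on_scaleR smooth_on_compose[OF smooth_bump] smooth_on_const smooth_intros open_UNIV) auto

text \<open>The derivative is the identity plus \<open>l h *\<^sub>R v\<close>, a perturbation of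
  norm at most \<open>4 * exp 1 * norm v / r < 1\<close>; so it has trivial kernel.\<close>

lemma shift_map_derivative:
  assumes r: "r > 0" and v: "4 * exp 1 * norm v < r"
  obtains D where "(shift_map y r v has_derivative D) (at b)" "inj D"
proof -
  let ?x = "(b - y) /\<^sub>R r"
  define l where "l = (\<lambda>h. - (exp 1 * flat_exp 2 (1 - ?x \<bullet> ?x) * (2 * (?x \<bullet> (h /\<^sub>R r)))))"
  let ?D = "\<lambda>h. h + l h *\<^sub>R v"
  have "((\<lambda>b. (b - y) /\<^sub>R r) has_derivative (\<lambda>h. h /\<^sub>R r)) (at b)"
    by (auto intro!: derivative_eq_intros)
  from has_derivative_compose[OF this bump_derivative]
  have "((\<lambda>b. bump ((b - y) /\<^sub>R r)) has_derivative l) (at b)" unfolding l_def .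
  then have d: "(shift_map y r v has_derivative ?D) (at b)"
    unfolding shift_map_def[abs_def] by (auto intro!: derivative_eq_intros)
  have "h = 0" if h: "?D h = 0" for h
  proof (rule ccontr)
    assume "h \<noteq> 0"
    have "h = - (l h *\<^sub>R v)" using h by (simp add: eq_neg_iff_add_eq_0)
    then have "norm h = norm (l h *\<^sub>R v)" by (metis norm_minus_cancel)
    then have "norm h = \<bar>l h\<bar> * norm v" by simp
    also have "\<dots> \<le> (4 * exp 1 * norm (h /\<^sub>R r)) * norm v"
      unfolding l_def abs_minus_cancel by (intro mult_right_mono bump_derivative_bound) auto
    also have "\<dots> = (4 * exp 1 * norm v) * (norm h / r)"
      using r by (simp add: divide_inverse)
    also have "\<dots> < r * (norm h / r)"
      using v r \<open>h \<noteq> 0\<close> by (intro mult_strict_right_mono) auto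
    finally show False using r by simp
  qed
  then have "inj ?D" using linear_injective_0[OF has_derivative_linear[OF d]] by blast
  with d show ?thesis by (rule that)
qed

section \<open>Radial diffeomorphism between the plane and the unit disk\<close>

lemma inj_derivative_left_inverse:
  fixes f :: "'e::euclidean_space \<Rightarrow> 'e"
  assumes "smooth_on UNIV f" "smooth_on T g" "f a \<in> T" "\<And>x. g (f x) = x"
  shows "inj (frechet_derivative f (at a))"
proof -
  let ?D = "frechet_derivative f (at a)" and ?E = "frechet_derivative g (at (f a))"
  have "((\<lambda>x. g (f x)) has_derivative (\<lambda>h. ?E (?D h))) (at a)"
    by (rule has_derivative_compose[OF smooth_on_has_derivative[OF assms(1) UNIV_I] smooth_on_has_derivative[OF assms(2,3)]])
  then have "(\<lambda>h. ?E (?D h)) = (\<lambda>h. h)"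
    unfolding assms(4) using has_derivative_unique has_derivative_ident by blast
  then show ?thesis by (metis injI)
qed

text \<open>The squared length \<open>k\<close> of a vector becomes \<open>k / (1 + k)\<close>.
  Needed because a parametrization has to be defined on the entire plane, while charts are only
  known to contain small disks.\<close>

definition plane_to_disk :: "real^2 \<Rightarrow> real^2" where
  "plane_to_disk a = a /\<^sub>R sqrt (1 + a \<bullet> a)"

definition disk_to_plane :: "real^2 \<Rightarrow> real^2" where
  "disk_to_plane b = b /\<^sub>R sqrt (1 - b \<bullet> b)"

lemma ball_inner: "b \<in> ball (0 :: real^2) 1 \<longleftrightarrow> b \<bullet> b < 1"
proof -
  have "b \<bullet> b = (norm b)\<^sup>2" by (simp add: power2_norm_eq_inner)
  then show ?thesis unfolding mem_ball dist_0_norm by (metis abs_norm_cancel abs_square_less_1)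
qed

lemma plane_to_disk_in: "plane_to_disk a \<bullet> plane_to_disk a = (a \<bullet> a) / (1 + a \<bullet> a)" "plane_to_disk a \<in> ball 0 1"
proof -
  have p: "1 + a \<bullet> a > 0" by (simp add: add_pos_nonneg)
  then have "sqrt (1 + a \<bullet> a) * sqrt (1 + a \<bullet> a) = 1 + a \<bullet> a" by simp
  then show e: "plane_to_disk a \<bullet> plane_to_disk a = (a \<bullet> a) / (1 + a \<bullet> a)"
    unfolding plane_to_disk_def inner_scaleR_left inner_scaleR_right
    by (simp add: divide_inverse mult.assoc[symmetric] inverse_mult_distrib[symmetric])
  show "plane_to_disk a \<in> ball 0 1"
    unfolding ball_inner e using p by simp
qed

lemma disk_plane_inverse: "disk_to_plane (plane_to_disk a) = a" "b \<in> ball 0 1 \<Longrightarrow> plane_to_disk (disk_to_plane b) = b"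
proof -
  have p: "1 + a \<bullet> a > 0" by (simp add: add_pos_nonneg)
  have "1 - plane_to_disk a \<bullet> plane_to_disk a = 1 / (1 + a \<bullet> a)"
    unfolding plane_to_disk_in(1) using p by (simp add: field_simps)
  then have "disk_to_plane (plane_to_disk a) = (a /\<^sub>R sqrt (1 + a \<bullet> a)) /\<^sub>R sqrt (1 / (1 + a \<bullet> a))"
    by (simp add: disk_to_plane_def) (simp add: plane_to_disk_def)
  then show "disk_to_plane (plane_to_disk a) = a" using p by (simp add: real_sqrt_divide)
next
  assume "b \<in> ball 0 1"
  then have "b \<bullet> b < 1" by (simp only: ball_inner)
  then have p: "1 - b \<bullet> b > 0" by simp
  then have s: "sqrt (1 - b \<bullet> b) * sqrt (1 - b \<bullet> b) = 1 - b \<bullet> b" by simp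
  have "disk_to_plane b \<bullet> disk_to_plane b = (b \<bullet> b) / (1 - b \<bullet> b)"
    unfolding disk_to_plane_def inner_scaleR_left inner_scaleR_right
    using p by (simp add: divide_inverse mult.assoc[symmetric] inverse_mult_distrib[symmetric] s abs_of_nonneg)
  then have "1 + disk_to_plane b \<bullet> disk_to_plane b = 1 / (1 - b \<bullet> b)" using p by (simp add: field_simps)
  then have "plane_to_disk (disk_to_plane b) = (b /\<^sub>R sqrt (1 - b \<bullet> b)) /\<^sub>R sqrt (1 / (1 - b \<bullet> b))"
    by (simp add: plane_to_disk_def) (simp add: disk_to_plane_def)
  then show "plane_to_disk (disk_to_plane b) = b" using p by (simp add: real_sqrt_divide)
qed

lemma smooth_plane_to_disk: "smooth_on UNIV plane_to_disk"
proof -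
  have "1 + a \<bullet> a > 0" for a :: "real^2" by (simp add: add_pos_nonneg)
  moreover from this have "sqrt (1 + a \<bullet> a) \<noteq> 0" for a :: "real^2" by (simp add: less_imp_neq[symmetric])
  ultimately show ?thesis
    unfolding plane_to_disk_def[abs_def]
    by (intro smooth_on_scaleR smooth_on_inverse smooth_on_sqrt smooth_intros open_UNIV)
qed

lemma smooth_disk_to_plane: "smooth_on (ball 0 1) disk_to_plane"
proof -
  have "1 - b \<bullet> b > 0" if "b \<in> ball 0 1" for b :: "real^2" using that ball_inner[of b] by simp
  moreover from this have "sqrt (1 - b \<bullet> b) \<noteq> 0" if "b \<in> ball 0 1" for b :: "real^2"
    using that by (simp add: less_imp_neq[symmetric])
  ultimately show ?thesis
    unfolding disk_to_plane_def[abs_def]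
    by (intro smooth_on_scaleR smooth_on_inverse smooth_on_sqrt smooth_intros open_ball)
qed

section \<open>Pairs of points in the image of one immersed plane\<close>

definition reachable :: "('a, real^2) atlas \<Rightarrow> 'a \<Rightarrow> 'a \<Rightarrow> bool" where
  "reachable N x y \<longleftrightarrow> (\<exists>\<Psi>. (\<forall>a. local_param N \<Psi> a) \<and> x \<in> range \<Psi> \<and> y \<in> range \<Psi>)"

lemma local_param_compose:
  assumes N: "smooth_atlas N" and c: "c \<in> N" and W: "open W" "a \<in> W" "\<Phi> ` W \<subseteq> snd c ` fst c" "smooth_on W \<Phi>"
    and inj: "inj (frechet_derivative \<Phi> (at a))" and \<Psi>: "\<And>x. x \<in> W \<Longrightarrow> \<Psi> x = chart_inv c (\<Phi> x)"
  shows "local_param N \<Psi> a"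
  unfolding local_param_def
proof (intro bexI[of _ c] exI[of _ W] conjI W(1,2))
  have in_c: "\<Psi> x \<in> fst c" and eq: "snd c (\<Psi> x) = \<Phi> x" if "x \<in> W" for x
    using \<Psi>[OF that] W(3) that chart_inv_in[of "\<Phi> x" c] chart_chart_inv[of "\<Phi> x" c] by auto
  show "\<Psi> ` W \<subseteq> fst c" using in_c by blast
  show "smooth_on W (\<lambda>x. snd c (\<Psi> x))" by (rule smooth_on_transform[OF W(1,4)]) (rule eq)
  have "frechet_derivative (\<lambda>x. snd c (\<Psi> x)) (at a) = frechet_derivative \<Phi> (at a)"
    by (rule frechet_derivative_cong_open[OF W(1,2)]) (rule eq)
  then show "inj (param_derivative c \<Psi> a)" using inj by simp
  show "c \<in> charts_at N (\<Psi> a)" using in_c[OF W(2)] c by (simp add: charts_at_iff)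
qed

lemma reachable_in_disk:
  assumes N: "smooth_atlas N" and c: "c \<in> N" and r: "r > 0" "ball w r \<subseteq> snd c ` fst c"
    and x: "x \<in> fst c" "snd c x \<in> ball w r" and y: "y \<in> fst c" "snd c y \<in> ball w r"
  shows "reachable N x y"
  unfolding reachable_def
proof (intro exI conjI allI)
  let ?\<Phi> = "\<lambda>a. w + r *\<^sub>R plane_to_disk a"
  let ?\<Psi> = "\<lambda>a. chart_inv c (?\<Phi> a)"
  have in_ball: "?\<Phi> a \<in> ball w r" for a
    using plane_to_disk_in(2)[of a] r(1) by (simp add: dist_norm)
  have s: "smooth_on UNIV ?\<Phi>" by (intro smooth_intros smooth_plane_to_disk open_UNIV)
  show "local_param N ?\<Psi> a" for a
  proof (rule local_param_compose[OF N c open_UNIV UNIV_I _ s])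
    show "range ?\<Phi> \<subseteq> snd c ` fst c" using in_ball r(2) by blast
    have "smooth_on (ball w r) (\<lambda>b. disk_to_plane ((b - w) /\<^sub>R r))"
    proof (rule smooth_on_compose[OF smooth_disk_to_plane])
      show "(\<lambda>b. (b - w) /\<^sub>R r) ` ball w r \<subseteq> ball 0 1"
        using scaled_in_ball[OF r(1)] by blast
    qed (auto intro!: smooth_intros)
    then show "inj (frechet_derivative ?\<Phi> (at a))"
      by (rule inj_derivative_left_inverse[OF s _ in_ball]) (use r(1) in \<open>simp add: disk_plane_inverse\<close>)
  qed simp
  have range: "z \<in> range ?\<Psi>" if z: "z \<in> fst c" "snd c z \<in> ball w r" for z
  proof -
    have "(snd c z - w) /\<^sub>R r \<in> ball 0 1" using z(2) scaled_in_ball[OF r(1)] by blast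
    then have "?\<Phi> (disk_to_plane ((snd c z - w) /\<^sub>R r)) = snd c z" using r(1) by (simp add: disk_plane_inverse)
    then show ?thesis using chart_inv_eq[OF smooth_atlasD(1)[OF N c] z(1)] by (metis rangeI)
  qed
  show "x \<in> range ?\<Psi>" "y \<in> range ?\<Psi>" using range x y by blast+
qed

text \<open>The immersed plane through \<open>x\<close> and \<open>y\<close> is followed by a local
  shift, supported in the chart disk, that moves \<open>y\<close> to \<open>y'\<close>. It must not
  move \<open>x\<close> away: if \<open>x\<close> lies in the disk, the disk itself serves;
  otherwise \<open>x\<close> is outside the support.\<close>

lemma reachable_push:
  assumes N: "smooth_atlas N" and H: "Hausdorff_space (manifold_topology N)" and c: "c \<in> N" and r: "r > 0" "ball w (3 * r) \<subseteq> snd c ` fst c"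
    and y: "y \<in> fst c" "snd c y \<in> ball w r" and y': "y' \<in> fst c" "snd c y' \<in> ball w r"
    and near: "4 * exp 1 * norm (snd c y' - snd c y) < r" and reach: "reachable N x y"
  shows "reachable N x y'"
proof (cases "x \<in> fst c \<and> snd c x \<in> ball w (3 * r)")
  case True
  then show ?thesis
    using reachable_in_disk[OF N c _ r(2), of x y'] y' r(1) by (auto simp: dist_norm)
next
  case False
  define v where "v = snd c y' - snd c y"
  define \<pi> where "\<pi> = shift_map (snd c y) r v"
  let ?B = "fst c \<inter> snd c -` ball w (3 * r)"
  have "4 * norm v \<le> 4 * exp 1 * norm v" using mult_right_mono[of 1 "exp 1" "norm v"] by simp
  then have v: "4 * exp 1 * norm v < r" "norm v < r"
    using near norm_ge_zero[of v] unfolding v_def[symmetric] by linarith+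
  \<comment> \<open>A point that is moved lies within \<open>r\<close> of \<open>snd c y\<close>,
    which lies within \<open>r\<close> of \<open>w\<close>, and it moves by less than
    \<open>r\<close>; this explains the radius \<open>3 * r\<close>.\<close>
  have \<pi>B: "\<pi> b \<in> ball w (3 * r)" if b: "b \<in> ball w (3 * r)" for b
  proof (cases "norm (b - snd c y) \<ge> r")
    case True
    then show ?thesis using shift_map_outside[OF r(1)] b by (simp add: \<pi>_def)
  next
    case False
    have "norm (\<pi> b - w) \<le> norm (\<pi> b - b) + (norm (b - snd c y) + norm (snd c y - w))"
      using norm_triangle_ineq[of "\<pi> b - b" "b - w"] norm_triangle_ineq[of "b - snd c y" "snd c y - w"] by simp
    also have "\<dots> < r + (r + r)"
      using shift_map_dist[of "snd c y" r v b] v(2) False y(2)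
      by (intro add_strict_mono) (auto simp: \<pi>_def dist_norm norm_minus_commute)
    finally show ?thesis by (simp add: dist_norm norm_minus_commute)
  qed
  obtain \<Psi> where \<Psi>: "\<And>a. local_param N \<Psi> a" "x \<in> range \<Psi>" "y \<in> range \<Psi>" using reach unfolding reachable_def by blast
  define \<Psi>' where "\<Psi>' = (\<lambda>a. if \<Psi> a \<in> ?B then chart_inv c (\<pi> (snd c (\<Psi> a))) else \<Psi> a)"
  have "local_param N \<Psi>' a" for a
  proof (cases "\<Psi> a \<in> ?B")
    case True
    then have c': "c \<in> charts_at N (\<Psi> a)" using c by (simp add: charts_at_iff)
    obtain W where W: "open W" "a \<in> W" "\<Psi> ` W \<subseteq> fst c" "smooth_on W (\<lambda>x. snd c (\<Psi> x))" "inj (param_derivative c \<Psi> a)"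
      by (rule local_paramE[OF N \<Psi>(1) c'])
    define V where "V = W \<inter> (\<lambda>x. snd c (\<Psi> x)) -` ball w (3 * r)"
    have V: "open V"
      unfolding V_def by (rule continuous_open_preimage[OF smooth_on_continuous[OF W(4)] W(1) open_ball])
    have aV: "a \<in> V" using True W(2) by (simp add: V_def)
    show ?thesis
    proof (rule local_param_compose[OF N c V aV])
      show "(\<lambda>x. \<pi> (snd c (\<Psi> x))) ` V \<subseteq> snd c ` fst c" using \<pi>B r(2) by (auto simp: V_def)
      show "smooth_on V (\<lambda>x. \<pi> (snd c (\<Psi> x)))"
        unfolding \<pi>_def
        by (rule smooth_on_compose[OF smooth_shift_map smooth_on_subset[OF W(4)] V]) (auto simp: V_def)
      obtain D where D: "(\<pi> has_derivative D) (at (snd c (\<Psi> a)))" "inj D"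
        unfolding \<pi>_def using shift_map_derivative[OF r(1) v(1)] by metis
      have "((\<lambda>x. \<pi> (snd c (\<Psi> x))) has_derivative (\<lambda>h. D (param_derivative c \<Psi> a h))) (at a)"
        by (rule has_derivative_compose[OF param_has_derivative[OF N \<Psi>(1) c'] D(1)])
      then have "frechet_derivative (\<lambda>x. \<pi> (snd c (\<Psi> x))) (at a) = (\<lambda>h. D (param_derivative c \<Psi> a h))"
        by (rule frechet_derivative_at[symmetric])
      then show "inj (frechet_derivative (\<lambda>x. \<pi> (snd c (\<Psi> x))) (at a))"
        using inj_compose[OF D(2) W(5)] by (simp add: o_def)
      show "\<Psi>' x = chart_inv c (\<pi> (snd c (\<Psi> x)))" if "x \<in> V" for x
        using that W(3) by (auto simp: \<Psi>'_def V_def)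
    qed
  next
    case False
    \<comment> \<open>A compact set inside \<open>?B\<close> that contains the support of the shift.
      The surface is Hausdorff, so it is closed and its complement is a neighbourhood of
      \<open>\<Psi> a\<close>, on which the new map agrees with \<open>\<Psi>\<close>.\<close>
    let ?K = "chart_inv c ` cball (snd c y) r"
    have "b \<in> ball w (3 * r)" if "b \<in> cball (snd c y) r" for b
    proof -
      have "norm (b - w) \<le> norm (b - snd c y) + norm (snd c y - w)"
        using norm_triangle_ineq[of "b - snd c y" "snd c y - w"] by simp
      also have "\<dots> < r + 2 * r"
        using that y(2) r(1) by (intro add_le_less_mono) (auto simp: dist_norm norm_minus_commute)
      finally show ?thesis by (simp add: dist_norm norm_minus_commute)
    qed
    then have KB: "cball (snd c y) r \<subseteq> ball w (3 * r)" by blast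
    have "compactin (top_of_set (snd c ` fst c)) (cball (snd c y) r)"
      using KB r(2) by (auto simp: compactin_subtopology)
    then have "compactin (manifold_topology N) ?K"
      by (rule image_compactin[OF _ continuous_map_chart_inv[OF N c]])
    then have "closedin (manifold_topology N) ?K" using H compactin_imp_closedin by blast
    then have opK: "openin (manifold_topology N) (carrier N - ?K)"
      by (simp add: closedin_def topspace_manifold[OF N])
    have "z \<in> ?B" if "z \<in> ?K" for z
      using that KB r(2) chart_inv_in[of _ c] chart_chart_inv[of _ c] by fastforce
    then have "\<Psi> a \<notin> ?K" using False by blast
    obtain d where d: "d \<in> charts_at N (\<Psi> a)" using \<Psi>(1)[of a] unfolding local_param_def by blast
    then have dN: "d \<in> N" "\<Psi> a \<in> fst d" by (auto simp: charts_at_iff)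
    obtain W where W: "open W" "a \<in> W" "\<Psi> ` W \<subseteq> fst d" "smooth_on W (\<lambda>x. snd d (\<Psi> x))" "inj (param_derivative d \<Psi> a)"
      by (rule local_paramE[OF N \<Psi>(1) d])
    let ?O = "snd d ` ((carrier N - ?K) \<inter> fst d)"
    have "open ?O" using opK dN unfolding openin_manifold[OF N] by blast
    define V where "V = W \<inter> (\<lambda>x. snd d (\<Psi> x)) -` ?O"
    have V: "open V"
      unfolding V_def by (rule continuous_open_preimage[OF smooth_on_continuous[OF W(4)] W(1) \<open>open ?O\<close>])
    have aV: "a \<in> V" using W(2) dN \<open>\<Psi> a \<notin> ?K\<close> charts_at_carrier[OF d] by (auto simp: V_def)
    have eq: "\<Psi>' b = \<Psi> b" if b: "b \<in> V" for b
    proof -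
      have "\<Psi> b \<in> fst d" using b W(3) by (auto simp: V_def)
      moreover obtain m where "m \<in> carrier N - ?K" "m \<in> fst d" "snd d (\<Psi> b) = snd d m" using b unfolding V_def by blast
      ultimately have nK: "\<Psi> b \<notin> ?K" using inj_onD[OF smooth_atlasD(1)[OF N dN(1)]] by blast
      show ?thesis
      proof (cases "\<Psi> b \<in> ?B")
        case True
        then have inv: "chart_inv c (snd c (\<Psi> b)) = \<Psi> b" using chart_inv_eq[OF smooth_atlasD(1)[OF N c]] by blast
        then have "snd c (\<Psi> b) \<notin> cball (snd c y) r" using nK by (metis imageI)
        then have "\<pi> (snd c (\<Psi> b)) = snd c (\<Psi> b)"
          unfolding \<pi>_def by (intro shift_map_outside[OF r(1)]) (simp add: dist_norm norm_minus_commute)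
        then show ?thesis using True inv by (simp add: \<Psi>'_def)
      next
        case False
        then show ?thesis by (simp only: \<Psi>'_def if_False)
      qed
    qed
    show ?thesis
    proof (rule local_param_compose[OF N dN(1) V aV])
      show "(\<lambda>x. snd d (\<Psi> x)) ` V \<subseteq> snd d ` fst d" using W(3) by (auto simp: V_def)
      show "smooth_on V (\<lambda>x. snd d (\<Psi> x))" by (rule smooth_on_subset[OF W(4)]) (auto simp: V_def)
      show "inj (param_derivative d \<Psi> a)" by (rule W(5))
      show "\<Psi>' b = chart_inv d (snd d (\<Psi> b))" if "b \<in> V" for b
        using eq[OF that] that W(3) chart_inv_eq[OF smooth_atlasD(1)[OF N dN(1)], of "\<Psi> b"] by (auto simp: V_def)
    qed
  qed
  moreover have "x \<in> range \<Psi>'"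
  proof -
    obtain a where a: "x = \<Psi> a" using \<Psi>(2) by blast
    then have "\<Psi> a \<notin> ?B" using False by blast
    then have "\<Psi>' a = x" unfolding a by (simp only: \<Psi>'_def if_False)
    then show ?thesis by blast
  qed
  moreover have "y' \<in> range \<Psi>'"
  proof -
    obtain a where a: "y = \<Psi> a" using \<Psi>(3) by blast
    have "y \<in> ?B" using y r(1) by (auto simp: dist_norm)
    then have "\<Psi>' a = chart_inv c (snd c y')" using a by (simp add: \<Psi>'_def \<pi>_def shift_map_centre v_def)
    then have "\<Psi>' a = y'" using chart_inv_eq[OF smooth_atlasD(1)[OF N c] y'(1)] by simp
    then show ?thesis by blast
  qed
  ultimately show ?thesis unfolding reachable_def by blast
qed

lemma reachable_locally_constant:
  assumes N: "smooth_atlas N" and H: "Hausdorff_space (manifold_topology N)" and z: "z \<in> carrier N"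
  obtains U where "openin (manifold_topology N) U" "z \<in> U"
    "\<forall>y\<in>U. \<forall>y'\<in>U. reachable N x y \<longrightarrow> reachable N x y'" "\<forall>y\<in>U. reachable N y z"
proof -
  obtain c where "c \<in> charts_at N z" using z by (rule carrierE)
  then have c: "c \<in> N" "z \<in> fst c" by (auto simp: charts_at_iff)
  obtain e where e: "e > 0" "ball (snd c z) e \<subseteq> snd c ` fst c"
    using smooth_atlasD(2)[OF N c(1)] c(2) open_contains_ball by blast
  define r where "r = e / 3"
  have r: "r > 0" "ball (snd c z) (3 * r) \<subseteq> snd c ` fst c" using e by (auto simp: r_def)
  \<comment> \<open>Two points of the small disk are less than \<open>2 * \<eta>\<close> apart, and
    \<open>4 * exp 1 * (2 * \<eta>)\<close> is eight ninths of \<open>r\<close>, as the shift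
    requires.\<close>
  define \<eta> where "\<eta> = r / (9 * exp 1)"
  have exp1: "(1::real) \<le> exp 1" by simp
  have \<eta>: "\<eta> > 0" "8 * exp 1 * \<eta> < r" using r(1) by (auto simp: \<eta>_def)
  have "r * 1 \<le> r * (9 * exp 1)" using r(1) exp1 by (intro mult_left_mono) linarith+
  then have \<eta>r: "\<eta> \<le> r" by (simp add: \<eta>_def divide_le_eq)
  let ?U = "fst c \<inter> snd c -` ball (snd c z) \<eta>"
  show ?thesis
  proof (rule that)
    show "openin (manifold_topology N) ?U" by (rule openin_chart_vimage[OF N c(1) open_ball])
    show "z \<in> ?U" using c \<eta> by simp
    show "\<forall>y\<in>?U. reachable N y z"
    proof
      fix y assume y: "y \<in> ?U"
      show "reachable N y z"
        by (rule reachable_in_disk[OF N c(1) _ r(2)]) (use y c \<eta>r r(1) in \<open>auto simp: dist_norm\<close>)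
    qed
    show "\<forall>y\<in>?U. \<forall>y'\<in>?U. reachable N x y \<longrightarrow> reachable N x y'"
    proof (intro ballI impI)
      fix y y' assume y: "y \<in> ?U" and y': "y' \<in> ?U" and reach: "reachable N x y"
      have "norm (snd c y' - snd c y) \<le> norm (snd c z - snd c y') + norm (snd c z - snd c y)"
        using norm_triangle_ineq4[of "snd c z - snd c y" "snd c z - snd c y'"] by simp
      also have "\<dots> < 2 * \<eta>" using y y' by (simp add: dist_norm)
      finally have "4 * exp 1 * norm (snd c y' - snd c y) \<le> 4 * exp 1 * (2 * \<eta>)" by (intro mult_left_mono) auto
      then have "4 * exp 1 * norm (snd c y' - snd c y) < r" using \<eta>(2) by linarith
      then show "reachable N x y'"
        by (rule reachable_push[OF N H c(1) r _ _ _ _ _ reach, rotated 4]) (use y y' \<eta>r in auto)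
    qed
  qed
qed

text \<open>Reachability from \<open>x\<close> passes between any two points of a small
  neighbourhood, in both directions; so the reachable points and the others both form open sets. The
  neighbourhood of \<open>x\<close> itself shows that the first set is not empty.\<close>

lemma connected_surface_reachable:
  assumes N: "smooth_manifold N" and conn: "connected_space (manifold_topology N)"
    and x: "x \<in> carrier N" and y: "y \<in> carrier N"
  shows "reachable N x y"
proof -
  have A: "smooth_atlas N" and H: "Hausdorff_space (manifold_topology N)"
    using smooth_manifold_imp_smooth_atlas[OF N] N by (auto simp: smooth_manifold_def)
  have op: "openin (manifold_topology N) {z \<in> carrier N. reachable N x z \<longleftrightarrow> b}" for b
  proof (subst openin_subopen, intro ballI)
    fix z assume z: "z \<in> {z \<in> carrier N. reachable N x z \<longleftrightarrow> b}"
    have zN: "z \<in> carrier N" using z by blast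
    obtain U where U: "openin (manifold_topology N) U" "z \<in> U"
      "\<forall>y\<in>U. \<forall>y'\<in>U. reachable N x y \<longrightarrow> reachable N x y'" "\<forall>y\<in>U. reachable N y z"
      by (rule reachable_locally_constant[OF A H zN])
    then have "U \<subseteq> {z \<in> carrier N. reachable N x z \<longleftrightarrow> b}"
      using z openin_subset[OF U(1)] unfolding topspace_manifold[OF A] by blast
    then show "\<exists>T. openin (manifold_topology N) T \<and> z \<in> T \<and> T \<subseteq> {z \<in> carrier N. reachable N x z \<longleftrightarrow> b}"
      using U by blast
  qed
  let ?T = "{z \<in> carrier N. reachable N x z}"
  have "carrier N - ?T = {z \<in> carrier N. reachable N x z \<longleftrightarrow> False}" by auto
  then have "closedin (manifold_topology N) ?T"
    using op[of False] by (auto simp: closedin_def topspace_manifold[OF A])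
  moreover have "openin (manifold_topology N) ?T" using op[of True] by simp
  moreover have "x \<in> ?T"
  proof -
    obtain U where "openin (manifold_topology N) U" "x \<in> U"
      "\<forall>y\<in>U. \<forall>y'\<in>U. reachable N x y \<longrightarrow> reachable N x y'" "\<forall>y\<in>U. reachable N y x"
      by (rule reachable_locally_constant[OF A H x])
    then show ?thesis using x by blast
  qed
  ultimately have "?T = carrier N"
    using conn unfolding connected_space_clopen_in topspace_manifold[OF A] by blast
  then show ?thesis using y by blast
qed

section \<open>Positive paths between fibers\<close>

lemma unit_vector_derivative:
  "(unit_vector has_vector_derivative unit_vector (\<theta> + pi / 2)) (at \<theta>)"
  "((\<lambda>\<theta>. unit_vector (\<theta> + pi / 2)) has_vector_derivative - unit_vector \<theta>) (at \<theta>)"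
proof -
  have c: "(cos has_vector_derivative - sin \<theta>) (at \<theta>)" and s: "(sin has_vector_derivative cos \<theta>) (at \<theta>)" for \<theta> :: real
    by (auto simp: has_real_derivative_iff_has_vector_derivative[symmetric] intro!: derivative_eq_intros)
  have scale: "((\<lambda>x. f x *\<^sub>R v) has_vector_derivative f' *\<^sub>R v) (at \<theta>)"
    if "(f has_vector_derivative f') (at \<theta>)" for f f' and v :: "real^2" and \<theta> :: real
    using bounded_linear.has_vector_derivative[OF bounded_linear_scaleR_left that] .
  have u: "unit_vector = (\<lambda>x. cos x *\<^sub>R axis 1 1 + sin x *\<^sub>R axis 2 1)"
    by (simp add: fun_eq_iff unit_vector_def vector_2_axis)
  have shift: "(\<lambda>\<theta>. unit_vector (\<theta> + pi / 2)) = (\<lambda>x. (- sin x) *\<^sub>R axis 1 1 + cos x *\<^sub>R axis 2 1 :: real^2)"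
    unfolding u by (simp add: fun_eq_iff cos_add sin_add)
  show "(unit_vector has_vector_derivative unit_vector (\<theta> + pi / 2)) (at \<theta>)"
    unfolding fun_cong[OF shift] unfolding u by (intro has_vector_derivative_add scale c s)
  have "((\<lambda>x. (- sin x) *\<^sub>R axis 1 1 + cos x *\<^sub>R axis 2 1 :: real^2) has_vector_derivative
      (- cos \<theta>) *\<^sub>R axis 1 1 + (- sin \<theta>) *\<^sub>R axis 2 1) (at \<theta>)"
    by (intro has_vector_derivative_add scale c has_vector_derivative_minus s)
  then show "((\<lambda>\<theta>. unit_vector (\<theta> + pi / 2)) has_vector_derivative - unit_vector \<theta>) (at \<theta>)"
    unfolding shift by (simp add: u)
qed

text \<open>The contactomorphism from the one-jets of the circle to the spherization of the plane: the
  covector at \<open>u e(q) + p e'(q)\<close> with direction \<open>e(q) = unit_vector q\<close>.\<close>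

definition hodograph :: "real \<Rightarrow> real \<Rightarrow> real \<Rightarrow> real^2" where
  "hodograph q p u = u *\<^sub>R unit_vector q + p *\<^sub>R unit_vector (q + pi / 2)"

text \<open>The component along the conormal is \<open>u' - p * q'\<close>, the value of the contact
  form of the one-jets on the velocity. Legendrian curves and positive motions therefore
  correspond.\<close>

lemma hodograph_derivative:
  assumes "(q has_real_derivative q') (at r)" "(p has_real_derivative p') (at r)" "(u has_real_derivative u') (at r)"
  shows "((\<lambda>r. hodograph (q r) (p r) (u r)) has_vector_derivative
    (u' - p r * q') *\<^sub>R unit_vector (q r) + (u r * q' + p') *\<^sub>R unit_vector (q r + pi / 2)) (at r)"
proof -
  note q = assms(1)[unfolded has_real_derivative_iff_has_vector_derivative]
  have 1: "((\<lambda>r. unit_vector (q r)) has_vector_derivative q' *\<^sub>R unit_vector (q r + pi / 2)) (at r)"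
    using vector_diff_chain_at[OF q unit_vector_derivative(1)] by (simp add: o_def)
  have 2: "((\<lambda>r. unit_vector (q r + pi / 2)) has_vector_derivative q' *\<^sub>R - unit_vector (q r)) (at r)"
    using vector_diff_chain_at[OF q unit_vector_derivative(2)] by (simp add: o_def)
  have "((\<lambda>r. hodograph (q r) (p r) (u r)) has_vector_derivative
    (u r *\<^sub>R (q' *\<^sub>R unit_vector (q r + pi / 2)) + u' *\<^sub>R unit_vector (q r))
     + (p r *\<^sub>R (q' *\<^sub>R - unit_vector (q r)) + p' *\<^sub>R unit_vector (q r + pi / 2))) (at r)"
    unfolding hodograph_def
    by (intro has_vector_derivative_add has_vector_derivative_scaleR[OF assms(3) 1] has_vector_derivative_scaleR[OF assms(2) 2])
  then show ?thesis by (simp add: algebra_simps)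
qed

lemma unit_vector_orthogonal: "unit_vector q \<bullet> unit_vector (q + pi / 2) = 0"
  by (simp add: unit_vector_inner)

theorem positive_path_between_fibers:
  fixes N :: "('a, real^2) atlas"
  assumes N: "smooth_manifold N" and conn: "connected_space (manifold_topology N)"
    and x: "x \<in> carrier N" and y: "y \<in> carrier N"
  shows "\<exists>\<phi>. legendrian_immersion_path circle_atlas (spherization_atlas N) (spherization_form N) \<phi> \<and>
           positive_path circle_atlas (spherization_atlas N) (spherization_form N) \<phi> \<and>
           legendrian_embedding circle_atlas (spherization_atlas N) (spherization_form N) (\<phi> 0) \<and>
           \<phi> 0 ` carrier circle_atlas = spherization_fiber N x \<and>
           legendrian_embedding circle_atlas (spherization_atlas N) (spherization_form N) (\<phi> 1) \<and>
           \<phi> 1 ` carrier circle_atlas = spherization_fiber N y"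
proof -
  obtain \<Psi> where \<Psi>: "\<And>a. local_param N \<Psi> a" "x \<in> range \<Psi>" "y \<in> range \<Psi>"
    using connected_surface_reachable[OF N conn x y] unfolding reachable_def by blast
  obtain v w where vw: "x = \<Psi> v" "y = \<Psi> w" using \<Psi>(2,3) by blast
  obtain E where E: "\<And>t s. t \<in> {0..1} \<Longrightarrow> loop_u_dot E t s - loop_p t s * (- loop_a_dot t * sin s + E / 10) > norm (w - v)"
    using loop_positive[of "norm (w - v)"] by metis
  \<comment> \<open>The straight translation changes the conormal speed by
    \<open>unit_vector q \<bullet> (w - v)\<close>, at most \<open>norm (w - v)\<close> in size;
    \<open>E\<close> was chosen to exceed this.\<close>
  define Q where "Q = (\<lambda>t s. hodograph (loop_q E t s) (loop_p t s) (loop_u E t s) + (v + t *\<^sub>R (w - v)))"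
  interpret pushed_family N \<Psi> Q "loop_q E"
  proof
    show "smooth_atlas N" by (rule smooth_manifold_imp_smooth_atlas[OF N])
    show "local_param N \<Psi> a" for a by (rule \<Psi>(1))
    have s: "smooth_on UNIV (\<lambda>z. unit_vector (loop_q E (fst z) (snd z)))"
      "smooth_on UNIV (\<lambda>z. unit_vector (loop_q E (fst z) (snd z) + pi / 2))"
      by (intro smooth_on_unit_vector smooth_on_add loop_smooth smooth_on_const open_UNIV)+
    show "smooth_on UNIV (\<lambda>z. Q (fst z) (snd z))"
      unfolding Q_def hodograph_def
      by (intro smooth_on_add[OF open_UNIV] smooth_on_scaleR[OF open_UNIV] loop_smooth s smooth_on_const smooth_on_fst smooth_on_id open_UNIV)
    show "smooth_on UNIV (\<lambda>z. loop_q E (fst z) (snd z))" by (rule loop_smooth)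
    have p: "unit_vector (r + 2 * pi) = unit_vector r" for r using unit_vector_add_2pi_int[of r 1] by simp
    have "unit_vector (r + 2 * pi + pi / 2) = unit_vector (r + pi / 2)" for r
      using p[of "r + pi / 2"] by (simp add: add.assoc add.commute[of "pi / 2"])
    then show "Q t (s + 2 * pi) = Q t s" for t s
      unfolding Q_def hodograph_def loop_periodic p by simp
    show "loop_q E t (s + 2 * pi) = loop_q E t s + 2 * pi" for t s by (rule loop_periodic)
  qed
  have dQs: "(Q t has_vector_derivative (loop_u E t s * loop_q' t s + loop_p' t s) *\<^sub>R unit_vector (loop_q E t s + pi / 2)) (at s)" for t s
  proof -
    have "((\<lambda>s. Q t s) has_vector_derivative ((loop_p t s * loop_q' t s - loop_p t s * loop_q' t s) *\<^sub>R unit_vector (loop_q E t s)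
       + (loop_u E t s * loop_q' t s + loop_p' t s) *\<^sub>R unit_vector (loop_q E t s + pi / 2)) + 0) (at s)"
      unfolding Q_def by (intro has_vector_derivative_add hodograph_derivative loop_ds has_vector_derivative_const)
    then show ?thesis by simp
  qed
  have leg: "legendrian_immersion circle_atlas STN (spherization_form N) (family t)" if t: "t \<in> {0..1}" for t
  proof (rule legendrian_family[OF t dQs loop_ds(1)])
    show "unit_vector (loop_q E t s) \<bullet> ((loop_u E t s * loop_q' t s + loop_p' t s) *\<^sub>R unit_vector (loop_q E t s + pi / 2)) = 0" for s
      by (simp add: unit_vector_orthogonal)
    \<comment> \<open>Where \<open>q' = 0\<close> the coefficient reduces to \<open>p'\<close>, so
      the immersion property of the curve in the one-jets is inherited.\<close>
    show "(loop_u E t s * loop_q' t s + loop_p' t s) *\<^sub>R unit_vector (loop_q E t s + pi / 2) \<noteq> 0 \<or> loop_q' t s \<noteq> 0" for s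
      using loop_immersed[OF t, of s] by (cases "loop_q' t s = 0") auto
  qed
  have pos: "positive_path circle_atlas STN (spherization_form N) family"
  proof (rule positive_family)
    fix t s
    have "((\<lambda>t. v + t *\<^sub>R (w - v)) has_vector_derivative (w - v)) (at t)"
      by (auto intro!: derivative_eq_intros)
    then show "((\<lambda>t. Q t s) has_vector_derivative
      ((loop_u_dot E t s - loop_p t s * (- loop_a_dot t * sin s + E / 10)) *\<^sub>R unit_vector (loop_q E t s)
       + (loop_u E t s * (- loop_a_dot t * sin s + E / 10) + loop_a_dot t * loop_pa (loop_a t) (sin s) (cos s)) *\<^sub>R unit_vector (loop_q E t s + pi / 2))
       + (w - v)) (at t)"
      unfolding Q_def by (intro has_vector_derivative_add hodograph_derivative[OF loop_dt])
  next
    fix t s :: real assume t: "t \<in> {0..1}"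
    have cs: "\<bar>unit_vector (loop_q E t s) \<bullet> (w - v)\<bar> \<le> norm (w - v)"
      using Cauchy_Schwarz_ineq2[of "unit_vector (loop_q E t s)" "w - v"] by simp
    have ee: "unit_vector (loop_q E t s) \<bullet> unit_vector (loop_q E t s) = 1" by (simp add: unit_vector_inner)
    show "0 < unit_vector (loop_q E t s) \<bullet>
      (((loop_u_dot E t s - loop_p t s * (- loop_a_dot t * sin s + E / 10)) *\<^sub>R unit_vector (loop_q E t s)
       + (loop_u E t s * (- loop_a_dot t * sin s + E / 10) + loop_a_dot t * loop_pa (loop_a t) (sin s) (cos s)) *\<^sub>R unit_vector (loop_q E t s + pi / 2))
       + (w - v))"
      unfolding inner_add_right[of "unit_vector (loop_q E t s)"] inner_scaleR_right unit_vector_orthogonal ee mult_1_right mult_zero_right add_0_right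
      using E[OF t, of s] cs by linarith
  qed
  \<comment> \<open>At both ends \<open>p = u = 0\<close>: under the hodograph transform the zero
    section becomes the fiber over a point, here translated to \<open>v\<close> and to
    \<open>w\<close>.\<close>
  have ends: "Q 0 s = v" "Q 1 s = w" "loop_q E 0 s = s + 0" "loop_q E 1 s = s + E / 10" for s
    by (simp_all add: Q_def hodograph_def)
  have t01: "(0::real) \<in> {0..1}" "(1::real) \<in> {0..1}" by auto
  show ?thesis
    using smooth_family leg pos fiber_family[OF t01(1) ends(1,3)] fiber_family[OF t01(2) ends(2,4)] vw
    unfolding legendrian_immersion_path_def legendrian_embedding_def
    by (intro exI[of _ family]) auto
qed

theorem theorem3:
  shows
    "(\<forall>L :: ((real^'n, real^'n) jet, real^'n) atlas.
        legendrian_submanifold L (jet_atlas euclidean_atlas) (jet_form euclidean_atlas) \<and>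
        compact_space (manifold_topology L) \<longrightarrow>
        (\<exists>\<phi>. legendrian_embedding_path L (jet_atlas euclidean_atlas) (jet_form euclidean_atlas) \<phi> \<and>
             positive_path L (jet_atlas euclidean_atlas) (jet_form euclidean_atlas) \<phi> \<and>
             closed_legendrian_path L \<phi> \<and> (\<exists>t\<in>{0..1}. \<phi> t ` carrier L = carrier L)))
     \<and>
     (\<exists>C \<in> connected_components_of
              (legendrian_embedding_space circle_atlas (jet_atlas circle_atlas) (jet_form circle_atlas)).
        (\<forall>f\<in>C. homotopic_with (\<lambda>_. True) (manifold_topology circle_atlas)
                  (manifold_topology (jet_atlas circle_atlas)) f (jet_extension circle_atlas (\<lambda>_. 0))) \<and>
        (\<exists>\<phi>. legendrian_embedding_path circle_atlas (jet_atlas circle_atlas) (jet_form circle_atlas) \<phi> \<and>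
             positive_path circle_atlas (jet_atlas circle_atlas) (jet_form circle_atlas) \<phi> \<and>
             closed_legendrian_path circle_atlas \<phi> \<and> path_in circle_atlas C \<phi>))
     \<and>
     (\<exists>C \<in> connected_components_of
              (legendrian_immersion_space circle_atlas (jet_atlas circle_atlas) (jet_form circle_atlas)).
        (\<forall>f. smooth_map circle_atlas euclidean_atlas f \<longrightarrow> jet_extension circle_atlas f \<in> C) \<and>
        (\<exists>\<phi>. legendrian_immersion_path circle_atlas (jet_atlas circle_atlas) (jet_form circle_atlas) \<phi> \<and>
             positive_path circle_atlas (jet_atlas circle_atlas) (jet_form circle_atlas) \<phi> \<and>
             closed_legendrian_path circle_atlas \<phi> \<and> path_in circle_atlas C \<phi>))
     \<and>
     (\<forall>N :: ('a, real^2) atlas.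
        smooth_manifold N \<and> connected_space (manifold_topology N) \<longrightarrow>
        (\<forall>x\<in>carrier N. \<forall>y\<in>carrier N. \<exists>\<phi>.
           legendrian_immersion_path circle_atlas (spherization_atlas N) (spherization_form N) \<phi> \<and>
           positive_path circle_atlas (spherization_atlas N) (spherization_form N) \<phi> \<and>
           legendrian_embedding circle_atlas (spherization_atlas N) (spherization_form N) (\<phi> 0) \<and>
           \<phi> 0 ` carrier circle_atlas = spherization_fiber N x \<and>
           legendrian_embedding circle_atlas (spherization_atlas N) (spherization_form N) (\<phi> 1) \<and>
           \<phi> 1 ` carrier circle_atlas = spherization_fiber N y))"
  by (intro conjI closed_positive_path_of_embeddings closed_positive_path_of_immersions allI impI ballI
      closed_positive_path_euclidean positive_path_between_fibers; elim conjE; assumption)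

end
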